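(* Let $n\ge1$ and let $\Omega$ be a smooth uniformly h-convex bounded domain in $\mathbb{H}^{n+1}$. Then $$\mathrm{Vol}_w(\Omega)+\sum_{k=0}^n\frac1{k+1}\int_{\partial\Omega}\cosh r\,\sigma_k(\kappa)\,d\mu\le\left(\mathrm{Vol}_w(\Omega)^{\frac1{n+1}}+\frac1{n+1}\mathrm{Vol}_w(\Omega)^{-\frac n{n+1}}\int_{\partial\Omega}\cosh r\,d\mu\right)^{n+1}.$$
   Context: $\mathbb{H}^{n+1}$ is hyperbolic space of curvature $-1$ with a fixed origin; $r$ is the distance to the origin, and $\mathrm{Vol}_w(\Omega)=\int_\Omega\cosh r\,dv$. $\kappa=(\kappa_1,\dots,\kappa_n)$ are the principal curvatures of $\partial\Omega$ with respect to the outward unit normal (positive for geodesic spheres), $\sigma_k$ is the $k$-th elementary symmetric function ($\sigma_0=1$), $d\mu$ the area element. A smooth bounded domain (compact, connected, nonempty interior, smooth boundary) is uniformly h-convex if for some $\delta>0$ all $\kappa_i>1+\delta$ on its boundary. *)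

theory Defs
  imports "HOL-Analysis.Analysis"
begin

section \<open>Smooth maps\<close>

primrec Ck_on ::
  "nat \<Rightarrow> 'a::real_normed_vector set \<Rightarrow> ('a \<Rightarrow> 'b::real_normed_vector) \<Rightarrow> bool" where
  "Ck_on 0 U f \<longleftrightarrow> continuous_on U f"
| "Ck_on (Suc k) U f \<longleftrightarrow>
     (\<forall>x\<in>U. f differentiable (at x)) \<and>
     (\<forall>v. Ck_on k U (\<lambda>x. frechet_derivative f (at x) v))"

text \<open>Meant for open sets \<open>U\<close> only.\<close>

definition smooth_on ::
  "'a::real_normed_vector set \<Rightarrow> ('a \<Rightarrow> 'b::real_normed_vector) \<Rightarrow> bool" where
  "smooth_on U f \<longleftrightarrow> (\<forall>k. Ck_on k U f)"


section \<open>The hyperboloid model of hyperbolic space\<close>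

text \<open>With \<open>n = CARD('n)\<close>, the type \<open>'n option\<close> has \<open>n + 1\<close> elements, so that
  \<open>real ^ ('n option)\<close> is Euclidean space of dimension \<open>n + 1\<close> and the following type is
  Minkowski space of signature \<open>(n + 1, 1)\<close>; its first component is the time coordinate.\<close>

type_synonym 'n minkowski = "real \<times> (real ^ ('n option))"

definition lorentz :: "'n::finite minkowski \<Rightarrow> 'n minkowski \<Rightarrow> real" where
  "lorentz X Y = snd X \<bullet> snd Y - fst X * fst Y"

definition hyp_space :: "'n::finite minkowski set" where
  "hyp_space = {X. lorentz X X = - 1 \<and> fst X > 0}"

definition hyp_tangent :: "'n::finite minkowski \<Rightarrow> 'n minkowski set" where
  "hyp_tangent p = {v. lorentz p v = 0}"

definition hyp_dist :: "'n::finite minkowski \<Rightarrow> 'n minkowski \<Rightarrow> real" where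
  "hyp_dist X Y = arcosh (- lorentz X Y)"

definition hyp_origin :: "'n::finite minkowski" where
  "hyp_origin = (1, 0)"

definition hyp_radius :: "'n::finite minkowski \<Rightarrow> real" where
  "hyp_radius X = hyp_dist hyp_origin X"


section \<open>Riemannian measure of submanifolds\<close>

text \<open>Local parametrizations of a submanifold \<open>M\<close> of dimension \<open>CARD('d)\<close>.\<close>

definition local_parametrization ::
  "'n::finite minkowski set \<Rightarrow> (real ^ 'd::finite) set \<Rightarrow> (real ^ 'd \<Rightarrow> 'n minkowski) \<Rightarrow> bool"
where
  "local_parametrization M U \<phi> \<longleftrightarrow>
     open U \<and> smooth_on U \<phi> \<and>
     openin (top_of_set M) (\<phi> ` U) \<and> (\<exists>\<psi>. homeomorphism U (\<phi> ` U) \<phi> \<psi>) \<and>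
     (\<forall>x\<in>U. inj (frechet_derivative \<phi> (at x)))"

text \<open>The coefficients of the metric induced by the Lorentz form.\<close>

definition metric_matrix ::
  "(real ^ 'd::finite \<Rightarrow> 'n::finite minkowski) \<Rightarrow> real ^ 'd \<Rightarrow> real ^ 'd ^ 'd" where
  "metric_matrix \<phi> x = (\<chi> i j. lorentz (frechet_derivative \<phi> (at x) (axis i 1))
                                      (frechet_derivative \<phi> (at x) (axis j 1)))"

text \<open>The unique Borel measure concentrated on \<open>M\<close> that is \<open>sqrt (det g) dx\<close> in every local
  parametrization; \<open>M\<close> is a submanifold of \<^const>\<open>hyp_space\<close> of dimension \<open>CARD('d)\<close>.\<close>

definition riemannian_measure ::
  "('d::finite) itself \<Rightarrow> 'n::finite minkowski set \<Rightarrow> 'n minkowski measure" where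
  "riemannian_measure T M = (THE \<mu>.
     sets \<mu> = sets borel \<and> emeasure \<mu> (- M) = 0 \<and>
     (\<forall>U (\<phi> :: real ^ 'd \<Rightarrow> 'n minkowski) A.
        local_parametrization M U \<phi> \<longrightarrow> A \<in> sets borel \<longrightarrow> A \<subseteq> U \<longrightarrow>
        emeasure \<mu> (\<phi> ` A) = (\<integral>\<^sup>+x\<in>A. ennreal (sqrt (det (metric_matrix \<phi> x))) \<partial>lborel)))"

definition hyp_volume :: "'n::finite minkowski measure" where
  "hyp_volume = riemannian_measure TYPE('n option) hyp_space"


section \<open>Smooth domains and their boundaries\<close>

definition bdry :: "'n::finite minkowski set \<Rightarrow> 'n minkowski set" where
  "bdry \<Omega> = top_of_set hyp_space frontier_of \<Omega>"

definition defining_function ::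
  "'n::finite minkowski set \<Rightarrow> 'n minkowski \<Rightarrow> 'n minkowski set \<Rightarrow> ('n minkowski \<Rightarrow> real) \<Rightarrow> bool"
where
  "defining_function \<Omega> p U \<rho> \<longleftrightarrow>
     open U \<and> p \<in> U \<and> smooth_on U \<rho> \<and>
     \<Omega> \<inter> U = {q \<in> hyp_space \<inter> U. \<rho> q \<le> 0} \<and>
     (\<exists>v \<in> hyp_tangent p. frechet_derivative \<rho> (at p) v \<noteq> 0)"

definition smooth_bounded_domain :: "'n::finite minkowski set \<Rightarrow> bool" where
  "smooth_bounded_domain \<Omega> \<longleftrightarrow>
     \<Omega> \<subseteq> hyp_space \<and> compact \<Omega> \<and> connected \<Omega> \<and>
     top_of_set hyp_space interior_of \<Omega> \<noteq> {} \<and>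
     (\<forall>p \<in> bdry \<Omega>. \<exists>U \<rho>. defining_function \<Omega> p U \<rho>)"

text \<open>The outward unit normal is the positively normalized gradient (in hyperbolic space) of a
  local defining function, which is negative inside the domain.\<close>

definition outer_normal :: "'n::finite minkowski set \<Rightarrow> 'n minkowski \<Rightarrow> 'n minkowski" where
  "outer_normal \<Omega> p = (THE \<nu>. \<nu> \<in> hyp_tangent p \<and> lorentz \<nu> \<nu> = 1 \<and>
     (\<exists>U \<rho> c. defining_function \<Omega> p U \<rho> \<and> c > 0 \<and>
        (\<forall>v \<in> hyp_tangent p. frechet_derivative \<rho> (at p) v = c * lorentz \<nu> v)))"

definition bdry_tangent :: "'n::finite minkowski set \<Rightarrow> 'n minkowski \<Rightarrow> 'n minkowski set" where
  "bdry_tangent \<Omega> p = {v \<in> hyp_tangent p. lorentz (outer_normal \<Omega> p) v = 0}"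

definition area_measure :: "'n::finite minkowski set \<Rightarrow> 'n minkowski measure" where
  "area_measure \<Omega> = riemannian_measure TYPE('n) (bdry \<Omega>)"


section \<open>Principal curvatures\<close>

definition hyp_tangent_proj :: "'n::finite minkowski \<Rightarrow> 'n minkowski \<Rightarrow> 'n minkowski" where
  "hyp_tangent_proj p w = w + lorentz p w *\<^sub>R p"

text \<open>The Levi-Civita connection of hyperbolic space is the tangential part of the flat connection
  of Minkowski space. Hence the shape operator at \<open>p\<close> is the map
  \<open>v \<mapsto> hyp_tangent_proj p (W v)\<close> on the tangent space of the boundary, where \<open>W\<close> is the derivative
  of the outward unit normal along the boundary. The principal curvatures are its eigenvalues,
  repeated with multiplicity, for an orthonormal eigenbasis \<open>e\<close>.\<close>

definition are_principal_curvatures ::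
  "'n::finite minkowski set \<Rightarrow> 'n minkowski \<Rightarrow> real ^ 'n \<Rightarrow> bool" where
  "are_principal_curvatures \<Omega> p \<kappa> \<longleftrightarrow>
     (\<exists>W (e :: 'n \<Rightarrow> 'n minkowski).
        (outer_normal \<Omega> has_derivative W) (at p within bdry \<Omega>) \<and>
        (\<forall>i. e i \<in> bdry_tangent \<Omega> p) \<and>
        (\<forall>i j. lorentz (e i) (e j) = (if i = j then 1 else 0)) \<and>
        (\<forall>i. hyp_tangent_proj p (W (e i)) = (\<kappa> $ i) *\<^sub>R e i))"

text \<open>Determined up to a permutation of the entries.\<close>

definition principal_curvatures ::
  "'n::finite minkowski set \<Rightarrow> 'n minkowski \<Rightarrow> real ^ 'n" where
  "principal_curvatures \<Omega> p = (SOME \<kappa>. are_principal_curvatures \<Omega> p \<kappa>)"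

definition elem_sym :: "nat \<Rightarrow> real ^ 'n::finite \<Rightarrow> real" where
  "elem_sym k \<kappa> = (\<Sum>I | card I = k. \<Prod>i\<in>I. \<kappa> $ i)"

definition uniformly_h_convex :: "'n::finite minkowski set \<Rightarrow> bool" where
  "uniformly_h_convex \<Omega> \<longleftrightarrow>
     (\<exists>\<delta>>0. \<forall>p \<in> bdry \<Omega>. \<forall>i. principal_curvatures \<Omega> p $ i > 1 + \<delta>)"


section \<open>Weighted volume and curvature integrals\<close>

definition weighted_volume :: "'n::finite minkowski set \<Rightarrow> real" where
  "weighted_volume \<Omega> = (LINT p:\<Omega>|hyp_volume. cosh (hyp_radius p))"

definition weighted_curvature_integral :: "nat \<Rightarrow> 'n::finite minkowski set \<Rightarrow> real" where
  "weighted_curvature_integral k \<Omega> =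
     (LINT p:bdry \<Omega>|area_measure \<Omega>.
        cosh (hyp_radius p) * elem_sym k (principal_curvatures \<Omega> p))"

end

(* The projection snd of the hyperboloid model to R^(n+1) turns the measure cosh r dv into Lebesgue
   measure, and h-convexity makes the image B of the domain a convex body. Moving each boundary point
   p along snd (nu p), where nu p in Minkowski space is the outward unit normal, sweeps out the bodies
   H t = {y. normal p . y <= normal p . snd p + t * fst p for all boundary points p}, a family of
   convex bodies that is concave in t; here fst p = cosh r. The Jacobian of the sweep is
   cosh r * prod_i (1 + s * kappa_i), so

     |H t| = |B| + sum_k t^(k+1)/(k+1) * int cosh r sigma_k dmu,

   and the left side of the theorem is |H 1|. By the Brunn-Minkowski inequality |H t|^(1/(n+1)) is at
   least the linear interpolation of its values at t = 0 and t = 1; comparing slopes at t = 0 bounds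
   |H 1| by |B| and the integral of cosh r over the boundary. *)

theory Submission
  imports Defs
begin

section \<open>Calculus of smooth maps\<close>

text \<open>Why curvature 1 is the threshold: in the coordinates \<open>snd p\<close> the Hessian of
  a defining function on a boundary tangent vector v is a positive multiple of II(v, v) - (fst nu /
  fst p) <v, v>, where |fst nu| < fst p. The same factor fst p * kappa_i - fst nu decides whether an
  exterior point lies on one of the rays, so h-convexity enters twice: for the convexity of B, and
  for the sweep to fill the exterior. That swept points stay in H t rests on
  \<open>snd (outer_normal \<Omega> p) \<bullet> normal q \<le> fst q\<close> for all boundary
  points p and q, which a maximum over p proves. The definitions shape the rest. The Riemannian
  measure and the outward normal are definite descriptions, so existence and uniqueness precede
  every computation. The principal curvatures are chosen pointwise, with no measurability known in
  advance. The volume expansion is therefore replaced by two inequalities: an upper bound for small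
  t whose slope is the integral of cosh r, and a lower bound at t = 1.\<close>

lemma Ck_on_subset: "Ck_on k U f \<Longrightarrow> V \<subseteq> U \<Longrightarrow> Ck_on k V f"
  by (induction k arbitrary: f) (auto intro: continuous_on_subset)

lemma Ck_on_cong:
  assumes "open U" "\<And>x. x \<in> U \<Longrightarrow> f x = g x" "Ck_on k U f"
  shows "Ck_on k U g"
  using assms(2,3)
proof (induction k arbitrary: f g)
  case 0
  then show ?case by (simp cong: continuous_on_cong)
next
  case (Suc k)
  have d: "(g has_derivative frechet_derivative f (at x)) (at x)" if "x \<in> U" for x
  proof (rule has_derivative_transform_within_open[OF _ assms(1) that])
    show "(f has_derivative frechet_derivative f (at x)) (at x)"
      using Suc.prems(2) that by (simp add: frechet_derivative_works[symmetric])
  qed (use Suc.prems(1) in simp)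
  have e: "frechet_derivative g (at x) = frechet_derivative f (at x)" if "x \<in> U" for x
    using frechet_derivative_at[OF d[OF that]] by simp
  have "Ck_on k U (\<lambda>x. frechet_derivative g (at x) v)" for v
    by (rule Suc.IH[of "\<lambda>x. frechet_derivative f (at x) v"]) (use Suc.prems e in auto)
  then show ?case
    using d by (auto simp: differentiable_def)
qed

lemma Ck_on_SucD: "Ck_on (Suc k) U f \<Longrightarrow> Ck_on k U f"
proof (induction k arbitrary: f)
  case 0
  then show ?case
    by (auto intro!: continuous_at_imp_continuous_on differentiable_imp_continuous_within)
next
  case (Suc k)
  show ?case
    unfolding Ck_on.simps(2)[of k] using Suc.prems Suc.IH unfolding Ck_on.simps(2)[of "Suc k"] by blast
qed

lemma Ck_on_SucI:
  assumes "open U" "\<And>x. x \<in> U \<Longrightarrow> (f has_derivative f' x) (at x)" "\<And>v. Ck_on k U (\<lambda>x. f' x v)"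
  shows "Ck_on (Suc k) U f"
proof -
  have "frechet_derivative f (at x) = f' x" if "x \<in> U" for x
    using frechet_derivative_at[OF assms(2)[OF that]] by simp
  then have "Ck_on k U (\<lambda>x. frechet_derivative f (at x) v)" for v
    by (intro Ck_on_cong[OF assms(1) _ assms(3)[of v]]) simp
  then show ?thesis
    using assms(2) by (auto simp: differentiable_def)
qed

lemma Ck_on_SucE:
  assumes "Ck_on (Suc k) U f"
  shows "x \<in> U \<Longrightarrow> (f has_derivative frechet_derivative f (at x)) (at x)"
    and "Ck_on k U (\<lambda>x. frechet_derivative f (at x) v)"
  using assms by (auto simp: frechet_derivative_works[symmetric])

lemma Ck_on_const: "Ck_on k U (\<lambda>x. c)"
  by (induction k arbitrary: c) auto

lemma Ck_on_bounded_linear: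
  assumes "bounded_linear f"
  shows "Ck_on k U f"
proof (cases k)
  case 0
  then show ?thesis using assms by (simp add: linear_continuous_on)
next
  case (Suc j)
  have "frechet_derivative f (at x) = f" for x
    using frechet_derivative_at[OF bounded_linear_imp_has_derivative[OF assms]] by simp
  then show ?thesis
    using Suc assms by (auto simp: Ck_on_const bounded_linear_imp_differentiable)
qed

lemma Ck_on_add:
  assumes "open U" "Ck_on k U f" "Ck_on k U g"
  shows "Ck_on k U (\<lambda>x. f x + g x)"
  using assms(2,3)
proof (induction k arbitrary: f g)
  case 0
  then show ?case by (auto intro: continuous_on_add)
next
  case (Suc k)
  show ?case
    by (rule Ck_on_SucI[OF assms(1) has_derivative_add
          [OF Ck_on_SucE(1)[OF Suc.prems(1)] Ck_on_SucE(1)[OF Suc.prems(2)]]])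
      (auto intro: Suc.IH Ck_on_SucE(2)[OF Suc.prems(1)] Ck_on_SucE(2)[OF Suc.prems(2)])
qed

lemma Ck_on_bilinear:
  assumes "bounded_bilinear h" "open U" "Ck_on k U f" "Ck_on k U g"
  shows "Ck_on k U (\<lambda>x. h (f x) (g x))"
  using assms(3,4)
proof (induction k arbitrary: f g)
  case 0
  then show ?case by (auto intro: bounded_bilinear.continuous_on[OF assms(1)])
next
  case (Suc k)
  show ?case
    by (rule Ck_on_SucI[OF assms(2) bounded_bilinear.FDERIV
          [OF assms(1) Ck_on_SucE(1)[OF Suc.prems(1)] Ck_on_SucE(1)[OF Suc.prems(2)]]])
      (auto intro!: Ck_on_add assms(2) intro: Suc.IH Ck_on_SucE(2)[OF Suc.prems(1)]
        Ck_on_SucE(2)[OF Suc.prems(2)] Ck_on_SucD[OF Suc.prems(1)] Ck_on_SucD[OF Suc.prems(2)])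
qed

lemmas Ck_on_mult = Ck_on_bilinear[OF bounded_bilinear_mult]
lemmas Ck_on_scaleR = Ck_on_bilinear[OF bounded_bilinear_scaleR]
lemmas Ck_on_inner = Ck_on_bilinear[OF bounded_bilinear_inner]

lemma Ck_on_sum:
  assumes "open U" "\<And>i. i \<in> I \<Longrightarrow> Ck_on k U (f i)"
  shows "Ck_on k U (\<lambda>x. \<Sum>i\<in>I. f i x)"
  using assms(2)
  by (induction I rule: infinite_finite_induct) (auto intro!: Ck_on_const Ck_on_add assms(1))

lemma Ck_on_compose:
  fixes f :: "'a::euclidean_space \<Rightarrow> 'b::euclidean_space" and g :: "'b \<Rightarrow> 'c::real_normed_vector"
  assumes "open U" "Ck_on k V g" "Ck_on k U f" "f ` U \<subseteq> V"
  shows "Ck_on k U (\<lambda>x. g (f x))"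
  using assms(2,3)
proof (induction k arbitrary: g)
  case 0
  then show ?case using assms(4) continuous_on_compose2[of V g U f] by simp
next
  case (Suc k)
  \<comment> \<open>The direction in which g is differentiated varies with x, whereas
    \<open>Ck_on\<close> speaks of fixed directions. Expansion in the basis leaves finitely many
    fixed ones with scalar coefficients.\<close>
  have d: "((\<lambda>x. g (f x)) has_derivative
      (\<lambda>v. \<Sum>b\<in>Basis. (frechet_derivative f (at x) v \<bullet> b) *\<^sub>R frechet_derivative g (at (f x)) b)) (at x)"
    if "x \<in> U" for x
  proof -
    have g: "(g has_derivative frechet_derivative g (at (f x))) (at (f x))"
      using Ck_on_SucE(1)[OF Suc.prems(1)] that assms(4) by blast
    have "((\<lambda>x. g (f x)) has_derivative (\<lambda>v. frechet_derivative g (at (f x)) (frechet_derivative f (at x) v))) (at x)"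
      using diff_chain_at[OF Ck_on_SucE(1)[OF Suc.prems(2) that] g] by (simp add: o_def)
    then show ?thesis
    proof (rule has_derivative_eq_rhs, intro ext)
      fix v
      let ?w = "frechet_derivative f (at x) v"
      show "frechet_derivative g (at (f x)) ?w = (\<Sum>b\<in>Basis. (?w \<bullet> b) *\<^sub>R frechet_derivative g (at (f x)) b)"
      proof -
        have l: "linear (frechet_derivative g (at (f x)))"
          using g by (rule has_derivative_linear)
        show ?thesis
          using linear_sum[OF l, of "\<lambda>b. (?w \<bullet> b) *\<^sub>R b" Basis]
          by (simp add: euclidean_representation linear_scale[OF l])
      qed
    qed
  qed
  show ?case
  proof (rule Ck_on_SucI[OF assms(1) d])
    fix v
    show "Ck_on k U (\<lambda>x. \<Sum>b\<in>Basis. (frechet_derivative f (at x) v \<bullet> b) *\<^sub>R frechet_derivative g (at (f x)) b)"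
      by (intro Ck_on_sum Ck_on_scaleR Ck_on_inner assms(1) Ck_on_const Ck_on_SucE(2)[OF Suc.prems(2)]
          Suc.IH[of "\<lambda>y. frechet_derivative g (at y) b" for b] Ck_on_SucE(2)[OF Suc.prems(1)]
          Ck_on_SucD[OF Suc.prems(2)])
  qed
qed

text \<open>The derivative of the reciprocal is a product of reciprocals and the derivative of f, so
  order k of the reciprocal yields order k + 1. \<open>Ck_on_sqrt\<close> follows the same
  pattern.\<close>

lemma Ck_on_inverse:
  fixes f :: "'a::real_normed_vector \<Rightarrow> real"
  assumes "open U" "Ck_on k U f" "\<And>x. x \<in> U \<Longrightarrow> f x \<noteq> 0"
  shows "Ck_on k U (\<lambda>x. inverse (f x))"
  using assms(2)
proof (induction k)
  case 0
  then show ?case using assms(3) by (auto intro: continuous_on_inverse)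
next
  case (Suc k)
  show ?case
  proof (rule Ck_on_SucI[OF assms(1)])
    show "((\<lambda>x. inverse (f x)) has_derivative
        (\<lambda>v. - 1 * (inverse (f x) * frechet_derivative f (at x) v * inverse (f x)))) (at x)" if "x \<in> U" for x
      using Deriv.has_derivative_inverse[OF assms(3)[OF that] Ck_on_SucE(1)[OF Suc.prems that]] by simp
    show "Ck_on k U (\<lambda>x. - 1 * (inverse (f x) * frechet_derivative f (at x) v * inverse (f x)))" for v
      by (intro Ck_on_mult assms(1) Ck_on_const Suc.IH Ck_on_SucD[OF Suc.prems] Ck_on_SucE(2)[OF Suc.prems])
  qed
qed

lemma Ck_on_sqrt:
  fixes f :: "'a::real_normed_vector \<Rightarrow> real"
  assumes "open U" "Ck_on k U f" "\<And>x. x \<in> U \<Longrightarrow> f x > 0"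
  shows "Ck_on k U (\<lambda>x. sqrt (f x))"
  using assms(2)
proof (induction k)
  case 0
  then show ?case by (auto intro: continuous_on_real_sqrt)
next
  case (Suc k)
  show ?case
  proof (rule Ck_on_SucI[OF assms(1)])
    show "((\<lambda>x. sqrt (f x)) has_derivative
        (\<lambda>v. frechet_derivative f (at x) v * (inverse (sqrt (f x)) * (1/2)))) (at x)" if "x \<in> U" for x
      by (rule has_derivative_eq_rhs[OF has_derivative_real_sqrt[OF assms(3)[OF that] Ck_on_SucE(1)[OF Suc.prems that]]])
        (simp add: fun_eq_iff field_simps)
    show "Ck_on k U (\<lambda>x. frechet_derivative f (at x) v * (inverse (sqrt (f x)) * (1/2)))" for v
    proof (intro Ck_on_mult assms(1) Ck_on_const Ck_on_SucE(2)[OF Suc.prems] Ck_on_inverse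
        Suc.IH[OF Ck_on_SucD[OF Suc.prems]])
      show "sqrt (f x) \<noteq> 0" if "x \<in> U" for x
        using assms(3)[OF that] by simp
    qed
  qed
qed

lemma Ck_on_Pair:
  assumes "open U" "Ck_on k U f" "Ck_on k U g"
  shows "Ck_on k U (\<lambda>x. (f x, g x))"
  using assms(2,3)
proof (induction k arbitrary: f g)
  case 0
  then show ?case by (auto intro: continuous_on_Pair)
next
  case (Suc k)
  show ?case
    by (rule Ck_on_SucI[OF assms(1) has_derivative_Pair
          [OF Ck_on_SucE(1)[OF Suc.prems(1)] Ck_on_SucE(1)[OF Suc.prems(2)]]])
      (auto intro: Suc.IH Ck_on_SucE(2)[OF Suc.prems(1)] Ck_on_SucE(2)[OF Suc.prems(2)])
qed

lemma Ck_on_snd: "open U \<Longrightarrow> Ck_on k U f \<Longrightarrow> Ck_on k U (\<lambda>x. snd (f x :: 'b::euclidean_space \<times> 'c::euclidean_space))"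
  for f :: "'a::euclidean_space \<Rightarrow> _"
  by (rule Ck_on_compose[OF _ Ck_on_bounded_linear[OF bounded_linear_snd, where U=UNIV]]) simp_all

lemma Ck_on_imp_frechet_continuous:
  assumes "Ck_on (Suc 0) U f"
  shows "continuous_on U (\<lambda>x. frechet_derivative f (at x) v)"
  using Ck_on_SucE(2)[OF assms] by simp

lemma smooth_on_has_derivative:
  "smooth_on U f \<Longrightarrow> x \<in> U \<Longrightarrow> (f has_derivative frechet_derivative f (at x)) (at x)"
  unfolding smooth_on_def using Ck_on_SucE(1) by blast

lemma smooth_on_continuous_on: "smooth_on U f \<Longrightarrow> continuous_on U f"
  unfolding smooth_on_def using Ck_on.simps(1) by blast

lemma smooth_on_derivative: "smooth_on U f \<Longrightarrow> smooth_on U (\<lambda>x. frechet_derivative f (at x) v)"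
  unfolding smooth_on_def using Ck_on_SucE(2) by blast

lemma smooth_on_subset: "smooth_on U f \<Longrightarrow> V \<subseteq> U \<Longrightarrow> smooth_on V f"
  unfolding smooth_on_def using Ck_on_subset by blast

lemma smooth_on_compose:
  fixes f :: "'a::euclidean_space \<Rightarrow> 'b::euclidean_space" and g :: "'b \<Rightarrow> 'c::real_normed_vector"
  shows "open U \<Longrightarrow> smooth_on V g \<Longrightarrow> smooth_on U f \<Longrightarrow> f ` U \<subseteq> V \<Longrightarrow> smooth_on U (\<lambda>x. g (f x))"
  unfolding smooth_on_def using Ck_on_compose by blast

section \<open>Symmetry of second derivatives\<close>

lemma second_difference_mvt:
  fixes f :: "'a::real_normed_vector \<Rightarrow> real"
  assumes "Ck_on (Suc (Suc 0)) U f" "h > 0"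
    and U: "\<And>s t. 0 \<le> s \<Longrightarrow> s \<le> h \<Longrightarrow> 0 \<le> t \<Longrightarrow> t \<le> h \<Longrightarrow> x + s *\<^sub>R v + t *\<^sub>R w \<in> U"
  obtains s t where "0 \<le> s" "s \<le> h" "0 \<le> t" "t \<le> h"
    "f (x + h *\<^sub>R v + h *\<^sub>R w) - f (x + h *\<^sub>R v) - f (x + h *\<^sub>R w) + f x
     = h * h * frechet_derivative (\<lambda>y. frechet_derivative f (at y) v) (at (x + s *\<^sub>R v + t *\<^sub>R w)) w"
proof -
  let ?D = "\<lambda>y. frechet_derivative f (at y)"
  note d1 = Ck_on_SucE(1)[OF assms(1)]
  note d2 = Ck_on_SucE(1)[OF Ck_on_SucE(2)[OF assms(1), of v]]
  \<comment> \<open>A difference of f in direction w, as a function of the displacement along v. The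
    mean value theorem in s and then in t turns the second difference, which is symmetric in v and
    w, into a mixed derivative at one point.\<close>
  define g where "g s = f (x + s *\<^sub>R v + h *\<^sub>R w) - f (x + s *\<^sub>R v)" for s
  have gd: "(g has_real_derivative ?D (x + s *\<^sub>R v + h *\<^sub>R w) v - ?D (x + s *\<^sub>R v) v) (at s)"
    if "0 \<le> s" "s \<le> h" for s
  proof -
    have m: "x + s *\<^sub>R v + h *\<^sub>R w \<in> U" "x + s *\<^sub>R v \<in> U"
      using U[of s h] U[of s 0] that assms(2) by auto
    have "(f \<circ> (\<lambda>s. x + s *\<^sub>R v + h *\<^sub>R w) has_derivative ?D (x + s *\<^sub>R v + h *\<^sub>R w) \<circ> (\<lambda>c. c *\<^sub>R v)) (at s)"
      by (rule diff_chain_at[OF _ d1]) (auto intro!: derivative_eq_intros m)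
    moreover have "(f \<circ> (\<lambda>s. x + s *\<^sub>R v) has_derivative ?D (x + s *\<^sub>R v) \<circ> (\<lambda>c. c *\<^sub>R v)) (at s)"
      by (rule diff_chain_at[OF _ d1]) (auto intro!: derivative_eq_intros m)
    ultimately have "(g has_derivative (\<lambda>c. ?D (x + s *\<^sub>R v + h *\<^sub>R w) (c *\<^sub>R v) - ?D (x + s *\<^sub>R v) (c *\<^sub>R v))) (at s)"
      unfolding g_def[abs_def] o_def by (rule has_derivative_diff)
    then show ?thesis
      unfolding has_field_derivative_def
      by (rule has_derivative_eq_rhs)
        (simp add: linear_scale[OF has_derivative_linear[OF d1[OF m(1)]]]
          linear_scale[OF has_derivative_linear[OF d1[OF m(2)]]] fun_eq_iff right_diff_distrib mult.commute)
  qed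
  obtain s where s: "0 < s" "s < h" "g h - g 0 = (h - 0) * (?D (x + s *\<^sub>R v + h *\<^sub>R w) v - ?D (x + s *\<^sub>R v) v)"
    using MVT2[OF assms(2) gd] by auto
  define k where "k t = ?D (x + s *\<^sub>R v + t *\<^sub>R w) v" for t
  have kd: "(k has_real_derivative frechet_derivative (\<lambda>y. ?D y v) (at (x + s *\<^sub>R v + t *\<^sub>R w)) w) (at t)"
    if "0 \<le> t" "t \<le> h" for t
  proof -
    have m: "x + s *\<^sub>R v + t *\<^sub>R w \<in> U"
      using U[of s t] that s by auto
    have "((\<lambda>y. ?D y v) \<circ> (\<lambda>t. x + s *\<^sub>R v + t *\<^sub>R w) has_derivative
        frechet_derivative (\<lambda>y. ?D y v) (at (x + s *\<^sub>R v + t *\<^sub>R w)) \<circ> (\<lambda>c. c *\<^sub>R w)) (at t)"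
      by (rule diff_chain_at[OF _ d2]) (auto intro!: derivative_eq_intros m)
    then show ?thesis
      unfolding k_def[abs_def] o_def
      unfolding has_field_derivative_def
      by (rule has_derivative_eq_rhs)
        (simp add: linear_scale[OF has_derivative_linear[OF d2[OF m]]] fun_eq_iff)
  qed
  obtain t where t: "0 < t" "t < h" "k h - k 0 = (h - 0) * frechet_derivative (\<lambda>y. ?D y v) (at (x + s *\<^sub>R v + t *\<^sub>R w)) w"
    using MVT2[OF assms(2) kd] by auto
  show ?thesis
  proof (rule that[of s t])
    have "g h - g 0 = h * (h * frechet_derivative (\<lambda>y. ?D y v) (at (x + s *\<^sub>R v + t *\<^sub>R w)) w)"
      using s(3) t(3) by (simp add: k_def)
    then show "f (x + h *\<^sub>R v + h *\<^sub>R w) - f (x + h *\<^sub>R v) - f (x + h *\<^sub>R w) + f x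
      = h * h * frechet_derivative (\<lambda>y. ?D y v) (at (x + s *\<^sub>R v + t *\<^sub>R w)) w"
      by (simp add: g_def)
  qed (use s t in auto)
qed

text \<open>The second difference over the parallelogram spanned by h v and h w equals h * h times
  either mixed derivative, each at some point of the parallelogram. By continuity the two mixed
  derivatives at x differ by at most e.\<close>

lemma second_derivative_symmetric:
  fixes f :: "'a::real_normed_vector \<Rightarrow> real"
  assumes "Ck_on (Suc (Suc 0)) U f" "open U" "x \<in> U"
  shows "frechet_derivative (\<lambda>y. frechet_derivative f (at y) v) (at x) w
       = frechet_derivative (\<lambda>y. frechet_derivative f (at y) w) (at x) v"
proof (rule field_le_epsilon[THEN antisym[OF _ field_le_epsilon]])
  let ?H = "\<lambda>v w y. frechet_derivative (\<lambda>y. frechet_derivative f (at y) v) (at y) w"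
  have main: "?H v w x \<le> ?H w v x + e" if "e > 0" for e v w
  proof -
    have c: "continuous_on U (?H v w)" for v w
      by (rule Ck_on_imp_frechet_continuous[OF Ck_on_SucE(2)[OF assms(1)]])
    have ex: "\<exists>d>0. \<forall>y. dist y x < d \<longrightarrow> y \<in> U \<and> \<bar>?H v w y - ?H v w x\<bar> < e/2" for v w
    proof -
      obtain d1 where d1: "d1 > 0" "\<forall>y\<in>U. dist y x < d1 \<longrightarrow> dist (?H v w y) (?H v w x) < e/2"
        using c[of v w] assms(3) \<open>e > 0\<close> unfolding continuous_on_iff by (meson half_gt_zero)
      obtain d2 where d2: "d2 > 0" "ball x d2 \<subseteq> U"
        using assms(2,3) open_contains_ball by blast
      show ?thesis
        using d1 d2 by (intro exI[of _ "min d1 d2"]) (auto simp: dist_real_def dist_commute subset_iff)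
    qed
    obtain d1 where d1: "d1 > 0" "\<And>y. dist y x < d1 \<Longrightarrow> y \<in> U \<and> \<bar>?H v w y - ?H v w x\<bar> < e/2"
      using ex[of v w] by blast
    obtain d2 where d2: "d2 > 0" "\<And>y. dist y x < d2 \<Longrightarrow> y \<in> U \<and> \<bar>?H w v y - ?H w v x\<bar> < e/2"
      using ex[of w v] by blast
    \<comment> \<open>The parallelogram has to fit into the ball of radius \<open>min d1 d2\<close>
      around x; the added 1 keeps the denominator positive when v and w vanish.\<close>
    define h where "h = min d1 d2 / (2 * (norm v + norm w + 1))"
    have nn0: "0 \<le> norm v + norm w" by simp
    then have nn: "norm v + norm w + 1 > 0" by linarith
    have "r < 2 * (r + 1)" if "0 \<le> r" for r :: real using that by simp
    from this[OF nn0] have nn2: "norm v + norm w < 2 * (norm v + norm w + 1)" .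
    have h: "h > 0" using d1(1) d2(1) nn by (simp add: h_def)
    have near: "dist (x + s *\<^sub>R a + t *\<^sub>R b) x < min d1 d2"
      if "0 \<le> s" "s \<le> h" "0 \<le> t" "t \<le> h" "norm a + norm b = norm v + norm w" for s t a b
    proof -
      have "dist (x + s *\<^sub>R a + t *\<^sub>R b) x = norm (s *\<^sub>R a + t *\<^sub>R b)"
        by (simp add: dist_norm algebra_simps)
      also have "\<dots> \<le> s * norm a + t * norm b"
        using that norm_triangle_ineq[of "s *\<^sub>R a" "t *\<^sub>R b"] by simp
      also have "\<dots> \<le> h * norm a + h * norm b"
        using that by (intro add_mono mult_right_mono) auto
      also have "\<dots> = h * (norm v + norm w)" using that(5) by (simp add: distrib_left[symmetric])
      also have "\<dots> < h * (2 * (norm v + norm w + 1))"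
        by (rule mult_strict_left_mono[OF nn2 h])
      also have "\<dots> = min d1 d2"
        unfolding h_def using nn by simp
      finally show ?thesis .
    qed
    obtain s t where st: "0 \<le> s" "s \<le> h" "0 \<le> t" "t \<le> h"
      "f (x + h *\<^sub>R v + h *\<^sub>R w) - f (x + h *\<^sub>R v) - f (x + h *\<^sub>R w) + f x = h * h * ?H v w (x + s *\<^sub>R v + t *\<^sub>R w)"
      by (rule second_difference_mvt[OF assms(1) h, of x v w]) (use near[of _ _ v w] d1(2) in force)+
    obtain s' t' where st': "0 \<le> s'" "s' \<le> h" "0 \<le> t'" "t' \<le> h"
      "f (x + h *\<^sub>R w + h *\<^sub>R v) - f (x + h *\<^sub>R w) - f (x + h *\<^sub>R v) + f x = h * h * ?H w v (x + s' *\<^sub>R w + t' *\<^sub>R v)"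
      by (rule second_difference_mvt[OF assms(1) h, of x w v]) (use near[of _ _ w v] d1(2) in force)+
    have "h * h * ?H v w (x + s *\<^sub>R v + t *\<^sub>R w) = h * h * ?H w v (x + s' *\<^sub>R w + t' *\<^sub>R v)"
      using st(5) st'(5) by (simp add: algebra_simps)
    then have eq: "?H v w (x + s *\<^sub>R v + t *\<^sub>R w) = ?H w v (x + s' *\<^sub>R w + t' *\<^sub>R v)"
      using h by simp
    have "\<bar>?H v w (x + s *\<^sub>R v + t *\<^sub>R w) - ?H v w x\<bar> < e/2"
      using d1(2)[of "x + s *\<^sub>R v + t *\<^sub>R w"] near[of s t v w] st by auto
    moreover have "\<bar>?H w v (x + s' *\<^sub>R w + t' *\<^sub>R v) - ?H w v x\<bar> < e/2"
      using d2(2)[of "x + s' *\<^sub>R w + t' *\<^sub>R v"] near[of s' t' w v] st' by auto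
    ultimately show ?thesis using eq by linarith
  qed
  show "e > 0 \<Longrightarrow> ?H v w x \<le> ?H w v x + e" for e by (rule main)
  show "e > 0 \<Longrightarrow> ?H w v x \<le> ?H v w x + e" for e by (rule main)
qed

text \<open>The implicit function theorem: \<open>Phi\<close> keeps x and replaces s by R (x, s),
  its derivative is invertible where the partial derivative in s is nonzero, and h is the last
  coordinate of the local inverse on level 0. The set B also excludes zeros off the graph, which
  later makes the image of a boundary chart relatively open.\<close>

lemma smooth_implicit_graph:
  fixes R :: "'a::euclidean_space \<times> real \<Rightarrow> real"
  assumes "open W" "smooth_on W R" "(x0,s0) \<in> W" "R (x0,s0) = 0"
    and "frechet_derivative R (at (x0,s0)) (0,1) \<noteq> 0"
  obtains B U h where "open B" "(x0,s0) \<in> B" "B \<subseteq> W" "open U" "x0 \<in> U" "smooth_on U h"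
    "\<And>x. x \<in> U \<Longrightarrow> (x, h x) \<in> B" "\<And>x s. (x,s) \<in> B \<Longrightarrow> R (x,s) = 0 \<longleftrightarrow> x \<in> U \<and> s = h x"
proof -
  define D where "D z = frechet_derivative R (at z)" for z
  define W' where "W' = {z\<in>W. D z (0,1) \<noteq> 0}"
  have cD: "continuous_on W (\<lambda>z. D z v)" for v
    unfolding D_def using smooth_on_continuous_on[OF smooth_on_derivative[OF assms(2)]] .
  have "open W'"
  proof -
    have "W' = W \<inter> (\<lambda>z. D z (0,1)) -` (- {0})" by (auto simp: W'_def)
    then show ?thesis
      using continuous_open_preimage[OF cD[of "(0,1)"] assms(1)] by (simp add: open_Compl)
  qed
  have a: "(x0,s0) \<in> W'" using assms(3,5) by (simp add: W'_def D_def)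
  have W'W: "W' \<subseteq> W" by (auto simp: W'_def)
  have dR: "(R has_derivative D z) (at z)" if "z \<in> W'" for z
    using smooth_on_has_derivative[OF assms(2)] that unfolding D_def by (auto simp: W'_def)
  have linD: "linear (D z)" if "z \<in> W'" for z
    using has_derivative_linear[OF dR[OF that]] .
  define Phi where "Phi z = (fst z, R z)" for z
  define Phi' where "Phi' z v = (fst v, D z v)" for z and v :: "'a \<times> real"
  define Psi' where "Psi' z w = (fst w, (snd w - D z (fst w, 0)) / D z (0,1))" for z and w :: "'a \<times> real"
  have dPhi: "(Phi has_derivative Phi' z) (at z)" if "z \<in> W'" for z
    unfolding Phi_def[abs_def] Phi'_def[abs_def]
    by (intro has_derivative_Pair dR[OF that] has_derivative_fst has_derivative_ident)
  have split: "D z (u, r) = D z (u, 0) + r * D z (0, 1)" if "z \<in> W'" for z u r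
    using linear_add[OF linD[OF that], of "(u,0)" "(0,r)"]
      linear_scale[OF linD[OF that], of r "(0,1)"] by simp
  have nz: "D z (0,1) \<noteq> 0" if "z \<in> W'" for z using that by (simp add: W'_def)
  have inv1: "Phi' z \<circ> Psi' z = id" if "z \<in> W'" for z
  proof
    fix w :: "'a \<times> real"
    show "(Phi' z \<circ> Psi' z) w = id w"
      using split[OF that, of "fst w" "(snd w - D z (fst w, 0)) / D z (0,1)"] nz[OF that]
      by (simp add: Phi'_def Psi'_def)
  qed
  have inv2: "Psi' z \<circ> Phi' z = id" if "z \<in> W'" for z
  proof
    fix w :: "'a \<times> real"
    show "(Psi' z \<circ> Phi' z) w = id w"
      using split[OF that, of "fst w" "snd w"] nz[OF that]
      by (simp add: Phi'_def Psi'_def)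
  qed
  have blPhi': "bounded_linear (Phi' z)" if "z \<in> W'" for z
    using has_derivative_bounded_linear[OF dPhi[OF that]] .
  have blPsi': "bounded_linear (Psi' z)" if "z \<in> W'" for z
    using right_inverse_linear[OF _ inv1[OF that]] blPhi'[OF that]
    by (simp add: linear_conv_bounded_linear)
  let ?a = "(x0,s0)"
  \<comment> \<open>Smoothness controls one direction at a time; the operator norm of the change of
    the derivative is bounded by the sum of the changes over the basis vectors.\<close>
  have ons: "\<exists>d>0. \<forall>z. dist ?a z < d \<longrightarrow> onorm (\<lambda>v. Phi' z v - Phi' ?a v) < e" if "e > 0" for e
  proof -
    define S where "S z = (\<Sum>b\<in>Basis. \<bar>D z b - D ?a b\<bar>)" for z
    have "continuous_on W' S"
      unfolding S_def by (intro continuous_intros continuous_on_subset[OF cD W'W])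
    then have "\<exists>d>0. \<forall>z\<in>W'. dist z ?a < d \<longrightarrow> dist (S z) (S ?a) < e"
      using a that unfolding continuous_on_iff by blast
    then obtain d1 where d1: "d1 > 0" "\<And>z. z \<in> W' \<Longrightarrow> dist z ?a < d1 \<Longrightarrow> dist (S z) (S ?a) < e"
      by metis
    obtain d2 where d2: "d2 > 0" "ball ?a d2 \<subseteq> W'"
      using \<open>open W'\<close> a open_contains_ball by blast
    have "onorm (\<lambda>v. Phi' z v - Phi' ?a v) < e" if "dist ?a z < min d1 d2" for z
    proof -
      have zW: "z \<in> W'" using that d2 by auto
      have "S ?a = 0" by (simp add: S_def)
      then have Se: "S z < e"
        using d1(2)[OF zW] that by (simp add: dist_commute dist_real_def)
      have "norm (Phi' z v - Phi' ?a v) \<le> S z * norm v" for v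
      proof -
        have rep: "D y v = (\<Sum>b\<in>Basis. (v \<bullet> b) * D y b)" if "y \<in> W'" for y
          using linear_sum[OF linD[OF that], of "\<lambda>b. (v \<bullet> b) *\<^sub>R b" Basis]
          by (simp add: euclidean_representation linear_scale[OF linD[OF that]])
        have "D z v - D ?a v = (\<Sum>b\<in>Basis. (v \<bullet> b) * (D z b - D ?a b))"
          unfolding rep[OF zW] rep[OF a] by (simp add: sum_subtractf right_diff_distrib)
        also have "\<bar>\<dots>\<bar> \<le> (\<Sum>b\<in>Basis. \<bar>(v \<bullet> b) * (D z b - D ?a b)\<bar>)"
          by (rule sum_abs)
        also have "\<dots> \<le> (\<Sum>b\<in>Basis. norm v * \<bar>D z b - D ?a b\<bar>)"
          by (intro sum_mono) (simp add: abs_mult mult_right_mono Basis_le_norm)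
        finally show ?thesis
          by (simp add: Phi'_def S_def sum_distrib_left mult.commute norm_Pair)
      qed
      then show ?thesis using Se onorm_le[of "\<lambda>v. Phi' z v - Phi' ?a v" "S z"] by force
    qed
    then show ?thesis using d1(1) d2(1) by (intro exI[of _ "min d1 d2"]) simp
  qed
  obtain r where r: "r > 0" "ball ?a r \<subseteq> W'" "inj_on Phi (ball ?a r)"
    using has_derivative_locally_injective[OF a \<open>open W'\<close> blPsi'[OF a] inv2[OF a] dPhi ons] by blast
  define B where "B = ball ?a r"
  have BW': "B \<subseteq> W'" and injB: "inj_on Phi B" and opB: "open B" and aB: "?a \<in> B"
    using r by (simp_all add: B_def)
  have contB: "continuous_on B Phi"
    by (intro continuous_at_imp_continuous_on ballI has_derivative_continuous[OF dPhi]) (use BW' in auto)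
  define V where "V = Phi ` B"
  have opV: "open V"
    unfolding V_def by (rule invariance_of_domain[OF contB opB injB])
  define g where "g = inv_into B Phi"
  have gPhi: "g (Phi z) = z" if "z \<in> B" for z
    using that injB by (simp add: g_def)
  have Phig: "g y \<in> B" "Phi (g y) = y" if "y \<in> V" for y
    using that unfolding V_def g_def by (auto intro: inv_into_into f_inv_into_f)
  define U where "U = (\<lambda>x. (x, 0::real)) -` V"
  define h where "h x = snd (g (x, 0))" for x
  have opU: "open U"
    unfolding U_def using opV by (intro open_vimage continuous_intros)
  have gx: "g (x, 0) = (x, h x)" "(x, h x) \<in> B" "R (x, h x) = 0" if "x \<in> U" for x
  proof -
    have "(x, 0) \<in> V" using that by (simp add: U_def)
    from Phig[OF this] show "g (x, 0) = (x, h x)" "(x, h x) \<in> B" "R (x, h x) = 0"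
      by (auto simp: Phi_def h_def prod_eq_iff) (metis prod.collapse)+
  qed
  have iff: "R (x,s) = 0 \<longleftrightarrow> x \<in> U \<and> s = h x" if "(x,s) \<in> B" for x s
  proof
    assume "R (x,s) = 0"
    then have P: "Phi (x,s) = (x,0)" by (simp add: Phi_def)
    then have "(x,0) \<in> V" using that unfolding V_def by force
    moreover have "h x = s" using gPhi[OF that] P by (simp add: h_def)
    ultimately show "x \<in> U \<and> s = h x" by (simp add: U_def)
  qed (use gx in auto)
  have x0U: "x0 \<in> U" using iff[of x0 s0] aB assms(4) by simp
  have dh: "(h has_derivative (\<lambda>v. - 1 * (D (x, h x) (v, 0) * inverse (D (x, h x) (0, 1))))) (at x)"
    if "x \<in> U" for x
  proof -
    have zB: "(x, h x) \<in> B" by (rule gx(2)[OF that])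
    have zW: "(x, h x) \<in> W'" using zB BW' by blast
    have "(g has_derivative Psi' (x, h x)) (at (Phi (x, h x)))"
      by (rule has_derivative_inverse_strong[OF opB zB contB gPhi dPhi[OF zW] inv1[OF zW]])
    moreover have "Phi (x, h x) = (x, 0)" using gx(3)[OF that] by (simp add: Phi_def)
    ultimately have g': "(g has_derivative Psi' (x, h x)) (at (x, 0))" by simp
    have "((\<lambda>x. (x, 0::real)) has_derivative (\<lambda>v. (v, 0))) (at x)"
      by (intro has_derivative_Pair has_derivative_ident has_derivative_const)
    from has_derivative_snd[OF diff_chain_at[OF this g']]
    have "((\<lambda>x. snd ((g \<circ> (\<lambda>x. (x, 0))) x)) has_derivative (\<lambda>v. snd ((Psi' (x, h x) \<circ> (\<lambda>v. (v, 0))) v))) (at x)" .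
    then have "(h has_derivative (\<lambda>v. snd ((Psi' (x, h x) \<circ> (\<lambda>v. (v, 0))) v))) (at x)"
      unfolding h_def[abs_def] by (simp add: o_def)
    then show ?thesis
      by (rule has_derivative_eq_rhs) (simp add: Psi'_def fun_eq_iff divide_inverse)
  qed
  \<comment> \<open>The derivative of h is a quotient of derivatives of R along the graph of h, so
    each order of smoothness of h yields the next.\<close>
  have "Ck_on k U h" for k
  proof (induction k)
    case 0
    then show ?case
      by (auto intro!: continuous_at_imp_continuous_on has_derivative_continuous[OF dh])
  next
    case (Suc k)
    have graph: "Ck_on k U (\<lambda>x. (x, h x))"
      by (intro Ck_on_Pair opU Suc Ck_on_bounded_linear bounded_linear_ident)
    have sD: "Ck_on k W' (\<lambda>z. D z v)" for v
      using smooth_on_subset[OF smooth_on_derivative[OF assms(2)] W'W] unfolding D_def smooth_on_def by blast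
    have sub: "(\<lambda>x. (x, h x)) ` U \<subseteq> W'" using gx(2) BW' by auto
    have comp: "Ck_on k U (\<lambda>x. D (x, h x) v)" for v
      by (rule Ck_on_compose[OF opU sD graph sub])
    show ?case
    proof (rule Ck_on_SucI[OF opU dh])
      show "Ck_on k U (\<lambda>x. - 1 * (D (x, h x) (v, 0) * inverse (D (x, h x) (0, 1))))" for v
      proof (intro Ck_on_mult opU Ck_on_const comp Ck_on_inverse)
        show "D (x, h x) (0, 1) \<noteq> 0" if "x \<in> U" for x
          using nz gx(2)[OF that] BW' by blast
      qed
    qed
  qed
  then have sh: "smooth_on U h" by (simp add: smooth_on_def)
  show ?thesis
    by (rule that[OF opB aB subset_trans[OF BW' W'W] opU x0U sh gx(2) iff])
qed

section \<open>Determinants\<close>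

text \<open>A rotation that takes a to a multiple of a coordinate vector makes the matrix diagonal,
  with one nontrivial entry. This computes the volume density of hyperbolic space and the Gram
  determinant of a projected frame.\<close>

lemma det_identity_plus_rank_one:
  fixes a :: "real ^ 'd::finite"
  shows "det (\<chi> i j. (if i = j then 1 else 0) + c * a $ i * a $ j) = 1 + c * (a \<bullet> a)"
proof -
  let ?M = "(\<chi> i j. (if i = j then 1 else 0) + c * a $ i * a $ j) :: real ^ 'd ^ 'd"
  \<comment> \<open>Any index can carry the image of a; the result does not mention it.\<close>
  fix k :: 'd
  obtain f :: "real ^ 'd \<Rightarrow> real ^ 'd" where f: "orthogonal_transformation f" "f a = norm a *\<^sub>R axis k 1"
    using orthogonal_transformation_exists[of a "norm a *\<^sub>R axis k 1"] by auto
  let ?Q = "matrix f"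
  have lf: "linear f" using f(1) by (simp add: orthogonal_transformation_linear)
  have Qv: "?Q *v x = f x" for x using lf by (simp add: matrix_works)
  have oQ: "orthogonal_matrix ?Q" using f(1) by (simp add: orthogonal_transformation_matrix)
  have Mv: "?M *v x = x + (c * (a \<bullet> x)) *\<^sub>R a" for x
  proof (subst vec_eq_iff, intro allI)
    fix i
    have "(?M *v x) $ i = (\<Sum>j\<in>UNIV. (if i = j then x $ j else 0) + c * (a $ j * x $ j) * a $ i)"
      unfolding matrix_vector_mult_def by (auto intro!: sum.cong simp: algebra_simps)
    also have "\<dots> = x $ i + (\<Sum>j\<in>UNIV. c * (a $ j * x $ j) * a $ i)"
      by (simp add: sum.distrib)
    also have "(\<Sum>j\<in>UNIV. c * (a $ j * x $ j) * a $ i) = c * (a \<bullet> x) * a $ i"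
      by (simp add: inner_vec_def sum_distrib_left sum_distrib_right)
    finally show "(?M *v x) $ i = (x + (c * (a \<bullet> x)) *\<^sub>R a) $ i" by simp
  qed
  let ?D = "(\<chi> i j. if i = j then (if i = k then 1 + c * (a \<bullet> a) else 1) else 0) :: real ^ 'd ^ 'd"
  have "?Q ** ?M ** transpose ?Q = ?D"
  proof (subst matrix_eq, intro allI)
    fix x :: "real ^ 'd"
    have "?Q *v (transpose ?Q *v x) = x"
      using oQ unfolding orthogonal_matrix_def
      by (simp only: matrix_vector_mul_assoc matrix_vector_mul_lid)
    then have "f (transpose ?Q *v x) = x"
      by (simp only: Qv)
    moreover have "a \<bullet> (transpose ?Q *v x) = (?Q *v a) \<bullet> x"
      by (metis dot_lmul_matrix transpose_matrix_vector inner_commute)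
    then have "a \<bullet> (transpose ?Q *v x) = f a \<bullet> x"
      by (simp only: Qv)
    ultimately have "(?Q ** ?M ** transpose ?Q) *v x = x + (c * (f a \<bullet> x)) *\<^sub>R f a"
      by (simp only: matrix_vector_mul_assoc[symmetric] Mv Qv linear_add[OF lf] linear_scale[OF lf])
    also have "\<dots> = x + (c * (a \<bullet> a) * x $ k) *\<^sub>R axis k 1"
      by (simp add: f(2) inner_axis' dot_square_norm power2_eq_square mult.commute mult.left_commute)
    also have "\<dots> = ?D *v x"
    proof (subst vec_eq_iff, intro allI)
      fix i
      have "(?D *v x) $ i = (\<Sum>j\<in>UNIV. if i = j then (if i = k then 1 + c * (a \<bullet> a) else 1) * x $ j else 0)"
        unfolding matrix_vector_mult_def vec_lambda_beta by (rule sum.cong) auto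
      then show "(x + (c * (a \<bullet> a) * x $ k) *\<^sub>R axis k 1) $ i = (?D *v x) $ i"
        by (simp add: axis_def algebra_simps)
    qed
    finally show "(?Q ** ?M ** transpose ?Q) *v x = ?D *v x" .
  qed
  moreover have "det (?Q ** ?M ** transpose ?Q) = det ?M * (det ?Q * det ?Q)"
    by (simp add: det_mul det_transpose)
  moreover have "det ?D = 1 + c * (a \<bullet> a)"
    by (subst det_diagonal) (simp_all add: prod.If_cases)
  moreover have "det ?Q * det ?Q = 1"
    using det_orthogonal_matrix[OF oQ] by auto
  ultimately show ?thesis by simp
qed

text \<open>Conjugation by c is a sign-preserving bijection between the permutations of the two
  index types, and it matches the terms of the Leibniz formula.\<close>

lemma det_reindex:
  fixes A :: "real ^ 'd::finite ^ 'd" and c :: "'e::finite \<Rightarrow> 'd"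
  assumes "bij c"
  shows "det (\<chi> i j. A $ c i $ c j) = det A"
proof -
  have ic: "bij (inv c)" using assms by (rule bij_imp_bij_inv)
  have ci: "inv c (c x) = x" "c (inv c y) = y" "inv (inv c) = c" for x y
    using assms by (simp_all add: bij_is_inj bij_is_surj surj_f_inv_f inv_inv_eq)
  have mc: "map_permutation UNIV c p = (\<lambda>y. c (p (inv c y)))" for p
    using assms by (simp add: map_permutation_def restrict_id_def fun_eq_iff bij_is_surj)
  have mic: "map_permutation UNIV (inv c) q = (\<lambda>x. inv c (q (c x)))" for q
    using ic by (simp add: map_permutation_def restrict_id_def fun_eq_iff bij_is_surj ci(3))
  have bij_perm: "bij_betw (map_permutation UNIV c) {p. p permutes UNIV} {p. p permutes UNIV}"
  proof (rule bij_betwI[where g = "map_permutation UNIV (inv c)"])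
    show "map_permutation UNIV c \<in> {p. p permutes UNIV} \<rightarrow> {p. p permutes UNIV}"
      using map_permutation_permutes[where f=c and A=UNIV and B=UNIV] assms by auto
    show "map_permutation UNIV (inv c) \<in> {p. p permutes UNIV} \<rightarrow> {p. p permutes UNIV}"
      using map_permutation_permutes[where f="inv c" and A=UNIV and B=UNIV] ic by auto
  qed (simp_all add: mc mic ci)
  have mp: "map_permutation UNIV c p (c i) = c (p i)" for p i
    by (simp add: mc ci)
  have "det A = (\<Sum>p | p permutes UNIV. of_int (sign (map_permutation UNIV c p)) * (\<Prod>i\<in>UNIV. A $ i $ map_permutation UNIV c p i))"
    unfolding det_def by (rule sum.reindex_bij_betw[OF bij_perm, symmetric])
  also have "\<dots> = det (\<chi> i j. A $ c i $ c j)"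
    unfolding det_def
  proof (rule sum.cong[OF refl])
    fix p :: "'e \<Rightarrow> 'e" assume "p \<in> {p. p permutes UNIV}"
    then have "sign (map_permutation UNIV c p) = sign p"
      using assms by (intro sign_map_permutation) (auto simp: bij_is_inj)
    moreover have "(\<Prod>i\<in>UNIV. A $ i $ map_permutation UNIV c p i) = (\<Prod>i\<in>UNIV. A $ c i $ c (p i))"
      by (subst prod.reindex_bij_betw[OF assms, symmetric]) (simp add: mp)
    ultimately show "of_int (sign (map_permutation UNIV c p)) * (\<Prod>i\<in>UNIV. A $ i $ map_permutation UNIV c p i)
      = of_int (sign p) * (\<Prod>i\<in>UNIV. (\<chi> i j. A $ c i $ c j) $ i $ p i)" by simp
  qed
  finally show ?thesis ..
qed

text \<open>A permutation that moves \<open>None\<close> picks a vanishing entry of the row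
  \<open>None\<close>. Those that fix it are the \<open>map_option p\<close>, with the sign of
  p.\<close>

lemma det_option_block:
  fixes A :: "real ^ ('n::finite option) ^ ('n option)"
  assumes "A $ None $ None = 1" "\<And>j. A $ None $ Some j = 0"
  shows "det A = det (\<chi> i j. A $ Some i $ Some j)"
proof -
  have mp: "map_permutation UNIV Some p = map_option p" for p :: "'n \<Rightarrow> 'n"
  proof
    fix x show "map_permutation UNIV Some p x = map_option p x"
      by (cases x) (auto simp: map_permutation_def restrict_id_def)
  qed
  have bij_perm: "bij_betw map_option {p. p permutes (UNIV :: 'n set)} {p. p permutes UNIV \<and> p None = None}"
  proof (rule bij_betwI[where g = "\<lambda>p x. the (p (Some x))"])
    show "map_option \<in> {p :: 'n \<Rightarrow> 'n. p permutes UNIV} \<rightarrow> {p. p permutes UNIV \<and> p None = None}"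
    proof (rule funcsetI)
      fix p :: "'n \<Rightarrow> 'n" assume "p \<in> {p. p permutes UNIV}"
      then have "bij p" by (simp add: permutes_bij)
      then have "inv p \<circ> p = id" "p \<circ> inv p = id"
        by (simp_all add: bij_is_inj bij_is_surj surj_iff[symmetric])
      then have "map_option (inv p \<circ> p) = id" "map_option (p \<circ> inv p) = id"
        by (simp_all only: option.map_id0)
      then have "map_option (inv p) \<circ> map_option p = id" "map_option p \<circ> map_option (inv p) = id"
        by (auto simp: fun_eq_iff option.map_comp)
      then have "bij (map_option p)" by (rule o_bij)
      then show "map_option p \<in> {p. p permutes UNIV \<and> p None = None}"
        using bij_imp_permutes by fastforce
    qed
    show "(\<lambda>p x. the (p (Some x))) \<in> {p. p permutes UNIV \<and> p None = None} \<rightarrow> {p :: 'n \<Rightarrow> 'n. p permutes UNIV}"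
    proof (rule funcsetI)
      fix p :: "'n option \<Rightarrow> 'n option" assume "p \<in> {p. p permutes UNIV \<and> p None = None}"
      then have p: "p permutes UNIV" "p None = None" by simp_all
      have "bij p" using p(1) by (simp add: permutes_bij)
      have S: "p (Some x) \<noteq> None" for x
        using p(2) \<open>bij p\<close> by (metis bij_is_inj injD option.distinct(1))
      have "inj (\<lambda>x. the (p (Some x)))"
      proof (rule injI)
        fix x y assume "the (p (Some x)) = the (p (Some y))"
        then have "p (Some x) = p (Some y)" using S by (metis option.exhaust_sel)
        then show "x = y" using \<open>bij p\<close> by (metis bij_is_inj injD option.inject)
      qed
      then have "bij (\<lambda>x. the (p (Some x)))"
        by (simp add: bij_def finite_UNIV_inj_surj)
      then show "(\<lambda>x. the (p (Some x))) \<in> {p. p permutes UNIV}"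
        using bij_imp_permutes by fastforce
    qed
    show "(\<lambda>x. the (map_option p (Some x))) = p" for p :: "'n \<Rightarrow> 'n" by simp
    show "map_option (\<lambda>x. the (p (Some x))) = p" if "p \<in> {p. p permutes UNIV \<and> p None = None}" for p :: "'n option \<Rightarrow> 'n option"
    proof
      have "bij p" "p None = None" using that permutes_bij by auto
      then have S: "p (Some x) \<noteq> None" for x
        by (metis bij_is_inj injD option.distinct(1))
      fix x show "map_option (\<lambda>x. the (p (Some x))) x = p x"
        using S that by (cases x) auto
    qed
  qed
  have "det A = (\<Sum>p | p permutes UNIV \<and> p None = None. of_int (sign p) * (\<Prod>i\<in>UNIV. A $ i $ p i))"
    unfolding det_def
  proof (rule sum.mono_neutral_right)
    show "\<forall>p\<in>{p. p permutes UNIV} - {p. p permutes UNIV \<and> p None = None}.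
        of_int (sign p) * (\<Prod>i\<in>UNIV. A $ i $ p i) = 0"
    proof
      fix p :: "'n option \<Rightarrow> 'n option" assume "p \<in> {p. p permutes UNIV} - {p. p permutes UNIV \<and> p None = None}"
      then obtain j where "p None = Some j" by auto
      then have "A $ None $ p None = 0" by (simp add: assms(2))
      then have "(\<Prod>i\<in>UNIV. A $ i $ p i) = 0" by (intro prod_zero) auto
      then show "of_int (sign p) * (\<Prod>i\<in>UNIV. A $ i $ p i) = 0" by simp
    qed
  qed (auto intro: finite_permutations)
  also have "\<dots> = (\<Sum>p | p permutes UNIV. of_int (sign (map_option p)) * (\<Prod>i\<in>UNIV. A $ i $ map_option p i))"
    by (rule sum.reindex_bij_betw[OF bij_perm, symmetric])
  also have "\<dots> = det (\<chi> i j. A $ Some i $ Some j)"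
    unfolding det_def
  proof (rule sum.cong[OF refl])
    fix p :: "'n \<Rightarrow> 'n" assume "p \<in> {p. p permutes UNIV}"
    then have "sign (map_option p) = sign p"
      unfolding mp[symmetric] by (intro sign_map_permutation) auto
    moreover have "(\<Prod>i\<in>UNIV. A $ i $ map_option p i) = (\<Prod>i\<in>UNIV. A $ Some i $ Some (p i))"
      unfolding UNIV_option_conv by (subst prod.insert) (auto simp: prod.reindex assms(1))
    ultimately show "of_int (sign (map_option p)) * (\<Prod>i\<in>UNIV. A $ i $ map_option p i)
      = of_int (sign p) * (\<Prod>i\<in>UNIV. (\<chi> i j. A $ Some i $ Some j) $ i $ p i)" by simp
  qed
  finally show ?thesis .
qed

section \<open>Change of variables\<close>

text \<open>The image of A is the preimage of A under the continuous inverse.\<close>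

lemma homeomorphism_image_borel:
  fixes f :: "'a::topological_space \<Rightarrow> 'b::topological_space"
  assumes "homeomorphism U (f ` U) f g" "f ` U \<in> sets borel" "A \<in> sets borel" "A \<subseteq> U"
  shows "f ` A \<in> sets borel"
proof -
  have g: "continuous_on (f ` U) g" and gf: "\<And>x. x \<in> U \<Longrightarrow> g (f x) = x"
    using assms(1) by (auto simp: homeomorphism_def)
  have "g \<in> borel_measurable (restrict_space borel (f ` U))"
    using g by (rule borel_measurable_continuous_on_restrict)
  then have "g -` A \<inter> space (restrict_space borel (f ` U)) \<in> sets (restrict_space borel (f ` U))"
    using assms(3) by (rule measurable_sets)
  moreover have "g -` A \<inter> space (restrict_space borel (f ` U)) = f ` A"
    using gf assms(4) by (force simp: space_restrict_space)
  ultimately show ?thesis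
    using assms(2) by (simp add: sets_restrict_space_iff)
qed

text \<open>On the compact pieces of an exhaustion of U the Jacobian is integrable, which is what
  \<open>has_measure_differentiable_image\<close> asks for. Monotone convergence then covers all of
  A, where both sides may be infinite.\<close>

lemma emeasure_injective_image_wellorder:
  fixes F :: "real ^ 'm::{finite,wellorder} \<Rightarrow> real ^ 'm::_"
  assumes U: "open U" and d: "\<And>x. x \<in> U \<Longrightarrow> (F has_derivative F' x) (at x)"
    and cd: "continuous_on U (\<lambda>x. \<bar>det (matrix (F' x))\<bar>)" and inj: "inj_on F U"
    and A: "A \<in> sets borel" "A \<subseteq> U"
  shows "emeasure lborel (F ` A) = (\<integral>\<^sup>+x\<in>A. ennreal \<bar>det (matrix (F' x))\<bar> \<partial>lborel)"
proof -
  let ?j = "\<lambda>x. \<bar>det (matrix (F' x))\<bar>"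
  have cF: "continuous_on U F"
    by (intro continuous_at_imp_continuous_on ballI has_derivative_continuous[OF d])
  obtain G where G: "homeomorphism U (F ` U) F G"
    using invariance_of_domain_homeomorphism[OF U cF _ inj] by auto
  have opFU: "open (F ` U)"
    using invariance_of_domain[OF cF U inj] .
  obtain C where C: "\<And>n::nat. compact (C n)" "\<And>n. C n \<subseteq> U" "\<And>n. C n \<subseteq> interior (C (Suc n))" "\<Union> (range C) = U"
    using open_Union_compact_subsets[OF U] by metis
  define B where "B n = A \<inter> C n" for n
  have Bm: "B n \<in> sets borel" for n
    unfolding B_def using A(1) C(1) by (auto intro: borel_closed compact_imp_closed)
  have BU: "B n \<subseteq> U" for n using C(2) by (auto simp: B_def)
  have incB: "incseq B"
    using C(3) interior_subset by (intro incseq_SucI) (fastforce simp: B_def)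
  have unB: "(\<Union>n. B n) = A" using C(4) A(2) by (auto simp: B_def)
  have FB: "F ` B n \<in> sets borel" for n
    by (rule homeomorphism_image_borel[OF G _ Bm BU]) (simp add: opFU)
  have main: "emeasure lborel (F ` B n) = (\<integral>\<^sup>+x\<in>B n. ennreal (?j x) \<partial>lborel)" for n
  proof -
    have "integrable lborel (\<lambda>x. indicator (C n) x *\<^sub>R ?j x)"
      by (intro borel_integrable_compact C continuous_on_subset[OF cd C(2)])
    then have "set_integrable lborel (C n) ?j"
      by (simp add: set_integrable_def)
    then have si: "set_integrable lborel (B n) ?j"
      by (rule set_integrable_subset) (use Bm in \<open>auto simp: B_def\<close>)
    have io: "(?j has_integral integral (B n) ?j) (B n)"
      using set_borel_integral_eq_integral(1)[OF si] by (rule integrable_integral)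
    have nn: "(\<integral>\<^sup>+x\<in>B n. ennreal (?j x) \<partial>lborel) = ennreal (integral (B n) ?j)"
    proof -
      have "(\<integral>\<^sup>+x. ennreal (indicator (B n) x * ?j x) \<partial>lborel) = ennreal (integral (B n) ?j)"
      proof (rule nn_integral_has_integral_lborel)
        show "(\<lambda>x. indicator (B n) x * ?j x) \<in> borel_measurable borel"
          using borel_measurable_integrable[OF si[unfolded set_integrable_def]] by simp
        show "((\<lambda>x. indicator (B n) x * ?j x) has_integral integral (B n) ?j) UNIV"
          using io unfolding has_integral_restrict_UNIV[of "B n", symmetric]
          by (rule has_integral_cong[THEN iffD1, rotated]) (auto simp: indicator_def)
      qed simp
      then show ?thesis
        by (subst (asm) nn_integral_cong[of _ _ "\<lambda>x. ennreal (?j x) * indicator (B n) x"])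
          (auto simp: indicator_def)
    qed
    have "F ` B n \<in> lmeasurable \<and> measure lebesgue (F ` B n) = integral (B n) ?j"
    proof (rule has_measure_differentiable_image[THEN iffD2, OF _ _ _ io])
      show "B n \<in> sets lebesgue" using Bm[of n] by simp
      show "(F has_derivative F' x) (at x within B n)" if "x \<in> B n" for x
        by (rule has_derivative_at_withinI[OF d]) (use that BU in auto)
      show "inj_on F (B n)" using inj BU by (rule inj_on_subset)
    qed
    then have "emeasure lebesgue (F ` B n) = ennreal (integral (B n) ?j)"
      by (metis emeasure_eq_measure2)
    then show ?thesis
      using nn FB[of n] by simp
  qed
  \<comment> \<open>With the right side read as a measure, the passage to the limit is continuity
    from below on both sides.\<close>
  define W where "W = density lborel (\<lambda>x. indicator U x * ennreal (?j x))"
  have mj: "(\<lambda>x. indicator U x * ennreal (?j x)) \<in> borel_measurable lborel"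
  proof -
    have "(\<lambda>x. indicator U x *\<^sub>R ?j x) \<in> borel_measurable borel"
      by (rule borel_measurable_continuous_on_indicator) (use U cd in simp_all)
    then have "(\<lambda>x. ennreal (indicator U x *\<^sub>R ?j x)) \<in> borel_measurable borel"
      by measurable
    moreover have "(\<lambda>x. ennreal (indicator U x *\<^sub>R ?j x)) = (\<lambda>x. indicator U x * ennreal (?j x))"
      by (auto simp: fun_eq_iff indicator_def)
    ultimately have "(\<lambda>x. indicator U x * ennreal (?j x)) \<in> borel_measurable borel" by (simp only:)
    then show ?thesis by simp
  qed
  have eW: "emeasure W X = (\<integral>\<^sup>+x\<in>X. ennreal (?j x) \<partial>lborel)" if "X \<in> sets borel" "X \<subseteq> U" for X
    unfolding W_def using that mj
    by (subst emeasure_density) (auto intro!: nn_integral_cong simp: indicator_def)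
  have "emeasure lborel (\<Union>n. F ` B n) = (SUP n. emeasure lborel (F ` B n))"
    by (rule SUP_emeasure_incseq[symmetric]) (use FB incB in \<open>auto simp: incseq_def intro!: image_mono\<close>)
  also have "\<dots> = (SUP n. emeasure W (B n))"
    using main eW[OF Bm BU] by simp
  also have "\<dots> = emeasure W (\<Union>n. B n)"
    by (rule SUP_emeasure_incseq) (use Bm incB in \<open>auto simp: W_def\<close>)
  also have "\<dots> = (\<integral>\<^sup>+x\<in>A. ennreal (?j x) \<partial>lborel)"
    using eW[OF A] by (simp add: unB)
  finally show ?thesis
    using unB by (simp add: image_UN[symmetric])
qed

text \<open>The change of variables theorem of the library needs a well-ordered index type, so that
  coordinates are renumbered by the following copy of an initial segment of the naturals.\<close>

typedef ('d::finite) idx = "{..<CARD('d)}"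
  by (rule exI[of _ 0]) simp

instantiation idx :: (finite) wellorder
begin

definition less_eq_idx :: "'a idx \<Rightarrow> 'a idx \<Rightarrow> bool" where
  "less_eq_idx x y \<longleftrightarrow> Rep_idx x \<le> Rep_idx y"

definition less_idx :: "'a idx \<Rightarrow> 'a idx \<Rightarrow> bool" where
  "less_idx x y \<longleftrightarrow> Rep_idx x < Rep_idx y"

instance
proof
  fix P :: "'a idx \<Rightarrow> bool" and a
  assume *: "\<And>x. (\<And>y. y < x \<Longrightarrow> P y) \<Longrightarrow> P x"
  show "P a"
    by (induction a rule: measure_induct_rule[of Rep_idx]) (use * in \<open>auto simp: less_idx_def\<close>)
qed (auto simp: less_eq_idx_def less_idx_def Rep_idx_inject)

end

instance idx :: (finite) finite
proof
  have "finite (range (Rep_idx :: 'a idx \<Rightarrow> nat))"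
    by (rule finite_subset[of _ "{..<CARD('a)}"]) (use Rep_idx in auto)
  then show "finite (UNIV :: 'a idx set)"
    by (rule finite_imageD) (simp add: inj_on_def Rep_idx_inject)
qed

lemma bij_to_idx: obtains c :: "'d::finite \<Rightarrow> 'd idx" where "bij c"
proof -
  have "CARD('d idx) = CARD('d)"
    by (simp add: type_definition.card[OF type_definition_idx])
  then obtain c :: "'d \<Rightarrow> 'd idx" where "bij_betw c UNIV UNIV"
    using finite_same_card_bij[of "UNIV :: 'd set" "UNIV :: 'd idx set"] by auto
  then show ?thesis using that by blast
qed

lemma prod_Basis_vec: "(\<Prod>b\<in>Basis. f b) = (\<Prod>i\<in>UNIV. f (axis i 1 :: real ^ 'd::finite))"
proof -
  have "(Basis :: (real ^ 'd) set) = range (\<lambda>i. axis i 1)"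
    by (auto simp: Basis_vec_def)
  moreover have "inj (\<lambda>i. axis i 1 :: real ^ 'd)"
    by (auto simp: inj_def axis_eq_axis)
  ultimately show ?thesis using prod.reindex[of "\<lambda>i. axis i 1 :: real ^ 'd" UNIV f] by simp
qed

lemma emeasure_box_vec:
  fixes l u :: "real ^ 'd::finite"
  assumes "\<And>i. l $ i \<le> u $ i"
  shows "emeasure lborel (box l u) = ennreal (\<Prod>i\<in>UNIV. u $ i - l $ i)"
proof -
  have "emeasure lborel (box l u) = ennreal (\<Prod>b\<in>Basis. (u - l) \<bullet> b)"
    by (rule emeasure_lborel_box) (use assms in \<open>auto simp: Basis_vec_def inner_axis\<close>)
  then show ?thesis by (simp add: prod_Basis_vec inner_axis)
qed

text \<open>Coordinate boxes go to coordinate boxes with permuted sides, and Lebesgue measure is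
  determined by its values on boxes.\<close>

lemma lborel_distr_reindex:
  fixes c :: "'e::finite \<Rightarrow> 'd::finite"
  assumes "bij c"
  shows "distr lborel borel (\<lambda>x :: real ^ 'd. (\<chi> i. x $ c i) :: real ^ 'e) = lborel"
proof (rule lborel_eqI[symmetric])
  let ?P = "\<lambda>x :: real ^ 'd. (\<chi> i. x $ c i) :: real ^ 'e"
  let ?Q = "\<lambda>y :: real ^ 'e. (\<chi> j. y $ inv c j) :: real ^ 'd"
  have mP: "?P \<in> borel_measurable borel"
    by (intro borel_measurable_continuous_onI continuous_intros)
  have ci: "inv c (c x) = x" "c (inv c y) = y" for x y
    using assms by (simp_all add: bij_is_inj bij_is_surj surj_f_inv_f)
  fix l u :: "real ^ 'e"
  assume "\<And>b. b \<in> Basis \<Longrightarrow> l \<bullet> b \<le> u \<bullet> b"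
  then have lu: "l $ i \<le> u $ i" for i
    using \<open>\<And>b. b \<in> Basis \<Longrightarrow> l \<bullet> b \<le> u \<bullet> b\<close>[of "axis i 1"] by (simp add: inner_axis)
  have pre: "?P -` box l u = box (?Q l) (?Q u)"
    by (auto simp: mem_box_cart ci) (metis ci)+
  have "emeasure (distr lborel borel ?P) (box l u) = emeasure lborel (box (?Q l) (?Q u))"
    using mP by (subst emeasure_distr) (simp_all add: pre)
  also have "\<dots> = ennreal (\<Prod>j\<in>UNIV. u $ inv c j - l $ inv c j)"
    by (subst emeasure_box_vec) (simp_all add: lu)
  also have "(\<Prod>j\<in>UNIV. u $ inv c j - l $ inv c j) = (\<Prod>i\<in>UNIV. u $ i - l $ i)"
    by (rule prod.reindex_bij_betw[OF bij_imp_bij_inv[OF assms], of "\<lambda>i. u $ i - l $ i"])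
  also have "\<dots> = (\<Prod>b\<in>Basis. (u - l) \<bullet> b)"
    by (simp add: prod_Basis_vec inner_axis)
  finally show "emeasure (distr lborel borel ?P) (box l u) = (\<Prod>b\<in>Basis. (u - l) \<bullet> b)" .
qed simp

text \<open>The renumberings P and Q preserve Lebesgue measure, and by \<open>det_reindex\<close>
  conjugation with them does not change the Jacobian determinant.\<close>

lemma emeasure_injective_image:
  fixes F :: "real ^ 'd::finite \<Rightarrow> real ^ 'd"
  assumes U: "open U" and d: "\<And>x. x \<in> U \<Longrightarrow> (F has_derivative F' x) (at x)"
    and cd: "continuous_on U (\<lambda>x. \<bar>det (matrix (F' x))\<bar>)" and inj: "inj_on F U"
    and A: "A \<in> sets borel" "A \<subseteq> U"
  shows "emeasure lborel (F ` A) = (\<integral>\<^sup>+x\<in>A. ennreal \<bar>det (matrix (F' x))\<bar> \<partial>lborel)"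
proof -
  obtain c :: "'d \<Rightarrow> 'd idx" where c: "bij c" by (rule bij_to_idx)
  have ic: "bij (inv c)" using c by (rule bij_imp_bij_inv)
  have ci: "inv c (c x) = x" "c (inv c y) = y" for x y
    using c by (simp_all add: bij_is_inj bij_is_surj surj_f_inv_f)
  define P where "P = (\<lambda>x :: real ^ 'd. (\<chi> i. x $ inv c i) :: real ^ 'd idx)"
  define Q where "Q = (\<lambda>y :: real ^ 'd idx. (\<chi> j. y $ c j) :: real ^ 'd)"
  have PQ: "P (Q y) = y" "Q (P x) = x" for x y
    by (simp_all add: P_def Q_def vec_eq_iff ci)
  have linP: "linear P" and linQ: "linear Q"
    by (auto simp: P_def Q_def linear_iff vec_eq_iff)
  have contP: "continuous_on S P" and contQ: "continuous_on T Q" for S T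
    using linP linQ by (simp_all add: linear_continuous_on linear_linear)
  have mP: "P \<in> borel_measurable borel" and mQ: "Q \<in> borel_measurable borel"
    using contP contQ by (auto intro: borel_measurable_continuous_onI)
  have dP: "distr lborel borel P = lborel" and dQ: "distr lborel borel Q = lborel"
    unfolding P_def Q_def using lborel_distr_reindex[OF ic] lborel_distr_reindex[OF c] by auto
  have imP: "P ` X = Q -` X" for X
  proof (intro set_eqI iffI)
    fix y assume "y \<in> Q -` X"
    then show "y \<in> P ` X" by (intro image_eqI[of _ P "Q y"]) (simp_all add: PQ)
  qed (auto simp: PQ)
  have PB: "P ` X \<in> sets borel" if "X \<in> sets borel" for X
    using measurable_sets[OF mQ that] by (simp add: imP)
  have eP: "emeasure lborel (P ` X) = emeasure lborel X" if "X \<in> sets borel" for X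
  proof -
    have "emeasure lborel (P ` X) = emeasure (distr lborel borel Q) X"
      unfolding imP using that mQ by (subst emeasure_distr) auto
    then show ?thesis by (simp add: dQ)
  qed
  let ?F = "\<lambda>y. P (F (Q y))" and ?F' = "\<lambda>y v. P (F' (Q y) (Q v))"
  have opPU: "open (P ` U)"
    unfolding imP by (rule open_vimage[OF U contQ])
  have dF: "(?F has_derivative ?F' y) (at y)" if "y \<in> P ` U" for y
  proof -
    have "Q y \<in> U" using that PQ by auto
    from diff_chain_at[OF linear_imp_has_derivative[OF linQ] d[OF this]]
    have "((\<lambda>y. F (Q y)) has_derivative (\<lambda>v. F' (Q y) (Q v))) (at y)"
      by (simp add: o_def)
    from diff_chain_at[OF this linear_imp_has_derivative[OF linP]] show ?thesis
      by (simp add: o_def)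
  qed
  have det_eq: "det (matrix (?F' (P x))) = det (matrix (F' x))" if "x \<in> U" for x
  proof -
    have "matrix (?F' (P x)) = (\<chi> i j. matrix (F' x) $ inv c i $ inv c j)"
    proof -
      have "Q (axis j 1) $ i = axis (inv c j) 1 $ i" for i j
        unfolding Q_def axis_def using ci by (simp, metis)
      then have Qa: "Q (axis j 1) = axis (inv c j) 1" for j
        by (intro vec_eq_iff[THEN iffD2] allI)
      show ?thesis
        by (simp add: matrix_def PQ Qa) (simp add: P_def)
    qed
    then show ?thesis using det_reindex[OF ic] by metis
  qed
  have cdet: "continuous_on (P ` U) (\<lambda>y. \<bar>det (matrix (?F' y))\<bar>)"
  proof -
    have "continuous_on (P ` U) (\<lambda>y. \<bar>det (matrix (F' (Q y)))\<bar>)"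
      by (rule continuous_on_compose2[OF cd contQ]) (auto simp: PQ)
    moreover have "\<bar>det (matrix (F' (Q y)))\<bar> = \<bar>det (matrix (?F' y))\<bar>" if "y \<in> P ` U" for y
    proof -
      from that obtain x where "x \<in> U" "y = P x" by auto
      then show ?thesis using det_eq[of x] by (simp only: PQ)
    qed
    ultimately show ?thesis by (rule continuous_on_eq)
  qed
  have injF: "inj_on ?F (P ` U)"
  proof -
    have "inj_on P X" for X using PQ by (intro inj_on_inverseI)
    moreover have "inj_on Q X" for X using PQ by (intro inj_on_inverseI)
    moreover have "Q ` P ` U = U" by (simp add: image_image PQ)
    ultimately have "inj_on (P \<circ> (F \<circ> Q)) (P ` U)"
      using inj by (intro comp_inj_on) simp_all
    then show ?thesis by (simp add: o_def)
  qed
  have cF: "continuous_on U F"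
    by (intro continuous_at_imp_continuous_on ballI has_derivative_continuous[OF d])
  obtain G where G: "homeomorphism U (F ` U) F G"
    using invariance_of_domain_homeomorphism[OF U cF _ inj] by auto
  have "open (F ` U)"
    using invariance_of_domain[OF cF U inj] .
  then have FA: "F ` A \<in> sets borel"
    by (intro homeomorphism_image_borel[OF G _ A]) simp
  have "emeasure lborel (F ` A) = emeasure lborel (?F ` (P ` A))"
    using eP[OF FA] by (simp add: image_image PQ)
  also have "\<dots> = (\<integral>\<^sup>+y\<in>P ` A. ennreal \<bar>det (matrix (?F' y))\<bar> \<partial>lborel)"
    by (rule emeasure_injective_image_wellorder[OF opPU dF cdet injF PB[OF A(1)]]) (use A(2) in auto)
  also have "\<dots> = (\<integral>\<^sup>+y. ennreal \<bar>det (matrix (?F' y))\<bar> * indicator (P ` A) y \<partial>distr lborel borel P)"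
    by (simp add: dP)
  also have "\<dots> = (\<integral>\<^sup>+x. ennreal \<bar>det (matrix (?F' (P x)))\<bar> * indicator (P ` A) (P x) \<partial>lborel)"
  proof (rule nn_integral_distr[of P lborel borel "\<lambda>y. ennreal \<bar>det (matrix (?F' y))\<bar> * indicator (P ` A) y"])
    have "(\<lambda>y. indicator (P ` A) y *\<^sub>R \<bar>det (matrix (?F' y))\<bar>) \<in> borel_measurable borel"
      using A(2) by (intro borel_measurable_continuous_on_indicator PB A(1) continuous_on_subset[OF cdet]) auto
    then have "(\<lambda>y. ennreal (indicator (P ` A) y *\<^sub>R \<bar>det (matrix (?F' y))\<bar>)) \<in> borel_measurable borel"
      by measurable
    moreover have "(\<lambda>y. ennreal (indicator (P ` A) y *\<^sub>R \<bar>det (matrix (?F' y))\<bar>))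
        = (\<lambda>y. ennreal \<bar>det (matrix (?F' y))\<bar> * indicator (P ` A) y)"
      by (auto simp: fun_eq_iff indicator_def)
    ultimately have "(\<lambda>y. ennreal \<bar>det (matrix (?F' y))\<bar> * indicator (P ` A) y) \<in> borel_measurable borel"
      by (simp only:)
    then show "(\<lambda>y. ennreal \<bar>det (matrix (?F' y))\<bar> * indicator (P ` A) y) \<in> borel_measurable (distr lborel borel P)"
      by simp
  qed (use mP in simp)
  also have "\<dots> = (\<integral>\<^sup>+x\<in>A. ennreal \<bar>det (matrix (F' x))\<bar> \<partial>lborel)"
  proof (rule nn_integral_cong)
    fix x
    have "P x \<in> P ` A \<longleftrightarrow> x \<in> A" using PQ by (metis image_iff)
    then have "indicator (P ` A) (P x) = (indicator A x :: ennreal)"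
      by (simp add: indicator_def)
    then show "ennreal \<bar>det (matrix (?F' (P x)))\<bar> * indicator (P ` A) (P x)
      = ennreal \<bar>det (matrix (F' x))\<bar> * indicator A x"
      using det_eq[of x] A(2) by (cases "x \<in> A") auto
  qed
  finally show ?thesis .
qed

text \<open>The formula for sets says that the push-forward of the Jacobian density is Lebesgue
  measure on the image. Integrating f against both gives the formula for functions.\<close>

lemma nn_integral_injective_image:
  fixes F :: "real ^ 'd::finite \<Rightarrow> real ^ 'd"
  assumes U: "open U" and d: "\<And>x. x \<in> U \<Longrightarrow> (F has_derivative F' x) (at x)"
    and cd: "continuous_on U (\<lambda>x. \<bar>det (matrix (F' x))\<bar>)" and inj: "inj_on F U"
    and f: "f \<in> borel_measurable borel"
  shows "(\<integral>\<^sup>+y\<in>F ` U. f y \<partial>lborel) = (\<integral>\<^sup>+x\<in>U. f (F x) * ennreal \<bar>det (matrix (F' x))\<bar> \<partial>lborel)"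
proof -
  let ?j = "\<lambda>x. \<bar>det (matrix (F' x))\<bar>"
  have cF: "continuous_on U F"
    by (intro continuous_at_imp_continuous_on ballI has_derivative_continuous[OF d])
  have opFU: "open (F ` U)"
    using invariance_of_domain[OF cF U inj] .
  \<comment> \<open>The value 0 off U only makes the map Borel on the whole space; the density g
    vanishes there.\<close>
  define F0 where "F0 x = (if x \<in> U then F x else 0)" for x
  have mF0: "F0 \<in> borel_measurable borel"
    unfolding F0_def[abs_def] using cF U
    by (intro borel_measurable_continuous_on_if) (auto intro: continuous_intros)
  define g where "g x = ennreal (?j x) * indicator U x" for x
  have mg: "g \<in> borel_measurable borel"
  proof -
    have "(\<lambda>x. indicator U x *\<^sub>R ?j x) \<in> borel_measurable borel"
      by (rule borel_measurable_continuous_on_indicator) (use U cd in simp_all)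
    then have "(\<lambda>x. ennreal (indicator U x *\<^sub>R ?j x)) \<in> borel_measurable borel"
      by measurable
    moreover have "(\<lambda>x. ennreal (indicator U x *\<^sub>R ?j x)) = g"
      by (auto simp: fun_eq_iff indicator_def g_def)
    ultimately show ?thesis by (simp only:)
  qed
  have eq: "distr (density lborel g) borel F0 = density lborel (indicator (F ` U))"
  proof (rule measure_eqI)
    fix X assume "X \<in> sets (distr (density lborel g) borel F0)"
    then have X: "X \<in> sets borel" by simp
    have pre: "F0 -` X \<in> sets borel" using measurable_sets[OF mF0 X] by simp
    let ?A = "F0 -` X \<inter> U"
    have "emeasure (distr (density lborel g) borel F0) X = emeasure (density lborel g) (F0 -` X)"
      using X mF0 by (subst emeasure_distr) auto
    also have "\<dots> = (\<integral>\<^sup>+x\<in>F0 -` X. g x \<partial>lborel)"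
      using pre mg by (subst emeasure_density) auto
    also have "\<dots> = (\<integral>\<^sup>+x\<in>?A. ennreal (?j x) \<partial>lborel)"
      by (rule nn_integral_cong) (auto simp: g_def indicator_def)
    also have "\<dots> = emeasure lborel (F ` ?A)"
      by (rule emeasure_injective_image[OF U d cd inj, symmetric]) (use pre U in auto)
    also have "F ` ?A = F ` U \<inter> X" by (auto simp: F0_def)
    also have "emeasure lborel (F ` U \<inter> X) = (\<integral>\<^sup>+x\<in>X. indicator (F ` U) x \<partial>lborel)"
      using X opFU by (simp add: indicator_inter_arith[symmetric])
    also have "\<dots> = emeasure (density lborel (indicator (F ` U))) X"
      using X opFU by (subst emeasure_density) auto
    finally show "emeasure (distr (density lborel g) borel F0) X = emeasure (density lborel (indicator (F ` U))) X" .
  qed simp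
  have "(\<integral>\<^sup>+y\<in>F ` U. f y \<partial>lborel) = (\<integral>\<^sup>+y. f y \<partial>density lborel (indicator (F ` U)))"
    using f opFU by (subst nn_integral_density) (auto simp: mult.commute)
  also have "\<dots> = (\<integral>\<^sup>+x. f (F0 x) \<partial>density lborel g)"
    unfolding eq[symmetric] using f mF0 by (subst nn_integral_distr) auto
  also have "\<dots> = (\<integral>\<^sup>+x. g x * f (F0 x) \<partial>lborel)"
    using f mF0 mg by (subst nn_integral_density) auto
  also have "\<dots> = (\<integral>\<^sup>+x\<in>U. f (F x) * ennreal (?j x) \<partial>lborel)"
    by (rule nn_integral_cong) (auto simp: g_def F0_def indicator_def mult.commute)
  finally show ?thesis .
qed

section \<open>Uniqueness of the Riemannian measure\<close>

text \<open>This gives differentiability of transition maps between charts. If L is a left inverse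
  of E, then L o g has the identity as derivative at t x, and t is recovered from L (g (t y)) = L (f
  y); continuity of t keeps t y in the range where the linear approximation of L o g is
  good.\<close>

lemma has_derivative_left_factor:
  fixes f :: "'a::euclidean_space \<Rightarrow> 'c::euclidean_space" and g :: "'b::euclidean_space \<Rightarrow> 'c"
  assumes f: "(f has_derivative D) (at x)" and g: "(g has_derivative E) (at (t x))" and "inj E"
    and ct: "isCont t x" and ev: "\<forall>\<^sub>F y in at x. g (t y) = f y" and gx: "g (t x) = f x"
  obtains T where "(t has_derivative T) (at x)" "D = E \<circ> T"
proof -
  have linE: "linear E" using g by (rule has_derivative_linear)
  obtain L where L: "linear L" "L \<circ> E = id"
    using linear_injective_left_inverse[OF linE assms(3)] by blast
  have blL: "bounded_linear L" using L(1) by (simp add: linear_conv_bounded_linear)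
  define T where "T = L \<circ> D"
  have dk: "((\<lambda>z. L (g z)) has_derivative (\<lambda>v. v)) (at (t x))"
    using bounded_linear.has_derivative[OF blL g] L(2) by (simp add: fun_eq_iff)
  have df: "((\<lambda>y. L (f y)) has_derivative T) (at x)"
    unfolding T_def using bounded_linear.has_derivative[OF blL f] by (simp add: o_def)
  have blT: "bounded_linear T" using df by (rule has_derivative_bounded_linear)
  obtain K where K: "K > 0" "\<And>v. norm (T v) \<le> norm v * K"
    using bounded_linear.pos_bounded[OF blT] by blast
  have "\<exists>d>0. \<forall>y. norm (y - x) < d \<longrightarrow> norm (t y - t x - T (y - x)) \<le> e * norm (y - x)" if "e > 0" for e
  proof -
    \<comment> \<open>The bound 1/2 lets the term e1 * a be absorbed on the left, which gives a
      \<le> 2 * (K + 1) * b. The other bound then makes e1 * a at most e / 2 * b.\<close>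
    define e1 where "e1 = min (1/2) (e / (4 * (K + 1)))"
    define e2 where "e2 = min 1 (e / 2)"
    have e1: "e1 > 0" "e1 \<le> 1/2" "e1 * (2 * (K + 1)) \<le> e / 2"
    proof -
      show "e1 > 0" using that K(1) by (simp add: e1_def)
      show "e1 \<le> 1/2" unfolding e1_def by (rule min.cobounded1)
      have "e1 * (2 * (K + 1)) \<le> e / (4 * (K + 1)) * (2 * (K + 1))"
        using K(1) by (intro mult_right_mono) (auto simp: e1_def)
      also have "\<dots> = e / 2" using K(1) by (simp add: field_simps)
      finally show "e1 * (2 * (K + 1)) \<le> e / 2" .
    qed
    have e2: "e2 > 0" "e2 \<le> 1" "e2 \<le> e / 2" using that by (auto simp: e2_def)
    obtain d1 where d1: "d1 > 0" "\<And>z. norm (z - t x) < d1 \<Longrightarrow>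
        norm (L (g z) - L (g (t x)) - (z - t x)) \<le> e1 * norm (z - t x)"
      using dk e1(1) unfolding has_derivative_at_alt by blast
    obtain d2 where d2: "d2 > 0" "\<And>y. norm (y - x) < d2 \<Longrightarrow>
        norm (L (f y) - L (f x) - T (y - x)) \<le> e2 * norm (y - x)"
      using df e2(1) unfolding has_derivative_at_alt by blast
    obtain d3 where d3: "d3 > 0" "\<And>y. dist y x < d3 \<Longrightarrow> dist (t y) (t x) < d1"
      using ct d1(1) unfolding continuous_at_eps_delta by blast
    obtain d4 where d4: "d4 > 0" "\<And>y. y \<noteq> x \<Longrightarrow> dist y x < d4 \<Longrightarrow> g (t y) = f y"
      using ev unfolding eventually_at by blast
    have "norm (t y - t x - T (y - x)) \<le> e * norm (y - x)" if "norm (y - x) < min d2 (min d3 d4)" for y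
    proof -
      define a where "a = norm (t y - t x)"
      define b where "b = norm (y - x)"
      have gy: "g (t y) = f y" using d4(2)[of y] that gx by (cases "y = x") (auto simp: dist_norm)
      have 1: "norm (L (f y) - L (f x) - (t y - t x)) \<le> e1 * a"
        using d1(2)[of "t y"] d3(2)[of y] that by (simp add: a_def gy gx dist_norm)
      have 2: "norm (L (f y) - L (f x) - T (y - x)) \<le> e2 * b"
        using d2(2)[of y] that by (simp add: b_def)
      have 3: "norm (t y - t x - T (y - x)) \<le> e1 * a + e2 * b"
      proof -
        have "t y - t x - T (y - x) = (L (f y) - L (f x) - T (y - x)) - (L (f y) - L (f x) - (t y - t x))"
          by simp
        then have "norm (t y - t x - T (y - x)) \<le> norm (L (f y) - L (f x) - T (y - x)) + norm (L (f y) - L (f x) - (t y - t x))"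
          by (metis norm_triangle_ineq4)
        then show ?thesis using 1 2 by linarith
      qed
      have "a \<le> norm (t y - t x - T (y - x)) + norm (T (y - x))"
        unfolding a_def using norm_triangle_ineq[of "t y - t x - T (y - x)" "T (y - x)"] by simp
      also have "\<dots> \<le> (e1 * a + e2 * b) + b * K"
        using 3 K(2)[of "y - x"] by (intro add_mono) (simp_all add: b_def)
      also have "\<dots> \<le> (1/2 * a + 1 * b) + b * K"
        using e1(2) e2(2) K(1) by (intro add_mono mult_right_mono) (simp_all add: a_def b_def)
      finally have a: "a \<le> 2 * (K + 1) * b" by (simp add: algebra_simps)
      have "e1 * a \<le> e1 * (2 * (K + 1) * b)"
        using a e1(1) by (intro mult_left_mono) auto
      also have "\<dots> = e1 * (2 * (K + 1)) * b" by simp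
      also have "\<dots> \<le> e / 2 * b"
        using e1(3) by (intro mult_right_mono) (auto simp: b_def)
      finally have "e1 * a \<le> e / 2 * b" .
      moreover have "e2 * b \<le> e / 2 * b"
        using e2(3) by (intro mult_right_mono) (auto simp: b_def)
      ultimately have "e1 * a + e2 * b \<le> e * b" by (simp add: algebra_simps)
      with 3 show ?thesis by (simp add: b_def)
    qed
    then show ?thesis using d2(1) d3(1) d4(1) by (intro exI[of _ "min d2 (min d3 d4)"]) simp
  qed
  then have dt: "(t has_derivative T) (at x)"
    unfolding has_derivative_at_alt using blT by blast
  have "((\<lambda>y. g (t y)) has_derivative E \<circ> T) (at x)"
    using diff_chain_at[OF dt g] by (simp add: o_def)
  moreover have "((\<lambda>y. g (t y)) has_derivative D) (at x)"
    by (rule has_derivative_transform_eventually[OF f]) (use ev gx in \<open>auto elim: eventually_mono\<close>)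
  ultimately have "D = E \<circ> T" by (rule has_derivative_unique[symmetric])
  then show ?thesis using dt that by blast
qed

section \<open>The Lorentz form and the tangent spaces of hyperbolic space\<close>

lemma lorentz_bilinear: "bounded_bilinear (lorentz :: 'n::finite minkowski \<Rightarrow> _)"
proof (rule bounded_bilinear.intro)
  show "\<exists>K. \<forall>a b :: 'n minkowski. norm (lorentz a b) \<le> norm a * norm b * K"
  proof (intro exI[of _ 2] allI)
    fix a b :: "'n minkowski"
    have "\<bar>snd a \<bullet> snd b\<bar> \<le> norm (snd a) * norm (snd b)" by (rule Cauchy_Schwarz_ineq2)
    also have "\<dots> \<le> norm a * norm b"
      by (intro mult_mono) (simp_all, (metis norm_snd_le prod.collapse)+)
    finally have 1: "\<bar>snd a \<bullet> snd b\<bar> \<le> norm a * norm b" .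
    have "\<bar>fst a * fst b\<bar> = norm (fst a) * norm (fst b)" by (simp add: abs_mult)
    also have "\<dots> \<le> norm a * norm b"
      by (intro mult_mono) (simp_all del: real_norm_def, (metis norm_fst_le prod.collapse)+)
    finally show "norm (lorentz a b) \<le> norm a * norm b * 2" using 1 by (simp add: lorentz_def)
  qed
qed (simp_all add: lorentz_def inner_add_left inner_add_right algebra_simps)

lemmas lorentz_simps =
  bounded_bilinear.add_left[OF lorentz_bilinear] bounded_bilinear.add_right[OF lorentz_bilinear]
  bounded_bilinear.diff_left[OF lorentz_bilinear] bounded_bilinear.diff_right[OF lorentz_bilinear]
  bounded_bilinear.scaleR_left[OF lorentz_bilinear] bounded_bilinear.scaleR_right[OF lorentz_bilinear]
  bounded_bilinear.minus_left[OF lorentz_bilinear] bounded_bilinear.minus_right[OF lorentz_bilinear]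
  bounded_bilinear.zero_left[OF lorentz_bilinear] bounded_bilinear.zero_right[OF lorentz_bilinear]
lemmas lorentz_sum_left = bounded_bilinear.sum_left[OF lorentz_bilinear]
lemmas lorentz_sum_right = bounded_bilinear.sum_right[OF lorentz_bilinear]

lemma lorentz_commute: "lorentz X Y = lorentz Y X"
  by (simp add: lorentz_def inner_commute mult.commute)

text \<open>Tangent spaces of the hyperboloid are spacelike: the Cauchy-Schwarz inequality for the
  spatial parts is strict enough because the squared spatial length of p is one less than the square
  of its time coordinate.\<close>

lemma lorentz_tangent_pos:
  assumes "p \<in> hyp_space" "lorentz p v = 0" "v \<noteq> 0"
  shows "lorentz v v > 0"
proof -
  have p: "snd p \<bullet> snd p = fst p * fst p - 1" "fst p > 0"
    using assms(1) by (auto simp: hyp_space_def lorentz_def)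
  have pv: "snd p \<bullet> snd v = fst p * fst v"
    using assms(2) by (simp add: lorentz_def)
  have "snd v \<noteq> 0"
  proof
    assume "snd v = 0"
    then have "fst v = 0" using pv p(2) by simp
    then show False using \<open>snd v = 0\<close> assms(3) by (simp add: prod_eq_iff)
  qed
  then have pos: "snd v \<bullet> snd v > 0" by simp
  have "(snd p \<bullet> snd v)\<^sup>2 \<le> (snd p \<bullet> snd p) * (snd v \<bullet> snd v)"
    by (rule Cauchy_Schwarz_ineq)
  then have "(fst p)\<^sup>2 * (fst v)\<^sup>2 \<le> ((fst p)\<^sup>2 - 1) * (snd v \<bullet> snd v)"
    unfolding pv p(1) by (simp add: power_mult_distrib power2_eq_square mult_ac)
  also have "\<dots> < (fst p)\<^sup>2 * (snd v \<bullet> snd v)"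
    using pos by (simp add: left_diff_distrib)
  finally have "(fst v)\<^sup>2 < snd v \<bullet> snd v" using p(2) by simp
  then show ?thesis by (simp add: lorentz_def power2_eq_square)
qed

section \<open>Charts and their metric matrices\<close>

lemma local_parametrizationD:
  assumes "local_parametrization M U \<phi>"
  shows "open U" "smooth_on U \<phi>" "continuous_on U \<phi>" "inj_on \<phi> U" "\<phi> ` U \<subseteq> M"
    "\<And>x. x \<in> U \<Longrightarrow> (\<phi> has_derivative frechet_derivative \<phi> (at x)) (at x)"
    "\<And>x. x \<in> U \<Longrightarrow> inj (frechet_derivative \<phi> (at x))"
    "\<And>x. x \<in> U \<Longrightarrow> linear (frechet_derivative \<phi> (at x))"
proof -
  show o: "open U" and s: "smooth_on U \<phi>" and "\<And>x. x \<in> U \<Longrightarrow> inj (frechet_derivative \<phi> (at x))"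
    using assms by (auto simp: local_parametrization_def)
  show "continuous_on U \<phi>" by (rule smooth_on_continuous_on[OF s])
  obtain g where "homeomorphism U (\<phi> ` U) \<phi> g"
    using assms by (auto simp: local_parametrization_def)
  then show "inj_on \<phi> U" by (auto simp: homeomorphism_def intro: inj_on_inverseI)
  have "openin (top_of_set M) (\<phi> ` U)" using assms by (auto simp: local_parametrization_def)
  then show "\<phi> ` U \<subseteq> M" by (rule openin_imp_subset)
  show d: "\<And>x. x \<in> U \<Longrightarrow> (\<phi> has_derivative frechet_derivative \<phi> (at x)) (at x)"
    by (rule smooth_on_has_derivative[OF s])
  show "\<And>x. x \<in> U \<Longrightarrow> linear (frechet_derivative \<phi> (at x))"
    using d by (rule has_derivative_linear)
qed

lemma local_parametrization_inverse:
  assumes "local_parametrization M U \<phi>"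
  obtains g where "homeomorphism U (\<phi> ` U) \<phi> g"
  using assms by (auto simp: local_parametrization_def)

text \<open>Differentiation of \<open>lorentz (\<phi> y) (\<phi> y) = - 1\<close>.\<close>

lemma local_parametrization_tangent:
  assumes "local_parametrization M U \<phi>" "M \<subseteq> hyp_space" "x \<in> U"
  shows "lorentz (\<phi> x) (frechet_derivative \<phi> (at x) v) = 0"
proof -
  let ?D = "frechet_derivative \<phi> (at x)"
  note L = local_parametrizationD[OF assms(1)]
  have "((\<lambda>y. lorentz (\<phi> y) (\<phi> y)) has_derivative (\<lambda>v. lorentz (\<phi> x) (?D v) + lorentz (?D v) (\<phi> x))) (at x)"
    by (rule bounded_bilinear.FDERIV[OF lorentz_bilinear L(6) L(6)]) (rule assms(3))+
  moreover have "((\<lambda>y. lorentz (\<phi> y) (\<phi> y)) has_derivative (\<lambda>v. 0)) (at x)"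
  proof (rule has_derivative_transform_within_open[OF _ L(1) assms(3)])
    show "((\<lambda>y. - 1) has_derivative (\<lambda>v. 0)) (at x)" by simp
    show "- 1 = lorentz (\<phi> y) (\<phi> y)" if "y \<in> U" for y
    proof -
      have "\<phi> y \<in> hyp_space" using L(5) assms(2) that by blast
      then show ?thesis by (simp add: hyp_space_def)
    qed
  qed
  ultimately have "(\<lambda>v. lorentz (\<phi> x) (?D v) + lorentz (?D v) (\<phi> x)) = (\<lambda>v. 0)"
    by (rule has_derivative_unique)
  from fun_cong[OF this, of v] show ?thesis
    using lorentz_commute[of "\<phi> x" "?D v"] by simp
qed

text \<open>In this form, free of indices, the behaviour of the metric under a change of chart is a
  congruence of matrices.\<close>

lemma metric_matrix_inner:
  assumes "linear (frechet_derivative \<phi> (at x))"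
  shows "lorentz (frechet_derivative \<phi> (at x) v) (frechet_derivative \<phi> (at x) w) = v \<bullet> (metric_matrix \<phi> x *v w)"
proof -
  let ?D = "frechet_derivative \<phi> (at x)"
  have ex: "?D u = (\<Sum>i\<in>UNIV. u $ i *\<^sub>R ?D (axis i 1))" for u
  proof -
    have "u = (\<Sum>i\<in>UNIV. u $ i *\<^sub>R axis i 1)"
      using basis_expansion[of u] by (simp add: scalar_mult_eq_scaleR)
    then have "?D u = ?D (\<Sum>i\<in>UNIV. u $ i *\<^sub>R axis i 1)" by simp
    also have "\<dots> = (\<Sum>i\<in>UNIV. u $ i *\<^sub>R ?D (axis i 1))"
      by (simp add: linear_sum[OF assms] linear_scale[OF assms])
    finally show ?thesis .
  qed
  have "lorentz (?D v) (?D w) = (\<Sum>i\<in>UNIV. \<Sum>j\<in>UNIV. v $ i * (w $ j * lorentz (?D (axis i 1)) (?D (axis j 1))))"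
  proof -
    have "lorentz (?D v) (?D w) = (\<Sum>i\<in>UNIV. v $ i * lorentz (?D (axis i 1)) (?D w))"
      by (subst ex[of v]) (simp add: lorentz_sum_left lorentz_simps)
    moreover have "lorentz (?D (axis i 1)) (?D w) = (\<Sum>j\<in>UNIV. w $ j * lorentz (?D (axis i 1)) (?D (axis j 1)))" for i
      by (subst ex[of w]) (simp add: lorentz_sum_right lorentz_simps)
    ultimately show ?thesis by (simp add: sum_distrib_left)
  qed
  also have "\<dots> = v \<bullet> (metric_matrix \<phi> x *v w)"
    by (simp add: inner_vec_def matrix_vector_mult_def metric_matrix_def sum_distrib_left mult.commute mult.left_commute)
  finally show ?thesis .
qed

lemma matrix_eqI_inner:
  fixes A B :: "real ^ 'd::finite ^ 'd"
  assumes "\<And>v w. v \<bullet> (A *v w) = v \<bullet> (B *v w)"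
  shows "A = B"
proof (subst matrix_eq, intro allI)
  fix w
  have "\<forall>v. v \<bullet> (A *v w) = v \<bullet> (B *v w)" using assms by simp
  then show "A *v w = B *v w" by (rule vector_eq_ldot[THEN iffD1])
qed

text \<open>A kernel vector of the metric matrix would be mapped to a tangent vector of Lorentz
  length zero, hence to zero.\<close>

lemma det_metric_matrix_nonzero:
  assumes "local_parametrization M U \<phi>" "M \<subseteq> hyp_space" "x \<in> U"
  shows "det (metric_matrix \<phi> x) \<noteq> 0"
proof -
  let ?D = "frechet_derivative \<phi> (at x)"
  note L = local_parametrizationD[OF assms(1)]
  have "w = 0" if "metric_matrix \<phi> x *v w = 0" for w
  proof -
    have "lorentz (?D w) (?D w) = 0"
      using that by (simp add: metric_matrix_inner[OF L(8)[OF assms(3)]])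
    moreover have "\<phi> x \<in> hyp_space" using L(5) assms by auto
    ultimately have "?D w = 0"
      using lorentz_tangent_pos local_parametrization_tangent[OF assms] by fastforce
    then show ?thesis
      using L(7,8)[OF assms(3)] by (simp add: linear_injective_0)
  qed
  then have "inj ((*v) (metric_matrix \<phi> x))"
    by (simp add: linear_injective_0)
  then show ?thesis
    by (metis invertible_det_nz invertible_left_inverse matrix_left_invertible_injective)
qed

lemma continuous_on_det:
  assumes "\<And>i j. continuous_on S (\<lambda>x. A x $ i $ j)"
  shows "continuous_on S (\<lambda>x. det (A x :: real ^ 'd::finite ^ 'd))"
  unfolding det_def by (intro continuous_intros assms)

lemma continuous_on_det_metric_matrix:
  assumes "local_parametrization M U \<phi>"
  shows "continuous_on U (\<lambda>x. det (metric_matrix \<phi> x))"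
proof (rule continuous_on_det)
  note L = local_parametrizationD[OF assms]
  show "continuous_on U (\<lambda>x. metric_matrix \<phi> x $ i $ j)" for i j
    unfolding metric_matrix_def
    by (simp, intro bounded_bilinear.continuous_on[OF lorentz_bilinear]
        smooth_on_continuous_on smooth_on_derivative L(2))
qed

text \<open>The transition map t from \<phi> to \<theta> transforms the metric by congruence with
  its derivative T, so that the root of the determinant acquires the factor
  \<open>\<bar>det (matrix (T x))\<bar>\<close>. This is the factor in the change of variables
  formula.\<close>

lemma chart_integral_eq:
  fixes \<phi> \<theta> :: "real ^ 'd::finite \<Rightarrow> 'n::finite minkowski"
  assumes p1: "local_parametrization M U \<phi>" and p2: "local_parametrization M V \<theta>" and M: "M \<subseteq> hyp_space"
    and A: "A \<subseteq> U" and C: "C \<in> sets borel" "C \<subseteq> V" and eq: "\<phi> ` A = \<theta> ` C"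
  shows "(\<integral>\<^sup>+x\<in>A. ennreal (sqrt (det (metric_matrix \<phi> x))) \<partial>lborel)
       = (\<integral>\<^sup>+x\<in>C. ennreal (sqrt (det (metric_matrix \<theta> x))) \<partial>lborel)"
proof -
  note L1 = local_parametrizationD[OF p1]
  note L2 = local_parametrizationD[OF p2]
  obtain g where g: "homeomorphism V (\<theta> ` V) \<theta> g" by (rule local_parametrization_inverse[OF p2])
  have gt: "g (\<theta> z) = z" if "z \<in> V" for z using g that by (auto simp: homeomorphism_def)
  define U0 where "U0 = U \<inter> \<phi> -` (\<theta> ` V)"
  define t where "t x = g (\<phi> x)" for x
  have "openin (top_of_set M) (\<theta> ` V)" using p2 by (simp add: local_parametrization_def)
  then obtain W where W: "open W" "\<theta> ` V = M \<inter> W" by (auto simp: openin_open)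
  have "U0 = U \<inter> \<phi> -` W" using L1(5) W(2) by (auto simp: U0_def)
  then have opU0: "open U0"
    using continuous_open_preimage[OF L1(3,1) W(1)] by simp
  have U0: "x \<in> U" "t x \<in> V" "\<theta> (t x) = \<phi> x" if "x \<in> U0" for x
  proof -
    from that obtain z where "x \<in> U" "z \<in> V" "\<phi> x = \<theta> z" by (auto simp: U0_def)
    then show "x \<in> U" "t x \<in> V" "\<theta> (t x) = \<phi> x" by (simp_all add: t_def gt)
  qed
  have ct: "continuous_on U0 t"
    unfolding t_def
  proof (rule continuous_on_compose2[of "\<theta> ` V" g])
    show "continuous_on (\<theta> ` V) g" using g by (simp add: homeomorphism_def)
    show "continuous_on U0 \<phi>" by (rule continuous_on_subset[OF L1(3)]) (auto simp: U0_def)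
  qed (auto simp: U0_def)
  have injt: "inj_on t U0"
  proof (rule inj_onI)
    fix x y assume xy: "x \<in> U0" "y \<in> U0" "t x = t y"
    then have "\<phi> x = \<phi> y" using U0(3) by metis
    then show "x = y" using L1(4) U0(1) xy by (auto dest: inj_onD)
  qed
  have "\<exists>T. (t has_derivative T) (at x) \<and> frechet_derivative \<phi> (at x) = frechet_derivative \<theta> (at (t x)) \<circ> T"
    if x: "x \<in> U0" for x
  proof -
    have "isCont t x" using ct opU0 x by (simp add: continuous_on_eq_continuous_at)
    moreover have "\<forall>\<^sub>F y in at x. \<theta> (t y) = \<phi> y"
      by (rule eventually_at_topological[THEN iffD2]) (use opU0 x U0(3) in blast)
    ultimately obtain T where "(t has_derivative T) (at x)"
      "frechet_derivative \<phi> (at x) = frechet_derivative \<theta> (at (t x)) \<circ> T"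
      using has_derivative_left_factor[where f=\<phi> and g=\<theta> and t=t and x=x,
          OF L1(6)[OF U0(1)[OF x]] L2(6)[OF U0(2)[OF x]] L2(7)[OF U0(2)[OF x]] _ _ U0(3)[OF x]]
      by blast
    then show ?thesis by blast
  qed
  then obtain T where T: "\<And>x. x \<in> U0 \<Longrightarrow> (t has_derivative T x) (at x)"
    "\<And>x. x \<in> U0 \<Longrightarrow> frechet_derivative \<phi> (at x) = frechet_derivative \<theta> (at (t x)) \<circ> T x"
    by metis
  have key: "sqrt (det (metric_matrix \<phi> x)) = \<bar>det (matrix (T x))\<bar> * sqrt (det (metric_matrix \<theta> (t x)))"
    if x: "x \<in> U0" for x
  proof -
    let ?T = "matrix (T x)"
    have lT: "linear (T x)" by (rule has_derivative_linear[OF T(1)[OF x]])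
    have "metric_matrix \<phi> x = transpose ?T ** metric_matrix \<theta> (t x) ** ?T"
    proof (rule matrix_eqI_inner)
      fix v w
      have "v \<bullet> (metric_matrix \<phi> x *v w) = T x v \<bullet> (metric_matrix \<theta> (t x) *v T x w)"
        unfolding metric_matrix_inner[OF L1(8)[OF U0(1)[OF x]], symmetric]
          metric_matrix_inner[OF L2(8)[OF U0(2)[OF x]], symmetric] T(2)[OF x] o_def ..
      also have "\<dots> = (?T *v v) \<bullet> (metric_matrix \<theta> (t x) *v (?T *v w))"
        using lT by (simp add: matrix_works)
      also have "\<dots> = v \<bullet> ((transpose ?T ** metric_matrix \<theta> (t x) ** ?T) *v w)"
        by (metis dot_lmul_matrix matrix_vector_mul_assoc transpose_matrix_vector transpose_transpose)
      finally show "v \<bullet> (metric_matrix \<phi> x *v w) = v \<bullet> ((transpose ?T ** metric_matrix \<theta> (t x) ** ?T) *v w)" .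
    qed
    then have "det (metric_matrix \<phi> x) = (det ?T)\<^sup>2 * det (metric_matrix \<theta> (t x))"
      by (simp add: det_mul det_transpose power2_eq_square)
    then show ?thesis by (simp add: real_sqrt_mult)
  qed
  have nz: "sqrt (det (metric_matrix \<theta> (t x))) \<noteq> 0" if "x \<in> U0" for x
    using det_metric_matrix_nonzero[OF p2 M U0(2)[OF that]] by simp
  \<comment> \<open>T is known as a derivative at each single point; its Jacobian is continuous
    because it is the quotient of the two metric densities.\<close>
  have cdet: "continuous_on U0 (\<lambda>x. \<bar>det (matrix (T x))\<bar>)"
  proof (rule continuous_on_eq)
    show "continuous_on U0 (\<lambda>x. sqrt (det (metric_matrix \<phi> x)) / sqrt (det (metric_matrix \<theta> (t x))))"
    proof (intro continuous_on_divide continuous_on_real_sqrt)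
      show "continuous_on U0 (\<lambda>x. det (metric_matrix \<phi> x))"
        by (rule continuous_on_subset[OF continuous_on_det_metric_matrix[OF p1]]) (use U0(1) in auto)
      show "continuous_on U0 (\<lambda>x. det (metric_matrix \<theta> (t x)))"
        by (rule continuous_on_compose2[OF continuous_on_det_metric_matrix[OF p2] ct]) (use U0(2) in auto)
    qed (use nz in auto)
    show "sqrt (det (metric_matrix \<phi> x)) / sqrt (det (metric_matrix \<theta> (t x))) = \<bar>det (matrix (T x))\<bar>"
      if "x \<in> U0" for x
      using key[OF that] nz[OF that] by simp
  qed
  define f where "f z = ennreal (sqrt (det (metric_matrix \<theta> z))) * indicator C z" for z
  have mf: "f \<in> borel_measurable borel"
  proof -
    have "(\<lambda>z. indicator C z *\<^sub>R sqrt (det (metric_matrix \<theta> z))) \<in> borel_measurable borel"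
      by (intro borel_measurable_continuous_on_indicator C continuous_on_real_sqrt
          continuous_on_subset[OF continuous_on_det_metric_matrix[OF p2]])
    then have "(\<lambda>z. ennreal (indicator C z *\<^sub>R sqrt (det (metric_matrix \<theta> z)))) \<in> borel_measurable borel"
      by measurable
    moreover have "(\<lambda>z. ennreal (indicator C z *\<^sub>R sqrt (det (metric_matrix \<theta> z)))) = f"
      by (auto simp: f_def fun_eq_iff indicator_def)
    ultimately show ?thesis by (simp only:)
  qed
  have mem: "x \<in> A \<longleftrightarrow> x \<in> U0 \<and> t x \<in> C" for x
  proof
    assume x: "x \<in> A"
    then obtain z where z: "z \<in> C" "\<phi> x = \<theta> z" using eq by (metis image_iff)
    then show "x \<in> U0 \<and> t x \<in> C" using x A C(2) gt by (auto simp: U0_def t_def)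
  next
    assume x: "x \<in> U0 \<and> t x \<in> C"
    then have "\<phi> x \<in> \<phi> ` A" using U0(3)[of x] unfolding eq by (metis image_eqI)
    then obtain y where "y \<in> A" "\<phi> x = \<phi> y" by auto
    then show "x \<in> A" using L1(4) A U0(1)[of x] x by (metis inj_onD subsetD)
  qed
  have CU: "C \<subseteq> t ` U0"
  proof
    fix z assume z: "z \<in> C"
    then obtain x where "x \<in> A" "\<phi> x = \<theta> z" using eq by (metis image_iff)
    moreover have "z \<in> V" using z C(2) by blast
    ultimately have "t x = z" "x \<in> U0" using mem[of x] gt[of z] by (simp_all add: t_def)
    then show "z \<in> t ` U0" by blast
  qed
  have "(\<integral>\<^sup>+x\<in>C. ennreal (sqrt (det (metric_matrix \<theta> x))) \<partial>lborel) = (\<integral>\<^sup>+z\<in>t ` U0. f z \<partial>lborel)"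
    by (rule nn_integral_cong) (use CU in \<open>auto simp: f_def indicator_def\<close>)
  also have "\<dots> = (\<integral>\<^sup>+x\<in>U0. f (t x) * ennreal \<bar>det (matrix (T x))\<bar> \<partial>lborel)"
    by (rule nn_integral_injective_image[OF opU0 T(1) cdet injt mf])
  also have "\<dots> = (\<integral>\<^sup>+x\<in>A. ennreal (sqrt (det (metric_matrix \<phi> x))) \<partial>lborel)"
  proof (rule nn_integral_cong)
    fix x
    show "f (t x) * ennreal \<bar>det (matrix (T x))\<bar> * indicator U0 x
      = ennreal (sqrt (det (metric_matrix \<phi> x))) * indicator A x"
    proof (cases "x \<in> A")
      case True
      then have x: "x \<in> U0" "t x \<in> C" using mem by auto
      have "ennreal (sqrt (det (metric_matrix \<phi> x))) = ennreal (sqrt (det (metric_matrix \<theta> (t x)))) * ennreal \<bar>det (matrix (T x))\<bar>"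
        unfolding key[OF x(1)] by (subst mult.commute) (rule ennreal_mult'', simp)
      then show ?thesis using x True by (simp add: f_def)
    next
      case False
      then show ?thesis using mem by (auto simp: f_def indicator_def)
    qed
  qed
  finally show ?thesis ..
qed

lemma borel_image_chart:
  assumes "local_parametrization M U \<phi>" "M \<in> sets borel" "A \<in> sets borel" "A \<subseteq> U"
  shows "\<phi> ` A \<in> sets borel"
proof -
  obtain g where g: "homeomorphism U (\<phi> ` U) \<phi> g" by (rule local_parametrization_inverse[OF assms(1)])
  have "openin (top_of_set M) (\<phi> ` U)" using assms(1) by (simp add: local_parametrization_def)
  then obtain W where "open W" "\<phi> ` U = M \<inter> W" by (auto simp: openin_open)
  then have "\<phi> ` U \<in> sets borel" using assms(2) by auto
  then show ?thesis by (rule homeomorphism_image_borel[OF g _ assms(3,4)])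
qed

lemma borel_vimage_chart:
  assumes "local_parametrization M U \<phi>" "X \<in> sets borel"
  shows "U \<inter> \<phi> -` X \<in> sets borel"
proof -
  note L = local_parametrizationD[OF assms(1)]
  have "\<phi> \<in> borel_measurable (restrict_space borel U)"
    by (rule borel_measurable_continuous_on_restrict[OF L(3)])
  from measurable_sets[OF this assms(2)] show ?thesis
    using L(1) by (simp add: sets_restrict_space_iff space_restrict_space Int_commute)
qed

section \<open>The measure carried by one chart, and by an atlas\<close>

definition chart_density :: "(real ^ 'd::finite \<Rightarrow> 'n::finite minkowski) \<Rightarrow> (real ^ 'd) set \<Rightarrow> real ^ 'd \<Rightarrow> ennreal" where
  "chart_density \<phi> A x = ennreal (sqrt (det (metric_matrix \<phi> x))) * indicator A x"

text \<open>The push-forward of the metric density under the chart. The value 0 off A serves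
  measurability only, since the density vanishes there.\<close>

definition chart_measure :: "(real ^ 'd::finite \<Rightarrow> 'n::finite minkowski) \<Rightarrow> (real ^ 'd) set \<Rightarrow> 'n minkowski measure" where
  "chart_measure \<phi> A = distr (density lborel (chart_density \<phi> A)) borel (\<lambda>x. if x \<in> A then \<phi> x else 0)"

lemma measurable_chart_density:
  assumes "local_parametrization M U \<phi>" "A \<in> sets borel" "A \<subseteq> U"
  shows "chart_density \<phi> A \<in> borel_measurable borel"
proof -
  have "(\<lambda>z. indicator A z *\<^sub>R sqrt (det (metric_matrix \<phi> z))) \<in> borel_measurable borel"
    by (intro borel_measurable_continuous_on_indicator assms continuous_on_real_sqrt
        continuous_on_subset[OF continuous_on_det_metric_matrix[OF assms(1)]])
  then have "(\<lambda>z. ennreal (indicator A z *\<^sub>R sqrt (det (metric_matrix \<phi> z)))) \<in> borel_measurable borel"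
    by measurable
  moreover have "(\<lambda>z. ennreal (indicator A z *\<^sub>R sqrt (det (metric_matrix \<phi> z)))) = chart_density \<phi> A"
    by (auto simp: chart_density_def fun_eq_iff indicator_def)
  ultimately show ?thesis by (simp only:)
qed

lemma measurable_chart:
  assumes "local_parametrization M U \<phi>" "A \<in> sets borel" "A \<subseteq> U"
  shows "(\<lambda>x. if x \<in> A then \<phi> x else 0) \<in> borel_measurable borel"
  using assms local_parametrizationD(3)[OF assms(1)]
  by (intro borel_measurable_continuous_on_if) (auto intro: continuous_on_subset continuous_on_const)

lemma emeasure_chart_measure:
  assumes "local_parametrization M U \<phi>" "A \<in> sets borel" "A \<subseteq> U" "X \<in> sets borel"
  shows "emeasure (chart_measure \<phi> A) X = (\<integral>\<^sup>+x\<in>A \<inter> \<phi> -` X. ennreal (sqrt (det (metric_matrix \<phi> x))) \<partial>lborel)"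
proof -
  let ?f = "\<lambda>x. if x \<in> A then \<phi> x else 0"
  note mf = measurable_chart[OF assms(1-3)]
  have pre: "?f -` X \<in> sets borel" using measurable_sets[OF mf assms(4)] by simp
  have "emeasure (chart_measure \<phi> A) X = emeasure (density lborel (chart_density \<phi> A)) (?f -` X)"
    unfolding chart_measure_def using mf assms(4) by (subst emeasure_distr) auto
  also have "\<dots> = (\<integral>\<^sup>+x. chart_density \<phi> A x * indicator (?f -` X) x \<partial>lborel)"
    using pre measurable_chart_density[OF assms(1-3)] by (subst emeasure_density) auto
  also have "\<dots> = (\<integral>\<^sup>+x\<in>A \<inter> \<phi> -` X. ennreal (sqrt (det (metric_matrix \<phi> x))) \<partial>lborel)"
    by (rule nn_integral_cong) (auto simp: chart_density_def indicator_def)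
  finally show ?thesis .
qed

text \<open>\<open>riemannian_measure\<close> is a definite description, so its defining property
  becomes available only after existence and uniqueness. The images of a finite atlas, made
  disjoint, cut every Borel subset of M into pieces that lie in one chart each.\<close>

lemma riemannian_measure_characterization:
  fixes \<phi> :: "nat \<Rightarrow> real ^ 'd::finite \<Rightarrow> 'n::finite minkowski"
  assumes M: "M \<subseteq> hyp_space" "M \<in> sets borel"
    and charts: "\<And>k. k < m \<Longrightarrow> local_parametrization M (U k) (\<phi> k)"
    and cover: "M = (\<Union>k<m. \<phi> k ` U k)"
  defines "\<mu> \<equiv> riemannian_measure TYPE('d) M"
  shows "sets \<mu> = sets borel" "emeasure \<mu> (- M) = 0"
    "\<And>V \<theta> A. local_parametrization M V (\<theta> :: real ^ 'd \<Rightarrow> 'n minkowski) \<Longrightarrow> A \<in> sets borel \<Longrightarrow> A \<subseteq> V \<Longrightarrow>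
        emeasure \<mu> (\<theta> ` A) = (\<integral>\<^sup>+x\<in>A. ennreal (sqrt (det (metric_matrix \<theta> x))) \<partial>lborel)"
proof -
  define S where "S k = \<phi> k ` U k - (\<Union>j<k. \<phi> j ` U j)" for k
  define A where "A k = U k \<inter> \<phi> k -` S k" for k
  have opU: "U k \<in> sets borel" if "k < m" for k
    using local_parametrizationD(1)[OF charts[OF that]] by simp
  have imU: "\<phi> k ` U k \<in> sets borel" if "k < m" for k
    by (rule borel_image_chart[OF charts[OF that] M(2) opU[OF that] order_refl])
  have Sm: "S k \<in> sets borel" if "k < m" for k
    unfolding S_def using that imU by (intro sets.Diff sets.finite_UN) auto
  have Am: "A k \<in> sets borel" "A k \<subseteq> U k" if "k < m" for k
    using borel_vimage_chart[OF charts[OF that] Sm[OF that]] by (auto simp: A_def)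
  have "S k \<subseteq> \<phi> k ` U k" for k by (auto simp: S_def)
  then have im: "\<phi> k ` (A k \<inter> \<phi> k -` X) = S k \<inter> X" for k X
    unfolding A_def by blast
  have disj: "disjoint_family_on S {..<m}"
    unfolding disjoint_family_on_def S_def
  proof (intro ballI impI)
    fix i j :: nat assume "i \<noteq> j"
    then show "(\<phi> i ` U i - (\<Union>j<i. \<phi> j ` U j)) \<inter> (\<phi> j ` U j - (\<Union>i<j. \<phi> i ` U i)) = {}"
      by (cases "i < j") (auto simp: not_less_iff_gr_or_eq)
  qed
  have covS: "(\<Union>k<m. S k) = M"
  proof
    show "(\<Union>k<m. S k) \<subseteq> M" unfolding cover S_def by auto
    show "M \<subseteq> (\<Union>k<m. S k)"
    proof
      fix p assume "p \<in> M"
      then obtain k where k: "k < m" "p \<in> \<phi> k ` U k" unfolding cover by auto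
      define l where "l = (LEAST k. p \<in> \<phi> k ` U k)"
      have "p \<in> \<phi> l ` U l" unfolding l_def using k(2) by (rule LeastI[of "\<lambda>k. p \<in> \<phi> k ` U k"])
      moreover have "l \<le> k" unfolding l_def using k(2) by (rule Least_le[of "\<lambda>k. p \<in> \<phi> k ` U k"])
      moreover have "p \<notin> \<phi> j ` U j" if "j < l" for j using that not_less_Least unfolding l_def by blast
      ultimately show "p \<in> (\<Union>k<m. S k)" using k(1) by (auto simp: S_def intro!: bexI[of _ l])
    qed
  qed
  let ?c = "\<lambda>k. chart_measure (\<phi> k) (A k)"
  \<comment> \<open>Existence: the sum of the chart measures over the disjoint pieces. For any other
    chart the contribution of each piece is converted by \<open>chart_integral_eq\<close>.\<close>
  define \<nu> where "\<nu> = measure_of UNIV (sets borel) (\<lambda>X. \<Sum>k<m. emeasure (?c k) X)"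
  have setsc: "sets (?c k) = sets borel" for k by (simp add: chart_measure_def)
  have setsn: "sets \<nu> = sets borel"
    unfolding \<nu>_def using sets.sigma_sets_eq[of "borel :: 'n minkowski measure"]
    by (simp add: sets_measure_of)
  have en: "emeasure \<nu> X = (\<Sum>k<m. emeasure (?c k) X)" if "X \<in> sets borel" for X
    unfolding \<nu>_def
  proof (rule emeasure_measure_of_sigma)
    show "sigma_algebra (UNIV :: 'n minkowski set) (sets borel)" 
      using sets.sigma_algebra_axioms[of "borel :: 'n minkowski measure"] by simp
    show "positive (sets borel) (\<lambda>X. \<Sum>k<m. emeasure (?c k) X)" by (simp add: positive_def)
    show "countably_additive (sets borel) (\<lambda>X. \<Sum>k<m. emeasure (?c k) X)"
      unfolding countably_additive_def
    proof (intro allI impI)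
      fix F :: "nat \<Rightarrow> 'n minkowski set"
      assume F: "range F \<subseteq> sets borel" "disjoint_family F"
      have "(\<Sum>i. \<Sum>k<m. emeasure (?c k) (F i)) = (\<Sum>k<m. \<Sum>i. emeasure (?c k) (F i))"
        by (rule suminf_sum) (rule summableI)
      also have "\<dots> = (\<Sum>k<m. emeasure (?c k) (\<Union>i. F i))"
        by (intro sum.cong refl suminf_emeasure) (use F setsc in auto)
      finally show "(\<Sum>i. \<Sum>k<m. emeasure (?c k) (F i)) = (\<Sum>k<m. emeasure (?c k) (\<Union>i. F i))" .
    qed
  qed (rule that)
  have en': "emeasure \<nu> X = (\<Sum>k<m. \<integral>\<^sup>+x\<in>A k \<inter> \<phi> k -` X. ennreal (sqrt (det (metric_matrix (\<phi> k) x))) \<partial>lborel)"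
    if X: "X \<in> sets borel" for X
    unfolding en[OF X]
    by (rule sum.cong[OF refl]) (use emeasure_chart_measure[OF charts Am X] in auto)
  let ?P = "\<lambda>\<mu> :: 'n minkowski measure. sets \<mu> = sets borel \<and> emeasure \<mu> (- M) = 0 \<and>
     (\<forall>V (\<theta> :: real ^ 'd \<Rightarrow> 'n minkowski) C.
        local_parametrization M V \<theta> \<longrightarrow> C \<in> sets borel \<longrightarrow> C \<subseteq> V \<longrightarrow>
        emeasure \<mu> (\<theta> ` C) = (\<integral>\<^sup>+x\<in>C. ennreal (sqrt (det (metric_matrix \<theta> x))) \<partial>lborel))"
  have Pn: "?P \<nu>"
  proof (intro conjI allI impI)
    show "sets \<nu> = sets borel" by (rule setsn)
    have e: "A k \<inter> \<phi> k -` (- M) = {}" if "k < m" for k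
      using local_parametrizationD(5)[OF charts[OF that]] by (auto simp: A_def)
    have "- M \<in> sets borel" using M(2) by (metis borel_comp)
    then show "emeasure \<nu> (- M) = 0"
      by (subst en') (simp_all add: e)
  next
    fix V C and \<theta> :: "real ^ 'd \<Rightarrow> 'n minkowski"
    assume t: "local_parametrization M V \<theta>" and C: "C \<in> sets borel" "C \<subseteq> V"
    let ?B = "\<lambda>k. C \<inter> \<theta> -` S k"
    let ?j = "\<lambda>x. ennreal (sqrt (det (metric_matrix \<theta> x)))"
    note L = local_parametrizationD[OF t]
    have tC: "\<theta> ` C \<in> sets borel" by (rule borel_image_chart[OF t M(2) C])
    have Bm: "?B k \<in> sets borel" if "k < m" for k
    proof -
      have "?B k = C \<inter> (V \<inter> \<theta> -` S k)" using C(2) by auto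
      then show ?thesis using borel_vimage_chart[OF t Sm[OF that]] C(1) by auto
    qed
    have "emeasure \<nu> (\<theta> ` C) = (\<Sum>k<m. \<integral>\<^sup>+x\<in>?B k. ?j x \<partial>lborel)"
      unfolding en'[OF tC]
    proof (rule sum.cong[OF refl])
      fix k assume "k \<in> {..<m}"
      then have k: "k < m" by simp
      show "(\<integral>\<^sup>+x\<in>A k \<inter> \<phi> k -` (\<theta> ` C). ennreal (sqrt (det (metric_matrix (\<phi> k) x))) \<partial>lborel) = (\<integral>\<^sup>+x\<in>?B k. ?j x \<partial>lborel)"
      proof (rule chart_integral_eq[OF charts[OF k] t M(1)])
        show "A k \<inter> \<phi> k -` (\<theta> ` C) \<subseteq> U k" by (auto simp: A_def)
        show "?B k \<in> sets borel" by (rule Bm[OF k])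
        show "?B k \<subseteq> V" using C(2) by auto
        show "\<phi> k ` (A k \<inter> \<phi> k -` (\<theta> ` C)) = \<theta> ` ?B k" unfolding im by auto
      qed
    qed
    also have "\<dots> = (\<Sum>k<m. emeasure (chart_measure \<theta> C) (S k))"
      by (rule sum.cong[OF refl]) (use emeasure_chart_measure[OF t C Sm] in auto)
    also have "\<dots> = emeasure (chart_measure \<theta> C) (\<Union>k<m. S k)"
      by (rule sum_emeasure[OF _ disj]) (use Sm in \<open>auto simp: chart_measure_def\<close>)
    also have "\<dots> = (\<integral>\<^sup>+x\<in>C \<inter> \<theta> -` M. ?j x \<partial>lborel)"
      unfolding covS by (rule emeasure_chart_measure[OF t C M(2)])
    also have "C \<inter> \<theta> -` M = C" using L(5) C(2) by auto
    finally show "emeasure \<nu> (\<theta> ` C) = (\<integral>\<^sup>+x\<in>C. ?j x \<partial>lborel)" .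
  qed
  \<comment> \<open>A competitor vanishes off M and is prescribed by a chart on each piece
    \<open>S k\<close>, so it has no freedom left.\<close>
  have uniq: "\<mu>' = \<nu>" if P: "?P \<mu>'" for \<mu>'
  proof (rule measure_eqI)
    show "sets \<mu>' = sets \<nu>" using P setsn by simp
    fix X assume "X \<in> sets \<mu>'"
    then have X: "X \<in> sets borel" using P by simp
    have s: "sets \<mu>' = sets borel" using P by simp
    have nullM: "emeasure \<mu>' (X - M) = 0"
    proof -
      have "emeasure \<mu>' (X - M) \<le> emeasure \<mu>' (- M)"
        by (rule emeasure_mono) (use s M(2) in \<open>auto intro: borel_comp\<close>)
      then show ?thesis using P by simp
    qed
    have "emeasure \<mu>' X = emeasure \<mu>' ((X \<inter> M) \<union> (X - M))" by (simp add: Int_Diff_Un)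
    also have "\<dots> = emeasure \<mu>' (X \<inter> M)"
      using nullM X M(2) s by (subst emeasure_Un_null_set) (auto simp: null_sets_def)
    also have "X \<inter> M = (\<Union>k<m. S k \<inter> X)" using covS by auto
    also have "emeasure \<mu>' (\<Union>k<m. S k \<inter> X) = (\<Sum>k<m. emeasure \<mu>' (S k \<inter> X))"
    proof (rule sum_emeasure[symmetric])
      show "disjoint_family_on (\<lambda>k. S k \<inter> X) {..<m}"
        using disj unfolding disjoint_family_on_def by blast
    qed (use Sm X s in auto)
    also have "\<dots> = emeasure \<nu> X"
      unfolding en'[OF X]
    proof (rule sum.cong[OF refl])
      fix k assume "k \<in> {..<m}"
      then have k: "k < m" by simp
      have "A k \<inter> \<phi> k -` X \<in> sets borel"
      proof -
        have "A k \<inter> \<phi> k -` X = A k \<inter> (U k \<inter> \<phi> k -` X)" using Am[OF k] by auto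
        then show ?thesis using borel_vimage_chart[OF charts[OF k] X] Am[OF k] by auto
      qed
      moreover have "A k \<inter> \<phi> k -` X \<subseteq> U k" using Am[OF k] by auto
      ultimately have "emeasure \<mu>' (\<phi> k ` (A k \<inter> \<phi> k -` X)) = (\<integral>\<^sup>+x\<in>A k \<inter> \<phi> k -` X. ennreal (sqrt (det (metric_matrix (\<phi> k) x))) \<partial>lborel)"
        using P charts[OF k] by blast
      then show "emeasure \<mu>' (S k \<inter> X) = (\<integral>\<^sup>+x\<in>A k \<inter> \<phi> k -` X. ennreal (sqrt (det (metric_matrix (\<phi> k) x))) \<partial>lborel)"
        by (simp only: im)
    qed
    finally show "emeasure \<mu>' X = emeasure \<nu> X" .
  qed
  have "\<mu> = \<nu>"
    unfolding \<mu>_def riemannian_measure_def by (rule the_equality, rule Pn, erule uniq)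
  then have P: "?P \<mu>" using Pn by simp
  show "sets \<mu> = sets borel" "emeasure \<mu> (- M) = 0" using P by simp_all
  show "emeasure \<mu> (\<theta> ` C) = (\<integral>\<^sup>+x\<in>C. ennreal (sqrt (det (metric_matrix \<theta> x))) \<partial>lborel)"
    if "local_parametrization M V \<theta>" "C \<in> sets borel" "C \<subseteq> V" for V C and \<theta> :: "real ^ 'd \<Rightarrow> 'n minkowski"
    using P that by blast
qed

text \<open>The hypothesis on sets identifies the measure on the image of A with
  \<open>chart_measure \<theta> A\<close>, whose integrals are given by the rules for push-forwards
  and densities.\<close>

lemma nn_integral_chart:
  fixes \<theta> :: "real ^ 'd::finite \<Rightarrow> 'n::finite minkowski"
  assumes s: "sets \<mu> = sets borel"
    and e: "\<And>A. A \<in> sets borel \<Longrightarrow> A \<subseteq> V \<Longrightarrow>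
        emeasure \<mu> (\<theta> ` A) = (\<integral>\<^sup>+x\<in>A. ennreal (sqrt (det (metric_matrix \<theta> x))) \<partial>lborel)"
    and t: "local_parametrization M V \<theta>" and M: "M \<in> sets borel"
    and A: "A \<in> sets borel" "A \<subseteq> V" and f: "f \<in> borel_measurable borel"
  shows "(\<integral>\<^sup>+p\<in>\<theta> ` A. f p \<partial>\<mu>) = (\<integral>\<^sup>+x\<in>A. f (\<theta> x) * ennreal (sqrt (det (metric_matrix \<theta> x))) \<partial>lborel)"
proof -
  have tA: "\<theta> ` A \<in> sets borel" by (rule borel_image_chart[OF t M A])
  let ?g = "\<lambda>x. if x \<in> A then \<theta> x else 0"
  have eq: "density \<mu> (indicator (\<theta> ` A)) = chart_measure \<theta> A"
  proof (rule measure_eqI)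
    show "sets (density \<mu> (indicator (\<theta> ` A))) = sets (chart_measure \<theta> A)"
      using s by (simp add: chart_measure_def)
    fix X assume "X \<in> sets (density \<mu> (indicator (\<theta> ` A)))"
    then have X: "X \<in> sets borel" using s by simp
    have "A \<inter> \<theta> -` X = A \<inter> (V \<inter> \<theta> -` X)" using A(2) by auto
    then have m: "A \<inter> \<theta> -` X \<in> sets borel" using borel_vimage_chart[OF t X] A(1) by auto
    have "emeasure (density \<mu> (indicator (\<theta> ` A))) X = emeasure \<mu> (\<theta> ` A \<inter> X)"
      using X tA s by (subst emeasure_density) (auto simp: indicator_inter_arith[symmetric] cong: measurable_cong_sets)
    also have "\<theta> ` A \<inter> X = \<theta> ` (A \<inter> \<theta> -` X)" by auto
    also have "emeasure \<mu> \<dots> = emeasure (chart_measure \<theta> A) X"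
      using e[OF m] A(2) emeasure_chart_measure[OF t A X] by auto
    finally show "emeasure (density \<mu> (indicator (\<theta> ` A))) X = emeasure (chart_measure \<theta> A) X" .
  qed
  have f\<mu>: "f \<in> borel_measurable \<mu>" using f s by (simp cong: measurable_cong_sets)
  have "(\<integral>\<^sup>+p\<in>\<theta> ` A. f p \<partial>\<mu>) = (\<integral>\<^sup>+p. f p \<partial>density \<mu> (indicator (\<theta> ` A)))"
    using f\<mu> tA s by (subst nn_integral_density) (auto simp: mult.commute)
  also have "\<dots> = (\<integral>\<^sup>+x. f (?g x) \<partial>density lborel (chart_density \<theta> A))"
    unfolding eq chart_measure_def using f measurable_chart[OF t A] by (subst nn_integral_distr) auto
  also have "\<dots> = (\<integral>\<^sup>+x. chart_density \<theta> A x * f (?g x) \<partial>lborel)"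
    using f measurable_chart[OF t A] measurable_chart_density[OF t A]
    by (subst nn_integral_density) auto
  also have "\<dots> = (\<integral>\<^sup>+x\<in>A. f (\<theta> x) * ennreal (sqrt (det (metric_matrix \<theta> x))) \<partial>lborel)"
    by (rule nn_integral_cong) (auto simp: chart_density_def indicator_def mult.commute)
  finally show ?thesis .
qed

section \<open>The Brunn--Minkowski inequality\<close>

definition msum :: "'a::real_vector set \<Rightarrow> 'a set \<Rightarrow> 'a set" where
  "msum A B = (\<Union>x\<in>A. \<Union>y\<in>B. {x + y})"

lemma msum_commute: "msum A B = msum B A"
  by (force simp: msum_def add.commute)

lemma msum_mono: "A \<subseteq> C \<Longrightarrow> B \<subseteq> D \<Longrightarrow> msum A B \<subseteq> msum C D"
  unfolding msum_def by blast

lemma open_msum: "open A \<Longrightarrow> open (msum A B)" for A :: "'a::real_normed_vector set"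
  unfolding msum_def by (rule open_sums) simp

lemma bounded_msum: "bounded A \<Longrightarrow> bounded B \<Longrightarrow> bounded (msum A B)"
  for A :: "'a::real_normed_vector set"
  unfolding msum_def by (rule bounded_sums)

lemma open_bounded_fmeasurable: "open A \<Longrightarrow> bounded A \<Longrightarrow> A \<in> fmeasurable lborel"
  for A :: "'a::euclidean_space set"
  using emeasure_bounded_finite[of A] by (intro fmeasurableI) auto

text \<open>After division by the right side, the inequality of arithmetic and geometric means
  applies to the ratios a i / (a i + b i) and to b i / (a i + b i); the two arithmetic means add up
  to 1.\<close>

lemma box_product_bound:
  fixes a b :: "'i \<Rightarrow> real"
  assumes I: "finite I" "I \<noteq> {}" and a: "\<And>i. i \<in> I \<Longrightarrow> a i > 0" and b: "\<And>i. i \<in> I \<Longrightarrow> b i > 0"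
  shows "(root (card I) (prod a I) + root (card I) (prod b I)) ^ card I \<le> (\<Prod>i\<in>I. a i + b i)"
proof -
  let ?n = "card I"
  have n: "?n > 0" using I by (simp add: card_gt_0_iff)
  have ab: "a i + b i > 0" if "i \<in> I" for i using a[OF that] b[OF that] by simp
  have amgm: "root ?n (\<Prod>i\<in>I. f i / (a i + b i)) \<le> (\<Sum>i\<in>I. f i / (a i + b i) / ?n)"
    if "\<And>i. i \<in> I \<Longrightarrow> f i > 0" for f
  proof -
    have "(\<Prod>i\<in>I. f i / (a i + b i)) > 0"
      using that ab by (intro prod_pos) (auto intro: divide_pos_pos)
    then have "root ?n (\<Prod>i\<in>I. f i / (a i + b i)) = (\<Prod>i\<in>I. f i / (a i + b i)) powr (1 / ?n)"
      using n by (intro root_powr_inverse) simp_all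
    also have "\<dots> \<le> (\<Sum>i\<in>I. f i / (a i + b i) / ?n)"
      using that ab by (intro arith_geom_mean I) (auto intro!: divide_nonneg_nonneg less_imp_le)
    finally show ?thesis .
  qed
  let ?P = "\<Prod>i\<in>I. a i + b i"
  have Ppos: "?P > 0" using ab by (intro prod_pos) auto
  have "root ?n (prod a I) / root ?n ?P + root ?n (prod b I) / root ?n ?P
    = root ?n (\<Prod>i\<in>I. a i / (a i + b i)) + root ?n (\<Prod>i\<in>I. b i / (a i + b i))"
    using n by (simp add: real_root_divide prod_dividef)
  also have "\<dots> \<le> (\<Sum>i\<in>I. a i / (a i + b i) / ?n) + (\<Sum>i\<in>I. b i / (a i + b i) / ?n)"
    by (intro add_mono amgm a b)
  also have "\<dots> = (\<Sum>i\<in>I. 1 / ?n)"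
    unfolding sum.distrib[symmetric]
  proof (rule sum.cong[OF refl])
    fix i assume "i \<in> I"
    from ab[OF this] show "a i / (a i + b i) / ?n + b i / (a i + b i) / ?n = 1 / ?n"
      by (simp add: add_divide_distrib[symmetric])
  qed
  also have "\<dots> = 1" using n by simp
  finally have "root ?n (prod a I) + root ?n (prod b I) \<le> root ?n ?P"
    using n Ppos by (simp add: add_divide_distrib[symmetric] pos_divide_le_eq)
  then have "(root ?n (prod a I) + root ?n (prod b I)) ^ ?n \<le> root ?n ?P ^ ?n"
    using a b by (intro power_mono add_nonneg_nonneg real_root_ge_zero prod_nonneg) (auto intro: less_imp_le)
  also have "\<dots> = ?P" using n Ppos by simp
  finally show ?thesis .
qed

section \<open>The Brunn-Minkowski inequality for two boxes\<close>

lemma measure_box_pos_side: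
  fixes l u :: "'a::euclidean_space"
  assumes "box l u \<noteq> {}"
  shows "b \<in> Basis \<Longrightarrow> l \<bullet> b < u \<bullet> b" "measure lborel (box l u) = (\<Prod>b\<in>Basis. u \<bullet> b - l \<bullet> b)"
    "measure lborel (box l u) > 0"
proof -
  have lu: "\<And>b. b \<in> Basis \<Longrightarrow> l \<bullet> b < u \<bullet> b" using assms by (simp add: box_ne_empty)
  then show "b \<in> Basis \<Longrightarrow> l \<bullet> b < u \<bullet> b" by simp
  show m: "measure lborel (box l u) = (\<Prod>b\<in>Basis. u \<bullet> b - l \<bullet> b)"
    using lu by (subst measure_lborel_box_eq) (auto simp: inner_diff_left less_imp_le)
  show "measure lborel (box l u) > 0"
    unfolding m using lu by (intro prod_pos) auto
qed

lemma brunn_minkowski_box: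
  fixes l u l' u' :: "'a::euclidean_space"
  assumes ne: "box l u \<noteq> {}" "box l' u' \<noteq> {}"
  shows "(root DIM('a) (measure lborel (box l u)) + root DIM('a) (measure lborel (box l' u'))) ^ DIM('a)
    \<le> measure lborel (msum (box l u) (box l' u'))"
proof -
  note s = measure_box_pos_side[OF ne(1)] and s' = measure_box_pos_side[OF ne(2)]
  have sub: "box (l + l') (u + u') \<subseteq> msum (box l u) (box l' u')"
  proof
    fix z assume z: "z \<in> box (l + l') (u + u')"
    \<comment> \<open>The relative position of z in the b-th side of the summed box; dividing both
      given sides in this ratio splits z.\<close>
    define r where "r b = (z \<bullet> b - l \<bullet> b - l' \<bullet> b) / ((u \<bullet> b - l \<bullet> b) + (u' \<bullet> b - l' \<bullet> b))" for b
    have r: "0 < r b" "r b < 1" "r b * ((u \<bullet> b - l \<bullet> b) + (u' \<bullet> b - l' \<bullet> b)) = z \<bullet> b - l \<bullet> b - l' \<bullet> b"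
      if "b \<in> Basis" for b
    proof -
      have pos: "(u \<bullet> b - l \<bullet> b) + (u' \<bullet> b - l' \<bullet> b) > 0" using s(1)[OF that] s'(1)[OF that] by simp
      have zb: "l \<bullet> b + l' \<bullet> b < z \<bullet> b" "z \<bullet> b < u \<bullet> b + u' \<bullet> b"
        using z that by (auto simp: mem_box inner_add_left)
      show "0 < r b" "r b < 1" "r b * ((u \<bullet> b - l \<bullet> b) + (u' \<bullet> b - l' \<bullet> b)) = z \<bullet> b - l \<bullet> b - l' \<bullet> b"
        using pos zb by (simp_all add: r_def)
    qed
    define x where "x = (\<Sum>b\<in>Basis. (l \<bullet> b + r b * (u \<bullet> b - l \<bullet> b)) *\<^sub>R b)"
    have xb: "x \<bullet> b = l \<bullet> b + r b * (u \<bullet> b - l \<bullet> b)" if "b \<in> Basis" for b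
      using that by (simp add: x_def)
    have x: "x \<in> box l u"
      unfolding mem_box
    proof (intro ballI conjI)
      fix b :: 'a assume b: "b \<in> Basis"
      show "l \<bullet> b < x \<bullet> b" using xb[OF b] r(1)[OF b] s(1)[OF b] by simp
      have "r b * (u \<bullet> b - l \<bullet> b) < 1 * (u \<bullet> b - l \<bullet> b)"
        using r(2)[OF b] s(1)[OF b] by (intro mult_strict_right_mono) auto
      then show "x \<bullet> b < u \<bullet> b" using xb[OF b] by simp
    qed
    have y: "z - x \<in> box l' u'"
      unfolding mem_box
    proof (intro ballI conjI)
      fix b :: 'a assume b: "b \<in> Basis"
      have yb: "(z - x) \<bullet> b = l' \<bullet> b + r b * (u' \<bullet> b - l' \<bullet> b)"
        using xb[OF b] r(3)[OF b] by (simp add: inner_diff_left algebra_simps)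
      show "l' \<bullet> b < (z - x) \<bullet> b" using yb r(1)[OF b] s'(1)[OF b] by simp
      have "r b * (u' \<bullet> b - l' \<bullet> b) < 1 * (u' \<bullet> b - l' \<bullet> b)"
        using r(2)[OF b] s'(1)[OF b] by (intro mult_strict_right_mono) auto
      then show "(z - x) \<bullet> b < u' \<bullet> b" using yb by simp
    qed
    have "z = x + (z - x)" by simp
    then show "z \<in> msum (box l u) (box l' u')" using x y unfolding msum_def by blast
  qed
  have "(root DIM('a) (measure lborel (box l u)) + root DIM('a) (measure lborel (box l' u'))) ^ DIM('a)
    \<le> (\<Prod>b\<in>Basis. (u \<bullet> b - l \<bullet> b) + (u' \<bullet> b - l' \<bullet> b))"
    unfolding s(2) s'(2) by (rule box_product_bound) (use s(1) s'(1) in auto)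
  also have "\<dots> = measure lborel (box (l + l') (u + u'))"
  proof -
    have "box (l + l') (u + u') \<noteq> {}"
      using s(1) s'(1) by (auto simp: box_ne_empty inner_add_left intro!: add_strict_mono)
    then show ?thesis
      by (simp add: measure_box_pos_side(2) inner_add_left algebra_simps)
  qed
  also have "\<dots> \<le> measure lborel (msum (box l u) (box l' u'))"
  proof (rule measure_mono_fmeasurable[OF sub])
    show "msum (box l u) (box l' u') \<in> fmeasurable lborel"
      by (intro open_bounded_fmeasurable open_msum bounded_msum open_box bounded_box)
  qed simp
  finally show ?thesis .
qed

section \<open>Finite families of disjoint open boxes\<close>

definition box_family :: "'a::euclidean_space set set \<Rightarrow> bool" where
  "box_family P \<longleftrightarrow> finite P \<and> disjoint P \<and> (\<forall>K\<in>P. K \<noteq> {} \<and> (\<exists>l u. K = box l u))"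

definition below :: "'a::euclidean_space \<Rightarrow> real \<Rightarrow> 'a set" where "below b c = {x. x \<bullet> b < c}"

definition above :: "'a::euclidean_space \<Rightarrow> real \<Rightarrow> 'a set" where "above b c = {x. x \<bullet> b > c}"

lemma box_Int_below:
  fixes l u b :: "'a::euclidean_space"
  assumes "b \<in> Basis"
  shows "box l u \<inter> below b c = box l (\<Sum>i\<in>Basis. (if i = b then min (u \<bullet> i) c else u \<bullet> i) *\<^sub>R i)"
  using assms by (auto simp: below_def mem_box split: if_splits)

lemma box_Int_above:
  fixes l u b :: "'a::euclidean_space"
  assumes "b \<in> Basis"
  shows "box l u \<inter> above b c = box (\<Sum>i\<in>Basis. (if i = b then max (l \<bullet> i) c else l \<bullet> i) *\<^sub>R i) u"
  using assms by (auto simp: above_def mem_box split: if_splits)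

text \<open>The form with \<open>max\<close> and \<open>min\<close> covers all positions of the cut
  at once and makes continuity in c evident.\<close>

lemma measure_box_below:
  fixes l u b :: "'a::euclidean_space"
  assumes "b \<in> Basis" "box l u \<noteq> {}"
  shows "measure lborel (box l u \<inter> below b c) = max 0 (min (u \<bullet> b) c - l \<bullet> b) * (\<Prod>i\<in>Basis-{b}. u \<bullet> i - l \<bullet> i)"
proof -
  let ?u = "\<Sum>i\<in>Basis. (if i = b then min (u \<bullet> i) c else u \<bullet> i) *\<^sub>R i"
  have ub: "?u \<bullet> i = (if i = b then min (u \<bullet> i) c else u \<bullet> i)" if "i \<in> Basis" for i
    using that by simp
  note s = measure_box_pos_side(1)[OF assms(2)]
  show ?thesis
  proof (cases "l \<bullet> b \<le> min (u \<bullet> b) c")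
    case True
    have c: "\<forall>i\<in>Basis. l \<bullet> i \<le> ?u \<bullet> i"
      using True s ub by (auto simp: less_imp_le)
    have "measure lborel (box l u \<inter> below b c) = (\<Prod>i\<in>Basis. (?u - l) \<bullet> i)"
      unfolding box_Int_below[OF assms(1)] by (subst measure_lborel_box_eq, rule if_P, rule c)
    also have "\<dots> = (?u - l) \<bullet> b * (\<Prod>i\<in>Basis-{b}. (?u - l) \<bullet> i)"
      using assms(1) by (simp add: prod.remove)
    also have "(\<Prod>i\<in>Basis-{b}. (?u - l) \<bullet> i) = (\<Prod>i\<in>Basis-{b}. u \<bullet> i - l \<bullet> i)"
      by (rule prod.cong[OF refl]) (simp add: inner_diff_left ub)
    also have "(?u - l) \<bullet> b = max 0 (min (u \<bullet> b) c - l \<bullet> b)"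
      using True ub[OF assms(1)] by (simp add: inner_diff_left)
    finally show ?thesis .
  next
    case False
    then have "\<not> (\<forall>i\<in>Basis. l \<bullet> i \<le> ?u \<bullet> i)" using assms(1) ub[OF assms(1)] by (auto intro!: bexI[of _ b])
    then have "measure lborel (box l u \<inter> below b c) = 0"
      unfolding box_Int_below[OF assms(1)] by (rule trans[OF measure_lborel_box_eq if_not_P])
    moreover have "max 0 (min (u \<bullet> b) c - l \<bullet> b) = 0" using False by (auto simp: max_def)
    ultimately show ?thesis by simp
  qed
qed

lemma box_familyE:
  assumes "box_family P" "K \<in> P"
  obtains l u where "K = box l u" "box l u \<noteq> {}"
  using assms unfolding box_family_def by blast

lemma box_familyD:
  assumes "box_family P"
  shows "finite P" "open (\<Union>P)" "bounded (\<Union>P)" "\<Union>P \<in> fmeasurable lborel"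
    "measure lborel (\<Union>P) = (\<Sum>K\<in>P. measure lborel K)" "P \<noteq> {} \<Longrightarrow> measure lborel (\<Union>P) > 0"
proof -
  show fin: "finite P" using assms by (simp add: box_family_def)
  have K: "open K" "bounded K" "K \<in> sets lborel" "measure lborel K > 0" if "K \<in> P" for K
  proof -
    obtain l u where "K = box l u" "box l u \<noteq> {}" by (rule box_familyE[OF assms \<open>K \<in> P\<close>])
    then show "open K" "bounded K" "K \<in> sets lborel" "measure lborel K > 0"
      using measure_box_pos_side(3)[of l u] by auto
  qed
  show op: "open (\<Union>P)" using K by auto
  show bd: "bounded (\<Union>P)" using K fin by auto
  show "\<Union>P \<in> fmeasurable lborel"
    using op emeasure_bounded_finite[OF bd] by (intro fmeasurableI) auto
  have "K \<in> fmeasurable lborel" if "K \<in> P" for K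
    using K[OF that] emeasure_bounded_finite by (intro fmeasurableI) auto
  then show m: "measure lborel (\<Union>P) = (\<Sum>K\<in>P. measure lborel K)"
    using measure_UNION'[of P "\<lambda>K. K" lborel] assms
    by (simp add: box_family_def disjoint_def pairwise_def disjnt_def)
  show "P \<noteq> {} \<Longrightarrow> measure lborel (\<Union>P) > 0"
    unfolding m using K fin by (intro sum_pos) auto
qed

text \<open>Empty pieces are dropped, so a cut never increases the number of boxes, and it lowers
  the number as soon as some box misses H. This count drives the induction for
  Brunn-Minkowski.\<close>

lemma box_family_split:
  assumes P: "box_family P" and b: "b \<in> Basis" and H: "H = below b c \<or> H = above b c"
  defines "Q \<equiv> (\<lambda>K. K \<inter> H) ` P - {{}}"
  shows "box_family Q" "\<Union>Q = \<Union>P \<inter> H" "card Q \<le> card P"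
    "K \<in> P \<Longrightarrow> K \<inter> H = {} \<Longrightarrow> card Q < card P"
proof -
  have fin: "finite P" using P by (simp add: box_family_def)
  show "box_family Q"
    unfolding box_family_def
  proof (intro conjI ballI)
    show "finite Q" using fin by (simp add: Q_def)
    show "disjoint Q" using P unfolding box_family_def Q_def disjoint_def by blast
    fix X assume X: "X \<in> Q"
    then show "X \<noteq> {}" by (simp add: Q_def)
    from X obtain K where "K \<in> P" "X = K \<inter> H" by (auto simp: Q_def)
    moreover obtain l u where "K = box l u" by (rule box_familyE[OF P \<open>K \<in> P\<close>])
    ultimately show "\<exists>l u. X = box l u"
      using H box_Int_below[OF b, of l u c] box_Int_above[OF b, of l u c] by auto
  qed
  show "\<Union>Q = \<Union>P \<inter> H" by (auto simp: Q_def)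
  have "card Q \<le> card ((\<lambda>K. K \<inter> H) ` P)" unfolding Q_def using fin by (intro card_mono) auto
  also have "\<dots> \<le> card P" using fin by (rule card_image_le)
  finally show "card Q \<le> card P" .
  show "card Q < card P" if "K \<in> P" "K \<inter> H = {}"
  proof -
    have "Q \<subseteq> (\<lambda>K. K \<inter> H) ` (P - {K})" using that by (auto simp: Q_def)
    then have "card Q \<le> card ((\<lambda>K. K \<inter> H) ` (P - {K}))" using fin by (intro card_mono) auto
    also have "\<dots> \<le> card (P - {K})" using fin by (intro card_image_le) auto
    also have "\<dots> < card P" using fin that(1) by (meson card_Diff1_less)
    finally show ?thesis .
  qed
qed

text \<open>The two open half spaces omit only a hyperplane, which is a null set.\<close>

lemma measure_box_family_split:
  assumes P: "box_family P" and b: "b \<in> Basis"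
  shows "measure lborel (\<Union>P) = measure lborel (\<Union>P \<inter> below b c) + measure lborel (\<Union>P \<inter> above b c)"
proof -
  have N: "{x. x \<bullet> b = c} \<in> null_sets lborel"
  proof -
    have "negligible {x. b \<bullet> x = c}" using b by (intro negligible_hyperplane) (metis nonzero_Basis)
    then show ?thesis
      by (simp add: inner_commute negligible_iff_null_sets null_sets_completion_iff closed_hyperplane borel_closed)
  qed
  have o: "open (below b c)" "open (above b c)"
    by (auto simp: below_def above_def open_halfspace_component_lt open_halfspace_component_gt)
  note D = box_familyD[OF P]
  have fm: "\<Union>P \<inter> below b c \<in> fmeasurable lborel" "\<Union>P \<inter> above b c \<in> fmeasurable lborel"
    using o by (auto intro!: fmeasurable_Int_fmeasurable D(4))
  have "measure lborel (\<Union>P) = measure lborel ((\<Union>P \<inter> below b c \<union> \<Union>P \<inter> above b c) \<union> (\<Union>P \<inter> {x. x \<bullet> b = c}))"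
    by (rule arg_cong[of _ _ "measure lborel"]) (auto simp: below_def above_def)
  also have "\<dots> = measure lborel (\<Union>P \<inter> below b c \<union> \<Union>P \<inter> above b c)"
    by (rule measure_Un_null_set) (use D(2) o N in \<open>auto intro: null_set_Int1 null_set_Int2\<close>)
  also have "\<dots> = measure lborel (\<Union>P \<inter> below b c) + measure lborel (\<Union>P \<inter> above b c)"
    by (rule measure_Union) (use fm in \<open>auto simp: fmeasurable_def below_def above_def\<close>)
  finally show ?thesis .
qed

text \<open>The intersection of two boxes is a box whose sides are the intersections of the sides,
  so it is empty only if one coordinate already separates them or one box is empty.\<close>

lemma disjoint_boxes_separated:
  fixes l u l' u' :: "'a::euclidean_space"
  assumes "box l u \<inter> box l' u' = {}"
  obtains b c where "b \<in> Basis" "box l u \<subseteq> below b c" "box l' u' \<subseteq> above b c"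
    | b c where "b \<in> Basis" "box l' u' \<subseteq> below b c" "box l u \<subseteq> above b c"
    | "box l u = {}" | "box l' u' = {}"
proof -
  have "box (\<Sum>i\<in>Basis. max (l \<bullet> i) (l' \<bullet> i) *\<^sub>R i) (\<Sum>i\<in>Basis. min (u \<bullet> i) (u' \<bullet> i) *\<^sub>R i) = {}"
    using assms by (simp add: box_Int_box)
  then obtain b where b: "b \<in> Basis" "min (u \<bullet> b) (u' \<bullet> b) \<le> max (l \<bullet> b) (l' \<bullet> b)"
    by (auto simp: box_eq_empty)
  consider "u \<bullet> b \<le> l \<bullet> b" | "u' \<bullet> b \<le> l' \<bullet> b" | "u \<bullet> b \<le> l' \<bullet> b" | "u' \<bullet> b \<le> l \<bullet> b"
    using b(2) by linarith
  then show thesis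
  proof cases
    case 1
    then have "box l u = {}" using b(1) by (auto simp: box_eq_empty)
    then show thesis by (rule that(3))
  next
    case 2
    then have "box l' u' = {}" using b(1) by (auto simp: box_eq_empty)
    then show thesis by (rule that(4))
  next
    case 3
    show thesis
      by (rule that(1)[of b "u \<bullet> b"]) (use b(1) 3 in \<open>auto simp: below_def above_def mem_box\<close>, fastforce)
  next
    case 4
    show thesis
      by (rule that(2)[of b "u' \<bullet> b"]) (use b(1) 4 in \<open>auto simp: below_def above_def mem_box\<close>, fastforce)
  qed
qed

lemma box_family_separated:
  assumes P: "box_family P" and K: "K1 \<in> P" "K2 \<in> P" "K1 \<noteq> K2"
  obtains b c K K' where "b \<in> Basis" "K \<in> P" "K' \<in> P" "K \<subseteq> below b c" "K' \<subseteq> above b c"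
proof -
  obtain l u where 1: "K1 = box l u" "box l u \<noteq> {}" by (rule box_familyE[OF P K(1)])
  obtain l' u' where 2: "K2 = box l' u'" "box l' u' \<noteq> {}" by (rule box_familyE[OF P K(2)])
  have "K1 \<inter> K2 = {}" using P K by (auto simp: box_family_def disjoint_def)
  then have "box l u \<inter> box l' u' = {}" by (simp add: 1 2)
  then show thesis
    by (rule disjoint_boxes_separated) (use 1 2 K that in blast)+
qed

text \<open>The volume below level c is continuous in c and runs from 0 to the full volume, so the
  intermediate value theorem applies.\<close>

lemma box_family_level:
  fixes Q :: "'a::euclidean_space set set"
  assumes Q: "box_family Q" and b: "b \<in> Basis" and t: "0 \<le> t" "t \<le> measure lborel (\<Union>Q)"
  obtains c where "measure lborel (\<Union>Q \<inter> below b c) = t"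
proof -
  note D = box_familyD[OF Q]
  let ?f = "\<lambda>c. measure lborel (\<Union>Q \<inter> below b c)"
  have o: "open (below b c)" for c
    by (simp add: below_def open_halfspace_component_lt)
  have sum: "?f c = (\<Sum>K\<in>Q. measure lborel (K \<inter> below b c))" for c
  proof -
    have "\<Union>Q \<inter> below b c = (\<Union>K\<in>Q. K \<inter> below b c)" by auto
    moreover have "measure lborel (\<Union>K\<in>Q. K \<inter> below b c) = (\<Sum>K\<in>Q. measure lborel (K \<inter> below b c))"
    proof (rule measure_UNION'[OF D(1)])
      show "pairwise (\<lambda>i j. disjnt (i \<inter> below b c) (j \<inter> below b c)) Q"
        using Q by (auto simp: box_family_def disjoint_def pairwise_def disjnt_def)
      fix K assume "K \<in> Q"
      then obtain l u where "K = box l u" by (rule box_familyE[OF Q])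
      then show "K \<inter> below b c \<in> fmeasurable lborel"
        using emeasure_bounded_finite[of K] o
        by (intro fmeasurable_Int_fmeasurable fmeasurableI) auto
    qed
    ultimately show ?thesis by simp
  qed
  have "continuous_on UNIV (\<lambda>c. measure lborel (K \<inter> below b c))" if "K \<in> Q" for K
  proof -
    obtain l u where K: "K = box l u" "box l u \<noteq> {}" by (rule box_familyE[OF Q \<open>K \<in> Q\<close>])
    show ?thesis
      unfolding K(1) measure_box_below[OF b K(2)] by (intro continuous_intros)
  qed
  then have cont: "continuous_on UNIV ?f"
    unfolding sum by (intro continuous_on_sum)
  obtain R where R: "\<And>x. x \<in> \<Union>Q \<Longrightarrow> norm x \<le> R" using D(3) unfolding bounded_iff by blast
  have R': "\<bar>x \<bullet> b\<bar> \<le> \<bar>R\<bar>" if "x \<in> \<Union>Q" for x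
    using R[OF that] Basis_le_norm[OF b, of x] by linarith
  have lo: "\<Union>Q \<inter> below b (- \<bar>R\<bar> - 1) = {}"
    using R' by (fastforce simp: below_def)
  have hi: "\<Union>Q \<inter> below b (\<bar>R\<bar> + 1) = \<Union>Q"
    using R' by (fastforce simp: below_def)
  have "\<exists>c. - \<bar>R\<bar> - 1 \<le> c \<and> c \<le> \<bar>R\<bar> + 1 \<and> ?f c = t"
  proof (rule IVT')
    show "?f (- \<bar>R\<bar> - 1) \<le> t" unfolding lo using t(1) by simp
    show "t \<le> ?f (\<bar>R\<bar> + 1)" unfolding hi by (rule t(2))
    show "continuous_on {- \<bar>R\<bar> - 1..\<bar>R\<bar> + 1} ?f" by (rule continuous_on_subset[OF cont]) simp
  qed simp
  then show thesis using that by blast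
qed

text \<open>The Hadwiger-Ohmann argument. P is cut by a coordinate hyperplane that separates two of
  its boxes, Q by a parallel one that divides its volume in the same ratio. Corresponding parts have
  disjoint Minkowski sums, and by homogeneity the induction hypothesis contributes the shares r and
  1 - r of one and the same bound.\<close>

lemma brunn_minkowski_box_family_split:
  fixes P Q :: "'a::euclidean_space set set"
  defines "claim \<equiv> \<lambda>P Q :: 'a set set. (root DIM('a) (measure lborel (\<Union>P)) + root DIM('a) (measure lborel (\<Union>Q))) ^ DIM('a)
    \<le> measure lborel (msum (\<Union>P) (\<Union>Q))"
  assumes P: "box_family P" and Q: "box_family Q" "Q \<noteq> {}"
    and K: "K1 \<in> P" "K2 \<in> P" "K1 \<noteq> K2"
    and IH: "\<And>P' Q'. box_family P' \<Longrightarrow> box_family Q' \<Longrightarrow> P' \<noteq> {} \<Longrightarrow> Q' \<noteq> {} \<Longrightarrow>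
      card P' + card Q' < card P + card Q \<Longrightarrow> claim P' Q'"
  shows "claim P Q"
proof -
  let ?N = "DIM('a)"
  obtain b c K K' where b: "b \<in> Basis" and KK: "K \<in> P" "K' \<in> P" "K \<subseteq> below b c" "K' \<subseteq> above b c"
    by (rule box_family_separated[OF P K])
  have dis: "below b e \<inter> above b e = {}" for e by (auto simp: below_def above_def)
  define P1 where "P1 = (\<lambda>K. K \<inter> below b c) ` P - {{}}"
  define P2 where "P2 = (\<lambda>K. K \<inter> above b c) ` P - {{}}"
  note S1 = box_family_split[OF P b, of "below b c" c, folded P1_def, simplified]
  note S2 = box_family_split[OF P b, of "above b c" c, folded P2_def, simplified]
  have ne: "K \<noteq> {}" "K' \<noteq> {}" using P KK by (auto simp: box_family_def)
  have P1: "P1 \<noteq> {}" "card P1 < card P"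
  proof -
    have "K \<inter> below b c = K" using KK by auto
    moreover have "K \<inter> below b c \<in> (\<lambda>K. K \<inter> below b c) ` P" using KK(1) by blast
    ultimately have "K \<in> P1" using ne(1) by (simp add: P1_def)
    then show "P1 \<noteq> {}" by blast
    show "card P1 < card P" by (rule S1(4)[OF KK(2)]) (use KK dis in blast)
  qed
  have P2: "P2 \<noteq> {}" "card P2 < card P"
  proof -
    have "K' \<inter> above b c = K'" using KK by auto
    moreover have "K' \<inter> above b c \<in> (\<lambda>K. K \<inter> above b c) ` P" using KK(2) by blast
    ultimately have "K' \<in> P2" using ne(2) by (simp add: P2_def)
    then show "P2 \<noteq> {}" by blast
    show "card P2 < card P" by (rule S2(4)[OF KK(1)]) (use KK dis in blast)
  qed
  let ?V = "\<lambda>P :: 'a set set. measure lborel (\<Union>P)"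
  have VP: "?V P = ?V P1 + ?V P2"
    using measure_box_family_split[OF P b] by (simp add: S1(2) S2(2))
  have pos: "?V P1 > 0" "?V P2 > 0" "?V Q > 0"
    using box_familyD(6)[OF S1(1)] box_familyD(6)[OF S2(1)] box_familyD(6)[OF Q(1)] P1 P2 Q(2) by auto
  \<comment> \<open>The proportion of P below the cut. A whole box lies on either side, so it is
    strictly between 0 and 1.\<close>
  define r where "r = ?V P1 / ?V P"
  have r: "0 < r" "r < 1" using pos VP by (auto simp: r_def)
  have VP1: "?V P1 = r * ?V P" and VP2: "?V P2 = (1 - r) * ?V P"
    using pos VP by (auto simp: r_def field_simps)
  obtain e where e: "measure lborel (\<Union>Q \<inter> below b e) = r * ?V Q"
    by (rule box_family_level[OF Q(1) b, of "r * ?V Q"]) (use r pos in auto)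
  define Q1 where "Q1 = (\<lambda>K. K \<inter> below b e) ` Q - {{}}"
  define Q2 where "Q2 = (\<lambda>K. K \<inter> above b e) ` Q - {{}}"
  note T1 = box_family_split[OF Q(1) b, of "below b e" e, folded Q1_def, simplified]
  note T2 = box_family_split[OF Q(1) b, of "above b e" e, folded Q2_def, simplified]
  have VQ1: "?V Q1 = r * ?V Q" using e by (simp add: T1(2))
  have VQ2: "?V Q2 = (1 - r) * ?V Q"
    using measure_box_family_split[OF Q(1) b, of e] e by (simp add: T2(2) algebra_simps)
  have "?V Q1 > 0" "?V Q2 > 0" using VQ1 VQ2 r pos by auto
  then have Qne: "Q1 \<noteq> {}" "Q2 \<noteq> {}" by auto
  let ?W = "(root ?N (?V P) + root ?N (?V Q)) ^ ?N"
  have scale: "(root ?N (s * ?V P) + root ?N (s * ?V Q)) ^ ?N = s * ?W" if "s > 0" for s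
  proof -
    have "root ?N (s * ?V P) + root ?N (s * ?V Q) = root ?N s * (root ?N (?V P) + root ?N (?V Q))"
      by (simp add: real_root_mult distrib_left)
    then show ?thesis using that by (simp add: power_mult_distrib)
  qed
  have 1: "r * ?W \<le> measure lborel (msum (\<Union>P1) (\<Union>Q1))"
    using IH[OF S1(1) T1(1) P1(1) Qne(1)] P1(2) T1(3) scale[OF r(1)] unfolding claim_def VP1 VQ1 by simp
  have 2: "(1 - r) * ?W \<le> measure lborel (msum (\<Union>P2) (\<Union>Q2))"
    using IH[OF S2(1) T2(1) P2(1) Qne(2)] P2(2) T2(3) scale[of "1 - r"] r unfolding claim_def VP2 VQ2 by simp
  have fm: "msum (\<Union>P') (\<Union>Q') \<in> fmeasurable lborel" if "box_family P'" "box_family Q'" for P' Q' :: "'a set set"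
    using box_familyD[OF that(1)] box_familyD[OF that(2)]
    by (intro open_bounded_fmeasurable open_msum bounded_msum)
  \<comment> \<open>The levels of the two cuts add under Minkowski sums, so level c + e separates
    the two partial sums.\<close>
  have sub1: "msum (\<Union>P1) (\<Union>Q1) \<subseteq> below b (c + e)"
    unfolding S1(2) T1(2) by (auto simp: msum_def below_def inner_add_left)
  have sub2: "msum (\<Union>P2) (\<Union>Q2) \<subseteq> above b (c + e)"
    unfolding S2(2) T2(2) by (auto simp: msum_def above_def inner_add_left)
  have "?W \<le> measure lborel (msum (\<Union>P1) (\<Union>Q1)) + measure lborel (msum (\<Union>P2) (\<Union>Q2))"
    using 1 2 by (simp add: algebra_simps)
  also have "\<dots> = measure lborel (msum (\<Union>P1) (\<Union>Q1) \<union> msum (\<Union>P2) (\<Union>Q2))"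
  proof (rule measure_Union[symmetric])
    show "msum (\<Union>P1) (\<Union>Q1) \<inter> msum (\<Union>P2) (\<Union>Q2) = {}" using sub1 sub2 dis by blast
  qed (use fm[OF S1(1) T1(1)] fm[OF S2(1) T2(1)] in \<open>auto simp: fmeasurable_def\<close>)
  also have "\<dots> \<le> measure lborel (msum (\<Union>P) (\<Union>Q))"
  proof (rule measure_mono_fmeasurable)
    have "msum (\<Union>P1) (\<Union>Q1) \<subseteq> msum (\<Union>P) (\<Union>Q)" by (rule msum_mono) (auto simp: S1(2) T1(2))
    moreover have "msum (\<Union>P2) (\<Union>Q2) \<subseteq> msum (\<Union>P) (\<Union>Q)" by (rule msum_mono) (auto simp: S2(2) T2(2))
    ultimately show "msum (\<Union>P1) (\<Union>Q1) \<union> msum (\<Union>P2) (\<Union>Q2) \<subseteq> msum (\<Union>P) (\<Union>Q)" by blast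
  qed (intro sets.Un fmeasurableD fm S1(1) S2(1) T1(1) T2(1) P Q(1))+
  finally show ?thesis by (simp add: claim_def)
qed

text \<open>Induction on the total number of boxes. A cut may start from either family because the
  claim is symmetric; what remains is the case of two single boxes.\<close>

lemma brunn_minkowski_box_family:
  fixes P Q :: "'a::euclidean_space set set"
  assumes "box_family P" "box_family Q" "P \<noteq> {}" "Q \<noteq> {}"
  shows "(root DIM('a) (measure lborel (\<Union>P)) + root DIM('a) (measure lborel (\<Union>Q))) ^ DIM('a)
    \<le> measure lborel (msum (\<Union>P) (\<Union>Q))"
  using assms
proof (induction "card P + card Q" arbitrary: P Q rule: less_induct)
  case less
  consider K1 K2 where "K1 \<in> P" "K2 \<in> P" "K1 \<noteq> K2" | K1 K2 where "K1 \<in> Q" "K2 \<in> Q" "K1 \<noteq> K2"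
    | K L where "P = {K}" "Q = {L}"
    using less.prems(3,4) by (metis is_singletonI' is_singletonE)
  then show ?case
  proof cases
    case 1
    then show ?thesis
      by (rule brunn_minkowski_box_family_split[OF less.prems(1,2,4)]) (use less.hyps in blast)
  next
    case 2
    have "(root DIM('a) (measure lborel (\<Union>Q)) + root DIM('a) (measure lborel (\<Union>P))) ^ DIM('a)
        \<le> measure lborel (msum (\<Union>Q) (\<Union>P))"
      using 2
    proof (rule brunn_minkowski_box_family_split[OF less.prems(2,1,3)])
      fix P' Q' :: "'a set set"
      assume *: "box_family P'" "box_family Q'" "P' \<noteq> {}" "Q' \<noteq> {}" "card P' + card Q' < card Q + card P"
      have "(root DIM('a) (measure lborel (\<Union>Q')) + root DIM('a) (measure lborel (\<Union>P'))) ^ DIM('a)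
        \<le> measure lborel (msum (\<Union>Q') (\<Union>P'))"
        by (rule less.hyps) (use * in auto)
      then show "(root DIM('a) (measure lborel (\<Union>P')) + root DIM('a) (measure lborel (\<Union>Q'))) ^ DIM('a)
        \<le> measure lborel (msum (\<Union>P') (\<Union>Q'))"
        by (simp add: msum_commute add.commute)
    qed
    then show ?thesis by (simp add: msum_commute add.commute)
  next
    case 3
    obtain l u where 1: "K = box l u" "box l u \<noteq> {}"
      by (rule box_familyE[OF less.prems(1), of K]) (use 3 in auto)
    obtain l' u' where 2: "L = box l' u'" "box l' u' \<noteq> {}"
      by (rule box_familyE[OF less.prems(2), of L]) (use 3 in auto)
    show ?thesis using brunn_minkowski_box[OF 1(2) 2(2)] 1 2 3 by simp
  qed
qed

text \<open>Finitely many closed boxes that nearly exhaust A are refined to a division with disjoint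
  interiors; the passage to the interiors costs no measure.\<close>

lemma open_box_family_approx:
  fixes A :: "'a::euclidean_space set"
  assumes A: "open A" "bounded A" and e: "e > 0"
  obtains P where "box_family P" "\<Union>P \<subseteq> A" "measure lborel A - e < measure lborel (\<Union>P)"
proof -
  obtain D where D: "countable D" "D \<subseteq> Pow A" "\<And>X. X \<in> D \<Longrightarrow> \<exists>a b. X = cbox a b" "\<Union>D = A"
    using open_countable_Union_open_cbox[OF A(1)] by metis
  \<comment> \<open>With the empty set added the family is nonempty even if A is empty, so that
    \<open>from_nat_into\<close> enumerates it.\<close>
  define D' where "D' = insert {} D"
  have D': "countable D'" "D' \<noteq> {}" "\<Union>D' = A" "\<And>X. X \<in> D' \<Longrightarrow> \<exists>a b. X = cbox a b"
    using D by (auto simp: D'_def) (metis empty_as_interval)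
  define F where "F n = from_nat_into D' ` {..n}" for n :: nat
  have FD: "F n \<subseteq> D'" for n using from_nat_into[OF D'(2)] by (auto simp: F_def)
  have Fb: "\<Union>(F n) \<in> sets lborel" for n
    by (rule sets.finite_Union) (use FD D'(4) in \<open>fastforce simp: F_def\<close>)+
  have inc: "incseq (\<lambda>n. \<Union>(F n))" 
    unfolding incseq_def F_def by (intro allI impI Union_mono image_mono) auto
  have un: "(\<Union>n. \<Union>(F n)) = A"
  proof
    show "(\<Union>n. \<Union>(F n)) \<subseteq> A" using FD D'(3) by blast
    show "A \<subseteq> (\<Union>n. \<Union>(F n))"
    proof
      fix x assume "x \<in> A"
      then obtain X where X: "X \<in> D'" "x \<in> X" using D'(3) by blast
      then obtain n where "X = from_nat_into D' n" using from_nat_into_surj[OF D'(1)] by metis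
      then show "x \<in> (\<Union>n. \<Union>(F n))" using X by (auto simp: F_def)
    qed
  qed
  have "(\<lambda>n. measure lborel (\<Union>(F n))) \<longlonglongrightarrow> measure lborel (\<Union>n. \<Union>(F n))"
    by (rule Lim_measure_incseq) (use Fb inc un emeasure_bounded_finite[OF A(2)] in auto)
  then have "\<forall>\<^sub>F n in sequentially. measure lborel A - e < measure lborel (\<Union>(F n))"
    unfolding un using e by (intro order_tendstoD(1)) auto
  then obtain n where n: "measure lborel A - e < measure lborel (\<Union>(F n))"
    by (auto simp: eventually_sequentially)
  have "finite (F n)" by (simp add: F_def)
  moreover have "\<And>s. s \<in> F n \<Longrightarrow> \<exists>a b. s = cbox a b" using FD D'(4) by blast
  ultimately obtain p where p: "p division_of \<Union>(F n)"
    by (rule elementary_unions_intervals)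
  define P where "P = interior ` p - {{}}"
  have pf: "finite p" "\<Union>p = \<Union>(F n)" using p by (auto simp: division_of_def)
  have pb: "\<exists>a b. K = cbox a b" if "K \<in> p" for K using p that by (auto simp: division_of_def)
  have pd: "interior K \<inter> interior L = {}" if "K \<in> p" "L \<in> p" "K \<noteq> L" for K L
    using p that by (auto simp: division_of_def)
  have fam: "box_family P"
    unfolding box_family_def
  proof (intro conjI ballI)
    show "finite P" using pf(1) by (simp add: P_def)
    show "disjoint P" unfolding P_def disjoint_def using pd by blast
    fix X assume X: "X \<in> P"
    then show "X \<noteq> {}" by (simp add: P_def)
    from X obtain K where "K \<in> p" "X = interior K" by (auto simp: P_def)
    then show "\<exists>l u. X = box l u" using pb[of K] interior_cbox by metis
  qed
  have "measure lborel (\<Union>(F n)) \<le> (\<Sum>K\<in>p. measure lborel K)"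
    unfolding pf(2)[symmetric] using pf(1)
  proof (rule measure_Union_le)
    show "\<And>K. K \<in> p \<Longrightarrow> K \<in> sets lborel" using pb by fastforce
  qed
  also have "\<dots> = (\<Sum>K\<in>p. measure lborel (interior K))"
  proof (rule sum.cong[OF refl])
    fix K assume "K \<in> p"
    then obtain a b where "K = cbox a b" using pb by blast
    then show "measure lborel K = measure lborel (interior K)"
      by (simp add: interior_cbox measure_lborel_cbox_eq measure_lborel_box_eq)
  qed
  also have "\<dots> = measure lborel (\<Union>K\<in>p. interior K)"
  proof (rule measure_UNION'[symmetric, OF pf(1)])
    show "pairwise (\<lambda>K L. disjnt (interior K) (interior L)) p"
      using pd by (auto simp: pairwise_def disjnt_def)
    show "interior K \<in> fmeasurable lborel" if "K \<in> p" for K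
      using pb[OF that] by (intro open_bounded_fmeasurable) (auto simp: interior_cbox bounded_box)
  qed
  also have "(\<Union>K\<in>p. interior K) = \<Union>P" by (auto simp: P_def)
  finally have "measure lborel A - e < measure lborel (\<Union>P)" using n by linarith
  moreover have "\<Union>P \<subseteq> A"
  proof -
    have "\<Union>P \<subseteq> \<Union>p" using interior_subset by (auto simp: P_def)
    then show ?thesis using pf(2) un by blast
  qed
  ultimately show thesis using fam that by blast
qed

theorem brunn_minkowski_open:
  fixes A B :: "'a::euclidean_space set"
  assumes A: "open A" "bounded A" "A \<noteq> {}" and B: "open B" "bounded B" "B \<noteq> {}"
  shows "root DIM('a) (measure lborel A) + root DIM('a) (measure lborel B) \<le> root DIM('a) (measure lborel (msum A B))"
proof -
  let ?N = "DIM('a)"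
  have pos: "measure lborel X > 0" if X: "open X" "bounded X" "X \<noteq> {}" for X :: "'a set"
  proof -
    obtain x where "x \<in> X" using X(3) by auto
    then obtain a b where ab: "x \<in> box a b" "box a b \<subseteq> X"
      using open_contains_box X(1) by metis
    then have "0 < measure lborel (box a b)" using measure_box_pos_side(3)[of a b] by auto
    also have "\<dots> \<le> measure lborel X"
      by (rule measure_mono_fmeasurable[OF ab(2)]) (use open_bounded_fmeasurable[OF X(1,2)] in auto)
    finally show ?thesis .
  qed
  \<comment> \<open>The error is a fraction of the measure of X, at most one half, which leaves a
    positive remainder and hence a nonempty family.\<close>
  have ap: "\<exists>P. box_family P \<and> \<Union>P \<subseteq> X \<and> measure lborel X - measure lborel X / (real n + 2) < measure lborel (\<Union>P) \<and> P \<noteq> {}"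
    if X: "open X" "bounded X" "X \<noteq> {}" for X :: "'a set" and n :: nat
  proof -
    have "measure lborel X / (real n + 2) > 0" using pos[OF X] by simp
    then obtain P where P: "box_family P" "\<Union>P \<subseteq> X" "measure lborel X - measure lborel X / (real n + 2) < measure lborel (\<Union>P)"
      using open_box_family_approx[OF X(1,2)] by metis
    have "measure lborel X / (real n + 2) \<le> measure lborel X"
      using pos[OF X] by (simp add: divide_le_eq)
    then have "measure lborel (\<Union>P) > 0" using P(3) by linarith
    then have "P \<noteq> {}" by auto
    with P show ?thesis by blast
  qed
  obtain P where P: "\<And>n. box_family (P n)" "\<And>n. \<Union>(P n) \<subseteq> A" "\<And>n. P n \<noteq> {}"
    "\<And>n. measure lborel A - measure lborel A / (real n + 2) < measure lborel (\<Union>(P n))"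
    using ap[OF A] by metis
  obtain Q where Q: "\<And>n. box_family (Q n)" "\<And>n. \<Union>(Q n) \<subseteq> B" "\<And>n. Q n \<noteq> {}"
    "\<And>n. measure lborel B - measure lborel B / (real n + 2) < measure lborel (\<Union>(Q n))"
    using ap[OF B] by metis
  have le: "root ?N (measure lborel A - measure lborel A / (real n + 2)) + root ?N (measure lborel B - measure lborel B / (real n + 2))
      \<le> root ?N (measure lborel (msum A B))" for n
  proof -
    let ?s = "root ?N (measure lborel (\<Union>(P n))) + root ?N (measure lborel (\<Union>(Q n)))"
    have s0: "?s \<ge> 0" by (intro add_nonneg_nonneg real_root_ge_zero measure_nonneg)
    have "?s ^ ?N \<le> measure lborel (msum (\<Union>(P n)) (\<Union>(Q n)))"
      by (rule brunn_minkowski_box_family) (simp_all add: P Q)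
    also have "\<dots> \<le> measure lborel (msum A B)"
    proof (rule measure_mono_fmeasurable)
      show "msum (\<Union>(P n)) (\<Union>(Q n)) \<subseteq> msum A B" by (rule msum_mono[OF P(2) Q(2)])
      show "msum (\<Union>(P n)) (\<Union>(Q n)) \<in> sets lborel"
        using open_msum[OF box_familyD(2)[OF P(1)]] by simp
      show "msum A B \<in> fmeasurable lborel"
        by (intro open_bounded_fmeasurable open_msum bounded_msum A B)
    qed
    finally have "root ?N (?s ^ ?N) \<le> root ?N (measure lborel (msum A B))"
      by (intro real_root_le_mono) auto
    then have "?s \<le> root ?N (measure lborel (msum A B))"
      using s0 by (simp add: real_root_power_cancel)
    moreover have "root ?N (measure lborel A - measure lborel A / (real n + 2)) \<le> root ?N (measure lborel (\<Union>(P n)))"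
      "root ?N (measure lborel B - measure lborel B / (real n + 2)) \<le> root ?N (measure lborel (\<Union>(Q n)))"
      using P(4)[of n] Q(4)[of n] by (auto intro!: real_root_le_mono)
    ultimately show ?thesis by linarith
  qed
  have lim: "(\<lambda>n. root ?N (x - x / (real n + 2))) \<longlonglongrightarrow> root ?N x" for x
  proof -
    have "(\<lambda>n. x / real (n + 2)) \<longlonglongrightarrow> 0"
      by (rule LIMSEQ_ignore_initial_segment[OF lim_const_over_n])
    then have "(\<lambda>n. x - x / real (n + 2)) \<longlonglongrightarrow> x - 0"
      by (intro tendsto_diff tendsto_const)
    then show ?thesis by (intro tendsto_real_root) (simp add: add.commute)
  qed
  show ?thesis
    by (rule LIMSEQ_le_const2[OF tendsto_add[OF lim lim]]) (use le in blast)
qed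

section \<open>Hyperbolic space as a graph\<close>

definition lift :: "real ^ ('n::finite option) \<Rightarrow> 'n minkowski" where
  "lift x = (sqrt (1 + x \<bullet> x), x)"

definition dlift :: "real ^ ('n::finite option) \<Rightarrow> real ^ ('n option) \<Rightarrow> 'n minkowski" where
  "dlift x u = ((x \<bullet> u) / fst (lift x), u)"

lemma snd_lift [simp]: "snd (lift x) = x"
  and snd_dlift [simp]: "snd (dlift x u) = u"
  by (simp_all add: lift_def dlift_def)

lemma fst_lift_pos: "fst (lift x) > 0"
  by (simp add: lift_def add_pos_nonneg)

lemma fst_lift_sq: "fst (lift x) * fst (lift x) = 1 + x \<bullet> x"
  by (simp add: lift_def)

lemma lift_in_hyp_space: "lift x \<in> hyp_space"
  using fst_lift_pos[of x] fst_lift_sq[of x] by (simp add: hyp_space_def lorentz_def)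

lemma hyp_spaceD:
  assumes "p \<in> hyp_space"
  shows "fst p > 0" "fst p * fst p = 1 + snd p \<bullet> snd p" "lorentz p p = -1"
  using assms by (auto simp: hyp_space_def lorentz_def)

lemma lift_snd:
  assumes "p \<in> hyp_space"
  shows "lift (snd p) = p"
proof -
  have "sqrt (1 + snd p \<bullet> snd p) = fst p"
    using hyp_spaceD[OF assms] by (metis less_imp_le real_sqrt_mult_self real_sqrt_unique power2_eq_square)
  then show ?thesis by (simp add: lift_def prod_eq_iff)
qed

lemma range_lift: "range lift = hyp_space"
  using lift_in_hyp_space lift_snd by (metis (no_types, lifting) image_subset_iff rangeI subsetI subset_antisym)

lemma has_derivative_lift: "(lift has_derivative dlift x) (at x)"
proof -
  have p: "1 + x \<bullet> x > 0" by (simp add: add_pos_nonneg)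
  have "((\<lambda>x. 1 + x \<bullet> x) has_derivative (\<lambda>u. x \<bullet> u + u \<bullet> x)) (at x)"
    by (auto intro!: derivative_eq_intros)
  from has_derivative_real_sqrt[OF p this]
  have "((\<lambda>x. sqrt (1 + x \<bullet> x)) has_derivative (\<lambda>u. (x \<bullet> u) / fst (lift x))) (at x)"
    by (rule has_derivative_eq_rhs) (simp add: fun_eq_iff lift_def inner_commute field_simps)
  then show ?thesis
    unfolding lift_def[abs_def] dlift_def[abs_def] lift_def by (intro has_derivative_Pair has_derivative_ident) simp
qed

lemma frechet_derivative_lift: "frechet_derivative lift (at x) = dlift x"
  by (rule frechet_derivative_at[OF has_derivative_lift, symmetric])

lemma Ck_on_lift: "open U \<Longrightarrow> Ck_on k U lift"
  unfolding lift_def[abs_def]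
  by (intro Ck_on_Pair Ck_on_sqrt Ck_on_add Ck_on_const Ck_on_inner Ck_on_bounded_linear bounded_linear_ident)
    (auto simp: add_pos_nonneg)

lemma smooth_on_lift: "open U \<Longrightarrow> smooth_on U lift"
  by (simp add: smooth_on_def Ck_on_lift)

lemma continuous_on_lift: "continuous_on S lift"
  by (intro continuous_at_imp_continuous_on ballI has_derivative_continuous[OF has_derivative_lift])

lemma homeomorphism_lift: "homeomorphism UNIV hyp_space lift snd"
  unfolding homeomorphism_def
  using lift_snd by (auto simp: range_lift continuous_on_lift intro!: continuous_intros) (metis lift_in_hyp_space image_eqI snd_lift)

lemma local_parametrization_lift: "local_parametrization (hyp_space :: 'n::finite minkowski set) UNIV lift"
  unfolding local_parametrization_def
proof (intro conjI ballI)
  show "smooth_on UNIV lift" by (simp add: smooth_on_lift)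
  show "openin (top_of_set hyp_space) (range lift)" by (simp add: range_lift)
  show "\<exists>\<psi>. homeomorphism UNIV (range lift) lift \<psi>"
    using homeomorphism_lift by (auto simp: range_lift)
  show "inj (frechet_derivative lift (at x))" for x :: "real ^ ('n option)"
    unfolding frechet_derivative_lift by (rule injI) (metis snd_dlift)
qed simp

lemma lorentz_dlift: "lorentz (dlift x u) (dlift x w) = u \<bullet> w - (x \<bullet> u) * (x \<bullet> w) / (1 + x \<bullet> x)"
  by (simp add: lorentz_def dlift_def fst_lift_sq)

text \<open>In these coordinates the metric is the identity minus x x^T / (1 + |x|^2), a rank one
  change whose determinant is 1 / (1 + |x|^2).\<close>

lemma sqrt_det_metric_lift: "sqrt (det (metric_matrix lift x)) = 1 / fst (lift x)"
proof -
  have "metric_matrix lift x = (\<chi> i j. (if i = j then 1 else 0) + (- 1 / (1 + x \<bullet> x)) * x $ i * x $ j)"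
    by (simp add: metric_matrix_def frechet_derivative_lift lorentz_dlift vec_eq_iff inner_axis inner_axis_axis)
      (simp add: axis_def)
  then have "det (metric_matrix lift x) = 1 + (- 1 / (1 + x \<bullet> x)) * (x \<bullet> x)"
    by (simp only: det_identity_plus_rank_one)
  also have "\<dots> = 1 / (1 + x \<bullet> x)"
  proof -
    have "1 + x \<bullet> x \<noteq> 0" using inner_ge_zero[of x] by linarith
    then show ?thesis by (simp add: field_simps)
  qed
  finally show ?thesis by (simp add: lift_def real_sqrt_divide)
qed

section \<open>The volume weighted by cosh r\<close>

lemma hyp_space_borel: "(hyp_space :: 'n::finite minkowski set) \<in> sets borel"
proof -
  have "closed {X :: 'n minkowski. lorentz X X = - 1}"
    by (intro closed_Collect_eq bounded_bilinear.continuous_on[OF lorentz_bilinear] continuous_intros)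
  moreover have "open {X :: 'n minkowski. fst X > 0}"
    by (intro open_Collect_less continuous_intros)
  ultimately have "{X :: 'n minkowski. lorentz X X = - 1} \<inter> {X. fst X > 0} \<in> sets borel"
    by (intro sets.Int borel_closed borel_open)
  then show ?thesis by (simp add: hyp_space_def Collect_conj_eq)
qed

text \<open>The distance to the origin is arcosh of the time coordinate, and that coordinate is at
  least 1 on the hyperboloid.\<close>

lemma cosh_hyp_radius:
  assumes "p \<in> hyp_space"
  shows "cosh (hyp_radius p) = fst p"
proof -
  have "1 \<le> fst p * fst p" using hyp_spaceD(2)[OF assms] inner_ge_zero[of "snd p"] by linarith
  then have "1 \<le> fst p"
    using hyp_spaceD(1)[OF assms] by (metis mult_less_cancel_left_pos less_le_trans mult.right_neutral not_le order.strict_trans)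
  then show ?thesis
    by (simp add: hyp_radius_def hyp_dist_def hyp_origin_def lorentz_def)
qed

text \<open>The graph map is a single global chart, and its density 1 / \<open>fst (lift x)\<close>
  cancels the weight \<open>fst p\<close>.\<close>

lemma sets_hyp_volume: "sets (hyp_volume :: 'n::finite minkowski measure) = sets borel"
  and nn_integral_hyp_volume: "A \<in> sets borel \<Longrightarrow>
    (\<integral>\<^sup>+p\<in>lift ` A. ennreal (fst p) \<partial>(hyp_volume :: 'n minkowski measure)) = emeasure lborel A"
proof -
  have cov: "hyp_space = (\<Union>k<Suc 0. lift ` (UNIV :: (real ^ ('n option)) set))"
    by (simp add: range_lift lessThan_Suc)
  note C = riemannian_measure_characterization[where M = hyp_space and m = "Suc 0" and U = "\<lambda>_. UNIV"
      and \<phi> = "\<lambda>_. lift :: real ^ ('n option) \<Rightarrow> 'n minkowski",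
      OF order_refl hyp_space_borel local_parametrization_lift cov, folded hyp_volume_def]
  show s: "sets (hyp_volume :: 'n minkowski measure) = sets borel" by (rule C(1))
  assume A: "A \<in> sets borel"
  have mf: "(\<lambda>p :: 'n minkowski. ennreal (fst p)) \<in> borel_measurable borel"
    by (intro measurable_compose[OF _ measurable_ennreal] borel_measurable_continuous_onI continuous_intros)
  have "(\<integral>\<^sup>+p\<in>lift ` A. ennreal (fst p) \<partial>(hyp_volume :: 'n minkowski measure))
    = (\<integral>\<^sup>+x\<in>A. ennreal (fst (lift x)) * ennreal (sqrt (det (metric_matrix lift x))) \<partial>lborel)"
    by (rule nn_integral_chart[OF s C(3)[OF local_parametrization_lift] local_parametrization_lift hyp_space_borel A])
      (simp_all add: mf)
  also have "\<dots> = (\<integral>\<^sup>+x. indicator A x \<partial>lborel)"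
  proof (rule nn_integral_cong)
    fix x :: "real ^ ('n option)"
    have "ennreal (fst (lift x)) * ennreal (1 / fst (lift x)) = 1"
      using fst_lift_pos[of x] by (simp add: ennreal_mult'[symmetric])
    then show "ennreal (fst (lift x)) * ennreal (sqrt (det (metric_matrix lift x))) * indicator A x = indicator A x"
      by (simp add: sqrt_det_metric_lift)
  qed
  finally show "(\<integral>\<^sup>+p\<in>lift ` A. ennreal (fst p) \<partial>(hyp_volume :: 'n minkowski measure)) = emeasure lborel A"
    using A by simp
qed

lemma lift_image_snd:
  assumes "\<Omega> \<subseteq> hyp_space"
  shows "lift ` snd ` \<Omega> = \<Omega>"
  using assms lift_snd by (force simp: image_image subset_iff)

lemma weighted_volume_eq:
  fixes \<Omega> :: "'n::finite minkowski set"
  assumes "\<Omega> \<subseteq> hyp_space" "compact \<Omega>"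
  shows "weighted_volume \<Omega> = measure lborel (snd ` \<Omega>)"
proof -
  let ?A = "snd ` \<Omega>"
  have "compact ?A" using assms(2) by (intro compact_continuous_image continuous_intros)
  then have A: "?A \<in> sets borel" by (simp add: borel_compact)
  have O: "\<Omega> \<in> sets borel" using assms(2) by (simp add: borel_compact)
  have m: "(\<lambda>p. indicator \<Omega> p * fst p) \<in> borel_measurable (hyp_volume :: 'n minkowski measure)"
    unfolding measurable_cong_sets[OF sets_hyp_volume refl]
    by (intro borel_measurable_times borel_measurable_indicator O borel_measurable_continuous_onI continuous_intros)
  have "weighted_volume \<Omega> = (\<integral>p. indicator \<Omega> p * fst p \<partial>hyp_volume)"
    unfolding weighted_volume_def set_lebesgue_integral_def
    by (rule Bochner_Integration.integral_cong[OF refl]) (use assms(1) cosh_hyp_radius in \<open>auto simp: indicator_def\<close>)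
  also have "\<dots> = enn2real (\<integral>\<^sup>+p. ennreal (indicator \<Omega> p * fst p) \<partial>hyp_volume)"
    by (rule integral_eq_nn_integral[OF m]) (use assms(1) hyp_spaceD(1) in \<open>auto simp: indicator_def intro!: AE_I2 less_imp_le\<close>)
  also have "(\<integral>\<^sup>+p. ennreal (indicator \<Omega> p * fst p) \<partial>hyp_volume) = (\<integral>\<^sup>+p\<in>lift ` ?A. ennreal (fst p) \<partial>hyp_volume)"
    unfolding lift_image_snd[OF assms(1)] by (rule nn_integral_cong) (auto simp: indicator_def)
  also have "\<dots> = emeasure lborel ?A" by (rule nn_integral_hyp_volume[OF A])
  finally show ?thesis by (simp add: measure_def)
qed

lemma lift_tangent:
  "v \<in> hyp_tangent (lift x) \<longleftrightarrow> v = dlift x (snd v)"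
proof -
  have "v \<in> hyp_tangent (lift x) \<longleftrightarrow> x \<bullet> snd v = fst (lift x) * fst v"
    by (simp add: hyp_tangent_def lorentz_def)
  also have "\<dots> \<longleftrightarrow> fst v = (x \<bullet> snd v) / fst (lift x)"
    using fst_lift_pos[of x] by (auto simp: field_simps)
  finally show ?thesis by (simp add: dlift_def prod_eq_iff)
qed

lemma dlift_tangent: "dlift x u \<in> hyp_tangent (lift x)"
  by (simp add: lift_tangent)

lemma tangent_eq_dlift: "p \<in> hyp_space \<Longrightarrow> v \<in> hyp_tangent p \<Longrightarrow> v = dlift (snd p) (snd v)"
  using lift_tangent[of v "snd p"] by (simp add: lift_snd)

text \<open>The Euclidean normal of the projected boundary, not normalised.\<close>

definition nvec :: "'n::finite minkowski \<Rightarrow> 'n minkowski \<Rightarrow> real ^ ('n option)" where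
  "nvec p \<nu> = fst p *\<^sub>R snd \<nu> - fst \<nu> *\<^sub>R snd p"

text \<open>By the last identity \<open>nvec p \<nu>\<close> is orthogonal to the projections of the
  tangent vectors orthogonal to \<nu>. By the first, motion along \<open>snd \<nu>\<close> leaves
  the supporting hyperplane at the rate \<open>fst p\<close>. The bound on \<open>fst \<nu>\<close>,
  from Cauchy-Schwarz, is what principal curvatures greater than 1 will be compared with.\<close>

lemma nvec_identities:
  assumes p: "p \<in> hyp_space" and n: "\<nu> \<in> hyp_tangent p" "lorentz \<nu> \<nu> = 1"
  shows "snd \<nu> \<bullet> nvec p \<nu> = fst p" "snd p \<bullet> nvec p \<nu> = fst \<nu>" "\<bar>fst \<nu>\<bar> < fst p"
    "v \<in> hyp_tangent p \<Longrightarrow> fst p * lorentz \<nu> v = nvec p \<nu> \<bullet> snd v"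
proof -
  note P = hyp_spaceD[OF p]
  have t: "snd p \<bullet> snd \<nu> = fst p * fst \<nu>" using n(1) by (simp add: hyp_tangent_def lorentz_def)
  have u: "snd \<nu> \<bullet> snd \<nu> = 1 + fst \<nu> * fst \<nu>" using n(2) by (simp add: lorentz_def)
  show "snd \<nu> \<bullet> nvec p \<nu> = fst p"
    using t u by (simp add: nvec_def inner_diff_right inner_commute algebra_simps)
  have "snd p \<bullet> nvec p \<nu> = fst p * (fst p * fst \<nu>) - fst \<nu> * (snd p \<bullet> snd p)"
    by (simp add: nvec_def inner_diff_right t)
  also have "\<dots> = fst \<nu> * (fst p * fst p - snd p \<bullet> snd p)" by (simp add: algebra_simps)
  finally show "snd p \<bullet> nvec p \<nu> = fst \<nu>" by (simp add: P(2))
  have "(snd p \<bullet> snd \<nu>)\<^sup>2 \<le> (snd p \<bullet> snd p) * (snd \<nu> \<bullet> snd \<nu>)" by (rule Cauchy_Schwarz_ineq)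
  then have "(fst p * fst p) * (fst \<nu> * fst \<nu>) \<le> (fst p * fst p - 1) * (1 + fst \<nu> * fst \<nu>)"
    using P(2) by (simp add: t u power2_eq_square mult_ac)
  then have "(fst \<nu>)\<^sup>2 < (fst p)\<^sup>2" by (simp add: power2_eq_square algebra_simps)
  then show "\<bar>fst \<nu>\<bar> < fst p" using P(1) by (metis abs_of_pos power2_abs power2_less_imp_less less_imp_le)
  assume "v \<in> hyp_tangent p"
  then have "snd p \<bullet> snd v = fst p * fst v" by (simp add: hyp_tangent_def lorentz_def)
  then show "fst p * lorentz \<nu> v = nvec p \<nu> \<bullet> snd v"
    by (simp add: nvec_def lorentz_def inner_diff_left algebra_simps)
qed

section \<open>Gradients of defining functions\<close>

text \<open>The vector that represents a linear functional by the Lorentz form; the time component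
  changes sign because the form is negative there.\<close>

definition lgrad :: "('n::finite minkowski \<Rightarrow> real) \<Rightarrow> 'n minkowski" where
  "lgrad D = ((-1) * D (1, 0), \<Sum>b\<in>Basis. D (0, b) *\<^sub>R b)"

lemma lorentz_lgrad:
  assumes "linear D"
  shows "lorentz (lgrad D) v = D v"
proof -
  have 1: "D v = D (fst v, 0) + D (0, snd v)"
    using linear_add[OF assms, of "(fst v, 0)" "(0, snd v)"] by simp
  have 2: "D (fst v, 0) = fst v * D (1, 0)"
    using linear_scale[OF assms, of "fst v" "(1, 0)"] by simp
  have "(0, snd v) = (\<Sum>b\<in>Basis. (snd v \<bullet> b) *\<^sub>R (0 :: real, b))"
    by (simp add: prod_eq_iff fst_sum snd_sum euclidean_representation)
  then have "D (0, snd v) = D (\<Sum>b\<in>Basis. (snd v \<bullet> b) *\<^sub>R (0, b))" by simp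
  also have "\<dots> = (\<Sum>b\<in>Basis. (snd v \<bullet> b) * D (0, b))"
    by (simp only: linear_sum[OF assms] linear_scale[OF assms] real_scaleR_def)
  finally have 3: "D (0, snd v) = (\<Sum>b\<in>Basis. (snd v \<bullet> b) * D (0, b))" .
  show ?thesis
    unfolding 1 2 3 by (simp add: lorentz_def lgrad_def inner_sum_right inner_commute mult.commute)
qed

definition rgrad :: "('n::finite minkowski \<Rightarrow> real) \<Rightarrow> 'n minkowski \<Rightarrow> 'n minkowski" where
  "rgrad \<rho> q = lgrad (frechet_derivative \<rho> (at q))"

text \<open>On hyperbolic space this is the tangential projection of the Minkowski gradient, with a
  plus sign since \<open>lorentz q q = - 1\<close>. The same formula on an open set of Minkowski
  space can be differentiated in all directions.\<close>

definition ngrad :: "('n::finite minkowski \<Rightarrow> real) \<Rightarrow> 'n minkowski \<Rightarrow> 'n minkowski" where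
  "ngrad \<rho> q = rgrad \<rho> q + lorentz q (rgrad \<rho> q) *\<^sub>R q"

definition inv_norm :: "('n::finite minkowski \<Rightarrow> real) \<Rightarrow> 'n minkowski \<Rightarrow> real" where
  "inv_norm \<rho> q = inverse (sqrt (lorentz (ngrad \<rho> q) (ngrad \<rho> q)))"

definition unormal :: "('n::finite minkowski \<Rightarrow> real) \<Rightarrow> 'n minkowski \<Rightarrow> 'n minkowski" where
  "unormal \<rho> q = inv_norm \<rho> q *\<^sub>R ngrad \<rho> q"

lemma Ck_on_rgrad:
  assumes "open U" "smooth_on U \<rho>"
  shows "Ck_on k U (rgrad \<rho>)"
proof -
  have "Ck_on k U (\<lambda>q. frechet_derivative \<rho> (at q) v)" for v
    using smooth_on_derivative[OF assms(2)] by (simp add: smooth_on_def)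
  then show ?thesis
    unfolding rgrad_def[abs_def] lgrad_def
    by (intro Ck_on_Pair Ck_on_mult Ck_on_sum Ck_on_scaleR Ck_on_const assms(1))
qed

lemma Ck_on_ngrad:
  assumes "open U" "smooth_on U \<rho>"
  shows "Ck_on k U (ngrad \<rho>)"
  unfolding ngrad_def[abs_def]
  by (intro Ck_on_add Ck_on_scaleR Ck_on_bilinear[OF lorentz_bilinear] Ck_on_rgrad assms
      Ck_on_bounded_linear bounded_linear_ident)

lemma Ck_on_inv_norm:
  assumes "open U" "smooth_on U \<rho>" "\<And>q. q \<in> U \<Longrightarrow> lorentz (ngrad \<rho> q) (ngrad \<rho> q) > 0"
  shows "Ck_on k U (inv_norm \<rho>)"
  unfolding inv_norm_def[abs_def]
proof (intro Ck_on_inverse Ck_on_sqrt Ck_on_bilinear[OF lorentz_bilinear] Ck_on_ngrad assms)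
  show "sqrt (lorentz (ngrad \<rho> q) (ngrad \<rho> q)) \<noteq> 0" if "q \<in> U" for q
    using assms(3)[OF that] by simp
qed

lemma Ck_on_unormal:
  assumes "open U" "smooth_on U \<rho>" "\<And>q. q \<in> U \<Longrightarrow> lorentz (ngrad \<rho> q) (ngrad \<rho> q) > 0"
  shows "Ck_on k U (unormal \<rho>)"
  unfolding unormal_def[abs_def]
  by (intro Ck_on_scaleR Ck_on_inv_norm Ck_on_ngrad assms)

lemma ngrad_tangent:
  assumes "q \<in> hyp_space"
  shows "ngrad \<rho> q \<in> hyp_tangent q"
  using hyp_spaceD(3)[OF assms] by (simp add: hyp_tangent_def ngrad_def lorentz_simps)

lemma lorentz_ngrad:
  assumes "linear (frechet_derivative \<rho> (at q))" "v \<in> hyp_tangent q"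
  shows "frechet_derivative \<rho> (at q) v = lorentz (ngrad \<rho> q) v"
  using assms(2) lorentz_lgrad[OF assms(1), of v]
  by (simp add: hyp_tangent_def ngrad_def rgrad_def lorentz_simps)

lemma defining_functionD:
  assumes "defining_function \<Omega> p U \<rho>" and "q \<in> U"
  shows "(\<rho> has_derivative frechet_derivative \<rho> (at q)) (at q)" "linear (frechet_derivative \<rho> (at q))"
proof -
  show "(\<rho> has_derivative frechet_derivative \<rho> (at q)) (at q)"
    using smooth_on_has_derivative assms by (auto simp: defining_function_def)
  then show "linear (frechet_derivative \<rho> (at q))" by (rule has_derivative_linear)
qed

lemma ngrad_spacelike:
  assumes "defining_function \<Omega> p U \<rho>" "p \<in> hyp_space"
  shows "lorentz (ngrad \<rho> p) (ngrad \<rho> p) > 0"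
proof (rule lorentz_tangent_pos[OF assms(2)])
  have p: "p \<in> U" using assms(1) by (simp add: defining_function_def)
  show "lorentz p (ngrad \<rho> p) = 0" using ngrad_tangent[OF assms(2)] by (simp add: hyp_tangent_def)
  obtain v where v: "v \<in> hyp_tangent p" "frechet_derivative \<rho> (at p) v \<noteq> 0"
    using assms(1) by (auto simp: defining_function_def)
  then show "ngrad \<rho> p \<noteq> 0"
    using lorentz_ngrad[OF defining_functionD(2)[OF assms(1) p] v(1)] by (auto simp: lorentz_simps)
qed

text \<open>At q the hyperbolic gradient itself is a tangent direction in which the derivative does
  not vanish.\<close>

lemma defining_function_transfer:
  assumes "defining_function \<Omega> p U \<rho>" "q \<in> U" "q \<in> hyp_space" "lorentz (ngrad \<rho> q) (ngrad \<rho> q) > 0"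
  shows "defining_function \<Omega> q U \<rho>"
proof -
  have "frechet_derivative \<rho> (at q) (ngrad \<rho> q) \<noteq> 0"
    using lorentz_ngrad[OF defining_functionD(2)[OF assms(1,2)] ngrad_tangent[OF assms(3)]] assms(4) by simp
  then show ?thesis
    using assms(1,2) ngrad_tangent[OF assms(3), of \<rho>] by (auto simp: defining_function_def)
qed

lemma spacelike_neighbourhood:
  assumes "defining_function \<Omega> p U \<rho>" "p \<in> hyp_space"
  obtains V where "open V" "p \<in> V" "V \<subseteq> U" "\<And>q. q \<in> V \<Longrightarrow> lorentz (ngrad \<rho> q) (ngrad \<rho> q) > 0"
proof -
  have U: "open U" "smooth_on U \<rho>" "p \<in> U" using assms(1) by (auto simp: defining_function_def)
  let ?V = "U \<inter> (\<lambda>q. lorentz (ngrad \<rho> q) (ngrad \<rho> q)) -` {0<..}"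
  have "continuous_on U (ngrad \<rho>)" using Ck_on_ngrad[OF U(1,2), of 0] by simp
  then have "continuous_on U (\<lambda>q. lorentz (ngrad \<rho> q) (ngrad \<rho> q))"
    by (intro bounded_bilinear.continuous_on[OF lorentz_bilinear])
  then have "open ?V" by (rule continuous_open_preimage[OF _ U(1) open_greaterThan])
  moreover have "p \<in> ?V" using U(3) ngrad_spacelike[OF assms] by simp
  ultimately show thesis using that by blast
qed

text \<open>Paired with a fixed w the gradient is a directional derivative of \<rho>, so its
  derivative is a second derivative. The symmetry of the shape operator comes from here.\<close>

lemma lorentz_derivative_rgrad:
  assumes U: "open U" "smooth_on U \<rho>" "p \<in> U"
  shows "lorentz (frechet_derivative (rgrad \<rho>) (at p) u) w
    = frechet_derivative (\<lambda>q. frechet_derivative \<rho> (at q) w) (at p) u"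
proof -
  let ?G = "frechet_derivative (rgrad \<rho>) (at p)"
  have G: "(rgrad \<rho> has_derivative ?G) (at p)"
    by (rule Ck_on_SucE(1)[OF Ck_on_rgrad[OF U(1,2), of "Suc 0"] U(3)])
  have "((\<lambda>q. lorentz (rgrad \<rho> q) w) has_derivative (\<lambda>u. lorentz (?G u) w)) (at p)"
    using bounded_linear.has_derivative[OF bounded_bilinear.bounded_linear_left[OF lorentz_bilinear] G] .
  then have "((\<lambda>q. frechet_derivative \<rho> (at q) w) has_derivative (\<lambda>u. lorentz (?G u) w)) (at p)"
  proof (rule has_derivative_transform_within_open[OF _ U(1,3)])
    show "lorentz (rgrad \<rho> q) w = frechet_derivative \<rho> (at q) w" if "q \<in> U" for q
      unfolding rgrad_def
      by (rule lorentz_lgrad[OF has_derivative_linear[OF smooth_on_has_derivative[OF U(2) that]]])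
  qed
  then have "frechet_derivative (\<lambda>q. frechet_derivative \<rho> (at q) w) (at p) = (\<lambda>u. lorentz (?G u) w)"
    by (rule frechet_derivative_at[symmetric])
  then show ?thesis by simp
qed

text \<open>The first two summands of the derivative of the normalised gradient are normal, hence the
  shape operator is the Hessian up to a multiple of the metric.\<close>

lemma shape_hessian:
  assumes U: "open U" "smooth_on U \<rho>" "p \<in> U"
    and pos: "\<And>q. q \<in> U \<Longrightarrow> lorentz (ngrad \<rho> q) (ngrad \<rho> q) > 0"
    and w: "lorentz p w = 0" "lorentz (ngrad \<rho> p) w = 0"
  shows "lorentz (frechet_derivative (unormal \<rho>) (at p) u) w
    = inv_norm \<rho> p * (frechet_derivative (\<lambda>q. frechet_derivative \<rho> (at q) w) (at p) u
        + lorentz p (rgrad \<rho> p) * lorentz u w)"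
proof -
  have G: "(rgrad \<rho> has_derivative frechet_derivative (rgrad \<rho>) (at p)) (at p)"
    by (rule Ck_on_SucE(1)[OF Ck_on_rgrad[OF U(1,2), of "Suc 0"] U(3)])
  have I: "(inv_norm \<rho> has_derivative frechet_derivative (inv_norm \<rho>) (at p)) (at p)"
    by (rule Ck_on_SucE(1)[OF Ck_on_inv_norm[OF U(1,2) pos, of "Suc 0"] U(3)])
  let ?G = "frechet_derivative (rgrad \<rho>) (at p)"
  let ?N = "\<lambda>u. ?G u + (lorentz p (rgrad \<rho> p) *\<^sub>R u + (lorentz p (?G u) + lorentz u (rgrad \<rho> p)) *\<^sub>R p)"
  have N: "(ngrad \<rho> has_derivative ?N) (at p)"
    unfolding ngrad_def[abs_def]
    by (intro has_derivative_add G has_derivative_scaleR has_derivative_ident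
        bounded_bilinear.FDERIV[OF lorentz_bilinear])
  have "(unormal \<rho> has_derivative (\<lambda>u. inv_norm \<rho> p *\<^sub>R ?N u + frechet_derivative (inv_norm \<rho>) (at p) u *\<^sub>R ngrad \<rho> p)) (at p)"
    unfolding unormal_def[abs_def] by (rule has_derivative_scaleR[OF I N])
  then have "frechet_derivative (unormal \<rho>) (at p)
      = (\<lambda>u. inv_norm \<rho> p *\<^sub>R ?N u + frechet_derivative (inv_norm \<rho>) (at p) u *\<^sub>R ngrad \<rho> p)"
    by (rule frechet_derivative_at[symmetric])
  then have 1: "lorentz (frechet_derivative (unormal \<rho>) (at p) u) w
      = inv_norm \<rho> p * (lorentz (?G u) w + lorentz p (rgrad \<rho> p) * lorentz u w)"
    by (simp add: lorentz_simps w)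
  show ?thesis unfolding 1 lorentz_derivative_rgrad[OF U] ..
qed

section \<open>Orthonormal eigenbases\<close>

text \<open>Stationarity at a maximum, without differentiation. At t = b / h the expression times
  h^2 equals b^2 * (2 * h + g), and h = \<bar>g\<bar> + 1 makes the last factor positive.\<close>

lemma quadratic_no_linear_term:
  fixes b g :: real
  assumes "\<And>t. 2 * t * b + t\<^sup>2 * g \<le> 0"
  shows "b = 0"
proof (rule ccontr)
  assume "b \<noteq> 0"
  define h where "h = \<bar>g\<bar> + 1"
  define t where "t = b / h"
  have h: "h > 0" by (simp add: h_def add_nonneg_pos)
  then have th: "t * h = b" by (simp add: t_def)
  have "(2 * t * b + t\<^sup>2 * g) * h\<^sup>2 = 2 * (t * h) * b * h + (t * h)\<^sup>2 * g"
    by (simp add: power2_eq_square algebra_simps)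
  also have "\<dots> = b\<^sup>2 * (2 * h + g)"
    unfolding th by (simp add: power2_eq_square algebra_simps)
  finally have "(2 * t * b + t\<^sup>2 * g) * h\<^sup>2 = b\<^sup>2 * (2 * h + g)" .
  moreover have "(2 * t * b + t\<^sup>2 * g) * h\<^sup>2 \<le> 0"
    using assms[of t] by (intro mult_nonpos_nonneg) auto
  moreover have "b\<^sup>2 * (2 * h + g) > 0"
    using \<open>b \<noteq> 0\<close> by (intro mult_pos_pos) (auto simp: h_def)
  ultimately show False by linarith
qed

text \<open>The spectral theorem for an operator that is self-adjoint for B on T, where B is
  positive on T but may be indefinite elsewhere, as the Lorentz form is. A maximum of B (S v) v over
  the B-unit vectors of T is an eigenvector, and its B-orthogonal complement in T is invariant and
  of one dimension less.\<close>

lemma orthonormal_eigenbasis: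
  fixes B :: "'a::euclidean_space \<Rightarrow> 'a \<Rightarrow> real" and S :: "'a \<Rightarrow> 'a"
  assumes B: "bounded_bilinear B" "\<And>u v. B u v = B v u" and S: "linear S"
    and "subspace T" "\<And>v. v \<in> T \<Longrightarrow> v \<noteq> 0 \<Longrightarrow> B v v > 0" "\<And>v. v \<in> T \<Longrightarrow> S v \<in> T"
    "\<And>u v. u \<in> T \<Longrightarrow> v \<in> T \<Longrightarrow> B (S u) v = B u (S v)"
  shows "\<exists>E k. finite E \<and> card E = dim T \<and> E \<subseteq> T \<and> (\<forall>u\<in>E. \<forall>v\<in>E. B u v = (if u = v then 1 else 0))
    \<and> (\<forall>u\<in>E. S u = k u *\<^sub>R u)"
  using assms(4-)
proof (induction "dim T" arbitrary: T)
  case 0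
  then show ?case by (intro exI[of _ "{}"]) simp
next
  case (Suc n)
  note T = Suc.prems
  note Bs = bounded_bilinear.add_left[OF B(1)] bounded_bilinear.add_right[OF B(1)]
    bounded_bilinear.diff_left[OF B(1)] bounded_bilinear.diff_right[OF B(1)]
    bounded_bilinear.scaleR_left[OF B(1)] bounded_bilinear.scaleR_right[OF B(1)]
    bounded_bilinear.zero_left[OF B(1)] bounded_bilinear.zero_right[OF B(1)]
  have blS: "bounded_linear S" using S by (simp add: linear_conv_bounded_linear)
  have contB: "continuous_on X (\<lambda>v. B v v)" for X
    by (intro bounded_bilinear.continuous_on[OF B(1)] continuous_intros)
  have contQ: "continuous_on X (\<lambda>v. B (S v) v)" for X
    by (intro bounded_bilinear.continuous_on[OF B(1)] continuous_intros linear_continuous_on blS)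
  obtain x where x: "x \<in> T" "x \<noteq> 0"
    using Suc.hyps(2) by (metis dim_eq_0 nat.distinct(1) singletonI subsetI)
  define C where "C = {v \<in> T. B v v = 1}"
  have "(1 / sqrt (B x x)) *\<^sub>R x \<in> C"
    using T(2)[OF x] x T(1) by (simp add: C_def Bs subspace_scale)
  then have Cne: "C \<noteq> {}" by blast
  have "compact (T \<inter> sphere 0 1)"
    by (rule closed_Int_compact[OF closed_subspace[OF T(1)]]) simp
  moreover have "(1 / norm x) *\<^sub>R x \<in> T \<inter> sphere 0 1" using x T(1) by (simp add: subspace_scale)
  then have "T \<inter> sphere 0 1 \<noteq> {}" by blast
  ultimately have "\<exists>y\<in>T \<inter> sphere 0 1. \<forall>v\<in>T \<inter> sphere 0 1. B y y \<le> B v v"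
    by (intro continuous_attains_inf contB)
  then obtain y where y: "y \<in> T \<inter> sphere 0 1" "\<And>v. v \<in> T \<inter> sphere 0 1 \<Longrightarrow> B y y \<le> B v v"
    by metis
  define m where "m = B y y"
  have "y \<noteq> 0" using y(1) by auto
  then have m: "m > 0" using y(1) T(2)[of y] by (simp add: m_def)
  \<comment> \<open>The minimum m of B on the Euclidean unit sphere of T bounds the B-unit sphere C,
    which is therefore compact.\<close>
  have low: "m * (norm v)\<^sup>2 \<le> B v v" if "v \<in> T" for v
  proof (cases "v = 0")
    case False
    then have "(1 / norm v) *\<^sub>R v \<in> T \<inter> sphere 0 1" using that T(1) by (simp add: subspace_scale)
    then have "m \<le> B ((1 / norm v) *\<^sub>R v) ((1 / norm v) *\<^sub>R v)" using y(2) by (simp add: m_def)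
    also have "\<dots> = B v v / (norm v)\<^sup>2" by (simp add: Bs power2_eq_square)
    finally show ?thesis using False by (simp add: le_divide_eq)
  qed (simp add: Bs)
  have "bounded C"
    unfolding bounded_iff
  proof (intro exI[of _ "sqrt (1 / m)"] ballI)
    fix v assume "v \<in> C"
    then have "(norm v)\<^sup>2 \<le> 1 / m" using low[of v] m by (simp add: C_def field_simps)
    then show "norm v \<le> sqrt (1 / m)" by (rule real_le_rsqrt)
  qed
  moreover have "closed C"
  proof -
    have "closed {v. B v v = 1}"
      using contB by (intro closed_Collect_eq continuous_intros) auto
    moreover have "C = T \<inter> {v. B v v = 1}" by (auto simp: C_def)
    ultimately show ?thesis using closed_subspace[OF T(1)] by auto
  qed
  ultimately have "compact C" by (simp add: compact_eq_bounded_closed)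
  then have "\<exists>e\<in>C. \<forall>v\<in>C. B (S v) v \<le> B (S e) e"
    by (intro continuous_attains_sup Cne contQ)
  then obtain e where e: "e \<in> C" "\<And>v. v \<in> C \<Longrightarrow> B (S v) v \<le> B (S e) e"
    by metis
  have eT: "e \<in> T" and ee: "B e e = 1" using e(1) by (auto simp: C_def)
  define l where "l = B (S e) e"
  have up: "B (S v) v \<le> l * B v v" if "v \<in> T" for v
  proof (cases "v = 0")
    case False
    define a where "a = sqrt (B v v)"
    have a: "a > 0" "a * a = B v v" using T(2)[OF that False] by (simp_all add: a_def)
    have "(1 / a) *\<^sub>R v \<in> C" using a that T(1) T(2)[OF that False] by (simp add: C_def Bs subspace_scale)
    then have "B (S ((1 / a) *\<^sub>R v)) ((1 / a) *\<^sub>R v) \<le> l" using e(2) by (simp add: l_def)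
    then have "B (S v) v / (a * a) \<le> l" by (simp add: linear_scale[OF S] Bs)
    moreover have "B v v > 0" using T(2)[OF that False] .
    ultimately show ?thesis using a(2) by (simp add: divide_le_eq)
  qed (simp add: Bs)
  \<comment> \<open>The first variation at the maximum e vanishes in all directions B-orthogonal to
    e.\<close>
  have orth: "B (S e) w = 0" if w: "w \<in> T" "B e w = 0" for w
  proof (rule quadratic_no_linear_term)
    fix t :: real
    have "e + t *\<^sub>R w \<in> T" using eT w(1) T(1) by (simp add: subspace_add subspace_scale)
    from up[OF this] have "B (S e + t *\<^sub>R S w) (e + t *\<^sub>R w) \<le> l * B (e + t *\<^sub>R w) (e + t *\<^sub>R w)"
      by (simp add: linear_add[OF S] linear_scale[OF S])
    moreover have "B (S w) e = B (S e) w" using T(4)[OF w(1) eT] B(2) by metis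
    moreover have "B w e = 0" using w(2) B(2) by metis
    ultimately show "2 * t * B (S e) w + t\<^sup>2 * (B (S w) w - l * B w w) \<le> 0"
      by (simp add: Bs w(2) ee l_def[symmetric] power2_eq_square algebra_simps)
  qed
  \<comment> \<open>The difference S e - l e is B-orthogonal to e, hence by \<open>orth\<close> to S
    e, and therefore to itself.\<close>
  have Se: "S e = l *\<^sub>R e"
  proof -
    let ?x = "S e - l *\<^sub>R e"
    have xT: "?x \<in> T" using T(1) T(3)[OF eT] eT by (simp add: subspace_diff subspace_scale)
    have xe: "B ?x e = 0" by (simp add: Bs l_def ee)
    have w: "?x - B e ?x *\<^sub>R e \<in> T" "B e (?x - B e ?x *\<^sub>R e) = 0"
      using T(1) xT eT ee by (simp_all add: subspace_diff subspace_scale Bs(4,6))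
    have "B e ?x = 0" using xe B(2) by metis
    then have "B e ?x = 0" "B (S e) ?x = 0" using orth[OF xT] by auto
    then have "B ?x ?x = 0" by (simp add: Bs(3,5))
    then show ?thesis using T(2)[OF xT] by fastforce
  qed
  define T' where "T' = {w \<in> T. B e w = 0}"
  have sT': "subspace T'"
    using T(1) by (auto simp: T'_def subspace_def Bs)
  have SrT': "S v \<in> T'" if "v \<in> T'" for v
  proof -
    have "B e (S v) = B (S e) v" using T(4)[OF eT, of v] that by (simp add: T'_def)
    then show ?thesis using that T(3)[of v] by (simp add: T'_def Se Bs)
  qed
  have eT': "e \<notin> T'" by (simp add: T'_def ee)
  have "span (insert e T') = T"
  proof
    show "span (insert e T') \<subseteq> T"
      by (rule span_minimal) (use eT T(1) in \<open>auto simp: T'_def\<close>)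
    show "T \<subseteq> span (insert e T')"
    proof
      fix v assume v: "v \<in> T"
      have "v - B e v *\<^sub>R e \<in> T'" using v eT T(1) by (simp add: T'_def subspace_diff subspace_scale Bs ee)
      then have "v - B e v *\<^sub>R e \<in> span (insert e T')" by (simp add: span_base)
      moreover have "B e v *\<^sub>R e \<in> span (insert e T')" by (simp add: span_base span_scale)
      ultimately have "(v - B e v *\<^sub>R e) + B e v *\<^sub>R e \<in> span (insert e T')" by (rule span_add)
      then show "v \<in> span (insert e T')" by simp
    qed
  qed
  then have "dim T = dim (insert e T')" by (metis dim_span)
  also have "\<dots> = dim T' + 1"
  proof -
    have "e \<notin> span T'" using eT' sT' by (metis span_eq_iff)
    then show ?thesis by (simp add: dim_insert)
  qed
  finally have dT': "n = dim T'" using Suc.hyps(2) by simp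
  have "\<exists>E k. finite E \<and> card E = dim T' \<and> E \<subseteq> T' \<and> (\<forall>u\<in>E. \<forall>v\<in>E. B u v = (if u = v then 1 else 0))
      \<and> (\<forall>u\<in>E. S u = k u *\<^sub>R u)"
    by (rule Suc.hyps(1)[OF dT' sT']) (use T SrT' in \<open>auto simp: T'_def\<close>)
  then obtain E k where E: "finite E" "card E = dim T'" "E \<subseteq> T'"
    "\<And>u v. u \<in> E \<Longrightarrow> v \<in> E \<Longrightarrow> B u v = (if u = v then 1 else 0)" "\<And>u. u \<in> E \<Longrightarrow> S u = k u *\<^sub>R u"
    by blast
  have eE: "e \<notin> E" using E(3) eT' by blast
  have BeE: "B e u = 0" "B u e = 0" if "u \<in> E" for u
    using that E(3) B(2)[of u e] by (auto simp: T'_def)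
  show ?case
  proof (intro exI[of _ "insert e E"] exI[of _ "k(e := l)"] conjI)
    show "card (insert e E) = dim T" using E(1,2) eE dT' Suc.hyps(2) by simp
    show "insert e E \<subseteq> T" using E(3) eT by (auto simp: T'_def)
    show "\<forall>u\<in>insert e E. \<forall>v\<in>insert e E. B u v = (if u = v then 1 else 0)"
      using E(4) BeE ee eE by auto
    show "\<forall>u\<in>insert e E. S u = (k(e := l)) u *\<^sub>R u"
      using E(5) Se eE by auto
  qed (use E(1) in simp)
qed

section \<open>The boundary of a smooth domain\<close>

lemma nvec_inner:
  assumes "p \<in> hyp_space" "v \<in> hyp_tangent p"
  shows "fst p * lorentz N v = nvec p N \<bullet> snd v"
proof -
  have "snd p \<bullet> snd v = fst p * fst v" using assms(2) by (simp add: hyp_tangent_def lorentz_def)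
  then show ?thesis by (simp add: nvec_def lorentz_def inner_diff_left algebra_simps)
qed

lemma hyp_tangent_simps:
  "v \<in> hyp_tangent p \<Longrightarrow> w \<in> hyp_tangent p \<Longrightarrow> v + w \<in> hyp_tangent p"
  "v \<in> hyp_tangent p \<Longrightarrow> w \<in> hyp_tangent p \<Longrightarrow> v - w \<in> hyp_tangent p"
  "v \<in> hyp_tangent p \<Longrightarrow> c *\<^sub>R v \<in> hyp_tangent p"
  by (simp_all add: hyp_tangent_def lorentz_simps)

lemma hyp_tangent_eqI:
  assumes p: "p \<in> hyp_space" and xy: "x \<in> hyp_tangent p" "y \<in> hyp_tangent p"
    and eq: "\<And>v. v \<in> hyp_tangent p \<Longrightarrow> lorentz x v = lorentz y v"
  shows "x = y"
proof (rule ccontr)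
  assume "x \<noteq> y"
  have t: "x - y \<in> hyp_tangent p" using xy by (rule hyp_tangent_simps)
  then have "lorentz (x - y) (x - y) > 0"
    using lorentz_tangent_pos[OF p, of "x - y"] \<open>x \<noteq> y\<close> by (simp add: hyp_tangent_def)
  moreover have "lorentz (x - y) (x - y) = 0" using eq[OF t] by (simp add: lorentz_simps)
  ultimately show False by simp
qed

lemma inverse_sqrt_sq:
  fixes x :: real
  assumes "x > 0"
  shows "inverse (sqrt x) * inverse (sqrt x) * x = 1"
proof -
  have "sqrt x * sqrt x = x" "sqrt x \<noteq> 0" using assms by simp_all
  then show ?thesis by (simp add: field_simps)
qed

text \<open>If h had a component w orthogonal to g, then L w - g with L large would lie in the half
  space g < 0 and h would be positive on it.\<close>

lemma halfspace_functional:
  fixes g h :: "'a::real_inner"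
  assumes "g \<noteq> 0" "h \<noteq> 0" and le: "\<And>v. g \<bullet> v < 0 \<Longrightarrow> h \<bullet> v \<le> 0"
  obtains k where "k > 0" "h = k *\<^sub>R g"
proof -
  define k where "k = (g \<bullet> h) / (g \<bullet> g)"
  define w where "w = h - k *\<^sub>R g"
  have gg: "g \<bullet> g > 0" using assms(1) by simp
  have gw: "g \<bullet> w = 0" using gg by (simp add: w_def k_def inner_diff_right)
  have hw: "h \<bullet> w = w \<bullet> w" using gw by (simp add: w_def inner_diff_left inner_diff_right inner_commute)
  have "w \<bullet> w = 0"
  proof (rule ccontr)
    assume "w \<bullet> w \<noteq> 0"
    then have ww: "w \<bullet> w > 0" by (metis inner_ge_zero order_le_less)
    define L where "L = (\<bar>h \<bullet> g\<bar> + 1) / (w \<bullet> w)"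
    have "h \<bullet> (L *\<^sub>R w - g) \<le> 0"
      by (rule le) (use gg gw in \<open>simp add: inner_diff_right\<close>)
    moreover have "h \<bullet> (L *\<^sub>R w - g) = \<bar>h \<bullet> g\<bar> + 1 - h \<bullet> g"
      using ww by (simp add: inner_diff_right hw L_def)
    ultimately show False by linarith
  qed
  then have hk: "h = k *\<^sub>R g" by (simp add: w_def)
  have "h \<bullet> (- g) \<le> 0" by (rule le) (use gg in simp)
  then have "k * (g \<bullet> g) \<ge> 0" by (simp add: hk)
  then have "k \<ge> 0" using gg by (simp add: zero_le_mult_iff)
  moreover have "k \<noteq> 0" using hk assms(2) by auto
  ultimately have "k > 0" by simp
  then show thesis using hk by (rule that)
qed

locale smooth_domain =
  fixes \<Omega> :: "'n::finite minkowski set"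
  assumes smooth_domain: "smooth_bounded_domain \<Omega>"
begin

section \<open>The projection of the domain to Euclidean space\<close>

abbreviation "base \<equiv> snd ` \<Omega>"

lemma domain_subset: "\<Omega> \<subseteq> hyp_space"
  and compact_domain: "compact \<Omega>"
  and ex_defining_function: "p \<in> bdry \<Omega> \<Longrightarrow> \<exists>U \<rho>. defining_function \<Omega> p U \<rho>"
  using smooth_domain by (auto simp: smooth_bounded_domain_def)

lemma compact_base: "compact base"
  using compact_domain by (intro compact_continuous_image continuous_intros)

lemma closed_base: "closed base"
  using compact_base by (rule compact_imp_closed)

lemma connected_base: "connected base"
  using smooth_domain by (intro connected_continuous_image continuous_intros) (simp add: smooth_bounded_domain_def)

lemma lift_base: "lift ` base = \<Omega>"
  using domain_subset by (rule lift_image_snd)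

lemma lift_in_domain: "lift x \<in> \<Omega> \<longleftrightarrow> x \<in> base"
  using lift_base by (metis image_iff snd_lift)

lemma homeomorphic_map_lift: "homeomorphic_map euclidean (top_of_set hyp_space) (lift :: _ \<Rightarrow> 'n minkowski)"
  unfolding homeomorphic_map_maps homeomorphic_maps_def
  using lift_in_hyp_space lift_snd
  by (intro exI[of _ snd]) (auto simp: continuous_map_in_subtopology continuous_on_lift intro!: continuous_intros)

text \<open>\<open>bdry\<close> is a frontier relative to hyperbolic space; the homeomorphism
  \<open>lift\<close> turns it into the ordinary frontier of the base.\<close>

lemma bdry_eq: "bdry \<Omega> = lift ` frontier base"
  using homeomorphic_map_frontier_of[OF homeomorphic_map_lift, of base] by (simp add: bdry_def lift_base)

lemma interior_base: "interior base \<noteq> {}"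
  using homeomorphic_map_interior_of[OF homeomorphic_map_lift, of base] smooth_domain
  by (auto simp: lift_base smooth_bounded_domain_def)

lemma frontier_subset_base: "frontier base \<subseteq> base"
  using closed_base by (rule frontier_subset_closed)

lemma bdryD:
  assumes "p \<in> bdry \<Omega>"
  shows "p \<in> hyp_space" "p \<in> \<Omega>" "snd p \<in> frontier base" "lift (snd p) = p"
proof -
  obtain a where a: "a \<in> frontier base" "p = lift a" using assms bdry_eq by auto
  then show "p \<in> hyp_space" "p \<in> \<Omega>" "snd p \<in> frontier base" "lift (snd p) = p"
    using frontier_subset_base lift_in_domain lift_in_hyp_space by auto
qed

lemma compact_bdry: "compact (bdry \<Omega>)"
  unfolding bdry_eq
  by (intro compact_continuous_image[OF continuous_on_lift compact_frontier[OF compact_base]])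

lemma bdry_nonempty: "bdry \<Omega> \<noteq> {}"
proof -
  have "base \<noteq> {}" using interior_base interior_subset by blast
  moreover have "base \<noteq> UNIV" using compact_base compact_imp_bounded not_bounded_UNIV by metis
  ultimately show ?thesis using frontier_eq_empty[of base] by (simp add: bdry_eq)
qed

lemma bdry_subset_hyp_space: "bdry \<Omega> \<subseteq> hyp_space"
  using bdryD(1) by auto

lemma bdry_borel: "bdry \<Omega> \<in> sets borel"
  using compact_bdry by (rule borel_compact)

text \<open>In base coordinates the defining function lives on an open set of Euclidean space. It
  vanishes at \<open>snd p\<close>, since a negative value would persist nearby and place that point
  in the interior of the base.\<close>

lemma local_function:
  assumes p: "p \<in> bdry \<Omega>" and d: "defining_function \<Omega> p U \<rho>"
  defines "W \<equiv> lift -` U" and "R \<equiv> \<lambda>x. \<rho> (lift x)"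
  shows "open W" "snd p \<in> W" "smooth_on W R" "R (snd p) = 0"
    "\<And>x. x \<in> W \<Longrightarrow> x \<in> base \<longleftrightarrow> R x \<le> 0"
    "\<And>x. x \<in> W \<Longrightarrow> (R has_derivative (\<lambda>u. frechet_derivative \<rho> (at (lift x)) (dlift x u))) (at x)"
proof -
  have U: "open U" "p \<in> U" "smooth_on U \<rho>" and O: "\<Omega> \<inter> U = {q \<in> hyp_space \<inter> U. \<rho> q \<le> 0}"
    using d by (auto simp: defining_function_def)
  show oW: "open W"
    unfolding W_def using U(1) by (rule open_vimage[OF _ continuous_on_lift])
  show pW: "snd p \<in> W" using U(2) bdryD(4)[OF p] by (simp add: W_def)
  show sR: "smooth_on W R"
    unfolding R_def by (rule smooth_on_compose[OF oW U(3) smooth_on_lift[OF oW]]) (auto simp: W_def)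
  show iff: "x \<in> base \<longleftrightarrow> R x \<le> 0" if "x \<in> W" for x
    using that O lift_in_domain[of x] lift_in_hyp_space[of x] by (auto simp: W_def R_def)
  show "(R has_derivative (\<lambda>u. frechet_derivative \<rho> (at (lift x)) (dlift x u))) (at x)" if "x \<in> W" for x
    using diff_chain_at[OF has_derivative_lift defining_functionD(1)[OF d], of x] that
    by (simp add: R_def W_def o_def)
  show "R (snd p) = 0"
  proof (rule ccontr)
    assume "R (snd p) \<noteq> 0"
    moreover have "R (snd p) \<le> 0" using iff[OF pW] bdryD(2)[OF p] by blast
    ultimately have neg: "R (snd p) < 0" by simp
    let ?V = "W \<inter> R -` {..<0}"
    have "open ?V"
      by (rule continuous_open_preimage[OF smooth_on_continuous_on[OF sR] oW open_lessThan])
    moreover have "?V \<subseteq> base" using iff by auto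
    moreover have "snd p \<in> ?V" using pW neg by simp
    ultimately have "snd p \<in> interior base" using interior_maximal by blast
    then show False using bdryD(3)[OF p] by (simp add: frontier_def)
  qed
qed

lemma defining_vanishes:
  assumes d: "defining_function \<Omega> p U \<rho>" and q: "q \<in> bdry \<Omega>" "q \<in> U" "lorentz (ngrad \<rho> q) (ngrad \<rho> q) > 0"
  shows "defining_function \<Omega> q U \<rho>" "\<rho> q = 0"
proof -
  show d': "defining_function \<Omega> q U \<rho>"
    by (rule defining_function_transfer[OF d q(2) bdryD(1)[OF q(1)] q(3)])
  show "\<rho> q = 0" using local_function(4)[OF q(1) d'] bdryD(4)[OF q(1)] by simp
qed

section \<open>The outward normal and its independence of the defining function\<close>

lemma directional_sign:
  fixes R :: "real ^ ('n option) \<Rightarrow> real"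
  assumes "(R has_derivative D) (at a)" "R a = 0"
  shows "D v < 0 \<Longrightarrow> \<exists>d>0. \<forall>t. 0 < t \<longrightarrow> t < d \<longrightarrow> R (a + t *\<^sub>R v) < 0"
    and "D v > 0 \<Longrightarrow> \<exists>d>0. \<forall>t. 0 < t \<longrightarrow> t < d \<longrightarrow> R (a + t *\<^sub>R v) > 0"
proof -
  have "((\<lambda>t. a + t *\<^sub>R v) has_derivative (\<lambda>c. c *\<^sub>R v)) (at 0)"
    by (auto intro!: derivative_eq_intros)
  from diff_chain_at[OF this, of R D] assms(1)
  have "((\<lambda>t. R (a + t *\<^sub>R v)) has_derivative (\<lambda>c. D (c *\<^sub>R v))) (at 0)"
    by (simp add: o_def)
  then have "((\<lambda>t. R (a + t *\<^sub>R v)) has_real_derivative D v) (at 0)"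
    unfolding has_field_derivative_def
    by (rule has_derivative_eq_rhs) (simp add: fun_eq_iff linear_scale[OF has_derivative_linear[OF assms(1)]])
  from DERIV_neg_dec_right[OF this] DERIV_pos_inc_right[OF this]
  show "D v < 0 \<Longrightarrow> \<exists>d>0. \<forall>t. 0 < t \<longrightarrow> t < d \<longrightarrow> R (a + t *\<^sub>R v) < 0"
    and "D v > 0 \<Longrightarrow> \<exists>d>0. \<forall>t. 0 < t \<longrightarrow> t < d \<longrightarrow> R (a + t *\<^sub>R v) > 0"
    by (auto simp: assms(2))
qed

text \<open>The chain rule through \<open>lift\<close>, combined with \<open>nvec_inner\<close>: the
  Euclidean gradient of the transported function is a positive multiple of \<open>nvec\<close>,
  which is thus normal to the projected boundary.\<close>

lemma derivative_base:
  assumes p: "p \<in> bdry \<Omega>" and d: "defining_function \<Omega> p U \<rho>"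
  shows "((\<lambda>x. \<rho> (lift x)) has_derivative (\<lambda>u. nvec p (ngrad \<rho> p) \<bullet> u / fst p)) (at (snd p))"
proof -
  have pU: "p \<in> U" using d by (simp add: defining_function_def)
  note h = bdryD(1)[OF p]
  have "frechet_derivative \<rho> (at (lift (snd p))) (dlift (snd p) u) = nvec p (ngrad \<rho> p) \<bullet> u / fst p" for u
  proof -
    have t: "dlift (snd p) u \<in> hyp_tangent p" using dlift_tangent[of "snd p" u] by (simp add: bdryD(4)[OF p])
    have "frechet_derivative \<rho> (at p) (dlift (snd p) u) = lorentz (ngrad \<rho> p) (dlift (snd p) u)"
      by (rule lorentz_ngrad[OF defining_functionD(2)[OF d pU] t])
    then show ?thesis
      using nvec_inner[OF h t, of "ngrad \<rho> p"] hyp_spaceD(1)[OF h] by (simp add: bdryD(4)[OF p] field_simps)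
  qed
  then show ?thesis using local_function(6)[OF p d local_function(2)[OF p d]] by simp
qed

lemma nvec_nonzero:
  assumes "p \<in> hyp_space" "N \<in> hyp_tangent p" "N \<noteq> 0"
  shows "nvec p N \<noteq> 0"
proof
  assume "nvec p N = 0"
  then have "fst p * lorentz N N = 0" using nvec_inner[OF assms(1,2), of N] by simp
  then show False
    using lorentz_tangent_pos[OF assms(1) _ assms(3)] assms(2) hyp_spaceD(1)[OF assms(1)] by (simp add: hyp_tangent_def)
qed

text \<open>Both functions describe the same set near p, so no direction strictly enters the domain
  according to one and strictly leaves it according to the other. Their gradients in base
  coordinates are then positively proportional by \<open>halfspace_functional\<close>.\<close>

lemma defining_functions_comparable:
  assumes p: "p \<in> bdry \<Omega>" and d1: "defining_function \<Omega> p U1 \<rho>1" and d2: "defining_function \<Omega> p U2 \<rho>2"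
  obtains k where "k > 0" "ngrad \<rho>2 p = k *\<^sub>R ngrad \<rho>1 p"
proof -
  note h = bdryD(1)[OF p]
  let ?a = "snd p"
  note L1 = local_function[OF p d1] and L2 = local_function[OF p d2]
  have nz: "nvec p (ngrad \<rho> p) \<noteq> 0" if "defining_function \<Omega> p U \<rho>" for U \<rho>
    using ngrad_spacelike[OF that h] by (intro nvec_nonzero[OF h ngrad_tangent[OF h]]) (auto simp: lorentz_simps)
  obtain k where k: "k > 0" "nvec p (ngrad \<rho>2 p) = k *\<^sub>R nvec p (ngrad \<rho>1 p)"
  proof (rule halfspace_functional[OF nz[OF d1] nz[OF d2]])
    fix v assume neg: "nvec p (ngrad \<rho>1 p) \<bullet> v < 0"
    show "nvec p (ngrad \<rho>2 p) \<bullet> v \<le> 0"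
    proof (rule ccontr)
      assume pos: "\<not> ?thesis"
      have "nvec p (ngrad \<rho>1 p) \<bullet> v / fst p < 0" "nvec p (ngrad \<rho>2 p) \<bullet> v / fst p > 0"
        using neg pos hyp_spaceD(1)[OF h] by (simp_all add: divide_neg_pos)
      then obtain e1 e2 where "e1 > 0" "\<forall>t. 0 < t \<longrightarrow> t < e1 \<longrightarrow> \<rho>1 (lift (?a + t *\<^sub>R v)) < 0"
        "e2 > 0" "\<forall>t. 0 < t \<longrightarrow> t < e2 \<longrightarrow> \<rho>2 (lift (?a + t *\<^sub>R v)) > 0"
        using directional_sign(1)[OF derivative_base[OF p d1] L1(4), of v] directional_sign(2)[OF derivative_base[OF p d2] L2(4), of v]
        by blast
      then have e: "e1 > 0" "\<And>t. 0 < t \<Longrightarrow> t < e1 \<Longrightarrow> \<rho>1 (lift (?a + t *\<^sub>R v)) < 0"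
        "e2 > 0" "\<And>t. 0 < t \<Longrightarrow> t < e2 \<Longrightarrow> \<rho>2 (lift (?a + t *\<^sub>R v)) > 0"
        by blast+
      obtain r where r: "r > 0" "ball ?a r \<subseteq> lift -` U1 \<inter> lift -` U2"
        using L1(1,2) L2(1,2) open_contains_ball[of "lift -` U1 \<inter> lift -` U2"] by blast
      define z where "z = r / (norm v + 1)"
      define t where "t = min (min e1 e2) z / 2"
      have nv: "norm v + 1 > 0" by (simp add: add_nonneg_pos)
      have t: "0 < t" "t < e1" "t < e2" "t < r / (norm v + 1)"
      proof -
        have "z > 0" using r nv by (simp add: z_def)
        then show "0 < t" "t < e1" "t < e2" "t < r / (norm v + 1)"
          using e(1,3) unfolding z_def[symmetric] by (auto simp: t_def)
      qed
      have "t * norm v \<le> t * (norm v + 1)" using t(1) by simp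
      also have "\<dots> < r" using t(4) nv by (simp add: less_divide_eq)
      finally have "?a + t *\<^sub>R v \<in> ball ?a r" using t(1) by (simp add: dist_norm)
      then have in12: "?a + t *\<^sub>R v \<in> lift -` U1" "?a + t *\<^sub>R v \<in> lift -` U2" using r(2) by auto
      then have "?a + t *\<^sub>R v \<in> base" using L1(5)[OF in12(1)] e(2)[OF t(1,2)] by simp
      then have "\<rho>2 (lift (?a + t *\<^sub>R v)) \<le> 0" using L2(5)[OF in12(2)] by simp
      then show False using e(4)[OF t(1,3)] by simp
    qed
  qed (rule that)
  have "ngrad \<rho>2 p = k *\<^sub>R ngrad \<rho>1 p"
  proof (rule hyp_tangent_eqI[OF h])
    fix v assume v: "v \<in> hyp_tangent p"
    have "fst p * lorentz (ngrad \<rho>2 p) v = fst p * (k * lorentz (ngrad \<rho>1 p) v)"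
      unfolding nvec_inner[OF h v] k(2) using nvec_inner[OF h v, of "ngrad \<rho>1 p"] by simp
    then show "lorentz (ngrad \<rho>2 p) v = lorentz (k *\<^sub>R ngrad \<rho>1 p) v"
      using hyp_spaceD(1)[OF h] by (simp add: lorentz_simps)
  qed (auto intro: hyp_tangent_simps ngrad_tangent[OF h])
  then show thesis using that k(1) by blast
qed

text \<open>The normalised gradient meets the description. Any other candidate is a positive
  multiple of it by \<open>defining_functions_comparable\<close>, and both have unit length.\<close>

lemma outer_normal_eq:
  assumes p: "p \<in> bdry \<Omega>" and d: "defining_function \<Omega> p U \<rho>"
  shows "outer_normal \<Omega> p = unormal \<rho> p"
proof -
  note h = bdryD(1)[OF p]
  let ?N = "ngrad \<rho> p" and ?s = "inv_norm \<rho> p"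
  have pU: "p \<in> U" using d by (simp add: defining_function_def)
  have NN: "lorentz ?N ?N > 0" by (rule ngrad_spacelike[OF d h])
  have s: "?s > 0" "?s * ?s * lorentz ?N ?N = 1"
    using NN inverse_sqrt_sq[OF NN] by (simp_all add: inv_norm_def)
  show ?thesis
    unfolding outer_normal_def
  proof (rule the_equality)
    have "frechet_derivative \<rho> (at p) v = inverse ?s * lorentz (unormal \<rho> p) v" if "v \<in> hyp_tangent p" for v
      using lorentz_ngrad[OF defining_functionD(2)[OF d pU] that] s by (simp add: unormal_def lorentz_simps)
    then show "unormal \<rho> p \<in> hyp_tangent p \<and> lorentz (unormal \<rho> p) (unormal \<rho> p) = 1 \<and>
      (\<exists>U \<rho>' c. defining_function \<Omega> p U \<rho>' \<and> c > 0 \<and>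
        (\<forall>v\<in>hyp_tangent p. frechet_derivative \<rho>' (at p) v = c * lorentz (unormal \<rho> p) v))"
      using d s ngrad_tangent[OF h] unfolding unormal_def
      by (intro conjI exI[of _ U] exI[of _ \<rho>] exI[of _ "inverse ?s"] ballI) (auto intro: hyp_tangent_simps simp: lorentz_simps mult.assoc)
  next
    fix \<nu>
    assume "\<nu> \<in> hyp_tangent p \<and> lorentz \<nu> \<nu> = 1 \<and>
      (\<exists>U \<rho>' c. defining_function \<Omega> p U \<rho>' \<and> c > 0 \<and>
        (\<forall>v\<in>hyp_tangent p. frechet_derivative \<rho>' (at p) v = c * lorentz \<nu> v))"
    then obtain U' \<rho>' c where n: "\<nu> \<in> hyp_tangent p" "lorentz \<nu> \<nu> = 1" and d': "defining_function \<Omega> p U' \<rho>'"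
      and c: "c > 0" "\<And>v. v \<in> hyp_tangent p \<Longrightarrow> frechet_derivative \<rho>' (at p) v = c * lorentz \<nu> v"
      by blast
    have pU': "p \<in> U'" using d' by (simp add: defining_function_def)
    have "ngrad \<rho>' p = c *\<^sub>R \<nu>"
    proof (rule hyp_tangent_eqI[OF h ngrad_tangent[OF h]])
      show "c *\<^sub>R \<nu> \<in> hyp_tangent p" by (rule hyp_tangent_simps(3)[OF n(1)])
      show "lorentz (ngrad \<rho>' p) v = lorentz (c *\<^sub>R \<nu>) v" if "v \<in> hyp_tangent p" for v
        using lorentz_ngrad[OF defining_functionD(2)[OF d' pU'] that] c(2)[OF that] by (simp add: lorentz_simps)
    qed
    moreover obtain k where k: "k > 0" "ngrad \<rho>' p = k *\<^sub>R ?N"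
      by (rule defining_functions_comparable[OF p d d'])
    ultimately have "\<nu> = (k / c) *\<^sub>R ?N" using c(1) by (metis divide_inverse_commute scaleR_scaleR scaleR_one left_inverse less_irrefl)
    moreover define r where "r = k / c"
    ultimately have nr: "\<nu> = r *\<^sub>R ?N" by simp
    have "r > 0" using k(1) c(1) by (simp add: r_def)
    have "r * r * lorentz ?N ?N = ?s * ?s * lorentz ?N ?N" using n(2) s(2) by (simp add: nr lorentz_simps mult.assoc)
    then have "r * r = ?s * ?s" using NN by simp
    then have "r = ?s" using \<open>r > 0\<close> s(1) by (metis abs_of_pos power2_eq_square real_sqrt_abs)
    then show "\<nu> = unormal \<rho> p" using nr by (simp add: unormal_def)
  qed
qed

lemma outer_normal_unit:
  assumes p: "p \<in> bdry \<Omega>"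
  shows "outer_normal \<Omega> p \<in> hyp_tangent p" "lorentz (outer_normal \<Omega> p) (outer_normal \<Omega> p) = 1"
proof -
  obtain U \<rho> where d: "defining_function \<Omega> p U \<rho>" using ex_defining_function[OF p] by blast
  note h = bdryD(1)[OF p]
  have NN: "lorentz (ngrad \<rho> p) (ngrad \<rho> p) > 0" by (rule ngrad_spacelike[OF d h])
  show "outer_normal \<Omega> p \<in> hyp_tangent p"
    unfolding outer_normal_eq[OF p d] unormal_def by (rule hyp_tangent_simps(3)[OF ngrad_tangent[OF h]])
  have "inv_norm \<rho> p * (inv_norm \<rho> p * lorentz (ngrad \<rho> p) (ngrad \<rho> p)) = 1"
    using inverse_sqrt_sq[OF NN] by (simp only: inv_norm_def mult.assoc)
  then show "lorentz (outer_normal \<Omega> p) (outer_normal \<Omega> p) = 1"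
    unfolding outer_normal_eq[OF p d] unormal_def by (simp add: lorentz_simps)
qed

text \<open>A priori each boundary point has a defining function of its own. Since it is an open
  condition that the gradient be spacelike, one function represents the outward normal at all nearby
  boundary points, and the smoothness of \<open>unormal\<close> becomes usable.\<close>

lemma boundary_neighbourhood:
  assumes p: "p \<in> bdry \<Omega>"
  obtains U \<rho> where "defining_function \<Omega> p U \<rho>" "open U" "p \<in> U" "smooth_on U \<rho>"
    "\<And>q. q \<in> U \<Longrightarrow> lorentz (ngrad \<rho> q) (ngrad \<rho> q) > 0"
    "\<And>q. q \<in> bdry \<Omega> \<Longrightarrow> q \<in> U \<Longrightarrow> defining_function \<Omega> q U \<rho>"
    "\<And>q. q \<in> bdry \<Omega> \<Longrightarrow> q \<in> U \<Longrightarrow> \<rho> q = 0"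
    "\<And>q. q \<in> bdry \<Omega> \<Longrightarrow> q \<in> U \<Longrightarrow> outer_normal \<Omega> q = unormal \<rho> q"
proof -
  obtain U \<rho> where d: "defining_function \<Omega> p U \<rho>" using ex_defining_function[OF p] by blast
  obtain V where V: "open V" "p \<in> V" "V \<subseteq> U" "\<And>q. q \<in> V \<Longrightarrow> lorentz (ngrad \<rho> q) (ngrad \<rho> q) > 0"
    by (rule spacelike_neighbourhood[OF d bdryD(1)[OF p]]) blast
  have s: "smooth_on V \<rho>" using d V(3) smooth_on_subset by (auto simp: defining_function_def)
  have "\<Omega> \<inter> V = {q \<in> hyp_space \<inter> V. \<rho> q \<le> 0}" using d V(3) by (auto simp: defining_function_def)
  then have dV: "defining_function \<Omega> p V \<rho>"
    using d V(1,2) s by (auto simp: defining_function_def)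
  note v = defining_vanishes[OF dV _ _ V(4)]
  show thesis
    by (rule that[OF dV V(1,2) s V(4)]) (use v outer_normal_eq in blast)+
qed

lemma continuous_on_outer_normal: "continuous_on (bdry \<Omega>) (outer_normal \<Omega>)"
  unfolding continuous_on_eq_continuous_within
proof
  fix p assume p: "p \<in> bdry \<Omega>"
  obtain U \<rho> where U: "open U" "p \<in> U" "smooth_on U \<rho>" "\<And>q. q \<in> U \<Longrightarrow> lorentz (ngrad \<rho> q) (ngrad \<rho> q) > 0"
    "\<And>q. q \<in> bdry \<Omega> \<Longrightarrow> q \<in> U \<Longrightarrow> outer_normal \<Omega> q = unormal \<rho> q"
    by (rule boundary_neighbourhood[OF p]) blast
  obtain e where e: "e > 0" "ball p e \<subseteq> U" using U(1,2) open_contains_ball by blast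
  have "continuous_on U (unormal \<rho>)" using Ck_on_unormal[OF U(1,3,4), of 0] by simp
  then have "continuous (at p within bdry \<Omega>) (unormal \<rho>)"
    using U(1,2) by (metis continuous_at_imp_continuous_within continuous_on_eq_continuous_at)
  then show "continuous (at p within bdry \<Omega>) (outer_normal \<Omega>)"
  proof (rule continuous_transform_within[OF _ e(1) p])
    show "unormal \<rho> q = outer_normal \<Omega> q" if q: "q \<in> bdry \<Omega>" "dist q p < e" for q
    proof -
      have "q \<in> U" using e(2) q(2) by (auto simp: dist_commute)
      then show ?thesis using U(5)[OF q(1)] by simp
    qed
  qed
qed

section \<open>Tangent spaces and charts of the boundary\<close>

lemma bdry_tangent_iff: "v \<in> bdry_tangent \<Omega> p \<longleftrightarrow> lorentz p v = 0 \<and> lorentz (outer_normal \<Omega> p) v = 0"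
  by (auto simp: bdry_tangent_def hyp_tangent_def)

lemma subspace_bdry_tangent: "subspace (bdry_tangent \<Omega> p)"
  by (simp add: subspace_def bdry_tangent_iff lorentz_simps)

text \<open>Projection to the spatial part maps the boundary tangent space injectively onto the
  Euclidean hyperplane orthogonal to \<open>nvec p (outer_normal \<Omega> p)\<close>.\<close>

lemma dim_bdry_tangent:
  assumes p: "p \<in> bdry \<Omega>"
  shows "dim (bdry_tangent \<Omega> p) = CARD('n)"
proof -
  note h = bdryD(1)[OF p]
  let ?n = "outer_normal \<Omega> p"
  let ?M = "nvec p ?n"
  note u = outer_normal_unit[OF p]
  have "?n \<noteq> 0"
  proof
    assume "?n = 0"
    then show False using u(2) by (simp add: lorentz_simps)
  qed
  then have M: "?M \<noteq> 0" by (rule nvec_nonzero[OF h u(1)])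
  have im: "snd ` bdry_tangent \<Omega> p = {x. ?M \<bullet> x = 0}"
  proof
    show "snd ` bdry_tangent \<Omega> p \<subseteq> {x. ?M \<bullet> x = 0}"
      using nvec_inner[OF h, of _ ?n] by (fastforce simp: bdry_tangent_def)
    show "{x. ?M \<bullet> x = 0} \<subseteq> snd ` bdry_tangent \<Omega> p"
    proof
      fix x assume x: "x \<in> {x. ?M \<bullet> x = 0}"
      have t: "dlift (snd p) x \<in> hyp_tangent p" using dlift_tangent[of "snd p" x] by (simp add: bdryD(4)[OF p])
      then have "lorentz ?n (dlift (snd p) x) = 0"
        using nvec_inner[OF h t, of ?n] x hyp_spaceD(1)[OF h] by simp
      then show "x \<in> snd ` bdry_tangent \<Omega> p"
        using t by (intro image_eqI[of _ snd "dlift (snd p) x"]) (simp_all add: bdry_tangent_def)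
    qed
  qed
  have "inj_on snd (span (bdry_tangent \<Omega> p))"
    unfolding span_eq_iff[THEN iffD2, OF subspace_bdry_tangent]
  proof (rule inj_onI)
    fix v w assume vw: "v \<in> bdry_tangent \<Omega> p" "w \<in> bdry_tangent \<Omega> p" "snd v = snd w"
    then show "v = w" using tangent_eq_dlift[OF h, of v] tangent_eq_dlift[OF h, of w] by (simp add: bdry_tangent_def)
  qed
  then have "dim (snd ` bdry_tangent \<Omega> p) = dim (bdry_tangent \<Omega> p)"
    by (intro dim_image_eq) (simp_all add: linear_snd)
  then show ?thesis
    unfolding im using dim_hyperplane[OF M] by simp
qed

text \<open>Some partial derivative of the defining function is nonzero in base coordinates, so the
  projected boundary is locally a smooth graph over the other coordinates. Its lift is the
  chart.\<close>

lemma ex_boundary_chart: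
  assumes p: "p \<in> bdry \<Omega>" and S: "open S" "p \<in> S"
  obtains U \<phi> where "local_parametrization (bdry \<Omega>) (U :: (real ^ 'n) set) \<phi>" "p \<in> \<phi> ` U" "\<phi> ` U \<subseteq> S"
proof -
  obtain U0 \<rho> where N: "defining_function \<Omega> p U0 \<rho>" "open U0" "p \<in> U0" "smooth_on U0 \<rho>"
    "\<And>q. q \<in> U0 \<Longrightarrow> lorentz (ngrad \<rho> q) (ngrad \<rho> q) > 0"
    "\<And>q. q \<in> bdry \<Omega> \<Longrightarrow> q \<in> U0 \<Longrightarrow> \<rho> q = 0"
    by (rule boundary_neighbourhood[OF p]) blast
  let ?a = "snd p" and ?W = "lift -` U0"
  note L = local_function[OF p N(1)]
  define R where "R x = \<rho> (lift x)" for x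
  let ?D = "\<lambda>x u. frechet_derivative \<rho> (at (lift x)) (dlift x u)"
  have dR: "(R has_derivative ?D x) (at x)" if "x \<in> ?W" for x
    using L(6)[OF that] by (simp add: R_def[abs_def])
  have nzD: "\<exists>u. ?D x u \<noteq> 0" if "x \<in> ?W" for x
  proof -
    have t: "ngrad \<rho> (lift x) \<in> hyp_tangent (lift x)" by (rule ngrad_tangent[OF lift_in_hyp_space])
    have "?D x (snd (ngrad \<rho> (lift x))) = lorentz (ngrad \<rho> (lift x)) (ngrad \<rho> (lift x))"
      using lorentz_ngrad[OF defining_functionD(2)[OF N(1)] t] that t[unfolded lift_tangent] by simp
    then show ?thesis using N(5)[of "lift x"] that by (intro exI[of _ "snd (ngrad \<rho> (lift x))"]) simp
  qed
  \<comment> \<open>A zero of R with nonzero derivative has points with R > 0 arbitrarily near, so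
    it is not interior. Hence the frontier in this neighbourhood is the full zero set of R.\<close>
  have front: "x \<in> frontier base \<longleftrightarrow> R x = 0" if x: "x \<in> ?W" for x
  proof
    assume "x \<in> frontier base"
    then have "lift x \<in> bdry \<Omega>" by (simp add: bdry_eq)
    then show "R x = 0" using N(6) x by (simp add: R_def)
  next
    assume R0: "R x = 0"
    then have xb: "x \<in> base" using L(5)[OF x] by (simp add: R_def)
    have "x \<notin> interior base"
    proof
      assume xi: "x \<in> interior base"
      have lin: "linear (?D x)" using dR[OF x] by (rule has_derivative_linear)
      obtain u where "?D x u \<noteq> 0" using nzD[OF x] by blast
      then obtain v where v: "?D x v > 0"
        using linear_neg[OF lin, of u] by (metis linorder_neqE_linordered_idom neg_0_less_iff_less)
      obtain d where d: "d > 0" "\<And>t. 0 < t \<Longrightarrow> t < d \<Longrightarrow> R (x + t *\<^sub>R v) > 0"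
        using directional_sign(2)[OF dR[OF x] R0 v] by blast
      have "open (?W \<inter> interior base)" using L(1) by (intro open_Int open_interior)
      then obtain r where r: "r > 0" "ball x r \<subseteq> ?W \<inter> interior base"
        using x xi open_contains_ball by blast
      have nv: "norm v + 1 > 0" by (simp add: add_nonneg_pos)
      define z where "z = r / (norm v + 1)"
      define t where "t = min d z / 2"
      have t: "0 < t" "t < d" "t < r / (norm v + 1)"
      proof -
        have "z > 0" using r nv by (simp add: z_def)
        then show "0 < t" "t < d" "t < r / (norm v + 1)"
          using d(1) unfolding z_def[symmetric] by (auto simp: t_def)
      qed
      have "t * norm v \<le> t * (norm v + 1)" using t(1) by simp
      also have "\<dots> < r" using t(3) nv by (simp add: less_divide_eq)
      finally have "x + t *\<^sub>R v \<in> ball x r" using t(1) by (simp add: dist_norm)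
      then have y: "x + t *\<^sub>R v \<in> ?W" "x + t *\<^sub>R v \<in> base" using r(2) interior_subset by blast+
      then show False using L(5)[OF y(1)] d(2)[OF t(1,2)] by (simp add: R_def)
    qed
    then show "x \<in> frontier base" using xb closed_base by (simp add: frontier_def)
  qed
  obtain u where "?D ?a u \<noteq> 0" using nzD[OF L(2)] by blast
  then obtain i0 where i0: "?D ?a (axis i0 1) \<noteq> 0"
  proof -
    have lin: "linear (?D ?a)" using dR[OF L(2)] by (rule has_derivative_linear)
    have "?D ?a u = ?D ?a (\<Sum>i\<in>UNIV. u $ i *\<^sub>R axis i 1)"
      using basis_expansion[of u] by (simp add: scalar_mult_eq_scaleR)
    also have "\<dots> = (\<Sum>i\<in>UNIV. u $ i * ?D ?a (axis i 1))"
      by (simp only: linear_sum[OF lin] linear_scale[OF lin] real_scaleR_def)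
    finally show thesis using \<open>?D ?a u \<noteq> 0\<close> that by (metis (no_types, lifting) mult_zero_right sum.neutral)
  qed
  \<comment> \<open>An enumeration of the coordinates other than \<open>i0\<close>; with it
    \<open>J\<close> and \<open>K\<close> translate between graph coordinates and ambient
    ones.\<close>
  obtain b :: "'n \<Rightarrow> 'n option" where b: "bij_betw b UNIV (- {i0})"
  proof -
    have "card (- {i0} :: 'n option set) = card (UNIV :: 'n set)" by (simp add: Compl_eq_Diff_UNIV card_Diff_singleton)
    then show thesis using finite_same_card_bij[of "UNIV :: 'n set" "- {i0}"] that by auto
  qed
  have bi: "b j \<noteq> i0" "inv b (b j) = j" for j
    using b by (auto simp: bij_betw_def)
  have bs: "b (inv b i) = i" if "i \<noteq> i0" for i
    using b that by (metis ComplI bij_betw_def f_inv_into_f singletonD)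
  define J where "J z = (\<chi> i. if i = i0 then snd z else fst z $ inv b i)" for z :: "(real ^ 'n) \<times> real"
  define K where "K y = ((\<chi> j. y $ b j) :: real ^ 'n, y $ i0)" for y
  have JK: "J (K y) = y" "K (J z) = z" for y z
    by (auto simp: J_def K_def vec_eq_iff bs bi prod_eq_iff)
  have linJ: "linear J" and linK: "linear K"
    by (auto simp: J_def K_def linear_iff vec_eq_iff)
  have blJ: "bounded_linear J" and blK: "bounded_linear K"
    using linJ linK by (simp_all add: linear_conv_bounded_linear)
  have contK: "continuous_on X K" for X by (intro linear_continuous_on blK)
  have contJ: "continuous_on X J" for X by (intro linear_continuous_on blJ)
  define W' where "W' = J -` (?W \<inter> lift -` S)"
  have opW': "open W'"
    unfolding W'_def
    by (intro open_vimage[OF _ contJ] open_Int L(1) open_vimage[OF S(1) continuous_on_lift])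
  have smJ: "smooth_on W' J" by (simp add: smooth_on_def Ck_on_bounded_linear blJ)
  have "smooth_on W' (\<lambda>z. R (J z))"
    by (rule smooth_on_compose[OF opW' L(3)[folded R_def] smJ]) (auto simp: W'_def)
  moreover have "K ?a \<in> W'" using L(2) S(2) bdryD(4)[OF p] by (simp add: W'_def JK)
  moreover have "R (J (K ?a)) = 0" using L(4) by (simp add: JK R_def)
  moreover have "frechet_derivative (\<lambda>z. R (J z)) (at (K ?a)) (0, 1) \<noteq> 0"
  proof -
    have "((\<lambda>z. R (J z)) has_derivative (\<lambda>v. ?D ?a (J v))) (at (K ?a))"
      using diff_chain_at[OF linear_imp_has_derivative[OF linJ], of R "?D ?a" "K ?a"] dR[OF L(2)] by (simp add: o_def JK)
    then have "frechet_derivative (\<lambda>z. R (J z)) (at (K ?a)) (0, 1) = ?D ?a (J (0, 1))"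
      using frechet_derivative_at by metis
    also have "J (0, 1) = axis i0 1" by (simp add: J_def axis_def vec_eq_iff)
    finally show ?thesis using i0 by simp
  qed
  ultimately obtain B U h where B: "open B" "K ?a \<in> B" "B \<subseteq> W'" and U: "open U" "fst (K ?a) \<in> U" and h: "smooth_on U h"
    and g: "\<And>x. x \<in> U \<Longrightarrow> (x, h x) \<in> B" "\<And>x s. (x, s) \<in> B \<Longrightarrow> R (J (x, s)) = 0 \<longleftrightarrow> x \<in> U \<and> s = h x"
    using smooth_implicit_graph[OF opW', of "\<lambda>z. R (J z)" "fst (K ?a)" "snd (K ?a)"] by auto
  define \<phi> where "\<phi> x = lift (J (x, h x))" for x
  have BW: "J z \<in> ?W" "lift (J z) \<in> S" if "z \<in> B" for z using that B(3) by (auto simp: W'_def)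
  have img: "\<phi> ` U = bdry \<Omega> \<inter> (\<lambda>q. K (snd q)) -` B"
  proof
    show "\<phi> ` U \<subseteq> bdry \<Omega> \<inter> (\<lambda>q. K (snd q)) -` B"
    proof
      fix q assume "q \<in> \<phi> ` U"
      then obtain x where x: "x \<in> U" "q = lift (J (x, h x))" by (auto simp: \<phi>_def)
      have "R (J (x, h x)) = 0" using g x(1) by blast
      then have "J (x, h x) \<in> frontier base" using front BW(1)[OF g(1)[OF x(1)]] by blast
      then show "q \<in> bdry \<Omega> \<inter> (\<lambda>q. K (snd q)) -` B" using x g(1) by (auto simp: bdry_eq JK)
    qed
    show "bdry \<Omega> \<inter> (\<lambda>q. K (snd q)) -` B \<subseteq> \<phi> ` U"
    proof
      fix q assume q: "q \<in> bdry \<Omega> \<inter> (\<lambda>q. K (snd q)) -` B"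
      then have qb: "q \<in> bdry \<Omega>" "K (snd q) \<in> B" by auto
      have "snd q \<in> ?W" using BW(1)[OF qb(2)] by (simp add: JK)
      then have "R (J (K (snd q))) = 0" using front bdryD(3)[OF qb(1)] by (simp add: JK)
      then have m: "fst (K (snd q)) \<in> U" "snd (K (snd q)) = h (fst (K (snd q)))"
        using g(2)[of "fst (K (snd q))" "snd (K (snd q))"] qb(2) by auto
      have "\<phi> (fst (K (snd q))) = lift (J (K (snd q)))" unfolding \<phi>_def m(2)[symmetric] by simp
      also have "\<dots> = q" using bdryD(4)[OF qb(1)] by (simp add: JK)
      finally show "q \<in> \<phi> ` U" using m(1) by (metis image_eqI)
    qed
  qed
  \<comment> \<open>This left inverse is linear in the ambient point, so it yields both the
    homeomorphism and the injectivity of the derivative.\<close>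
  have ret: "fst (K (snd (\<phi> x))) = x" for x by (simp add: \<phi>_def JK)
  have sphi: "Ck_on k U \<phi>" for k
  proof -
    have "Ck_on k U (\<lambda>x. (x, h x))"
      using h by (intro Ck_on_Pair[OF U(1) Ck_on_bounded_linear[OF bounded_linear_ident]]) (simp add: smooth_on_def)
    then have "Ck_on k U (\<lambda>x. J (x, h x))"
      by (rule Ck_on_compose[OF U(1) Ck_on_bounded_linear[OF blJ, of k UNIV]]) simp
    then show ?thesis
      unfolding \<phi>_def[abs_def] by (rule Ck_on_compose[OF U(1) Ck_on_lift[OF open_UNIV]]) simp_all
  qed
  have cret: "continuous_on X (\<lambda>q :: 'n minkowski. K (snd q))" for X
    by (rule continuous_on_compose2[OF contK[of UNIV] continuous_on_snd[OF continuous_on_id]]) simp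
  have lp: "local_parametrization (bdry \<Omega>) U \<phi>"
    unfolding local_parametrization_def
  proof (intro conjI ballI)
    show "open U" by (rule U(1))
    show "smooth_on U \<phi>" using sphi by (simp add: smooth_on_def)
    have "open ((\<lambda>q :: 'n minkowski. K (snd q)) -` B)" by (rule open_vimage[OF B(1) cret])
    then show "openin (top_of_set (bdry \<Omega>)) (\<phi> ` U)" unfolding img by (metis openin_open_Int)
    show "\<exists>\<psi>. homeomorphism U (\<phi> ` U) \<phi> \<psi>"
    proof (intro exI[of _ "\<lambda>q. fst (K (snd q))"])
      show "homeomorphism U (\<phi> ` U) \<phi> (\<lambda>q. fst (K (snd q)))"
        unfolding homeomorphism_def
      proof (intro conjI ballI)
        show "(\<lambda>q. fst (K (snd q))) ` \<phi> ` U = U" by (simp add: image_image ret)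
        show "continuous_on U \<phi>" using sphi[of 0] by simp
        show "continuous_on (\<phi> ` U) (\<lambda>q. fst (K (snd q)))" by (intro continuous_on_fst cret)
      qed (auto simp: ret)
    qed
    fix x assume x: "x \<in> U"
    have d: "(\<phi> has_derivative frechet_derivative \<phi> (at x)) (at x)" by (rule Ck_on_SucE(1)[OF sphi[of "Suc 0"] x])
    have "((\<lambda>x. fst (K (snd (\<phi> x)))) has_derivative (\<lambda>v. fst (K (snd (frechet_derivative \<phi> (at x) v))))) (at x)"
      by (intro has_derivative_fst bounded_linear.has_derivative[OF blK] has_derivative_snd d)
    then have "((\<lambda>x. x) has_derivative (\<lambda>v. fst (K (snd (frechet_derivative \<phi> (at x) v))))) (at x)"
      by (simp add: ret)
    from has_derivative_unique[OF this has_derivative_ident]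
    have "fst (K (snd (frechet_derivative \<phi> (at x) v))) = v" for v by (rule fun_cong)
    then show "inj (frechet_derivative \<phi> (at x))" by (metis injI)
  qed
  have "p \<in> \<phi> ` U" unfolding img using p B(2) by simp
  moreover have "\<phi> ` U \<subseteq> S" unfolding \<phi>_def using BW(2) g(1) by auto
  ultimately show thesis using that lp by blast
qed

text \<open>A defining function vanishes along the chart, which puts the range of the derivative
  into the tangent space; equality holds because the dimensions agree.\<close>

lemma chart_derivative_range:
  assumes c: "local_parametrization (bdry \<Omega>) (U :: (real ^ 'n) set) \<phi>" and x: "x \<in> U"
  shows "range (frechet_derivative \<phi> (at x)) = bdry_tangent \<Omega> (\<phi> x)"
proof -
  note C = local_parametrizationD[OF c]
  let ?D = "frechet_derivative \<phi> (at x)"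
  have p: "\<phi> x \<in> bdry \<Omega>" using C(5) x by auto
  obtain V \<rho> where N: "defining_function \<Omega> (\<phi> x) V \<rho>" "open V" "\<phi> x \<in> V"
    "\<And>q. q \<in> bdry \<Omega> \<Longrightarrow> q \<in> V \<Longrightarrow> \<rho> q = 0" "outer_normal \<Omega> (\<phi> x) = unormal \<rho> (\<phi> x)"
    using boundary_neighbourhood[OF p] p by metis
  have sub: "range ?D \<subseteq> bdry_tangent \<Omega> (\<phi> x)"
  proof
    fix w assume "w \<in> range ?D"
    then obtain v where w: "w = ?D v" by auto
    have t: "lorentz (\<phi> x) w = 0"
      unfolding w by (rule local_parametrization_tangent[OF c bdry_subset_hyp_space x])
    have "((\<lambda>y. \<rho> (\<phi> y)) has_derivative (\<lambda>v. frechet_derivative \<rho> (at (\<phi> x)) (?D v))) (at x)"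
      using diff_chain_at[OF C(6)[OF x] defining_functionD(1)[OF N(1,3)]] by (simp add: o_def)
    moreover have "((\<lambda>y. \<rho> (\<phi> y)) has_derivative (\<lambda>v. 0)) (at x)"
    proof (rule has_derivative_transform_within_open[of "\<lambda>y. 0" _ _ _ "U \<inter> \<phi> -` V"])
      show "open (U \<inter> \<phi> -` V)" by (rule continuous_open_preimage[OF C(3,1) N(2)])
      show "0 = \<rho> (\<phi> y)" if y: "y \<in> U \<inter> \<phi> -` V" for y
      proof -
        have "\<phi> y \<in> bdry \<Omega>" "\<phi> y \<in> V" using y C(5) by blast+
        then show ?thesis by (simp add: N(4))
      qed
    qed (use x N(3) in auto)
    ultimately have "(\<lambda>v. frechet_derivative \<rho> (at (\<phi> x)) (?D v)) = (\<lambda>v. 0)" by (rule has_derivative_unique)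
    from fun_cong[OF this, of v] have "frechet_derivative \<rho> (at (\<phi> x)) w = 0" by (simp add: w)
    then have "lorentz (ngrad \<rho> (\<phi> x)) w = 0"
      using lorentz_ngrad[OF defining_functionD(2)[OF N(1,3)], of w] t by (simp add: hyp_tangent_def)
    then show "w \<in> bdry_tangent \<Omega> (\<phi> x)"
      using t by (simp add: bdry_tangent_iff N(5) unormal_def lorentz_simps)
  qed
  have "dim (range ?D) = dim (UNIV :: (real ^ 'n) set)"
    by (rule dim_image_eq[OF C(8)[OF x]]) (use C(7)[OF x] in \<open>simp add: inj_on_subset\<close>)
  then have "dim (bdry_tangent \<Omega> (\<phi> x)) \<le> dim (range ?D)"
    by (simp add: dim_bdry_tangent[OF p] dim_UNIV)
  then show ?thesis
    by (intro subspace_dim_equal sub subspace_bdry_tangent linear_subspace_image C(8)[OF x] subspace_UNIV)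
qed

text \<open>The outward normal is differentiated within the boundary only. Composition with a chart
  makes this an ordinary derivative on an open set, where derivatives are unique.\<close>

lemma derivative_along_chart:
  assumes c: "local_parametrization (bdry \<Omega>) (U :: (real ^ 'n) set) \<phi>" and x: "x \<in> U"
    and f: "(f has_derivative F) (at (\<phi> x) within bdry \<Omega>)"
  shows "((\<lambda>y. f (\<phi> y)) has_derivative (\<lambda>v. F (frechet_derivative \<phi> (at x) v))) (at x)"
proof -
  note C = local_parametrizationD[OF c]
  have "(f has_derivative F) (at (\<phi> x) within \<phi> ` U)"
    by (rule has_derivative_subset[OF f C(5)])
  from diff_chain_within[OF has_derivative_at_withinI[OF C(6)[OF x]] this]
  have "((\<lambda>y. f (\<phi> y)) has_derivative (\<lambda>v. F (frechet_derivative \<phi> (at x) v))) (at x within U)"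
    by (simp add: o_def)
  then show ?thesis using at_within_open[OF x C(1)] by simp
qed

text \<open>Differentiation along a chart of the two relations that say that the normal is tangent
  to hyperbolic space and has unit length. Consequently \<open>hyp_tangent_proj p\<close> does not
  change W v for tangent v.\<close>

lemma shape_tangent:
  assumes p: "p \<in> bdry \<Omega>" and W: "(outer_normal \<Omega> has_derivative W) (at p within bdry \<Omega>)"
    and v: "v \<in> bdry_tangent \<Omega> p"
  shows "lorentz p (W v) = 0" "lorentz (outer_normal \<Omega> p) (W v) = 0"
proof -
  obtain U \<phi> where c: "local_parametrization (bdry \<Omega>) (U :: (real ^ 'n) set) \<phi>" and "p \<in> \<phi> ` U"
    using ex_boundary_chart[OF p open_UNIV] by blast
  then obtain x where x: "x \<in> U" "p = \<phi> x" by auto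
  note C = local_parametrizationD[OF c]
  let ?D = "frechet_derivative \<phi> (at x)" and ?n = "\<lambda>y. outer_normal \<Omega> (\<phi> y)"
  obtain w where w: "v = ?D w" using v chart_derivative_range[OF c x(1)] x(2) by auto
  have dn: "(?n has_derivative (\<lambda>v. W (?D v))) (at x)"
    using derivative_along_chart[OF c x(1), of "outer_normal \<Omega>" W] W x(2) by simp
  have b: "\<phi> y \<in> bdry \<Omega>" if "y \<in> U" for y using C(5) that by blast
  have "((\<lambda>y. lorentz (\<phi> y) (?n y)) has_derivative (\<lambda>v. lorentz (\<phi> x) (W (?D v)) + lorentz (?D v) (?n x))) (at x)"
    by (rule bounded_bilinear.FDERIV[OF lorentz_bilinear C(6)[OF x(1)] dn])
  moreover have "((\<lambda>y. lorentz (\<phi> y) (?n y)) has_derivative (\<lambda>v. 0)) (at x)"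
    by (rule has_derivative_transform_within_open[of "\<lambda>y. 0", OF _ C(1) x(1)])
      (use outer_normal_unit(1)[OF b] in \<open>simp_all add: hyp_tangent_def\<close>)
  ultimately have "(\<lambda>v. lorentz (\<phi> x) (W (?D v)) + lorentz (?D v) (?n x)) = (\<lambda>v. 0)"
    by (rule has_derivative_unique)
  from fun_cong[OF this, of w] have "lorentz p (W v) + lorentz v (outer_normal \<Omega> p) = 0"
    by (simp add: w x(2))
  then show "lorentz p (W v) = 0"
    using v by (simp add: bdry_tangent_iff lorentz_commute[of v])
  have "((\<lambda>y. lorentz (?n y) (?n y)) has_derivative (\<lambda>v. lorentz (?n x) (W (?D v)) + lorentz (W (?D v)) (?n x))) (at x)"
    by (rule bounded_bilinear.FDERIV[OF lorentz_bilinear dn dn])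
  moreover have "((\<lambda>y. lorentz (?n y) (?n y)) has_derivative (\<lambda>v. 0)) (at x)"
    by (rule has_derivative_transform_within_open[of "\<lambda>y. 1", OF _ C(1) x(1)])
      (use outer_normal_unit(2)[OF b] in simp_all)
  ultimately have "(\<lambda>v. lorentz (?n x) (W (?D v)) + lorentz (W (?D v)) (?n x)) = (\<lambda>v. 0)"
    by (rule has_derivative_unique)
  from fun_cong[OF this, of w] show "lorentz (outer_normal \<Omega> p) (W v) = 0"
    by (simp add: w x(2) lorentz_commute[of "W _"])
qed

text \<open>A derivative within a hypersurface is determined in tangential directions only. This
  links the derivative hidden in \<open>are_principal_curvatures\<close> with any other derivative
  of the normal.\<close>

lemma within_derivative_unique:
  assumes p: "p \<in> bdry \<Omega>" and v: "v \<in> bdry_tangent \<Omega> p"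
    and F: "(f has_derivative F) (at p within bdry \<Omega>)" and G: "(f has_derivative G) (at p within bdry \<Omega>)"
  shows "F v = G v"
proof -
  obtain U \<phi> where c: "local_parametrization (bdry \<Omega>) (U :: (real ^ 'n) set) \<phi>" and "p \<in> \<phi> ` U"
    using ex_boundary_chart[OF p open_UNIV] by blast
  then obtain x where x: "x \<in> U" "p = \<phi> x" by auto
  obtain w where w: "v = frechet_derivative \<phi> (at x) w" using v chart_derivative_range[OF c x(1)] x(2) by auto
  have "(\<lambda>v. F (frechet_derivative \<phi> (at x) v)) = (\<lambda>v. G (frechet_derivative \<phi> (at x) v))"
    using derivative_along_chart[OF c x(1)] F G x(2) by (intro has_derivative_unique) blast+
  from fun_cong[OF this, of w] show ?thesis by (simp add: w)
qed

section \<open>Existence of principal curvatures\<close>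

lemma outer_normal_has_derivative:
  assumes p: "p \<in> bdry \<Omega>" and U: "open U" "p \<in> U" "smooth_on U \<rho>"
    "\<And>q. q \<in> U \<Longrightarrow> lorentz (ngrad \<rho> q) (ngrad \<rho> q) > 0"
    "\<And>q. q \<in> bdry \<Omega> \<Longrightarrow> q \<in> U \<Longrightarrow> outer_normal \<Omega> q = unormal \<rho> q"
  shows "(outer_normal \<Omega> has_derivative frechet_derivative (unormal \<rho>) (at p)) (at p within bdry \<Omega>)"
proof -
  obtain e where e: "e > 0" "ball p e \<subseteq> U" using U(1,2) open_contains_ball by blast
  have "(unormal \<rho> has_derivative frechet_derivative (unormal \<rho>) (at p)) (at p)"
    by (rule Ck_on_SucE(1)[OF Ck_on_unormal[OF U(1,3,4), of "Suc 0"] U(2)])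
  then show ?thesis
  proof (rule has_derivative_transform_within[OF has_derivative_at_withinI e(1) p])
    show "unormal \<rho> q = outer_normal \<Omega> q" if q: "q \<in> bdry \<Omega>" "dist q p < e" for q
    proof -
      have "q \<in> U" using e(2) q(2) by (auto simp: dist_commute)
      then show ?thesis using U(5)[OF q(1)] by simp
    qed
  qed
qed

text \<open>The choice in \<open>principal_curvatures\<close> needs a witness. Up to scaling and a
  multiple of the metric the shape operator is the Hessian of a defining function, so it is
  self-adjoint, and the Lorentz form is positive on the tangent space.\<close>

lemma ex_principal_curvatures:
  assumes p: "p \<in> bdry \<Omega>"
  shows "\<exists>\<kappa>. are_principal_curvatures \<Omega> p \<kappa>"
proof -
  obtain U \<rho> where U: "open U" "p \<in> U" "smooth_on U \<rho>"
    "\<And>q. q \<in> U \<Longrightarrow> lorentz (ngrad \<rho> q) (ngrad \<rho> q) > 0"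
    "\<And>q. q \<in> bdry \<Omega> \<Longrightarrow> q \<in> U \<Longrightarrow> outer_normal \<Omega> q = unormal \<rho> q"
    by (rule boundary_neighbourhood[OF p]) blast
  note h = bdryD(1)[OF p]
  let ?W = "frechet_derivative (unormal \<rho>) (at p)" and ?T = "bdry_tangent \<Omega> p"
  have dW: "(outer_normal \<Omega> has_derivative ?W) (at p within bdry \<Omega>)"
    by (rule outer_normal_has_derivative[OF p U])
  have linW: "linear ?W" using dW by (rule has_derivative_linear)
  define S where "S u = hyp_tangent_proj p (?W u)" for u
  have linS: "linear S"
    by (auto simp: S_def hyp_tangent_proj_def linear_iff linear_add[OF linW] linear_scale[OF linW] lorentz_simps algebra_simps)
  have SW: "S v = ?W v" if "v \<in> ?T" for v
    using shape_tangent(1)[OF p dW that] by (simp add: S_def hyp_tangent_proj_def)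
  have ST: "S v \<in> ?T" if "v \<in> ?T" for v
    using shape_tangent[OF p dW that] by (simp add: SW[OF that] bdry_tangent_iff)
  have Nw: "lorentz (ngrad \<rho> p) w = 0" if "w \<in> ?T" for w
  proof -
    have "inv_norm \<rho> p * lorentz (ngrad \<rho> p) w = 0"
      using that U(5)[OF p U(2)] by (simp add: bdry_tangent_iff unormal_def lorentz_simps)
    moreover have "inv_norm \<rho> p \<noteq> 0" using U(4)[OF U(2)] by (simp add: inv_norm_def)
    ultimately show ?thesis by simp
  qed
  have "Ck_on (Suc (Suc 0)) U \<rho>" using U(3) by (simp only: smooth_on_def)
  note sym = second_derivative_symmetric[OF this U(1,2)]
  have sh: "lorentz (?W u) w = inv_norm \<rho> p * (frechet_derivative (\<lambda>q. frechet_derivative \<rho> (at q) w) (at p) u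
        + lorentz p (rgrad \<rho> p) * lorentz u w)" if "w \<in> ?T" for u w
    using that Nw[OF that] by (intro shape_hessian[OF U(1,3,2,4)]) (simp_all add: bdry_tangent_iff)
  have symS: "lorentz (S u) v = lorentz u (S v)" if "u \<in> ?T" "v \<in> ?T" for u v
    using sh[OF that(1), of v] sh[OF that(2), of u] sym[of u v] that
    by (simp add: SW lorentz_commute[of u v] lorentz_commute[of u "?W v"])
  have "\<exists>E k. finite E \<and> card E = dim ?T \<and> E \<subseteq> ?T \<and> (\<forall>u\<in>E. \<forall>v\<in>E. lorentz u v = (if u = v then 1 else 0))
    \<and> (\<forall>u\<in>E. S u = k u *\<^sub>R u)"
  proof (rule orthonormal_eigenbasis[OF lorentz_bilinear lorentz_commute linS subspace_bdry_tangent])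
    show "0 < lorentz v v" if "v \<in> ?T" "v \<noteq> 0" for v
      using that lorentz_tangent_pos[OF h] by (simp add: bdry_tangent_iff)
  qed (use ST symS in auto)
  then obtain E k where E: "finite E" "card E = CARD('n)" "E \<subseteq> ?T"
    "\<And>u v. u \<in> E \<Longrightarrow> v \<in> E \<Longrightarrow> lorentz u v = (if u = v then 1 else 0)" "\<And>u. u \<in> E \<Longrightarrow> S u = k u *\<^sub>R u"
    unfolding dim_bdry_tangent[OF p] by blast
  obtain e :: "'n \<Rightarrow> 'n minkowski" where e: "bij_betw e UNIV E"
    using finite_same_card_bij[of "UNIV :: 'n set" E] E(1,2) by auto
  have eE: "e i \<in> E" for i using e by (auto simp: bij_betw_def)
  have ei: "e i = e j \<longleftrightarrow> i = j" for i j using e by (auto simp: bij_betw_def inj_eq)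
  have "are_principal_curvatures \<Omega> p (\<chi> i. k (e i))"
    unfolding are_principal_curvatures_def
  proof (intro exI[of _ ?W] exI[of _ e] conjI allI)
    show "(outer_normal \<Omega> has_derivative ?W) (at p within bdry \<Omega>)" by (rule dW)
    show "e i \<in> bdry_tangent \<Omega> p" for i using E(3) eE by blast
    show "lorentz (e i) (e j) = (if i = j then 1 else 0)" for i j
      using E(4)[OF eE eE] by (simp add: ei)
    show "hyp_tangent_proj p (?W (e i)) = (\<chi> i. k (e i)) $ i *\<^sub>R e i" for i
      using E(5)[OF eE[of i]] by (simp add: S_def)
  qed
  then show ?thesis by blast
qed

lemma curvature_frame:
  assumes p: "p \<in> bdry \<Omega>"
  obtains W and e :: "'n \<Rightarrow> 'n minkowski" where "(outer_normal \<Omega> has_derivative W) (at p within bdry \<Omega>)"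
    "\<And>i. e i \<in> bdry_tangent \<Omega> p" "\<And>i j. lorentz (e i) (e j) = (if i = j then 1 else 0)"
    "\<And>i. W (e i) = principal_curvatures \<Omega> p $ i *\<^sub>R e i"
proof -
  have "are_principal_curvatures \<Omega> p (principal_curvatures \<Omega> p)"
    unfolding principal_curvatures_def by (rule someI_ex[OF ex_principal_curvatures[OF p]])
  then obtain W and e :: "'n \<Rightarrow> 'n minkowski" where W: "(outer_normal \<Omega> has_derivative W) (at p within bdry \<Omega>)"
    and e: "\<And>i. e i \<in> bdry_tangent \<Omega> p" "\<And>i j. lorentz (e i) (e j) = (if i = j then 1 else 0)"
    "\<And>i. hyp_tangent_proj p (W (e i)) = principal_curvatures \<Omega> p $ i *\<^sub>R e i"
    unfolding are_principal_curvatures_def by blast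
  have "W (e i) = principal_curvatures \<Omega> p $ i *\<^sub>R e i" for i
    using e(3)[of i] shape_tangent(1)[OF p W e(1)[of i]] by (simp add: hyp_tangent_proj_def)
  then show thesis using that W e(1,2) by blast
qed

text \<open>Orthonormal vectors are independent, and their number is the dimension of the tangent
  space.\<close>

lemma frame_expansion:
  fixes e :: "'n \<Rightarrow> 'n minkowski"
  assumes p: "p \<in> bdry \<Omega>" and e: "\<And>i. e i \<in> bdry_tangent \<Omega> p"
    "\<And>i j. lorentz (e i) (e j) = (if i = j then 1 else 0)"
    and v: "v \<in> bdry_tangent \<Omega> p"
  shows "v = (\<Sum>i\<in>UNIV. lorentz (e i) v *\<^sub>R e i)"
proof -
  let ?f = "\<lambda>c :: real ^ 'n. \<Sum>i\<in>UNIV. c $ i *\<^sub>R e i"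
  have co: "lorentz (e j) (?f c) = c $ j" for c j
    by (simp add: lorentz_sum_right lorentz_simps e(2) if_distrib cong: if_cong)
  have lin: "linear ?f"
    by (simp add: linear_iff scaleR_add_left sum.distrib scaleR_sum_right)
  have "inj ?f"
  proof (rule injI)
    fix c d assume "?f c = ?f d"
    then have "lorentz (e j) (?f c) = lorentz (e j) (?f d)" for j by simp
    then show "c = d" by (simp only: co vec_eq_iff) simp
  qed
  then have "dim (range ?f) = dim (UNIV :: (real ^ 'n) set)"
    by (intro dim_image_eq lin) (simp add: inj_on_subset)
  then have d: "dim (bdry_tangent \<Omega> p) \<le> dim (range ?f)"
    by (simp add: dim_bdry_tangent[OF p])
  have "range ?f = bdry_tangent \<Omega> p"
  proof (rule subspace_dim_equal[OF _ subspace_bdry_tangent _ d])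
    show "subspace (range ?f)" by (rule linear_subspace_image[OF lin subspace_UNIV])
    show "range ?f \<subseteq> bdry_tangent \<Omega> p"
      using e(1) by (auto intro!: subspace_sum[OF subspace_bdry_tangent] subspace_scale[OF subspace_bdry_tangent])
  qed
  then obtain c where "v = ?f c" using v by blast
  then show ?thesis using co by simp
qed

end

section \<open>Strict convexity\<close>

text \<open>Reduction to finitely many basis directions lets limits in the point and in the
  direction be taken term by term.\<close>

lemma second_directional_derivative:
  fixes R :: "'a::euclidean_space \<Rightarrow> real"
  assumes W: "open W" "smooth_on W R" and z: "z \<in> W"
  shows "frechet_derivative R (at z) u = (\<Sum>b\<in>Basis. (u \<bullet> b) * frechet_derivative R (at z) b)"
    and "((\<lambda>x. frechet_derivative R (at x) u) has_derivative (\<lambda>w. \<Sum>b\<in>Basis. (u \<bullet> b) *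
        (\<Sum>c\<in>Basis. (w \<bullet> c) * frechet_derivative (\<lambda>x. frechet_derivative R (at x) b) (at z) c))) (at z)"
proof -
  have ex: "D u = (\<Sum>b\<in>Basis. (u \<bullet> b) * D b)" if "linear D" for D :: "'a \<Rightarrow> real" and u
    using linear_sum[OF that, of "\<lambda>b. (u \<bullet> b) *\<^sub>R b" Basis]
    by (simp add: euclidean_representation linear_scale[OF that])
  have 1: "frechet_derivative R (at x) u = (\<Sum>b\<in>Basis. (u \<bullet> b) * frechet_derivative R (at x) b)" if "x \<in> W" for x u
    by (rule ex[OF has_derivative_linear[OF smooth_on_has_derivative[OF W(2) that]]])
  show "frechet_derivative R (at z) u = (\<Sum>b\<in>Basis. (u \<bullet> b) * frechet_derivative R (at z) b)" by (rule 1[OF z])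
  have d: "((\<lambda>x. frechet_derivative R (at x) b) has_derivative frechet_derivative (\<lambda>x. frechet_derivative R (at x) b) (at z)) (at z)" for b
    by (rule smooth_on_has_derivative[OF smooth_on_derivative[OF W(2)] z])
  have e: "frechet_derivative (\<lambda>x. frechet_derivative R (at x) b) (at z) w
      = (\<Sum>c\<in>Basis. (w \<bullet> c) * frechet_derivative (\<lambda>x. frechet_derivative R (at x) b) (at z) c)" for b w
    by (rule ex[OF has_derivative_linear[OF d]])
  have "((\<lambda>x. \<Sum>b\<in>Basis. (u \<bullet> b) * frechet_derivative R (at x) b) has_derivative
      (\<lambda>w. \<Sum>b\<in>Basis. (u \<bullet> b) * frechet_derivative (\<lambda>x. frechet_derivative R (at x) b) (at z) w)) (at z)"
    by (intro has_derivative_sum has_derivative_mult_right d)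
  then have "((\<lambda>x. \<Sum>b\<in>Basis. (u \<bullet> b) * frechet_derivative R (at x) b) has_derivative
      (\<lambda>w. \<Sum>b\<in>Basis. (u \<bullet> b) *
        (\<Sum>c\<in>Basis. (w \<bullet> c) * frechet_derivative (\<lambda>x. frechet_derivative R (at x) b) (at z) c))) (at z)"
    by (rule has_derivative_eq_rhs) (intro ext sum.cong refl arg_cong[of _ _ "(*) _"] e)
  then show "((\<lambda>x. frechet_derivative R (at x) u) has_derivative (\<lambda>w. \<Sum>b\<in>Basis. (u \<bullet> b) *
        (\<Sum>c\<in>Basis. (w \<bullet> c) * frechet_derivative (\<lambda>x. frechet_derivative R (at x) b) (at z) c))) (at z)"
    by (rule has_derivative_transform_within_open[OF _ W(1) z]) (simp add: 1)
qed

text \<open>The second derivative taken twice in direction u. The coordinate form is continuous in z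
  and u jointly wherever R is smooth.\<close>

definition hess :: "('a::euclidean_space \<Rightarrow> real) \<Rightarrow> 'a \<Rightarrow> 'a \<Rightarrow> real" where
  "hess R z u = (\<Sum>b\<in>Basis. (u \<bullet> b) * (\<Sum>c\<in>Basis. (u \<bullet> c) * frechet_derivative (\<lambda>x. frechet_derivative R (at x) b) (at z) c))"

lemma hess_eqI:
  assumes "open W" "smooth_on W R" "z \<in> W" "((\<lambda>x. frechet_derivative R (at x) u) has_derivative D) (at z)"
  shows "hess R z u = D u"
  using has_derivative_unique[OF assms(4) second_directional_derivative(2)[OF assms(1-3), of u]]
  by (simp add: hess_def)

text \<open>A point where the function is critical along a segment with positive second derivative is
  not a maximum along the segment, so that sublevel sets are locally strictly convex.\<close>

definition strictly_quasiconvex_on :: "'a::euclidean_space set \<Rightarrow> ('a \<Rightarrow> real) \<Rightarrow> bool" where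
  "strictly_quasiconvex_on W R \<longleftrightarrow>
    (\<forall>z\<in>W. \<forall>u. u \<noteq> 0 \<longrightarrow> frechet_derivative R (at z) u = 0 \<longrightarrow> hess R z u > 0)"

text \<open>Otherwise there are violating points ever closer to a, each with a violating direction.
  After normalisation of the directions, a limit direction violates the hypothesis at a.\<close>

lemma quasiconvex_neighbourhood:
  fixes R :: "'a::euclidean_space \<Rightarrow> real"
  assumes W: "open W" "smooth_on W R" and a: "a \<in> W"
    and pos: "\<And>u. u \<noteq> 0 \<Longrightarrow> frechet_derivative R (at a) u = 0 \<Longrightarrow> hess R a u > 0"
  obtains r where "r > 0" "ball a r \<subseteq> W" "strictly_quasiconvex_on (ball a r) R"
proof -
  obtain r0 where r0: "r0 > 0" "ball a r0 \<subseteq> W" using W(1) a open_contains_ball by blast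
  have "\<exists>r>0. r \<le> r0 \<and> strictly_quasiconvex_on (ball a r) R"
  proof (rule ccontr)
    assume no: "\<not> ?thesis"
    have "\<exists>z u. z \<in> ball a (r0 / (real n + 1)) \<and> u \<noteq> 0 \<and> frechet_derivative R (at z) u = 0 \<and> hess R z u \<le> 0" for n :: nat
    proof -
      have "r0 / (real n + 1) > 0" "r0 / (real n + 1) \<le> r0"
        using r0(1) by (simp_all add: divide_le_eq)
      then have "\<not> strictly_quasiconvex_on (ball a (r0 / (real n + 1))) R" using no by blast
      then show ?thesis unfolding strictly_quasiconvex_on_def by (auto simp: not_less)
    qed
    then obtain z u where zu: "\<And>n. z n \<in> ball a (r0 / (real n + 1))" "\<And>n. u n \<noteq> 0"
      "\<And>n. frechet_derivative R (at (z n)) (u n) = 0" "\<And>n. hess R (z n) (u n) \<le> 0"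
      by metis
    have zW: "z n \<in> W" for n
    proof -
      have "r0 / (real n + 1) \<le> r0" using r0(1) by (simp add: divide_le_eq)
      then show ?thesis using zu(1)[of n] r0(2) by auto
    qed
    have "z \<longlonglongrightarrow> a"
    proof (rule metric_LIMSEQ_I)
      fix e :: real assume e: "e > 0"
      obtain N :: nat where N: "r0 / e < real N" using reals_Archimedean2 by blast
      have "dist (z n) a < e" if "n \<ge> N" for n
      proof -
        have "r0 / e < real n + 1" using N that by linarith
        then have "r0 / (real n + 1) < e" using e by (simp add: field_simps)
        then show ?thesis using zu(1)[of n] by (simp add: dist_commute)
      qed
      then show "\<exists>N. \<forall>n\<ge>N. dist (z n) a < e" by blast
    qed
    define v where "v n = (1 / norm (u n)) *\<^sub>R u n" for n
    have "\<forall>n. v n \<in> sphere 0 1" using zu(2) by (simp add: v_def)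
    then obtain w f where w: "w \<in> sphere 0 1" "strict_mono f" "(v \<circ> f) \<longlonglongrightarrow> w"
      using compact_sphere[of "0::'a" 1] unfolding compact_def by metis
    have lz: "(\<lambda>n. z (f n)) \<longlonglongrightarrow> a" using LIMSEQ_subseq_LIMSEQ[OF \<open>z \<longlonglongrightarrow> a\<close> w(2)] by (simp add: o_def)
    have lv: "(\<lambda>n. v (f n)) \<longlonglongrightarrow> w" using w(3) by (simp add: o_def)
    have c1: "(\<lambda>n. frechet_derivative R (at (z (f n))) b) \<longlonglongrightarrow> frechet_derivative R (at a) b" for b
    proof -
      have "continuous_on W (\<lambda>x. frechet_derivative R (at x) b)"
        by (rule smooth_on_continuous_on[OF smooth_on_derivative[OF W(2)]])
      then show ?thesis by (rule continuous_on_tendsto_compose[OF _ lz a]) (simp add: zW)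
    qed
    have c2: "(\<lambda>n. frechet_derivative (\<lambda>x. frechet_derivative R (at x) b) (at (z (f n))) c)
        \<longlonglongrightarrow> frechet_derivative (\<lambda>x. frechet_derivative R (at x) b) (at a) c" for b c
    proof -
      have "continuous_on W (\<lambda>y. frechet_derivative (\<lambda>x. frechet_derivative R (at x) b) (at y) c)"
        by (rule smooth_on_continuous_on[OF smooth_on_derivative[OF smooth_on_derivative[OF W(2)]]])
      then show ?thesis by (rule continuous_on_tendsto_compose[OF _ lz a]) (simp add: zW)
    qed
    have "(\<lambda>n. frechet_derivative R (at (z (f n))) (v (f n))) \<longlonglongrightarrow> frechet_derivative R (at a) w"
      unfolding second_directional_derivative(1)[OF W zW, of _ "v _"] second_directional_derivative(1)[OF W a, of w]
      by (intro tendsto_sum tendsto_mult tendsto_inner lv tendsto_const c1)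
    moreover have "frechet_derivative R (at (z n)) (v n) = 0" for n
      using zu(3)[of n] linear_scale[OF has_derivative_linear[OF smooth_on_has_derivative[OF W(2) zW[of n]]]]
      by (simp add: v_def)
    ultimately have D0: "frechet_derivative R (at a) w = 0" by (simp add: LIMSEQ_const_iff)
    have "(\<lambda>n. hess R (z (f n)) (v (f n))) \<longlonglongrightarrow> hess R a w"
      unfolding hess_def by (intro tendsto_sum tendsto_mult tendsto_inner lv tendsto_const c2)
    moreover have "hess R (z n) (v n) \<le> 0" for n
    proof -
      have "hess R (z n) (v n) = (1 / norm (u n)) * (1 / norm (u n)) * hess R (z n) (u n)"
        by (simp add: hess_def v_def sum_distrib_left mult.assoc)
      moreover have "0 \<le> (1 / norm (u n)) * (1 / norm (u n))" by simp
      ultimately show ?thesis using zu(4)[of n] by (simp only: mult_nonneg_nonpos)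
    qed
    ultimately have "hess R a w \<le> 0" by (intro LIMSEQ_le_const2[of _ "hess R a w" 0]) auto
    then show False using pos[of w] D0 w(1) by fastforce
  qed
  then obtain r where "r > 0" "r \<le> r0" "strictly_quasiconvex_on (ball a r) R" by blast
  moreover then have "ball a r \<subseteq> W" using r0(2) by auto
  ultimately show thesis using that by blast
qed

text \<open>The derivative vanishes at t and is positive just to the right of it, so g increases
  there.\<close>

lemma not_interior_maximum:
  fixes g :: "real \<Rightarrow> real"
  assumes d: "\<And>s. s \<in> {l<..<u} \<Longrightarrow> (g has_real_derivative g' s) (at s)" and t: "t \<in> {l<..<u}" "g' t = 0"
    and dd: "(g' has_real_derivative c) (at t)" "c > 0"
  shows "\<exists>s\<in>{l<..<u}. g s > g t"
proof -
  obtain e where e: "e > 0" "\<And>h. 0 < h \<Longrightarrow> h < e \<Longrightarrow> g' t < g' (t + h)"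
    using DERIV_pos_inc_right[OF dd] by blast
  define h where "h = min e (u - t) / 2"
  have h: "0 < h" "h < e" "t + h < u" using e(1) t(1) by (auto simp: h_def min_def field_simps)
  have "t < t + h" using h by simp
  moreover have "(g has_real_derivative g' s) (at s)" if "t \<le> s" "s \<le> t + h" for s
    by (rule d) (use that t(1) h in auto)
  ultimately have "\<exists>s. t < s \<and> s < t + h \<and> g (t + h) - g t = (t + h - t) * g' s"
    by (rule MVT2)
  then obtain s where s: "t < s" "s < t + h" "g (t + h) - g t = (t + h - t) * g' s" by blast
  have "g' s > 0" using e(2)[of "s - t"] s h t(2) by simp
  then have "h * g' s > 0" using h(1) by simp
  then have "g (t + h) > g t" using s(3) by simp
  then show ?thesis using h t(1) by (intro bexI[of _ "t + h"]) auto
qed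

text \<open>A maximum of R along the segment cannot be attained strictly inside, so the maximum is
  attained at an end and is at most 0. An inner point with value 0 would be an inner
  maximum.\<close>

lemma strictly_quasiconvex_segment:
  fixes R :: "'a::euclidean_space \<Rightarrow> real"
  assumes W: "open W" "smooth_on W R" "strictly_quasiconvex_on W R" and seg: "closed_segment x y \<subseteq> W"
    and xy: "x \<noteq> y" "R x \<le> 0" "R y \<le> 0" and t: "0 < t" "t < 1"
  shows "R (x + t *\<^sub>R (y - x)) < 0"
proof -
  let ?u = "y - x"
  define g where "g s = R (x + s *\<^sub>R ?u)" for s
  define g' where "g' s = frechet_derivative R (at (x + s *\<^sub>R ?u)) ?u" for s
  have inW: "x + s *\<^sub>R ?u \<in> W" if "0 \<le> s" "s \<le> 1" for s
  proof -
    have "x + s *\<^sub>R ?u \<in> closed_segment x y"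
      unfolding closed_segment_def using that by (intro CollectI exI[of _ s]) (simp add: algebra_simps)
    then show ?thesis using seg by blast
  qed
  have line: "((\<lambda>s. x + s *\<^sub>R ?u) has_derivative (\<lambda>c. c *\<^sub>R ?u)) (at s)" for s
    by (auto intro!: derivative_eq_intros)
  have dg: "(g has_real_derivative g' s) (at s)" if "0 \<le> s" "s \<le> 1" for s
  proof -
    note d = smooth_on_has_derivative[OF W(2) inW[OF that]]
    have "(g has_derivative (\<lambda>c. frechet_derivative R (at (x + s *\<^sub>R ?u)) (c *\<^sub>R ?u))) (at s)"
      using diff_chain_at[OF line d] by (simp add: g_def[abs_def] o_def)
    then show ?thesis
      unfolding has_field_derivative_def
      by (rule has_derivative_eq_rhs) (simp add: fun_eq_iff g'_def linear_scale[OF has_derivative_linear[OF d]] mult.commute)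
  qed
  have dg': "(g' has_real_derivative hess R (x + s *\<^sub>R ?u) ?u) (at s)" if "0 \<le> s" "s \<le> 1" for s
  proof -
    note d = second_directional_derivative(2)[OF W(1,2) inW[OF that], of ?u]
    have "(g' has_derivative (\<lambda>c. \<Sum>b\<in>Basis. (?u \<bullet> b) * (\<Sum>e\<in>Basis. ((c *\<^sub>R ?u) \<bullet> e) *
        frechet_derivative (\<lambda>x. frechet_derivative R (at x) b) (at (x + s *\<^sub>R ?u)) e))) (at s)"
      using diff_chain_at[OF line d] by (simp add: g'_def[abs_def] o_def)
    then show ?thesis
      unfolding has_field_derivative_def
      by (rule has_derivative_eq_rhs) (simp add: fun_eq_iff hess_def sum_distrib_left sum_distrib_right mult_ac)
  qed
  have "continuous_on {0..1} g"
    using dg by (intro continuous_at_imp_continuous_on ballI DERIV_isCont) auto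
  then obtain m where m: "m \<in> {0..1}" "\<And>s. s \<in> {0..1} \<Longrightarrow> g s \<le> g m"
    using continuous_attains_sup[of "{0..1::real}" g] by auto
  have no: "\<not> (0 < s \<and> s < 1 \<and> (\<forall>r\<in>{0..1}. g r \<le> g s))" for s
  proof
    assume s: "0 < s \<and> s < 1 \<and> (\<forall>r\<in>{0..1}. g r \<le> g s)"
    have "g' s = 0"
    proof (rule DERIV_local_max[OF dg])
      show "0 < min s (1 - s)" using s by simp
      show "\<forall>r. \<bar>s - r\<bar> < min s (1 - s) \<longrightarrow> g r \<le> g s"
      proof (intro allI impI)
        fix r assume "\<bar>s - r\<bar> < min s (1 - s)"
        then have "r \<in> {0..1}" by auto
        then show "g r \<le> g s" using s by blast
      qed
    qed (use s in auto)
    moreover have "hess R (x + s *\<^sub>R ?u) ?u > 0"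
      using W(3) inW[of s] s xy(1) calculation unfolding strictly_quasiconvex_on_def g'_def by simp
    ultimately have "\<exists>r\<in>{0<..<1}. g r > g s"
      using s by (intro not_interior_maximum[of 0 1 g g' s "hess R (x + s *\<^sub>R ?u) ?u"] dg dg') auto
    then obtain r where r: "0 < r" "r < 1" "g s < g r" by auto
    have "g r \<le> g s" using s r by simp
    then show False using r by simp
  qed
  have "m = 0 \<or> m = 1" using no[of m] m by auto
  then have "g m \<le> 0" using xy by (auto simp: g_def)
  then have "g t \<le> 0" using m(2)[of t] t by auto
  moreover have "g t \<noteq> 0"
  proof
    assume "g t = 0"
    then have "\<forall>r\<in>{0..1}. g r \<le> g t" using m(2) \<open>g m \<le> 0\<close> by force
    then show False using no t by blast
  qed
  ultimately show ?thesis by (simp add: g_def)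
qed

text \<open>The argument of Tietze and Nakajima: the pairs of points whose segment stays inside form a
  set that is both open and closed.\<close>

lemma connected_locally_strictly_convex:
  fixes A :: "'a::euclidean_space set"
  assumes A: "closed A" "connected A"
    and loc: "\<And>x. x \<in> A \<Longrightarrow> \<exists>r>0. \<forall>y\<in>A \<inter> ball x r. \<forall>z\<in>A \<inter> ball x r. closed_segment y z \<subseteq> A"
    and strict: "\<And>x y. x \<in> A \<Longrightarrow> y \<in> A \<Longrightarrow> x \<noteq> y \<Longrightarrow> closed_segment x y \<subseteq> A \<Longrightarrow> open_segment x y \<subseteq> interior A"
  shows "convex A"
proof (cases "A = {}")
  case False
  define S where "S = {(x, y). x \<in> A \<and> y \<in> A \<and> closed_segment x y \<subseteq> A}"
  \<comment> \<open>For each parameter t the point at t depends continuously on the pair, so S is an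
    intersection of closed sets.\<close>
  have Seq: "S = (A \<times> A) \<inter> (\<Inter>t\<in>{0..1}. (\<lambda>q. (1 - t) *\<^sub>R fst q + t *\<^sub>R snd q) -` A)"
    unfolding S_def closed_segment_image_interval by auto
  have "closed S"
    unfolding Seq using A(1)
    by (intro closed_Int closed_Times closed_INT ballI closed_vimage continuous_intros) auto
  then have cl: "closedin (top_of_set (A \<times> A)) S"
    by (rule closed_subset[rotated]) (auto simp: S_def)
  have op: "openin (top_of_set (A \<times> A)) S"
    unfolding openin_euclidean_subtopology_iff
  proof (intro conjI ballI)
    show "S \<subseteq> A \<times> A" by (auto simp: S_def)
    fix q assume "q \<in> S"
    then obtain x y where q: "q = (x, y)" and xy: "x \<in> A" "y \<in> A" "closed_segment x y \<subseteq> A" by (auto simp: S_def)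
    obtain rx where rx: "rx > 0" "\<And>u v. u \<in> A \<inter> ball x rx \<Longrightarrow> v \<in> A \<inter> ball x rx \<Longrightarrow> closed_segment u v \<subseteq> A"
      using loc[OF xy(1)] by blast
    obtain ry where ry: "ry > 0" "\<And>u v. u \<in> A \<inter> ball y ry \<Longrightarrow> v \<in> A \<inter> ball y ry \<Longrightarrow> closed_segment u v \<subseteq> A"
      using loc[OF xy(2)] by blast
    have comp: "dist x' x < e" "dist y' y < e" if "dist (x', y') (x, y) < e" for x' y' e
      using that dist_fst_le[of "(x', y')" "(x, y)"] dist_snd_le[of "(x', y')" "(x, y)"] by auto
    show "\<exists>e>0. \<forall>q'\<in>A \<times> A. dist q' q < e \<longrightarrow> q' \<in> S"
    proof (cases "x = y")
      case True
      have "(x', y') \<in> S" if "x' \<in> A" "y' \<in> A" "dist (x', y') (x, y) < rx" for x' y'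
        using rx(2)[of x' y'] comp[OF that(3)] that True by (auto simp: S_def dist_commute)
      then show ?thesis using rx(1) q by (intro exI[of _ rx]) auto
    next
      case False
      define d where "d = norm (y - x)"
      have d: "d > 0" using False by (simp add: d_def)
      define m where "m = min rx ry / 2"
      have m: "m > 0" "2 * m \<le> rx" "2 * m \<le> ry" using rx(1) ry(1) by (auto simp: m_def)
      \<comment> \<open>The end parts of the segment, up to parameter c, have length at most m and
        stay where local convexity applies; the middle part lies in the interior by strictness. The
        bound 1/3 keeps c below 1 - c.\<close>
      define c where "c = min (1/3) (m / d)"
      have c: "c > 0" "c \<le> 1/3" "c * d \<le> m"
      proof -
        show "c > 0" using m d by (simp add: c_def)
        show "c \<le> 1/3" unfolding c_def by (rule min.cobounded1)
        have "c * d \<le> m / d * d" using d by (intro mult_right_mono) (auto simp: c_def)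
        then show "c * d \<le> m" using d by simp
      qed
      let ?p = "\<lambda>x y t. (1 - t) *\<^sub>R x + t *\<^sub>R y"
      define K where "K = ?p x y ` {c..1 - c}"
      have "compact K"
        unfolding K_def by (intro compact_continuous_image continuous_intros) auto
      moreover have "K \<subseteq> interior A"
      proof -
        have "K \<subseteq> open_segment x y"
        proof
          fix k assume "k \<in> K"
          then obtain t where t: "c \<le> t" "t \<le> 1 - c" "k = ?p x y t" by (auto simp: K_def)
          then have "0 < t" "t < 1" using c(1) by linarith+
          then show "k \<in> open_segment x y" using False t(3) unfolding in_segment by blast
        qed
        then show ?thesis using strict[OF xy(1,2) False xy(3)] by blast
      qed
      ultimately obtain e where e: "e > 0" "\<And>k. k \<in> K \<Longrightarrow> ball k e \<subseteq> interior A"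
        using compact_subset_open_imp_ball_epsilon_subset[of K "interior A"] open_interior by (metis UN_subset_iff)
      \<comment> \<open>When both ends move by less than f, the middle part stays within e of K and
        the end parts within 2 * m of x and y.\<close>
      define f where "f = min e m"
      have f: "f > 0" using e m by (simp add: f_def)
      have "(x', y') \<in> S" if A': "x' \<in> A" "y' \<in> A" and ds: "dist (x', y') (x, y) < f" for x' y'
      proof -
        have near: "dist (?p x' y' t) (?p x y t) < f" if "0 \<le> t" "t \<le> 1" for t
        proof -
          have "?p x' y' t - ?p x y t = (1 - t) *\<^sub>R (x' - x) + t *\<^sub>R (y' - y)" by (simp add: algebra_simps)
          then have "dist (?p x' y' t) (?p x y t) \<le> (1 - t) * dist x' x + t * dist y' y"
            using norm_triangle_ineq[of "(1 - t) *\<^sub>R (x' - x)" "t *\<^sub>R (y' - y)"] that by (simp add: dist_norm)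
          also have "\<dots> < f"
            using comp[OF ds] that by (intro convex_bound_lt) auto
          finally show ?thesis .
        qed
        have mid: "?p x' y' t \<in> A" if "c \<le> t" "t \<le> 1 - c" for t
        proof -
          have "?p x' y' t \<in> ball (?p x y t) e" using near[of t] that c by (auto simp: f_def dist_commute)
          moreover have "?p x y t \<in> K" using that by (auto simp: K_def)
          ultimately show ?thesis using e(2) interior_subset by blast
        qed
        have dx: "dist (?p x y t) x = t * d" "dist (?p x y t) y = (1 - t) * d" if "0 \<le> t" "t \<le> 1" for t
        proof -
          have "?p x y t - x = t *\<^sub>R (y - x)" "?p x y t - y = (1 - t) *\<^sub>R (x - y)" by (simp_all add: algebra_simps)
          then show "dist (?p x y t) x = t * d" "dist (?p x y t) y = (1 - t) * d"
            using that by (simp_all add: dist_norm d_def norm_minus_commute)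
        qed
        have endx: "dist (?p x' y' t) x < rx" if "0 \<le> t" "t \<le> c" for t
        proof -
          have t1: "t \<le> 1" using that c(2) by linarith
          have "dist (?p x' y' t) (?p x y t) < m" using near[OF that(1) t1] by (simp add: f_def)
          moreover have "dist (?p x y t) x \<le> c * d"
            unfolding dx(1)[OF that(1) t1] using that d by (intro mult_right_mono) auto
          ultimately show ?thesis
            using dist_triangle[of "?p x' y' t" x "?p x y t"] c(3) m(2) by linarith
        qed
        have endy: "dist (?p x' y' t) y < ry" if "1 - c \<le> t" "t \<le> 1" for t
        proof -
          have t0: "0 \<le> t" using that c(2) by linarith
          have "dist (?p x' y' t) (?p x y t) < m" using near[OF t0 that(2)] by (simp add: f_def)
          moreover have "dist (?p x y t) y \<le> c * d"
            unfolding dx(2)[OF t0 that(2)] using that d by (intro mult_right_mono) auto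
          ultimately show ?thesis
            using dist_triangle[of "?p x' y' t" y "?p x y t"] c(3) m(3) by linarith
        qed
        have segA: "closed_segment (?p x' y' 0) (?p x' y' c) \<subseteq> A"
          using rx(2)[of "?p x' y' 0" "?p x' y' c"] endx[of 0] endx[of c] mid[of c] A'(1) c by (simp add: dist_commute)
        have segB: "closed_segment (?p x' y' (1 - c)) (?p x' y' 1) \<subseteq> A"
          using ry(2)[of "?p x' y' (1 - c)" "?p x' y' 1"] endy[of 1] endy[of "1 - c"] mid[of "1 - c"] A'(2) c
          by (simp add: dist_commute)
        have "?p x' y' t \<in> A" if "0 \<le> t" "t \<le> 1" for t
        proof -
          consider "t \<le> c" | "c \<le> t" "t \<le> 1 - c" | "1 - c \<le> t" by linarith
          then show ?thesis
          proof cases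
            case 1
            have "?p x' y' t = (1 - t / c) *\<^sub>R ?p x' y' 0 + (t / c) *\<^sub>R ?p x' y' c"
              using c(1) by (simp add: algebra_simps)
            then have "?p x' y' t \<in> closed_segment (?p x' y' 0) (?p x' y' c)"
              unfolding closed_segment_def using 1 c(1) that by (intro CollectI exI[of _ "t / c"]) simp
            then show ?thesis using segA by blast
          next
            case 2
            then show ?thesis by (rule mid)
          next
            case 3
            define r where "r = (t - (1 - c)) / c"
            have r: "0 \<le> r" "r \<le> 1" "r * c = t - (1 - c)" using 3 c(1) that by (auto simp: r_def divide_le_eq)
            have "(1 - r) *\<^sub>R ?p x' y' (1 - c) + r *\<^sub>R ?p x' y' 1 = ?p x' y' (1 - c + r * c)"
              by (simp add: algebra_simps)
            also have "\<dots> = ?p x' y' t" by (simp add: r(3))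
            finally have "?p x' y' t \<in> closed_segment (?p x' y' (1 - c)) (?p x' y' 1)"
              unfolding closed_segment_def using r(1,2) by (intro CollectI exI[of _ r]) simp
            then show ?thesis using segB by blast
          qed
        qed
        then have "closed_segment x' y' \<subseteq> A" unfolding closed_segment_def by blast
        then show ?thesis using A' by (simp add: S_def)
      qed
      then have "\<forall>q'\<in>A \<times> A. dist q' q < f \<longrightarrow> q' \<in> S" unfolding q by blast
      then show ?thesis using f by blast
    qed
  qed
  obtain x0 where "x0 \<in> A" using False by blast
  then have "(x0, x0) \<in> S" by (simp add: S_def)
  moreover have "connected (A \<times> A)" using A(2) by (simp add: connected_Times)
  ultimately have SA: "S = A \<times> A" using op cl unfolding connected_clopen by blast
  show ?thesis
    unfolding convex_contains_segment
  proof (intro ballI)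
    fix x y assume "x \<in> A" "y \<in> A"
    then have "(x, y) \<in> S" by (simp add: SA)
    then show "closed_segment x y \<subseteq> A" by (simp add: S_def)
  qed
qed simp

section \<open>Horospherically convex domains\<close>

locale h_convex_domain = smooth_domain +
  assumes h_convex: "uniformly_h_convex \<Omega>"
begin

lemma curvature_gt_1: "p \<in> bdry \<Omega> \<Longrightarrow> principal_curvatures \<Omega> p $ i > 1"
  using h_convex unfolding uniformly_h_convex_def by (metis add_strict_increasing2 less_trans less_add_same_cancel1)

text \<open>Not of unit length: with this scaling its inner product with the velocity
  \<open>snd (outer_normal \<Omega> p)\<close> of the sweep is \<open>fst p\<close>, which is cosh
  r.\<close>

definition normal :: "'a minkowski \<Rightarrow> real ^ ('a option)" where
  "normal p = nvec p (outer_normal \<Omega> p)"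

lemma shape_in_frame:
  fixes e :: "'a \<Rightarrow> 'a minkowski"
  assumes p: "p \<in> bdry \<Omega>" and e: "\<And>i. e i \<in> bdry_tangent \<Omega> p" "\<And>i j. lorentz (e i) (e j) = (if i = j then 1 else 0)"
    and W: "linear W" "\<And>i. W (e i) = k i *\<^sub>R e i" and v: "v \<in> bdry_tangent \<Omega> p"
  shows "W v = (\<Sum>i\<in>UNIV. (k i * lorentz (e i) v) *\<^sub>R e i)"
proof -
  have "W v = W (\<Sum>i\<in>UNIV. lorentz (e i) v *\<^sub>R e i)"
    using frame_expansion[OF p e v] by simp
  then show ?thesis by (simp add: linear_sum[OF W(1)] linear_scale[OF W(1)] W(2) mult.commute)
qed

text \<open>In an eigenframe both quadratic forms are diagonal, and every principal curvature
  exceeds 1.\<close>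

lemma shape_quadratic:
  assumes p: "p \<in> bdry \<Omega>" and W: "(outer_normal \<Omega> has_derivative W) (at p within bdry \<Omega>)"
    and v: "v \<in> bdry_tangent \<Omega> p" "v \<noteq> 0"
  shows "lorentz v v < lorentz (W v) v" "0 < lorentz v v"
proof -
  obtain W' e where W': "(outer_normal \<Omega> has_derivative W') (at p within bdry \<Omega>)"
    and e: "\<And>i. e i \<in> bdry_tangent \<Omega> p" "\<And>i j. lorentz (e i) (e j) = (if i = j then 1 else 0)"
    and k: "\<And>i. W' (e i) = principal_curvatures \<Omega> p $ i *\<^sub>R e i"
    by (rule curvature_frame[OF p]) blast
  let ?k = "\<lambda>i. principal_curvatures \<Omega> p $ i" and ?c = "\<lambda>i. lorentz (e i) v"
  have WW: "W v = W' v" by (rule within_derivative_unique[OF p v(1) W W'])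
  have "lorentz (W v) v = (\<Sum>i\<in>UNIV. ?k i * (?c i)\<^sup>2)"
    unfolding WW shape_in_frame[OF p e has_derivative_linear[OF W'] k v(1)]
    by (simp add: lorentz_sum_left lorentz_simps power2_eq_square mult.assoc)
  moreover have "lorentz v v = (\<Sum>i\<in>UNIV. (?c i)\<^sup>2)"
  proof -
    have "lorentz v v = lorentz (\<Sum>i\<in>UNIV. ?c i *\<^sub>R e i) v" using frame_expansion[OF p e v(1)] by simp
    then show ?thesis by (simp add: lorentz_sum_left lorentz_simps power2_eq_square)
  qed
  moreover have "(\<Sum>i\<in>UNIV. (?c i)\<^sup>2) < (\<Sum>i\<in>UNIV. ?k i * (?c i)\<^sup>2)"
  proof (rule sum_strict_mono_ex1)
    show "\<forall>i\<in>UNIV. (?c i)\<^sup>2 \<le> ?k i * (?c i)\<^sup>2"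
    proof
      fix i
      have "1 * (?c i)\<^sup>2 \<le> ?k i * (?c i)\<^sup>2"
        by (rule mult_right_mono) (use curvature_gt_1[OF p, of i] in simp_all)
      then show "(?c i)\<^sup>2 \<le> ?k i * (?c i)\<^sup>2" by simp
    qed
    have "\<exists>i. ?c i \<noteq> 0"
    proof (rule ccontr)
      assume "\<not> ?thesis"
      then have "v = 0" using frame_expansion[OF p e v(1)] by simp
      then show False using v(2) by simp
    qed
    then obtain i where "?c i \<noteq> 0" by blast
    then have "(?c i)\<^sup>2 < ?k i * (?c i)\<^sup>2"
      using curvature_gt_1[OF p, of i] by simp
    then show "\<exists>i\<in>UNIV. (?c i)\<^sup>2 < ?k i * (?c i)\<^sup>2" by blast
  qed simp
  ultimately show "lorentz v v < lorentz (W v) v" by simp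
  show "0 < lorentz v v"
    using lorentz_tangent_pos[OF bdryD(1)[OF p] _ v(2)] v(1) by (simp add: bdry_tangent_iff)
qed

lemma has_derivative_dlift:
  "((\<lambda>x. dlift x u) has_derivative
    (\<lambda>w. (((w \<bullet> u) * fst (lift a) - (a \<bullet> u) * ((a \<bullet> w) / fst (lift a))) / (fst (lift a) * fst (lift a)), 0))) (at a)"
proof -
  have "((\<lambda>x. fst (lift x)) has_derivative (\<lambda>w. fst (dlift a w))) (at a)"
    by (rule has_derivative_fst[OF has_derivative_lift])
  then have f: "((\<lambda>x. fst (lift x)) has_derivative (\<lambda>w. (a \<bullet> w) / fst (lift a))) (at a)"
    by (simp add: dlift_def)
  have n: "((\<lambda>x. x \<bullet> u) has_derivative (\<lambda>w. w \<bullet> u)) (at a)"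
    by (intro derivative_intros)
  have nz: "fst (lift a) \<noteq> 0" using fst_lift_pos[of a] by simp
  show ?thesis
    unfolding dlift_def by (intro has_derivative_Pair has_derivative_divide'[OF n f nz] has_derivative_const)
qed

text \<open>The second derivative of \<open>lift\<close> is a vector in the time direction with
  component \<open>lorentz v v / fst p\<close>. Combined with the normal part of the gradient it
  shows that \<open>inv_norm \<rho> p\<close> times the Hessian is the second fundamental form minus
  \<open>fst (outer_normal \<Omega> p) / fst p\<close> times the metric.\<close>

lemma hessian_positive:
  assumes p: "p \<in> bdry \<Omega>" and d: "defining_function \<Omega> p U \<rho>" and U: "open U" "p \<in> U" "smooth_on U \<rho>"
    and pos: "\<And>q. q \<in> U \<Longrightarrow> lorentz (ngrad \<rho> q) (ngrad \<rho> q) > 0"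
    and nu: "\<And>q. q \<in> bdry \<Omega> \<Longrightarrow> q \<in> U \<Longrightarrow> outer_normal \<Omega> q = unormal \<rho> q"
    and u: "u \<noteq> 0" "frechet_derivative (\<lambda>x. \<rho> (lift x)) (at (snd p)) u = 0"
  shows "hess (\<lambda>x. \<rho> (lift x)) (snd p) u > 0"
proof -
  note h = bdryD(1)[OF p] and L = local_function[OF p d]
  let ?a = "snd p" and ?W = "frechet_derivative (unormal \<rho>) (at p)"
  let ?R = "\<lambda>x. \<rho> (lift x)"
  define v where "v = dlift ?a u"
  have la: "lift ?a = p" by (rule bdryD(4)[OF p])
  have p0: "fst p > 0" "fst p * fst p = 1 + ?a \<bullet> ?a" using hyp_spaceD[OF h] by auto
  have vt: "v \<in> hyp_tangent p" using dlift_tangent[of ?a u] by (simp add: v_def la)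
  have "frechet_derivative ?R (at ?a) = (\<lambda>u. nvec p (ngrad \<rho> p) \<bullet> u / fst p)"
    by (rule frechet_derivative_at[symmetric, OF derivative_base[OF p d]])
  then have "nvec p (ngrad \<rho> p) \<bullet> u = 0" using u(2) p0 by simp
  then have Nv: "lorentz (ngrad \<rho> p) v = 0" using nvec_inner[OF h vt, of "ngrad \<rho> p"] p0 by (simp add: v_def)
  have nup: "outer_normal \<Omega> p = inv_norm \<rho> p *\<^sub>R ngrad \<rho> p" using nu[OF p U(2)] by (simp add: unormal_def)
  have vT: "v \<in> bdry_tangent \<Omega> p"
    using vt Nv by (simp add: bdry_tangent_iff hyp_tangent_def nup lorentz_simps)
  have "v \<noteq> 0" using u(1) by (auto simp: v_def dlift_def zero_prod_def)
  note q = shape_quadratic[OF p outer_normal_has_derivative[OF p U pos nu] vT this]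
  let ?G = "frechet_derivative (rgrad \<rho>) (at p)" and ?s = "inv_norm \<rho> p"
  have s: "?s > 0" using pos[OF U(2)] by (simp add: inv_norm_def)
  let ?h = "((u \<bullet> u) * fst p - (?a \<bullet> u) * ((?a \<bullet> u) / fst p)) / (fst p * fst p)"
  have vv: "lorentz v v = u \<bullet> u - (?a \<bullet> u) * (?a \<bullet> u) / (fst p * fst p)"
    unfolding v_def lorentz_dlift p0(2) ..
  have hv: "?h = lorentz v v / fst p"
    unfolding vv using p0(1) by (simp add: field_simps)
  have G: "(rgrad \<rho> has_derivative ?G) (at (lift ?a))"
    unfolding la by (rule Ck_on_SucE(1)[OF Ck_on_rgrad[OF U(1,3), of "Suc 0"] U(2)])
  have dG: "((\<lambda>x. rgrad \<rho> (lift x)) has_derivative (\<lambda>w. ?G (dlift ?a w))) (at ?a)"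
    using diff_chain_at[OF has_derivative_lift G] by (simp add: o_def)
  have "((\<lambda>x. lorentz (rgrad \<rho> (lift x)) (dlift x u)) has_derivative
      (\<lambda>w. lorentz (rgrad \<rho> (lift ?a)) (((w \<bullet> u) * fst (lift ?a) - (?a \<bullet> u) * ((?a \<bullet> w) / fst (lift ?a))) / (fst (lift ?a) * fst (lift ?a)), 0)
        + lorentz (?G (dlift ?a w)) (dlift ?a u))) (at ?a)"
    by (rule bounded_bilinear.FDERIV[OF lorentz_bilinear dG has_derivative_dlift])
  then have "((\<lambda>x. frechet_derivative ?R (at x) u) has_derivative
      (\<lambda>w. lorentz (rgrad \<rho> (lift ?a)) (((w \<bullet> u) * fst (lift ?a) - (?a \<bullet> u) * ((?a \<bullet> w) / fst (lift ?a))) / (fst (lift ?a) * fst (lift ?a)), 0)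
        + lorentz (?G (dlift ?a w)) (dlift ?a u))) (at ?a)"
  proof (rule has_derivative_transform_within_open[OF _ L(1,2)])
    fix x assume x: "x \<in> lift -` U"
    have "frechet_derivative ?R (at x) = (\<lambda>u. frechet_derivative \<rho> (at (lift x)) (dlift x u))"
      by (rule frechet_derivative_at[symmetric, OF L(6)[OF x]])
    then show "lorentz (rgrad \<rho> (lift x)) (dlift x u) = frechet_derivative ?R (at x) u"
      unfolding rgrad_def using lorentz_lgrad[OF defining_functionD(2)[OF d]] x by simp
  qed
  from hess_eqI[OF L(1,3,2) this]
  have "hess ?R ?a u = lorentz (rgrad \<rho> p) (?h, 0) + lorentz (?G v) v"
    by (simp add: la v_def)
  also have "lorentz (rgrad \<rho> p) (?h, 0) = - fst (rgrad \<rho> p) * (lorentz v v / fst p)"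
    unfolding hv by (simp add: lorentz_def)
  finally have H: "hess ?R ?a u = lorentz (?G v) v - fst (rgrad \<rho> p) * (lorentz v v / fst p)" by simp
  let ?c = "lorentz p (rgrad \<rho> p)"
  have "lorentz (?W v) v = ?s * (lorentz (?G v) v + ?c * lorentz v v)"
    unfolding lorentz_derivative_rgrad[OF U(1,3,2)]
    by (rule shape_hessian[OF U(1,3,2) pos _ Nv]) (use vT in \<open>simp_all add: bdry_tangent_iff\<close>)
  then have "?s * hess ?R ?a u = lorentz (?W v) v - ?s * (?c * lorentz v v) - ?s * (fst (rgrad \<rho> p) * (lorentz v v / fst p))"
    unfolding H by (simp add: algebra_simps)
  also have "\<dots> = lorentz (?W v) v - (fst (outer_normal \<Omega> p) / fst p) * lorentz v v"
    using p0(1) by (simp add: nup ngrad_def field_simps)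
  finally have Hs: "?s * hess ?R ?a u = lorentz (?W v) v - (fst (outer_normal \<Omega> p) / fst p) * lorentz v v" .
  \<comment> \<open>The coefficient of the metric stays below 1, whereas the second fundamental form
    exceeds the metric.\<close>
  have "fst (outer_normal \<Omega> p) < fst p"
    using nvec_identities(3)[OF h outer_normal_unit[OF p]] by simp
  then have "fst (outer_normal \<Omega> p) / fst p < 1" using p0(1) by simp
  then have "(fst (outer_normal \<Omega> p) / fst p) * lorentz v v < 1 * lorentz v v"
    using q(2) by (rule mult_strict_right_mono)
  then have "?s * hess ?R ?a u > 0" using Hs q(1) by simp
  then show ?thesis using s by (simp add: zero_less_mult_iff)
qed

text \<open>What the convexity argument uses about the frontier, in purely Euclidean terms.\<close>

lemma base_local:
  assumes a: "a \<in> frontier base"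
  obtains r R where "r > 0" "smooth_on (ball a r) R" "strictly_quasiconvex_on (ball a r) R" "R a = 0"
    "\<And>x. x \<in> ball a r \<Longrightarrow> x \<in> base \<longleftrightarrow> R x \<le> 0"
proof -
  let ?p = "lift a"
  have p: "?p \<in> bdry \<Omega>" using a by (simp add: bdry_eq)
  obtain U \<rho> where N: "defining_function \<Omega> ?p U \<rho>" "open U" "?p \<in> U" "smooth_on U \<rho>"
    "\<And>q. q \<in> U \<Longrightarrow> lorentz (ngrad \<rho> q) (ngrad \<rho> q) > 0"
    "\<And>q. q \<in> bdry \<Omega> \<Longrightarrow> q \<in> U \<Longrightarrow> outer_normal \<Omega> q = unormal \<rho> q"
    by (rule boundary_neighbourhood[OF p]) blast
  note L = local_function[OF p N(1), unfolded snd_lift]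
  obtain r where r: "r > 0" "ball a r \<subseteq> lift -` U" "strictly_quasiconvex_on (ball a r) (\<lambda>x. \<rho> (lift x))"
    using quasiconvex_neighbourhood[OF L(1,3,2)] hessian_positive[OF p N, unfolded snd_lift] by metis
  have "x \<in> base \<longleftrightarrow> \<rho> (lift x) \<le> 0" if "x \<in> ball a r" for x
    using L(5)[of x] that r(2) by blast
  then show thesis
    by (rule that[OF r(1) smooth_on_subset[OF L(3) r(2)] r(3) L(4)])
qed

text \<open>A frontier point inside the segment has R = 0 and is the midpoint of a short segment
  whose ends have R \<le> 0; strict quasiconvexity excludes this.\<close>

lemma base_strict:
  assumes xy: "x \<in> base" "y \<in> base" "x \<noteq> y" and seg: "closed_segment x y \<subseteq> base"
  shows "open_segment x y \<subseteq> interior base"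
proof
  fix z assume z: "z \<in> open_segment x y"
  then obtain t where t: "0 < t" "t < 1" "z = (1 - t) *\<^sub>R x + t *\<^sub>R y" by (auto simp: in_segment)
  have zb: "z \<in> base" using z seg open_closed_segment by blast
  show "z \<in> interior base"
  proof (rule ccontr)
    assume "z \<notin> interior base"
    then have "z \<in> frontier base" using zb closed_base by (simp add: frontier_def)
    then obtain r R where R: "r > 0" "smooth_on (ball z r) R" "strictly_quasiconvex_on (ball z r) R" "R z = 0"
      "\<And>x. x \<in> ball z r \<Longrightarrow> x \<in> base \<longleftrightarrow> R x \<le> 0"
      by (rule base_local) blast
    define l where "l = r / (norm (y - x) + 1)"
    have l: "l > 0" using R(1) by (simp add: l_def add_nonneg_pos)
    \<comment> \<open>Small enough for both displaced points to lie in the ball and on the given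
      segment.\<close>
    define s where "s = min l (min t (1 - t)) / 2"
    have s: "0 < s" "s < l" "s \<le> t" "s \<le> 1 - t" using l t by (auto simp: s_def)
    have sr: "s * norm (y - x) < r"
    proof -
      have nn: "norm (y - x) + 1 > 0" by (simp add: add_nonneg_pos)
      have "s * norm (y - x) \<le> s * (norm (y - x) + 1)" using s(1) by simp
      also have "\<dots> < l * (norm (y - x) + 1)" using s(2) nn by (rule mult_strict_right_mono)
      also have "\<dots> = r" using nn by (simp add: l_def)
      finally show ?thesis .
    qed
    let ?x = "z - s *\<^sub>R (y - x)" and ?y = "z + s *\<^sub>R (y - x)"
    have ball: "?x \<in> ball z r" "?y \<in> ball z r" using sr s(1) by (simp_all add: dist_norm)
    have "?x = (1 - (t - s)) *\<^sub>R x + (t - s) *\<^sub>R y" "?y = (1 - (t + s)) *\<^sub>R x + (t + s) *\<^sub>R y"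
      unfolding t(3) by (simp_all add: algebra_simps)
    then have "?x \<in> closed_segment x y" "?y \<in> closed_segment x y"
      unfolding closed_segment_def using s t(1,2)
      by (intro CollectI exI[of _ "t - s"] exI[of _ "t + s"], simp)+
    then have "?x \<in> base" "?y \<in> base" using seg by auto
    then have "R ?x \<le> 0" "R ?y \<le> 0" using R(5) ball by auto
    moreover have "?x \<noteq> ?y" using s(1) xy(3) by (simp add: eq_diff_eq algebra_simps flip: scaleR_add_left)
    moreover have "closed_segment ?x ?y \<subseteq> ball z r"
      using ball by (intro closed_segment_subset convex_ball)
    ultimately have "R (?x + (1/2) *\<^sub>R (?y - ?x)) < 0"
      by (intro strictly_quasiconvex_segment[OF open_ball R(2,3)]) auto
    moreover have "?x + (1/2) *\<^sub>R (?y - ?x) = z" by (simp add: algebra_simps flip: scaleR_add_left)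
    ultimately show False using R(4) by simp
  qed
qed

text \<open>Near the frontier the base is a sublevel set of a strictly quasiconvex function, hence
  locally convex. Connectedness of the domain makes this global.\<close>

lemma convex_base: "convex base"
proof (rule connected_locally_strictly_convex[OF closed_base connected_base _ base_strict])
  fix x assume x: "x \<in> base"
  show "\<exists>r>0. \<forall>y\<in>base \<inter> ball x r. \<forall>z\<in>base \<inter> ball x r. closed_segment y z \<subseteq> base"
  proof (cases "x \<in> interior base")
    case True
    then obtain r where r: "r > 0" "ball x r \<subseteq> base" by (auto simp: mem_interior)
    have "closed_segment y z \<subseteq> base" if "y \<in> ball x r" "z \<in> ball x r" for y z
      using closed_segment_subset[OF that convex_ball] r(2) by blast
    then show ?thesis using r(1) by blast
  next
    case False
    then have "x \<in> frontier base" using x closed_base by (simp add: frontier_def)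
    then obtain r R where R: "r > 0" "smooth_on (ball x r) R" "strictly_quasiconvex_on (ball x r) R"
      "\<And>z. z \<in> ball x r \<Longrightarrow> z \<in> base \<longleftrightarrow> R z \<le> 0"
      by (rule base_local) blast
    have "closed_segment y z \<subseteq> base" if yz: "y \<in> base \<inter> ball x r" "z \<in> base \<inter> ball x r" for y z
    proof (cases "y = z")
      case False
      have sub: "closed_segment y z \<subseteq> ball x r" using yz by (intro closed_segment_subset convex_ball) auto
      show ?thesis
      proof
        fix w assume w: "w \<in> closed_segment y z"
        then obtain t where t: "0 \<le> t" "t \<le> 1" "w = (1 - t) *\<^sub>R y + t *\<^sub>R z" by (auto simp: in_segment)
        have wt: "w = y + t *\<^sub>R (z - y)" unfolding t(3) by (simp add: algebra_simps)
        consider "t = 0" | "t = 1" | "0 < t" "t < 1" using t by linarith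
        then show "w \<in> base"
        proof cases
          case 3
          have "R w < 0"
            unfolding wt using yz R(4) by (intro strictly_quasiconvex_segment[OF open_ball R(2,3) sub False _ _ 3]) auto
          then show ?thesis using R(4) w sub by auto
        qed (use yz t(3) in auto)
      qed
    qed (use yz in auto)
    then show ?thesis using R(1) by blast
  qed
qed

text \<open>Towards a base point beyond the tangent hyperplane, the segment from
  \<open>snd p\<close> would stay in the convex base and yet start into the region where the
  defining function is positive.\<close>

lemma support:
  assumes p: "p \<in> bdry \<Omega>" and x: "x \<in> base"
  shows "normal p \<bullet> x \<le> normal p \<bullet> snd p"
proof (rule ccontr)
  assume no: "\<not> ?thesis"
  obtain U \<rho> where d: "defining_function \<Omega> p U \<rho>" using ex_defining_function[OF p] by blast
  note L = local_function[OF p d] and h = bdryD(1)[OF p]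
  have "inv_norm \<rho> p > 0" using ngrad_spacelike[OF d h] by (simp add: inv_norm_def)
  moreover have "normal p = inv_norm \<rho> p *\<^sub>R nvec p (ngrad \<rho> p)"
    by (simp add: normal_def outer_normal_eq[OF p d] unormal_def nvec_def scaleR_diff_right)
  ultimately have "nvec p (ngrad \<rho> p) \<bullet> (x - snd p) / fst p > 0"
    using no hyp_spaceD(1)[OF h] by (simp add: inner_diff_right zero_less_mult_iff flip: right_diff_distrib)
  from directional_sign(2)[OF derivative_base[OF p d] L(4) this]
  obtain e where e: "e > 0" "\<And>t. 0 < t \<Longrightarrow> t < e \<Longrightarrow> \<rho> (lift (snd p + t *\<^sub>R (x - snd p))) > 0"
    by blast
  obtain r where r: "r > 0" "ball (snd p) r \<subseteq> lift -` U" using L(1,2) open_contains_ball by blast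
  define l where "l = r / (norm (x - snd p) + 1)"
  have nn: "norm (x - snd p) + 1 > 0" by (simp add: add_nonneg_pos)
  have l: "l > 0" using r(1) nn by (simp add: l_def)
  define t where "t = min 1 (min e l) / 2"
  have t: "0 < t" "t < e" "t < l" "t \<le> 1" using l e(1) by (auto simp: t_def)
  have "t * norm (x - snd p) \<le> t * (norm (x - snd p) + 1)" using t(1) by simp
  also have "\<dots> < l * (norm (x - snd p) + 1)" using t(3) nn by (rule mult_strict_right_mono)
  also have "\<dots> = r" using nn by (simp add: l_def)
  finally have "snd p + t *\<^sub>R (x - snd p) \<in> lift -` U" using r(2) t(1) by (intro subsetD[OF r(2)]) (simp add: dist_norm)
  moreover have "snd p + t *\<^sub>R (x - snd p) \<in> base"
  proof -
    have "(1 - t) *\<^sub>R snd p + t *\<^sub>R x \<in> base"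
      using convex_base x bdryD(2)[OF p] t by (intro convexD_alt) auto
    moreover have "(1 - t) *\<^sub>R snd p + t *\<^sub>R x = snd p + t *\<^sub>R (x - snd p)" by (simp add: algebra_simps)
    ultimately show ?thesis by simp
  qed
  ultimately show False using L(5) e(2)[OF t(1,2)] by force
qed

section \<open>Strict support and the range of the normal field\<close>

lemma normal_identities:
  assumes p: "p \<in> bdry \<Omega>"
  shows "snd (outer_normal \<Omega> p) \<bullet> normal p = fst p" "snd p \<bullet> normal p = fst (outer_normal \<Omega> p)"
    "v \<in> hyp_tangent p \<Longrightarrow> fst p * lorentz (outer_normal \<Omega> p) v = normal p \<bullet> snd v"
    "fst p > 0" "\<bar>fst (outer_normal \<Omega> p)\<bar> < fst p" "normal p \<noteq> 0"
proof -
  note I = nvec_identities[OF bdryD(1)[OF p] outer_normal_unit[OF p], folded normal_def]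
  show "snd (outer_normal \<Omega> p) \<bullet> normal p = fst p" "snd p \<bullet> normal p = fst (outer_normal \<Omega> p)"
    "v \<in> hyp_tangent p \<Longrightarrow> fst p * lorentz (outer_normal \<Omega> p) v = normal p \<bullet> snd v"
    "\<bar>fst (outer_normal \<Omega> p)\<bar> < fst p" by (fact I)+
  show 0: "fst p > 0" by (rule hyp_spaceD(1)[OF bdryD(1)[OF p]])
  show "normal p \<noteq> 0" using I(1) 0 by auto
qed

text \<open>In case of equality the midpoint is an interior point on the supporting hyperplane, and
  a small step along the normal violates \<open>support\<close>.\<close>

lemma support_strict:
  assumes p: "p \<in> bdry \<Omega>" and x: "x \<in> base" "x \<noteq> snd p"
  shows "normal p \<bullet> x < normal p \<bullet> snd p"
proof (rule ccontr)
  assume "\<not> ?thesis"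
  then have eq: "normal p \<bullet> x = normal p \<bullet> snd p" using support[OF p x(1)] by simp
  let ?m = "midpoint x (snd p)"
  have "open_segment x (snd p) \<subseteq> interior base"
    using convex_base x bdryD(2)[OF p] by (intro base_strict) (auto simp: convex_contains_segment)
  then have "?m \<in> interior base" using x(2) by (metis midpoint_in_open_segment subsetD)
  then obtain r where r: "r > 0" "ball ?m r \<subseteq> base" by (auto simp: mem_interior)
  let ?n = "normal p"
  have n: "norm ?n > 0" using normal_identities(6)[OF p] by simp
  let ?y = "?m + (r / (2 * norm ?n)) *\<^sub>R ?n"
  have "?y \<in> ball ?m r" using r(1) n by (simp add: dist_norm)
  then have "?n \<bullet> ?y \<le> ?n \<bullet> snd p" using support[OF p] r(2) by blast
  moreover have "?n \<bullet> ?m = ?n \<bullet> snd p" by (simp add: midpoint_def inner_add_right eq)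
  moreover have "(r / (2 * norm ?n)) * (?n \<bullet> ?n) > 0" using r(1) n by simp
  ultimately show False by (simp add: inner_add_right)
qed

text \<open>In a chart this is an ordinary maximum on an open set, and the derivatives of the chart
  exhaust the tangential directions.\<close>

lemma critical_point:
  assumes p: "p \<in> bdry \<Omega>" and f: "(f has_derivative F) (at p within bdry \<Omega>)"
    and max: "\<And>q. q \<in> bdry \<Omega> \<Longrightarrow> f q \<le> (f p :: real)" and v: "v \<in> bdry_tangent \<Omega> p"
  shows "F v = 0"
proof -
  obtain U \<phi> where c: "local_parametrization (bdry \<Omega>) (U :: (real ^ 'a) set) \<phi>" and "p \<in> \<phi> ` U"
    using ex_boundary_chart[OF p open_UNIV] by blast
  then obtain x where x: "x \<in> U" "p = \<phi> x" by auto
  obtain w where w: "v = frechet_derivative \<phi> (at x) w" using v chart_derivative_range[OF c x(1)] x(2) by auto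
  note C = local_parametrizationD[OF c]
  have "(\<lambda>v. F (frechet_derivative \<phi> (at x) v)) = (\<lambda>v. 0)"
  proof (rule differential_zero_maxmin[OF x(1) C(1)])
    show "((\<lambda>y. f (\<phi> y)) has_derivative (\<lambda>v. F (frechet_derivative \<phi> (at x) v))) (at x)"
      using derivative_along_chart[OF c x(1)] f x(2) by blast
    show "(\<forall>y\<in>U. f (\<phi> y) \<le> f (\<phi> x)) \<or> (\<forall>y\<in>U. f (\<phi> x) \<le> f (\<phi> y))"
      by (intro disjI1 ballI) (use max C(5) x(2) in blast)
  qed
  from fun_cong[OF this, of w] show ?thesis by (simp add: w)
qed

text \<open>The projected frame spans the hyperplane orthogonal to \<open>normal p\<close>, so only
  the normal component of m remains.\<close>

lemma orthogonal_to_tangent: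
  fixes e :: "'a \<Rightarrow> 'a minkowski"
  assumes p: "p \<in> bdry \<Omega>" and e: "\<And>i. e i \<in> bdry_tangent \<Omega> p" "\<And>i j. lorentz (e i) (e j) = (if i = j then 1 else 0)"
    and m: "\<And>i. snd (e i) \<bullet> m = 0"
  shows "m = ((m \<bullet> normal p) / (normal p \<bullet> normal p)) *\<^sub>R normal p"
proof -
  let ?n = "normal p"
  define u where "u = m - ((m \<bullet> ?n) / (?n \<bullet> ?n)) *\<^sub>R ?n"
  have nn: "?n \<bullet> ?n \<noteq> 0" using normal_identities(6)[OF p] by simp
  have un: "?n \<bullet> u = 0" using nn by (simp add: u_def inner_diff_right inner_commute)
  let ?v = "dlift (snd p) u"
  have vt: "?v \<in> hyp_tangent p" using dlift_tangent[of "snd p" u] by (simp add: bdryD(4)[OF p])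
  have "lorentz (outer_normal \<Omega> p) ?v = 0"
    using normal_identities(3)[OF p vt] normal_identities(4)[OF p] un by simp
  then have "?v \<in> bdry_tangent \<Omega> p" using vt by (simp add: bdry_tangent_def)
  from frame_expansion[OF p e this] have "snd ?v = snd (\<Sum>i\<in>UNIV. lorentz (e i) ?v *\<^sub>R e i)" by simp
  then have "u = (\<Sum>i\<in>UNIV. lorentz (e i) ?v *\<^sub>R snd (e i))" by (simp add: snd_sum)
  then have "u \<bullet> m = (\<Sum>i\<in>UNIV. lorentz (e i) ?v *\<^sub>R snd (e i)) \<bullet> m" by (rule arg_cong)
  also have "\<dots> = (\<Sum>i\<in>UNIV. lorentz (e i) ?v * (snd (e i) \<bullet> m))" by (simp add: inner_sum_left)
  finally have "u \<bullet> m = (\<Sum>i\<in>UNIV. lorentz (e i) ?v * (snd (e i) \<bullet> m))" .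
  then have "u \<bullet> m = 0" by (simp add: m)
  then have "u \<bullet> u = 0" using un by (simp add: u_def inner_diff_right inner_commute)
  then show ?thesis by (simp add: u_def)
qed

text \<open>At a boundary point \<open>x\<close> that maximizes the left hand side, all principal curvatures are nonzero
  and hence \<open>normal q\<close> is a multiple of \<open>normal x\<close>.\<close>

lemma normal_support:
  assumes p: "p \<in> bdry \<Omega>" and q: "q \<in> bdry \<Omega>"
  shows "snd (outer_normal \<Omega> p) \<bullet> normal q \<le> fst q"
proof -
  let ?f = "\<lambda>x. snd (outer_normal \<Omega> x) \<bullet> normal q"
  have "continuous_on (bdry \<Omega>) ?f"
    by (intro continuous_intros continuous_on_outer_normal)
  then have "\<exists>x\<in>bdry \<Omega>. \<forall>y\<in>bdry \<Omega>. ?f y \<le> ?f x"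
    by (intro continuous_attains_sup compact_bdry bdry_nonempty)
  then obtain x where x: "x \<in> bdry \<Omega>" "\<And>y. y \<in> bdry \<Omega> \<Longrightarrow> ?f y \<le> ?f x" by blast
  obtain W e where W: "(outer_normal \<Omega> has_derivative W) (at x within bdry \<Omega>)"
    and e: "\<And>i. e i \<in> bdry_tangent \<Omega> x" "\<And>i j. lorentz (e i) (e j) = (if i = j then 1 else 0)"
    and k: "\<And>i. W (e i) = principal_curvatures \<Omega> x $ i *\<^sub>R e i"
    by (rule curvature_frame[OF x(1)]) blast
  have "(?f has_derivative (\<lambda>v. snd (W v) \<bullet> normal q)) (at x within bdry \<Omega>)"
    by (intro has_derivative_inner_left has_derivative_snd W)
  from critical_point[OF x(1) this x(2) e(1)]
  have "principal_curvatures \<Omega> x $ i * (snd (e i) \<bullet> normal q) = 0" for i by (simp add: k)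
  then have "snd (e i) \<bullet> normal q = 0" for i using curvature_gt_1[OF x(1), of i] by (metis mult_eq_0_iff not_one_less_zero)
  from orthogonal_to_tangent[OF x(1) e this]
  obtain c where c: "normal q = c *\<^sub>R normal x" by blast
  have fx: "?f x = c * fst x" using normal_identities(1)[OF x(1)] by (simp add: c)
  have "?f x \<le> fst q"
  \<comment> \<open>For c > 0 both points have the same outward direction, and strict support leaves
    only x = q. Otherwise the left side is at most 0.\<close>
  proof (cases "c > 0")
    case True
    have "snd x = snd q"
    proof (rule ccontr)
      assume ne: "snd x \<noteq> snd q"
      have "normal x \<bullet> snd q < normal x \<bullet> snd x"
        using support_strict[OF x(1)] bdryD(2)[OF q] ne by auto
      moreover have "normal q \<bullet> snd x \<le> normal q \<bullet> snd q"
        using support[OF q] bdryD(2)[OF x(1)] by blast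
      ultimately show False using True by (simp add: c)
    qed
    then have "x = q" using bdryD(4)[OF x(1)] bdryD(4)[OF q] by metis
    then show ?thesis using normal_identities(1)[OF q] by simp
  next
    case False
    then have "c * fst x \<le> 0" using normal_identities(4)[OF x(1)] by (simp add: mult_nonpos_nonneg)
    then show ?thesis using fx normal_identities(4)[OF q] by linarith
  qed
  then show ?thesis using x(2)[OF p] by simp
qed

section \<open>Every exterior point lies on an outward ray\<close>

lemma normal_has_derivative:
  assumes "(outer_normal \<Omega> has_derivative W) (at p within bdry \<Omega>)"
  shows "(normal has_derivative (\<lambda>v. fst p *\<^sub>R snd (W v) + fst v *\<^sub>R snd (outer_normal \<Omega> p)
    - (fst (outer_normal \<Omega> p) *\<^sub>R snd v + fst (W v) *\<^sub>R snd p))) (at p within bdry \<Omega>)"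
  unfolding normal_def[abs_def] nvec_def
  by (intro has_derivative_diff has_derivative_scaleR has_derivative_fst has_derivative_snd
      has_derivative_ident assms)

lemma continuous_on_normal: "continuous_on (bdry \<Omega>) normal"
  unfolding normal_def[abs_def] nvec_def by (intro continuous_intros continuous_on_outer_normal)

text \<open>The segment from an interior point to z crosses the frontier. The support inequality at
  the crossing is strict at the interior end, so by linearity it is violated beyond the
  crossing.\<close>

lemma exterior_has_support:
  assumes z: "z \<notin> base"
  obtains p where "p \<in> bdry \<Omega>" "(z - snd p) \<bullet> normal p > 0"
proof -
  obtain c where c: "c \<in> interior base" using interior_base by blast
  have "closed_segment c z \<inter> frontier base \<noteq> {}"
  proof (rule connected_Int_frontier)
    show "closed_segment c z \<inter> base \<noteq> {}" using c interior_subset by auto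
    show "closed_segment c z - base \<noteq> {}" using z by auto
  qed simp
  then obtain a where a: "a \<in> closed_segment c z" "a \<in> frontier base" by blast
  let ?p = "lift a"
  have p: "?p \<in> bdry \<Omega>" using a by (simp add: bdry_eq)
  obtain t where t: "0 \<le> t" "t \<le> 1" "a = (1 - t) *\<^sub>R c + t *\<^sub>R z" using a(1) by (auto simp: in_segment)
  have ca: "c \<noteq> a" using c a(2) by (auto simp: frontier_def)
  have "normal ?p \<bullet> c < normal ?p \<bullet> a"
    using support_strict[OF p, of c] c ca interior_subset by auto
  moreover have eq: "normal ?p \<bullet> a = (1 - t) * (normal ?p \<bullet> c) + t * (normal ?p \<bullet> z)"
    unfolding t(3) by (simp add: inner_add_right)
  ultimately have "0 < t * (normal ?p \<bullet> z - normal ?p \<bullet> c)" by (simp add: algebra_simps)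
  then have pos: "normal ?p \<bullet> z - normal ?p \<bullet> c > 0" using t(1) by (simp add: zero_less_mult_iff)
  have "t < 1"
  proof (rule ccontr)
    assume "\<not> t < 1"
    then have "t = 1" using t(2) by simp
    then have "a = z" using t(3) by simp
    then show False using a(2) z frontier_subset_base by auto
  qed
  have "(z - a) \<bullet> normal ?p = (1 - t) * (normal ?p \<bullet> z - normal ?p \<bullet> c)"
    using eq by (simp add: inner_diff_left inner_commute algebra_simps)
  then have "(z - snd ?p) \<bullet> normal ?p > 0" using pos \<open>t < 1\<close> by simp
  then show thesis using that p by blast
qed

text \<open>The maximum s of the quotient is the first time at which z satisfies all constraints of
  the parallel body. At a maximising p the first-order conditions along an eigenframe leave no
  discrepancy w between z and the point at time s on the ray from p.\<close>

lemma exterior_point_on_normal: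
  assumes z: "z \<notin> base"
  obtains p s where "p \<in> bdry \<Omega>" "s > 0" "z = snd p + s *\<^sub>R snd (outer_normal \<Omega> p)"
proof -
  let ?f = "\<lambda>p. (z - snd p) \<bullet> normal p / fst p"
  have "continuous_on (bdry \<Omega>) ?f"
    using normal_identities(4) by (intro continuous_intros continuous_on_normal) force
  then have "\<exists>x\<in>bdry \<Omega>. \<forall>y\<in>bdry \<Omega>. ?f y \<le> ?f x"
    by (intro continuous_attains_sup compact_bdry bdry_nonempty)
  then obtain p where p: "p \<in> bdry \<Omega>" "\<And>q. q \<in> bdry \<Omega> \<Longrightarrow> ?f q \<le> ?f p" by blast
  define s where "s = ?f p"
  note I = normal_identities[OF p(1)] and h = bdryD(1)[OF p(1)]
  let ?n = "outer_normal \<Omega> p"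
  obtain q where q: "q \<in> bdry \<Omega>" "(z - snd q) \<bullet> normal q > 0" by (rule exterior_has_support[OF z])
  have "?f q > 0" using q normal_identities(4)[OF q(1)] by simp
  then have s: "s > 0" using p(2)[OF q(1)] by (simp add: s_def)
  have sp: "(z - snd p) \<bullet> normal p = s * fst p" using I(4) by (simp add: s_def)
  \<comment> \<open>With s fixed the quotient is replaced by a difference that has its maximum 0 at
    p and is simpler to differentiate.\<close>
  let ?g = "\<lambda>q. (z - snd q) \<bullet> normal q - s * fst q"
  have gmax: "?g q \<le> ?g p" if "q \<in> bdry \<Omega>" for q
    using p(2)[OF that, folded s_def] normal_identities(4)[OF that] sp by (simp add: divide_le_eq)
  obtain W e where W: "(outer_normal \<Omega> has_derivative W) (at p within bdry \<Omega>)"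
    and e: "\<And>i. e i \<in> bdry_tangent \<Omega> p" "\<And>i j. lorentz (e i) (e j) = (if i = j then 1 else 0)"
    and k: "\<And>i. W (e i) = principal_curvatures \<Omega> p $ i *\<^sub>R e i"
    by (rule curvature_frame[OF p(1)]) blast
  let ?dN = "\<lambda>v. fst p *\<^sub>R snd (W v) + fst v *\<^sub>R snd ?n - (fst ?n *\<^sub>R snd v + fst (W v) *\<^sub>R snd p)"
  have dz: "((\<lambda>q. z - snd q) has_derivative (\<lambda>v. - snd v)) (at p within bdry \<Omega>)"
    by (rule has_derivative_eq_rhs[OF has_derivative_diff[OF has_derivative_const has_derivative_snd[OF has_derivative_ident]]]) simp
  have "(?g has_derivative (\<lambda>v. (z - snd p) \<bullet> ?dN v + (- snd v) \<bullet> normal p - s * fst v)) (at p within bdry \<Omega>)"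
    by (intro has_derivative_diff has_derivative_inner dz normal_has_derivative[OF W] has_derivative_mult_right
        has_derivative_fst has_derivative_ident)
  from critical_point[OF p(1) this gmax e(1)]
  have crit: "(z - snd p) \<bullet> ?dN (e i) - snd (e i) \<bullet> normal p - s * fst (e i) = 0" for i by simp
  define w where "w = z - snd p - s *\<^sub>R snd ?n"
  have en: "snd (e i) \<bullet> normal p = 0" for i
    using I(3)[of "e i"] e(1)[of i] by (simp add: bdry_tangent_def inner_commute)
  have nn: "snd ?n \<bullet> snd ?n = 1 + fst ?n * fst ?n"
    using outer_normal_unit(2)[OF p(1)] by (simp add: lorentz_def)
  have pn: "snd p \<bullet> snd ?n = fst p * fst ?n"
    using outer_normal_unit(1)[OF p(1)] by (simp add: hyp_tangent_def lorentz_def)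
  have ne: "snd ?n \<bullet> snd (e i) = fst ?n * fst (e i)" for i
    using e(1)[of i] by (simp add: bdry_tangent_iff lorentz_def)
  have ndN: "snd ?n \<bullet> ?dN (e i) = fst (e i)" for i
    by (simp add: k inner_add_right inner_diff_right ne nn inner_commute[of "snd ?n" "snd p"] pn algebra_simps)
  have wdN: "w \<bullet> ?dN (e i) = 0" for i
    using crit[of i] unfolding w_def inner_diff_left inner_scaleR_left ndN en by simp
  have wn: "normal p \<bullet> w = 0"
    using sp I(1) by (simp add: w_def inner_diff_right inner_commute inner_diff_left)
  let ?v = "dlift (snd p) w"
  have vt: "?v \<in> hyp_tangent p" using dlift_tangent[of "snd p" w] by (simp add: bdryD(4)[OF p(1)])
  have "lorentz ?n ?v = 0" using I(3)[OF vt] I(4) wn by simp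
  then have vT: "?v \<in> bdry_tangent \<Omega> p" using vt by (simp add: bdry_tangent_def)
  have pw: "snd p \<bullet> w = fst p * fst ?v" using vt by (simp add: hyp_tangent_def lorentz_def)
  have nw: "snd ?n \<bullet> w = fst ?n * fst ?v" using vT by (simp add: bdry_tangent_iff lorentz_def)
  \<comment> \<open>In direction e i the condition says that fst p * kappa_i - fst nu times the i-th
    coordinate of the lifted w vanishes, and the first factor is positive by h-convexity.\<close>
  have "lorentz (e i) ?v = 0" for i
  proof -
    let ?k = "principal_curvatures \<Omega> p $ i"
    have "w \<bullet> ?dN (e i) = fst p * (?k * (snd (e i) \<bullet> w)) + fst (e i) * (snd ?n \<bullet> w)
        - (fst ?n * (snd (e i) \<bullet> w) + ?k * fst (e i) * (snd p \<bullet> w))"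
      by (simp add: k inner_add_right inner_diff_right inner_commute[of w])
    also have "\<dots> = (fst p * ?k - fst ?n) * lorentz (e i) ?v"
      unfolding pw nw by (simp add: lorentz_def algebra_simps)
    finally have "(fst p * ?k - fst ?n) * lorentz (e i) ?v = 0" using wdN[of i] by simp
    moreover have "fst p * ?k - fst ?n > 0"
    proof -
      have "fst p * 1 < fst p * ?k" using curvature_gt_1[OF p(1), of i] I(4) by (intro mult_strict_left_mono) auto
      then show ?thesis using I(5) by simp
    qed
    ultimately show ?thesis by simp
  qed
  then have "?v = 0" using frame_expansion[OF p(1) e vT] by simp
  then have "w = 0" by (simp add: dlift_def zero_prod_def)
  then have "z = snd p + s *\<^sub>R snd ?n" by (simp add: w_def algebra_simps)
  then show thesis using that p(1) s by blast
qed

end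

section \<open>Parallel bodies\<close>

context h_convex_domain
begin

text \<open>The parallel bodies of the base in the direction field \<open>snd \<circ> outer_normal \<Omega>\<close>, written as an
  intersection of half spaces so that convexity in \<open>(t, y)\<close> is evident.\<close>

definition parallel :: "real \<Rightarrow> (real ^ ('a option)) set" where
  "parallel t = {y. \<forall>p\<in>bdry \<Omega>. normal p \<bullet> y \<le> normal p \<bullet> snd p + t * fst p}"

definition ray :: "'a minkowski \<Rightarrow> real \<Rightarrow> real ^ ('a option)" where
  "ray p s = snd p + s *\<^sub>R snd (outer_normal \<Omega> p)"

lemma normal_ray: "p \<in> bdry \<Omega> \<Longrightarrow> normal p \<bullet> ray p s = normal p \<bullet> snd p + s * fst p"
  using normal_identities(1)[of p] by (simp add: ray_def inner_add_right inner_commute)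

text \<open>By \<open>normal_support\<close> a ray never approaches the constraint of another
  boundary point faster than that constraint recedes.\<close>

lemma ray_in_parallel:
  assumes p: "p \<in> bdry \<Omega>" and s: "0 \<le> s" "s \<le> t"
  shows "ray p s \<in> parallel t"
  unfolding parallel_def
proof (intro CollectI ballI)
  fix q assume q: "q \<in> bdry \<Omega>"
  have "snd p \<in> base" using bdryD(2)[OF p] by (rule imageI)
  then have 1: "normal q \<bullet> snd p \<le> normal q \<bullet> snd q" by (rule support[OF q])
  have "s * (snd (outer_normal \<Omega> p) \<bullet> normal q) \<le> s * fst q"
    using normal_support[OF p q] s(1) by (rule mult_left_mono)
  also have "\<dots> \<le> t * fst q"
    using s(2) normal_identities(4)[OF q] by (intro mult_right_mono) simp_all
  finally show "normal q \<bullet> ray p s \<le> normal q \<bullet> snd q + t * fst q"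
    using 1 by (simp add: ray_def inner_add_right inner_commute)
qed

lemma base_subset_parallel:
  assumes "0 \<le> t"
  shows "base \<subseteq> parallel t"
  unfolding parallel_def
proof (intro subsetI CollectI ballI)
  fix x p assume x: "x \<in> base" and p: "p \<in> bdry \<Omega>"
  have "0 \<le> t * fst p" using assms normal_identities(4)[OF p] by simp
  then show "normal p \<bullet> x \<le> normal p \<bullet> snd p + t * fst p" using support[OF p x] by simp
qed

text \<open>The constraint belonging to p itself holds along its ray exactly up to time t.\<close>

lemma ray_in_parallel_iff:
  assumes p: "p \<in> bdry \<Omega>" and s: "0 \<le> s"
  shows "ray p s \<in> parallel t \<longleftrightarrow> s \<le> t"
proof
  assume "ray p s \<in> parallel t"
  then have "normal p \<bullet> ray p s \<le> normal p \<bullet> snd p + t * fst p" using p by (auto simp: parallel_def)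
  then have "s * fst p \<le> t * fst p" unfolding normal_ray[OF p] by simp
  then show "s \<le> t" using normal_identities(4)[OF p] by simp
qed (rule ray_in_parallel[OF p s])

lemma ray_notin_base:
  assumes p: "p \<in> bdry \<Omega>" and s: "0 < s"
  shows "ray p s \<notin> base"
proof
  assume "ray p s \<in> base"
  then have "ray p s \<in> parallel 0" using base_subset_parallel[of 0] by blast
  then show False using ray_in_parallel_iff[OF p, of s 0] s by simp
qed

text \<open>Exterior points are reached by \<open>exterior_point_on_normal\<close>. Time 0 is left
  out of the rays, which makes them disjoint from the base.\<close>

lemma parallel_eq:
  assumes "0 \<le> t"
  shows "parallel t = base \<union> (\<Union>p\<in>bdry \<Omega>. ray p ` {0<..t})"
proof
  show "base \<union> (\<Union>p\<in>bdry \<Omega>. ray p ` {0<..t}) \<subseteq> parallel t"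
    using base_subset_parallel[OF assms] by (auto intro: ray_in_parallel)
  show "parallel t \<subseteq> base \<union> (\<Union>p\<in>bdry \<Omega>. ray p ` {0<..t})"
  proof
    fix y assume y: "y \<in> parallel t"
    show "y \<in> base \<union> (\<Union>p\<in>bdry \<Omega>. ray p ` {0<..t})"
    proof (cases "y \<in> base")
      case False
      obtain p s where p: "p \<in> bdry \<Omega>" and s: "s > 0" and ye: "y = snd p + s *\<^sub>R snd (outer_normal \<Omega> p)"
        using exterior_point_on_normal[OF False] by metis
      have ye': "y = ray p s" unfolding ray_def by (rule ye)
      then have "s \<le> t" using y ray_in_parallel_iff[OF p, of s t] s by simp
      then have "s \<in> {0<..t}" using s by simp
      then show ?thesis unfolding ye' using p by blast
    qed simp
  qed
qed

text \<open>The time is recovered as the least t for which the point lies in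
  \<open>parallel t\<close>. At equal times strict support at p tells the starting points
  apart.\<close>

lemma ray_inject:
  assumes p: "p \<in> bdry \<Omega>" "q \<in> bdry \<Omega>" and s: "0 \<le> s" "0 \<le> s'" and eq: "ray p s = ray q s'"
  shows "p = q" "s = s'"
proof -
  have "s \<le> t \<longleftrightarrow> s' \<le> t" for t
    using ray_in_parallel_iff[OF p(1) s(1), of t] ray_in_parallel_iff[OF p(2) s(2), of t] eq by simp
  from this[of s] this[of s'] show ss: "s = s'" by simp
  have "snd q = snd p"
  proof (rule ccontr)
    assume ne: "snd q \<noteq> snd p"
    have "snd q \<in> base" using bdryD(2)[OF p(2)] by (rule imageI)
    then have 1: "normal p \<bullet> snd q < normal p \<bullet> snd p" using support_strict[OF p(1) _ ne] by simp
    have 2: "s * (snd (outer_normal \<Omega> q) \<bullet> normal p) \<le> s * fst p"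
      using normal_support[OF p(2,1)] s(1) by (rule mult_left_mono)
    have "normal p \<bullet> ray q s < normal p \<bullet> ray p s"
      unfolding normal_ray[OF p(1)] using 1 2 by (simp add: ray_def inner_add_right inner_commute)
    then show False using eq ss by simp
  qed
  then show "p = q" using bdryD(4)[OF p(1)] bdryD(4)[OF p(2)] by simp
qed

lemma closed_parallel: "closed (parallel t)"
proof -
  have e: "parallel t = (\<Inter>p\<in>bdry \<Omega>. {y. normal p \<bullet> y \<le> normal p \<bullet> snd p + t * fst p})"
    unfolding parallel_def by auto
  show ?thesis unfolding e by (intro closed_INT ballI closed_halfspace_le)
qed

lemma parallel_combination:
  assumes x: "x \<in> parallel s" and y: "y \<in> parallel t" and u: "0 \<le> u" "u \<le> 1"
  shows "(1 - u) *\<^sub>R x + u *\<^sub>R y \<in> parallel ((1 - u) * s + u * t)"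
  unfolding parallel_def
proof (intro CollectI ballI)
  fix p assume p: "p \<in> bdry \<Omega>"
  have "(1 - u) * (normal p \<bullet> x) \<le> (1 - u) * (normal p \<bullet> snd p + s * fst p)"
    using x p u by (intro mult_left_mono) (auto simp: parallel_def)
  moreover have "u * (normal p \<bullet> y) \<le> u * (normal p \<bullet> snd p + t * fst p)"
    using y p u by (intro mult_left_mono) (auto simp: parallel_def)
  ultimately show "normal p \<bullet> ((1 - u) *\<^sub>R x + u *\<^sub>R y) \<le> normal p \<bullet> snd p + ((1 - u) * s + u * t) * fst p"
    by (simp add: inner_add_right algebra_simps)
qed

lemma convex_parallel: "convex (parallel t)"
proof (rule convexI)
  fix x y :: "real ^ 'a option" and u v :: real
  assume xy: "x \<in> parallel t" "y \<in> parallel t" and uv: "0 \<le> u" "0 \<le> v" "u + v = 1"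
  have u: "u = 1 - v" and t: "(1 - v) * t + v * t = t" using uv by (simp_all add: algebra_simps)
  show "u *\<^sub>R x + v *\<^sub>R y \<in> parallel t"
    using parallel_combination[OF xy uv(2)] uv(1) unfolding t u by simp
qed

text \<open>Outside the base the body is covered by the image of the compact set
  \<open>bdry \<Omega> \<times> {0..t}\<close> under the rays.\<close>

lemma bounded_parallel:
  assumes "0 \<le> t"
  shows "bounded (parallel t)"
proof -
  let ?f = "\<lambda>z. ray (fst z) (snd z)"
  have "continuous_on (bdry \<Omega> \<times> {0..t}) (\<lambda>z. outer_normal \<Omega> (fst z))"
    by (rule continuous_on_compose2[OF continuous_on_outer_normal continuous_on_fst[OF continuous_on_id]]) auto
  then have "continuous_on (bdry \<Omega> \<times> {0..t}) ?f"
    unfolding ray_def by (intro continuous_intros)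
  then have "compact (?f ` (bdry \<Omega> \<times> {0..t}))"
    by (intro compact_continuous_image compact_Times compact_bdry) simp_all
  then have "bounded (base \<union> ?f ` (bdry \<Omega> \<times> {0..t}))"
    using compact_base by (auto simp: compact_imp_bounded)
  moreover have "parallel t \<subseteq> base \<union> ?f ` (bdry \<Omega> \<times> {0..t})"
    unfolding parallel_eq[OF assms] by force
  ultimately show ?thesis by (rule bounded_subset)
qed

lemma parallel_0: "parallel 0 = base"
  using parallel_eq[of 0] by simp

end

text \<open>Let t collect the time components of the frame. Orthonormality gives E^T E = I + t t^T,
  so the square of det E is 1 + |t|^2; tangency gives E^T x = fst p t. Together they force |t| =
  |x|, and 1 + |x|^2 is the square of \<open>fst p\<close>.\<close>

lemma det_lorentz_frame:
  fixes f :: "'a::finite option \<Rightarrow> 'a minkowski"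
  assumes p: "p \<in> hyp_space" and f: "\<And>i. f i \<in> hyp_tangent p"
    "\<And>i j. lorentz (f i) (f j) = (if i = j then 1 else 0)"
  shows "\<bar>det (\<chi> k i. snd (f i) $ k)\<bar> = fst p"
proof -
  define E :: "real ^ ('a option) ^ ('a option)" where "E = (\<chi> k i. snd (f i) $ k)"
  define t :: "real ^ ('a option)" where "t = (\<chi> i. fst (f i))"
  let ?T = "t \<bullet> t" and ?x = "snd p"
  have pp: "fst p > 0" "fst p * fst p = 1 + ?x \<bullet> ?x" using hyp_spaceD[OF p] by auto
  have G: "transpose E ** E = (\<chi> i j. (if i = j then 1 else 0) + 1 * t $ i * t $ j)"
  proof -
    have "(\<Sum>k\<in>UNIV. snd (f i) $ k * snd (f j) $ k) = (if i = j then 1 else 0) + fst (f i) * fst (f j)" for i j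
      using f(2)[of i j] by (simp add: lorentz_def inner_vec_def)
    then show ?thesis
      by (simp add: vec_eq_iff matrix_matrix_mult_def transpose_def E_def t_def)
  qed
  have d2: "det E * det E = 1 + ?T"
    using arg_cong[OF G, of det] det_identity_plus_rank_one[of 1 t] by (simp add: det_mul)
  have "?T \<ge> 0" by simp
  then have "det E * det E > 0" unfolding d2 by linarith
  then have "det E \<noteq> 0" by auto
  then have dT: "det (transpose E) \<noteq> 0" by simp
  have Ex: "transpose E *v ?x = fst p *\<^sub>R t"
  proof -
    have "(\<Sum>k\<in>UNIV. snd (f i) $ k * ?x $ k) = fst p * fst (f i)" for i
      using f(1)[of i] by (simp add: hyp_tangent_def lorentz_def inner_vec_def mult.commute)
    then show ?thesis by (simp add: vec_eq_iff matrix_vector_mult_def transpose_def E_def t_def)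
  qed
  have Et: "transpose E *v (E *v t) = (1 + ?T) *\<^sub>R t"
  proof -
    have "(\<Sum>j\<in>UNIV. ((if i = j then 1 else 0) + 1 * t $ i * t $ j) * t $ j) = (1 + ?T) * t $ i" for i
    proof -
      have "(\<Sum>j\<in>UNIV. ((if i = j then 1 else 0) + 1 * t $ i * t $ j) * t $ j)
          = (\<Sum>j\<in>UNIV. (if i = j then t $ j else 0) + (t $ j * t $ j) * t $ i)"
        by (rule sum.cong) (auto simp: algebra_simps)
      also have "\<dots> = (1 + ?T) * t $ i"
        unfolding sum.distrib sum_distrib_right[symmetric] inner_vec_def by (simp add: distrib_right)
      finally show ?thesis .
    qed
    then show ?thesis unfolding matrix_vector_mul_assoc G
      by (simp add: vec_eq_iff matrix_vector_mult_def)
  qed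
  \<comment> \<open>Cancelling the invertible matrix E^T compares E t with x; the inner product with
    x then determines |t|^2.\<close>
  have "transpose E *v (fst p *\<^sub>R (E *v t)) = transpose E *v ((1 + ?T) *\<^sub>R ?x)"
    using Ex Et by (simp add: matrix_vector_mult_scaleR mult.commute)
  then have eq: "fst p *\<^sub>R (E *v t) = (1 + ?T) *\<^sub>R ?x"
    using dT by (metis injD inj_matrix_vector_mult invertible_det_nz)
  have "(E *v t) \<bullet> ?x = t \<bullet> (transpose E *v ?x)"
    by (metis dot_lmul_matrix inner_commute transpose_transpose vector_transpose_matrix)
  then have "(E *v t) \<bullet> ?x = fst p * ?T" using Ex by simp
  then have "fst p * (fst p * ?T) = (1 + ?T) * (?x \<bullet> ?x)"
    using arg_cong[OF eq, of "\<lambda>v. v \<bullet> ?x"] by simp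
  then have "(1 + ?x \<bullet> ?x) * ?T = (1 + ?T) * (?x \<bullet> ?x)" using pp(2) by (metis mult.assoc)
  then have "?T = ?x \<bullet> ?x" by (simp add: algebra_simps)
  then have "det E * det E = fst p * fst p" using d2 pp by simp
  then have "\<bar>det E\<bar> = \<bar>fst p\<bar>" by (metis abs_mult_self_eq abs_ge_zero abs_mult power2_eq_square power2_eq_iff_nonneg)
  then show ?thesis using pp by (simp add: E_def)
qed

context h_convex_domain
begin

text \<open>In the frame formed by the normal and an eigenframe the normal direction splits off. The
  passage E from frame coordinates to Euclidean ones contributes \<open>fst p\<close>; the remaining
  matrix contributes the factors 1 + s * kappa_i and the determinant of the chart derivative in the
  frame.\<close>

lemma det_tube_derivative:
  fixes D :: "real ^ 'a \<Rightarrow> 'a minkowski" and L :: "real ^ ('a option) \<Rightarrow> real ^ ('a option)"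
  assumes p: "p \<in> bdry \<Omega>" and W: "(outer_normal \<Omega> has_derivative W) (at p within bdry \<Omega>)"
    and D: "linear D" "\<And>v. D v \<in> bdry_tangent \<Omega> p" and s: "0 \<le> s"
    and L: "linear L" "\<And>v. L v = snd (D (\<chi> j. v $ Some j)) + s *\<^sub>R snd (W (D (\<chi> j. v $ Some j)))
      + v $ None *\<^sub>R snd (outer_normal \<Omega> p)"
  shows "\<bar>det (matrix L)\<bar> = fst p * (\<Prod>i\<in>UNIV. 1 + s * principal_curvatures \<Omega> p $ i)
    * sqrt (det (\<chi> i j. lorentz (D (axis i 1)) (D (axis j 1))))"
proof -
  obtain W' and e :: "'a \<Rightarrow> 'a minkowski" where W': "(outer_normal \<Omega> has_derivative W') (at p within bdry \<Omega>)"
    and e: "\<And>i. e i \<in> bdry_tangent \<Omega> p" "\<And>i j. lorentz (e i) (e j) = (if i = j then 1 else 0)"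
    and We: "\<And>i. W' (e i) = principal_curvatures \<Omega> p $ i *\<^sub>R e i"
    using curvature_frame[OF p] by metis
  let ?k = "\<lambda>i. principal_curvatures \<Omega> p $ i" and ?\<nu> = "outer_normal \<Omega> p"
  let ?c = "\<lambda>i. 1 + s * ?k i"
  have W'W: "W v = W' v" if "v \<in> bdry_tangent \<Omega> p" for v
    by (rule within_derivative_unique[OF p that W W'])
  define f where "f i = (case i of None \<Rightarrow> ?\<nu> | Some j \<Rightarrow> e j)" for i
  have fS: "f None = ?\<nu>" "\<And>j. f (Some j) = e j" by (simp_all add: f_def)
  have eT: "e i \<in> hyp_tangent p" "lorentz ?\<nu> (e i) = 0" "lorentz (e i) ?\<nu> = 0" for i
    using e(1)[of i] by (auto simp: bdry_tangent_def lorentz_commute)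
  have f: "f i \<in> hyp_tangent p" "lorentz (f i) (f j) = (if i = j then 1 else 0)" for i j
    using outer_normal_unit[OF p] eT e(2) by (auto simp: f_def split: option.splits)
  define E :: "real ^ ('a option) ^ ('a option)" where "E = (\<chi> k i. snd (f i) $ k)"
  have dE: "\<bar>det E\<bar> = fst p" unfolding E_def by (rule det_lorentz_frame[OF bdryD(1)[OF p] f])
  define B :: "real ^ 'a ^ 'a" where "B = (\<chi> i j. lorentz (e i) (D (axis j 1)))"
  define r :: "real ^ ('a option) \<Rightarrow> real ^ 'a" where "r v = (\<chi> j. v $ Some j)" for v
  \<comment> \<open>The coordinates of L v in the frame f.\<close>
  define C where "C v = (\<chi> i. case i of None \<Rightarrow> v $ None | Some j \<Rightarrow> ?c j * lorentz (e j) (D (r v)))"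
    for v :: "real ^ ('a option)"
  have rl: "r (u + v) = r u + r v" "r (a *\<^sub>R v) = a *\<^sub>R r v" for u v a
    by (simp_all add: r_def vec_eq_iff)
  have Cl: "linear C"
    by (rule linearI)
       (auto simp: C_def vec_eq_iff rl linear_add[OF D(1)] linear_scale[OF D(1)] lorentz_simps algebra_simps split: option.splits)
  have ra: "r (axis None 1) = 0" "r (axis (Some j) 1) = axis j 1" for j
    by (simp_all add: r_def vec_eq_iff axis_def)
  have Ev: "L v = E *v C v" for v
  proof -
    let ?w = "D (r v)"
    have w: "?w = (\<Sum>i\<in>UNIV. lorentz (e i) ?w *\<^sub>R e i)" by (rule frame_expansion[OF p e D(2)])
    have W'l: "linear W'" using W' by (rule has_derivative_linear)
    have Ww: "W ?w = (\<Sum>i\<in>UNIV. (?k i * lorentz (e i) ?w) *\<^sub>R e i)"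
      unfolding W'W[OF D(2)] by (rule shape_in_frame[OF p e W'l We D(2)])
    have "snd ?w = snd (\<Sum>i\<in>UNIV. lorentz (e i) ?w *\<^sub>R e i)" using w by (rule arg_cong)
    then have sw: "snd ?w = (\<Sum>i\<in>UNIV. lorentz (e i) ?w *\<^sub>R snd (e i))" by (simp add: snd_sum)
    have sW: "snd (W ?w) = (\<Sum>i\<in>UNIV. (?k i * lorentz (e i) ?w) *\<^sub>R snd (e i))"
      unfolding Ww by (simp add: snd_sum)
    have "L v = (\<Sum>i\<in>UNIV. (?c i * lorentz (e i) ?w) *\<^sub>R snd (e i)) + v $ None *\<^sub>R snd ?\<nu>"
      unfolding L(2) r_def[symmetric] sW sw[unfolded r_def, folded r_def]
      by (simp add: scaleR_sum_right sum.distrib[symmetric] algebra_simps)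
    also have "\<dots> = (\<Sum>i\<in>UNIV. C v $ i *\<^sub>R snd (f i))"
      by (simp add: UNIV_option_conv sum.reindex C_def fS)
    also have "\<dots> = E *v C v"
      by (simp add: vec_eq_iff matrix_vector_mult_def E_def mult.commute)
    finally show ?thesis .
  qed
  have "matrix L = E ** matrix C"
    unfolding matrix_eq matrix_vector_mul_assoc[symmetric]
    using Ev matrix_vector_mul(2)[OF L(1)] matrix_vector_mul(2)[OF Cl] by metis
  then have dL: "det (matrix L) = det E * det (matrix C)" by (simp add: det_mul)
  have mC: "matrix C $ None $ None = 1" "matrix C $ None $ Some j = 0"
    "matrix C $ Some i $ Some j = ?c i * B $ i $ j" for i j
    by (simp_all add: matrix_def C_def ra B_def) (simp_all add: axis_def)
  have "det (matrix C) = det (\<chi> i j. matrix C $ Some i $ Some j)"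
    by (rule det_option_block) (rule mC)+
  also have "(\<chi> i j. matrix C $ Some i $ Some j) = (\<chi> i. ?c i *s B $ i)"
    by (simp add: vec_eq_iff mC algebra_simps)
  also have "det \<dots> = (\<Prod>i\<in>UNIV. ?c i) * det B"
    unfolding det_rows_mul by (simp add: vec_lambda_eta)
  finally have dC: "det (matrix C) = (\<Prod>i\<in>UNIV. ?c i) * det B" .
  have "(\<Sum>k\<in>UNIV. lorentz (e k) v * lorentz (e k) w) = lorentz v w" if "v \<in> bdry_tangent \<Omega> p" for v w
  proof -
    have "lorentz v w = lorentz (\<Sum>k\<in>UNIV. lorentz (e k) v *\<^sub>R e k) w"
      by (rule arg_cong[OF frame_expansion[OF p e that], of "\<lambda>v. lorentz v w"])
    then show ?thesis by (simp add: lorentz_sum_left lorentz_simps)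
  qed
  \<comment> \<open>B holds the frame coordinates of the chart derivative, so the metric matrix
    factors as B^T B and its root determinant is |det B|.\<close>
  then have "transpose B ** B = (\<chi> i j. lorentz (D (axis i 1)) (D (axis j 1)))"
    using D(2) by (simp add: vec_eq_iff matrix_matrix_mult_def transpose_def B_def)
  then have dB: "sqrt (det (\<chi> i j. lorentz (D (axis i 1)) (D (axis j 1)))) = \<bar>det B\<bar>"
    by (metis det_mul det_transpose real_sqrt_abs2)
  have "?c i > 0" for i using curvature_gt_1[OF p, of i] s by (intro add_pos_nonneg mult_nonneg_nonneg) auto
  then have "\<bar>\<Prod>i\<in>UNIV. ?c i\<bar> = (\<Prod>i\<in>UNIV. ?c i)" by (intro abs_of_nonneg prod_nonneg) (simp add: less_imp_le)
  then show ?thesis unfolding dL dC dB abs_mult dE by simp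
qed

end

section \<open>The volume of the parallel bodies\<close>

text \<open>Tonelli with the coordinate \<open>None\<close> split off as time; \<open>J\<close>
  preserves Lebesgue measure because boxes are products. The second claim is what later makes the
  tube weights measurable in charts.\<close>

lemma nn_integral_option_split:
  fixes f :: "real ^ ('d::finite option) \<Rightarrow> ennreal"
  assumes f: "f \<in> borel_measurable borel"
  defines "g \<equiv> \<lambda>x. \<integral>\<^sup>+s. f (\<chi> i. case i of None \<Rightarrow> s | Some j \<Rightarrow> x $ j) \<partial>lborel"
  shows "(\<integral>\<^sup>+y. f y \<partial>lborel) = (\<integral>\<^sup>+x. g x \<partial>lborel)" "g \<in> borel_measurable borel"
proof -
  define J where "J z = (\<chi> i. case i of None \<Rightarrow> snd z | Some j \<Rightarrow> fst z $ j)" for z :: "(real ^ 'd) \<times> real"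
  have "continuous_on UNIV J"
    unfolding J_def
  proof (rule continuous_on_vec_lambda)
    fix i :: "'d option"
    show "continuous_on UNIV (\<lambda>z :: (real ^ 'd) \<times> real. case i of None \<Rightarrow> snd z | Some j \<Rightarrow> fst z $ j)"
      by (cases i) (auto intro!: continuous_intros)
  qed
  then have mJ: "J \<in> borel_measurable borel" by (rule borel_measurable_continuous_onI)
  have dJ: "distr lborel borel J = lborel"
  proof (rule lborel_eqI[symmetric])
    fix l u :: "real ^ ('d option)"
    assume "\<And>b. b \<in> Basis \<Longrightarrow> l \<bullet> b \<le> u \<bullet> b"
    then have lu: "l $ i \<le> u $ i" for i
      using \<open>\<And>b. b \<in> Basis \<Longrightarrow> l \<bullet> b \<le> u \<bullet> b\<close>[of "axis i 1"] by (simp add: inner_axis)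
    let ?r = "\<lambda>x :: real ^ ('d option). (\<chi> j. x $ Some j) :: real ^ 'd"
    have pre: "J -` box l u = box (?r l) (?r u) \<times> {l $ None<..<u $ None}"
    proof (intro set_eqI)
      fix z
      show "z \<in> J -` box l u \<longleftrightarrow> z \<in> box (?r l) (?r u) \<times> {l $ None<..<u $ None}"
        by (auto simp: J_def mem_box_cart mem_Times_iff split: option.splits)
    qed
    have "emeasure (distr lborel borel J) (box l u) = emeasure (lborel \<Otimes>\<^sub>M lborel) (box (?r l) (?r u) \<times> {l $ None<..<u $ None})"
      using mJ by (subst emeasure_distr) (simp_all add: pre lborel_prod)
    also have "\<dots> = emeasure lborel (box (?r l) (?r u)) * emeasure lborel {l $ None<..<u $ None}"
      by (rule lborel.emeasure_pair_measure_Times) simp_all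
    also have "\<dots> = ennreal (\<Prod>j\<in>UNIV. u $ Some j - l $ Some j) * ennreal (u $ None - l $ None)"
      by (subst emeasure_box_vec) (simp_all add: lu)
    also have "\<dots> = ennreal (\<Prod>i\<in>UNIV. u $ i - l $ i)"
      by (simp add: UNIV_option_conv prod.reindex lu prod_nonneg ennreal_mult[symmetric] mult.commute)
    also have "(\<Prod>i\<in>UNIV. u $ i - l $ i) = (\<Prod>b\<in>Basis. (u - l) \<bullet> b)"
      by (simp add: prod_Basis_vec inner_axis)
    finally show "emeasure (distr lborel borel J) (box l u) = (\<Prod>b\<in>Basis. (u - l) \<bullet> b)" .
  qed simp
  have m: "(\<lambda>z. f (J z)) \<in> borel_measurable (lborel \<Otimes>\<^sub>M lborel)"
    unfolding lborel_prod using measurable_compose[OF mJ f] by simp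
  have gJ: "g = (\<lambda>x. \<integral>\<^sup>+s. f (J (x, s)) \<partial>lborel)" unfolding g_def J_def by simp
  have "(\<integral>\<^sup>+y. f y \<partial>lborel) = (\<integral>\<^sup>+z. f (J z) \<partial>lborel)"
    unfolding dJ[symmetric] using mJ f by (subst nn_integral_distr) (simp_all add: dJ)
  also have "\<dots> = (\<integral>\<^sup>+x. g x \<partial>lborel)"
    unfolding gJ using lborel.nn_integral_fst[OF m] by (simp add: lborel_prod)
  finally show "(\<integral>\<^sup>+y. f y \<partial>lborel) = (\<integral>\<^sup>+x. g x \<partial>lborel)" .
  show "g \<in> borel_measurable borel"
    unfolding gJ using lborel.borel_measurable_nn_integral_fst[OF m] by simp
qed

section \<open>The Jacobian of the sweep and the volume of a tube\<close>

lemma prod_one_plus_elem_sym: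
  fixes \<kappa> :: "real ^ 'n::finite"
  shows "(\<Prod>i\<in>UNIV. 1 + s * \<kappa> $ i) = (\<Sum>k=0..CARD('n). s ^ k * elem_sym k \<kappa>)"
proof -
  have "(\<Prod>i\<in>UNIV. 1 + s * \<kappa> $ i) = (\<Prod>i\<in>UNIV. s * \<kappa> $ i + 1)" by (simp add: add.commute)
  also have "\<dots> = (\<Sum>X\<in>Pow UNIV. (\<Prod>i\<in>X. s * \<kappa> $ i) * (\<Prod>i\<in>UNIV - X. 1))"
    by (rule prod_add) simp
  also have "\<dots> = (\<Sum>X\<in>UNIV. s ^ card X * (\<Prod>i\<in>X. \<kappa> $ i))"
    by (simp add: prod.distrib)
  also have "\<dots> = (\<Sum>k\<in>{0..CARD('n)}. \<Sum>X | X \<in> UNIV \<and> card X = k. s ^ card X * (\<Prod>i\<in>X. \<kappa> $ i))"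
    by (rule sum.group[symmetric]) (auto intro: card_mono[OF finite subset_UNIV])
  also have "\<dots> = (\<Sum>k=0..CARD('n). s ^ k * elem_sym k \<kappa>)"
    unfolding elem_sym_def sum_distrib_left by (intro sum.cong refl) auto
  finally show ?thesis .
qed

lemma elem_sym_0: "elem_sym 0 \<kappa> = 1"
proof -
  have "{I :: 'a set. card I = 0} = {{}}" by auto
  then show ?thesis by (simp add: elem_sym_def)
qed

context h_convex_domain
begin

text \<open>The integral over s from 0 to t of \<open>fst p\<close> times the product of all 1 + s *
  kappa_i at p: the volume swept per unit of boundary area.\<close>

definition tube_weight :: "real \<Rightarrow> 'a minkowski \<Rightarrow> real" where
  "tube_weight t p = fst p * (\<Sum>k=0..CARD('a). t ^ (k + 1) / (real k + 1) * elem_sym k (principal_curvatures \<Omega> p))"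

lemma elem_sym_nonneg:
  assumes p: "p \<in> bdry \<Omega>"
  shows "elem_sym k (principal_curvatures \<Omega> p) \<ge> 0"
  unfolding elem_sym_def using curvature_gt_1[OF p] by (intro sum_nonneg prod_nonneg) (auto simp: less_le_trans order.strict_implies_order intro: order_trans[of 0 1])

text \<open>\<open>tube_weight\<close> is an antiderivative in t of the expanded product, and the
  missing end point 0 is a null set.\<close>

lemma nn_integral_tube_density:
  assumes p: "p \<in> bdry \<Omega>" and t: "0 \<le> t" and c: "0 \<le> c"
  shows "(\<integral>\<^sup>+s. ennreal (fst p * (\<Prod>i\<in>UNIV. 1 + s * principal_curvatures \<Omega> p $ i) * c) * indicator {0<..t} s \<partial>lborel)
    = ennreal (tube_weight t p) * ennreal c"
proof -
  let ?e = "\<lambda>k. elem_sym k (principal_curvatures \<Omega> p)"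
  let ?f = "\<lambda>s. fst p * (\<Sum>k=0..CARD('a). s ^ k * ?e k) * c" and ?F = "\<lambda>s. tube_weight s p * c"
  have p0: "fst p > 0" by (rule normal_identities(4)[OF p])
  have "(\<integral>\<^sup>+s. ennreal (?f s) * indicator {0<..t} s \<partial>lborel) = (\<integral>\<^sup>+s. ennreal (?f s) * indicator {0..t} s \<partial>lborel)"
    by (rule nn_integral_cong_AE) (rule AE_mp[OF AE_lborel_singleton[of "0::real"]], rule AE_I2, auto simp: indicator_def)
  also have "\<dots> = ennreal (?F t - ?F 0)"
  proof (rule nn_integral_FTC_Icc[where f = ?f and F = ?F, OF _ _ _ t])
    show "?f \<in> borel_measurable borel" by measurable
    show "?f s \<ge> 0" if "s \<in> {0..t}" for s
      using that p0 c elem_sym_nonneg[OF p] by (intro mult_nonneg_nonneg sum_nonneg) auto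
    fix s :: real
    show "(?F has_real_derivative ?f s) (at s)"
      unfolding tube_weight_def
      by (rule derivative_eq_intros refl | simp)+ (auto simp: sum_distrib_left sum_distrib_right add.commute intro!: sum.cong)
  qed
  also have "?F 0 = 0" by (simp add: tube_weight_def)
  also have "ennreal (?F t - 0) = ennreal (tube_weight t p) * ennreal c"
    using c by (simp add: ennreal_mult'')
  finally show ?thesis unfolding prod_one_plus_elem_sym .
qed

text \<open>F sends a chart point together with a time to the point on the ray; it is injective by
  \<open>ray_inject\<close>, and Tonelli integrates its Jacobian over the time. Measurability of h
  comes out of the continuity of this Jacobian, since the pointwise choice of principal curvatures
  gives no direct access to it.\<close>

lemma tube:
  fixes \<phi> :: "real ^ 'a \<Rightarrow> 'a minkowski"
  assumes c: "local_parametrization (bdry \<Omega>) U \<phi>" and nu: "smooth_on U (\<lambda>x. outer_normal \<Omega> (\<phi> x))"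
    and A: "A \<in> sets borel" "A \<subseteq> U" and t: "0 \<le> t"
  defines "h \<equiv> \<lambda>x. ennreal (tube_weight t (\<phi> x)) * ennreal (sqrt (det (metric_matrix \<phi> x))) * indicator A x"
  shows "emeasure lborel (\<Union>p\<in>\<phi> ` A. ray p ` {0<..t}) = (\<integral>\<^sup>+x. h x \<partial>lborel)" "h \<in> borel_measurable borel"
    "(\<Union>p\<in>\<phi> ` A. ray p ` {0<..t}) \<in> sets borel"
proof -
  note L = local_parametrizationD[OF c]
  define r where "r y = (\<chi> j. y $ Some j)" for y :: "real ^ ('a option)"
  define V where "V = {y. r y \<in> U \<and> 0 < y $ None}"
  define g where "g x = outer_normal \<Omega> (\<phi> x)" for x
  define F where "F y = snd (\<phi> (r y)) + (y $ None) *\<^sub>R snd (g (r y))" for y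
  define T where "T = {y. r y \<in> A \<and> 0 < y $ None \<and> y $ None \<le> t}"
  have blr: "bounded_linear r"
    unfolding r_def by (rule linear_conv_bounded_linear[THEN iffD1], rule linearI) (simp_all add: vec_eq_iff)
  have cr: "continuous_on UNIV r" by (rule linear_continuous_on[OF blr])
  have bn: "bounded_linear (\<lambda>y :: real ^ ('a option). y $ None)" by (rule bounded_linear_vec_nth)
  have "open (r -` U)" by (rule open_vimage[OF L(1) cr])
  moreover have "open {y :: real ^ ('a option). 0 < y $ None}"
    by (intro open_Collect_less continuous_intros)
  ultimately have opV: "open V"
    using open_Int[of "r -` U" "{y. 0 < y $ None}"] by (simp add: V_def vimage_def Collect_conj_eq)
  have TV: "T \<subseteq> V" using A(2) by (auto simp: T_def V_def)
  have Tm: "T \<in> sets borel"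
  proof -
    have "r \<in> borel_measurable borel" using cr by (rule borel_measurable_continuous_onI)
    then have 1: "r -` A \<in> sets borel" using measurable_sets[of r borel borel A] A(1) by simp
    have "closed {y :: real ^ ('a option). y $ None \<le> t}" "open {y :: real ^ ('a option). 0 < y $ None}"
      by (intro closed_Collect_le open_Collect_less continuous_intros)+
    moreover have "T = r -` A \<inter> ({y. 0 < y $ None} \<inter> {y. y $ None \<le> t})" by (auto simp: T_def)
    ultimately show ?thesis using 1 by (auto intro!: sets.Int)
  qed
  have phiM: "\<phi> x \<in> bdry \<Omega>" if "x \<in> U" for x using L(5) that by blast
  have Fray: "F y = ray (\<phi> (r y)) (y $ None)" for y by (simp add: F_def ray_def g_def)
  have im: "F ` T = (\<Union>p\<in>\<phi> ` A. ray p ` {0<..t})"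
  proof
    show "F ` T \<subseteq> (\<Union>p\<in>\<phi> ` A. ray p ` {0<..t})" by (auto simp: Fray T_def)
    show "(\<Union>p\<in>\<phi> ` A. ray p ` {0<..t}) \<subseteq> F ` T"
    proof clarsimp
      fix x s assume x: "x \<in> A" and s: "0 < s" "s \<le> t"
      let ?y = "\<chi> i. case i of None \<Rightarrow> s | Some j \<Rightarrow> x $ j"
      have "r ?y = x" "?y $ None = s" by (simp_all add: r_def vec_eq_iff)
      then show "ray (\<phi> x) s \<in> F ` T" using x s by (intro image_eqI[of _ F ?y]) (simp_all add: Fray T_def)
    qed
  qed
  have injF: "inj_on F V"
  proof (rule inj_onI)
    fix y z assume y: "y \<in> V" and z: "z \<in> V" and e: "F y = F z"
    have yz: "r y \<in> U" "r z \<in> U" "0 \<le> y $ None" "0 \<le> z $ None" using y z by (auto simp: V_def)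
    have "\<phi> (r y) = \<phi> (r z)" and n: "y $ None = z $ None"
      using ray_inject[OF phiM[OF yz(1)] phiM[OF yz(2)] yz(3,4)] e by (auto simp: Fray)
    then have "r y = r z" using inj_onD[OF L(4)] yz by metis
    then have "y $ Some j = z $ Some j" for j by (simp add: r_def vec_eq_iff)
    then have "y $ i = z $ i" for i using n by (cases i) simp_all
    then show "y = z" by (simp add: vec_eq_iff)
  qed
  have CkF: "Ck_on (Suc 0) V F"
  proof -
    have rV: "r ` V \<subseteq> U" by (auto simp: V_def)
    have Ckr: "Ck_on (Suc 0) V r" by (rule Ck_on_bounded_linear[OF blr])
    have sp: "Ck_on (Suc 0) U \<phi>" using L(2) by (simp add: smooth_on_def)
    have sg: "Ck_on (Suc 0) U g" using nu unfolding smooth_on_def g_def by blast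
    show ?thesis unfolding F_def
      by (rule Ck_on_add[OF opV Ck_on_snd[OF opV Ck_on_compose[OF opV sp Ckr rV]]
          Ck_on_scaleR[OF opV Ck_on_bounded_linear[OF bn] Ck_on_snd[OF opV Ck_on_compose[OF opV sg Ckr rV]]]])
  qed
  let ?F' = "\<lambda>y. frechet_derivative F (at y)"
  have dF: "(F has_derivative ?F' y) (at y)" if "y \<in> V" for y
    using Ck_on_SucE(1)[OF CkF that] .
  have cF: "continuous_on V (\<lambda>y. \<bar>det (matrix (?F' y))\<bar>)"
    unfolding matrix_def
    by (intro continuous_on_rabs continuous_on_det) (simp add: continuous_on_component Ck_on_imp_frechet_continuous[OF CkF])
  have detF: "\<bar>det (matrix (?F' y))\<bar> = fst (\<phi> (r y)) * (\<Prod>i\<in>UNIV. 1 + y $ None * principal_curvatures \<Omega> (\<phi> (r y)) $ i)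
      * sqrt (det (metric_matrix \<phi> (r y)))" if y: "y \<in> V" for y
  proof -
    have x: "r y \<in> U" and s: "0 \<le> y $ None" using y by (auto simp: V_def)
    let ?p = "\<phi> (r y)" and ?D = "frechet_derivative \<phi> (at (r y))"
    have p: "?p \<in> bdry \<Omega>" by (rule phiM[OF x])
    obtain W where W: "(outer_normal \<Omega> has_derivative W) (at ?p within bdry \<Omega>)"
      using curvature_frame[OF p] by metis
    have dg: "(g has_derivative (\<lambda>v. W (?D v))) (at (r y))"
      unfolding g_def by (rule derivative_along_chart[OF c x W])
    have dr: "(r has_derivative r) (at y)" using blr by (rule bounded_linear_imp_has_derivative)
    have d1: "((\<lambda>y. \<phi> (r y)) has_derivative (\<lambda>v. ?D (r v))) (at y)"
      by (rule has_derivative_compose[OF dr L(6)[OF x]])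
    have d2: "((\<lambda>y. g (r y)) has_derivative (\<lambda>v. W (?D (r v)))) (at y)"
      by (rule has_derivative_compose[OF dr dg])
    have dn: "((\<lambda>y :: real ^ ('a option). y $ None) has_derivative (\<lambda>v. v $ None)) (at y)"
      using bn by (rule bounded_linear_imp_has_derivative)
    have "(F has_derivative (\<lambda>v. snd (?D (r v)) + (y $ None *\<^sub>R snd (W (?D (r v))) + v $ None *\<^sub>R snd (g (r y))))) (at y)"
      unfolding F_def by (intro has_derivative_add has_derivative_scaleR has_derivative_snd d1 d2 dn)
    from has_derivative_unique[OF dF[OF y] this]
    have e: "?F' y v = snd (?D (r v)) + (y $ None *\<^sub>R snd (W (?D (r v))) + v $ None *\<^sub>R snd (g (r y)))" for v
      by metis
    have "?D v \<in> bdry_tangent \<Omega> ?p" for v using chart_derivative_range[OF c x] by blast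
    from det_tube_derivative[OF p W L(8)[OF x] this s has_derivative_linear[OF dF[OF y]]]
    show ?thesis unfolding metric_matrix_def e by (simp add: r_def g_def add.assoc)
  qed
  define k where "k y = ennreal \<bar>det (matrix (?F' y))\<bar> * indicator T y" for y
  have km: "k \<in> borel_measurable borel"
  proof -
    have "(\<lambda>y. indicator V y *\<^sub>R \<bar>det (matrix (?F' y))\<bar>) \<in> borel_measurable borel"
      by (rule borel_measurable_continuous_on_indicator[OF _ cF]) (use opV in simp)
    then have "(\<lambda>y. ennreal (indicator V y *\<^sub>R \<bar>det (matrix (?F' y))\<bar>) * indicator T y) \<in> borel_measurable borel"
      using Tm by measurable
    moreover have "k = (\<lambda>y. ennreal (indicator V y *\<^sub>R \<bar>det (matrix (?F' y))\<bar>) * indicator T y)"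
      using TV by (auto simp: k_def fun_eq_iff indicator_def)
    ultimately show ?thesis by simp
  qed
  let ?J = "\<lambda>x s. (\<chi> i. case i of None \<Rightarrow> s | Some j \<Rightarrow> x $ j) :: real ^ ('a option)"
  have hk: "(\<integral>\<^sup>+s. k (?J x s) \<partial>lborel) = h x" for x
  proof (cases "x \<in> A")
    case True
    have rJ: "r (?J x s) = x" "?J x s $ None = s" for s by (simp_all add: r_def vec_eq_iff)
    have p: "\<phi> x \<in> bdry \<Omega>" using True A(2) by (intro phiM) auto
    have "k (?J x s) = ennreal (fst (\<phi> x) * (\<Prod>i\<in>UNIV. 1 + s * principal_curvatures \<Omega> (\<phi> x) $ i)
      * sqrt (det (metric_matrix \<phi> x))) * indicator {0<..t} s" for s
    proof (cases "s \<in> {0<..t}")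
      case s: True
      then have T: "?J x s \<in> T" using True by (simp add: T_def rJ)
      then have "?J x s \<in> V" using TV by blast
      from detF[OF this] show ?thesis using T s by (simp add: k_def rJ)
    next
      case False
      then have "?J x s \<notin> T" by (auto simp: T_def)
      then show ?thesis using False by (simp add: k_def)
    qed
    then have "(\<integral>\<^sup>+s. k (?J x s) \<partial>lborel) = (\<integral>\<^sup>+s. ennreal (fst (\<phi> x) * (\<Prod>i\<in>UNIV. 1 + s * principal_curvatures \<Omega> (\<phi> x) $ i)
      * sqrt (det (metric_matrix \<phi> x))) * indicator {0<..t} s \<partial>lborel)" by simp
    also have "\<dots> = ennreal (tube_weight t (\<phi> x)) * ennreal (sqrt (det (metric_matrix \<phi> x)))"
    proof (rule nn_integral_tube_density[OF p t])
      \<comment> \<open>A negative argument would make \<open>sqrt\<close> negative, so the sign is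
        read off from the Jacobian at time 1: it is an absolute value, and its other factors are
        positive.\<close>
      have V: "?J x 1 \<in> V" using True A(2) rJ(1)[of 1] by (auto simp: V_def)
      have "(\<Prod>i\<in>UNIV. 1 + 1 * principal_curvatures \<Omega> (\<phi> x) $ i) > 0"
        using curvature_gt_1[OF p] by (intro prod_pos ballI) (simp add: add_pos_pos less_trans[OF zero_less_one])
      then have "fst (\<phi> x) * (\<Prod>i\<in>UNIV. 1 + 1 * principal_curvatures \<Omega> (\<phi> x) $ i) > 0"
        using normal_identities(4)[OF p] by (rule mult_pos_pos[rotated])
      moreover have "0 \<le> fst (\<phi> x) * (\<Prod>i\<in>UNIV. 1 + 1 * principal_curvatures \<Omega> (\<phi> x) $ i) * sqrt (det (metric_matrix \<phi> x))"
        using detF[OF V] unfolding rJ by (metis abs_ge_zero)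
      ultimately show "0 \<le> sqrt (det (metric_matrix \<phi> x))" by (metis zero_le_mult_iff not_less)
    qed
    finally show ?thesis using True by (simp add: h_def)
  next
    case False
    have "?J x s \<notin> T" for s
    proof -
      have "r (?J x s) = x" by (simp add: r_def vec_eq_iff)
      then show ?thesis using False by (simp add: T_def)
    qed
    then show ?thesis using False by (simp add: k_def h_def)
  qed
  show "h \<in> borel_measurable borel"
    using nn_integral_option_split(2)[OF km] unfolding hk by simp
  have "emeasure lborel (F ` T) = (\<integral>\<^sup>+y\<in>T. ennreal \<bar>det (matrix (?F' y))\<bar> \<partial>lborel)"
    by (rule emeasure_injective_image[OF opV dF cF injF Tm TV])
  also have "\<dots> = (\<integral>\<^sup>+x. h x \<partial>lborel)"
    using nn_integral_option_split(1)[OF km] unfolding hk by (simp add: k_def)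
  finally show "emeasure lborel (\<Union>p\<in>\<phi> ` A. ray p ` {0<..t}) = (\<integral>\<^sup>+x. h x \<partial>lborel)" unfolding im .
  have contF: "continuous_on V F"
    using dF by (auto intro!: continuous_at_imp_continuous_on has_derivative_continuous)
  obtain G where G: "homeomorphism V (F ` V) F G"
    using invariance_of_domain_homeomorphism[OF opV contF _ injF] by auto
  have "open (F ` V)" by (rule invariance_of_domain[OF contF opV injF])
  then have "F ` T \<in> sets borel"
    by (intro homeomorphism_image_borel[OF G _ Tm TV]) simp
  then show "(\<Union>p\<in>\<phi> ` A. ray p ` {0<..t}) \<in> sets borel" unfolding im .
qed

text \<open>Compactness leaves finitely many charts, with the outward normal smooth along each, as
  \<open>tube\<close> requires. The images of the sets \<open>A k\<close> partition the boundary, so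
  that integrals over it become finite sums.\<close>

lemma boundary_atlas:
  obtains m :: nat and U \<phi> A where
    "\<And>k. k < m \<Longrightarrow> local_parametrization (bdry \<Omega>) (U k :: (real ^ 'a) set) (\<phi> k)"
    "\<And>k. k < m \<Longrightarrow> smooth_on (U k) (\<lambda>x. outer_normal \<Omega> (\<phi> k x))"
    "bdry \<Omega> = (\<Union>k<m. \<phi> k ` U k)" "\<And>k. k < m \<Longrightarrow> A k \<in> sets borel" "\<And>k. k < m \<Longrightarrow> A k \<subseteq> U k"
    "disjoint_family_on (\<lambda>k. \<phi> k ` A k) {..<m}" "bdry \<Omega> = (\<Union>k<m. \<phi> k ` A k)"
proof -
  define P where "P c \<longleftrightarrow> local_parametrization (bdry \<Omega>) (fst c) (snd c) \<and> smooth_on (fst c) (\<lambda>x. outer_normal \<Omega> (snd c x))"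
    for c :: "(real ^ 'a) set \<times> (real ^ 'a \<Rightarrow> 'a minkowski)"
  let ?im = "\<lambda>c :: (real ^ 'a) set \<times> (real ^ 'a \<Rightarrow> 'a minkowski). snd c ` fst c"
  have ex: "\<exists>c. P c \<and> p \<in> ?im c" if p: "p \<in> bdry \<Omega>" for p
  proof -
    obtain N \<rho> where N: "open N" "p \<in> N" "smooth_on N \<rho>"
      "\<And>q. q \<in> N \<Longrightarrow> lorentz (ngrad \<rho> q) (ngrad \<rho> q) > 0"
      "\<And>q. q \<in> bdry \<Omega> \<Longrightarrow> q \<in> N \<Longrightarrow> outer_normal \<Omega> q = unormal \<rho> q"
      by (rule boundary_neighbourhood[OF p]) metis
    obtain V \<theta> where V: "local_parametrization (bdry \<Omega>) (V :: (real ^ 'a) set) \<theta>" "p \<in> \<theta> ` V" "\<theta> ` V \<subseteq> N"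
      using ex_boundary_chart[OF p N(1,2)] by metis
    note L = local_parametrizationD[OF V(1)]
    have "Ck_on k V (\<lambda>x. outer_normal \<Omega> (\<theta> x))" for k
    proof (rule Ck_on_cong[OF L(1)])
      have 1: "Ck_on k V \<theta>" using L(2) by (simp add: smooth_on_def)
      have 2: "Ck_on k N (unormal \<rho>)" by (rule Ck_on_unormal[OF N(1,3)]) (rule N(4))
      show "Ck_on k V (\<lambda>x. unormal \<rho> (\<theta> x))" by (rule Ck_on_compose[OF L(1) 2 1 V(3)])
      show "unormal \<rho> (\<theta> x) = outer_normal \<Omega> (\<theta> x)" if "x \<in> V" for x
        using N(5)[of "\<theta> x"] L(5) V(3) that by (simp add: image_subset_iff)
    qed
    then have "P (V, \<theta>)" using V(1) by (simp add: P_def smooth_on_def)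
    then show ?thesis using V(2) by (intro exI[of _ "(V, \<theta>)"]) simp
  qed
  have 1: "openin (top_of_set (bdry \<Omega>)) s" if "s \<in> ?im ` Collect P" for s
    using that
  proof (rule imageE)
    fix c assume "s = ?im c" "c \<in> Collect P"
    then show ?thesis by (simp add: P_def local_parametrization_def)
  qed
  have 2: "bdry \<Omega> \<subseteq> \<Union>(?im ` Collect P)"
  proof
    fix p assume "p \<in> bdry \<Omega>"
    then obtain c where "P c" "p \<in> ?im c" using ex by metis
    then show "p \<in> \<Union>(?im ` Collect P)" by (intro UnionI[of "?im c"] imageI) simp_all
  qed
  have "\<exists>D\<subseteq>?im ` Collect P. finite D \<and> bdry \<Omega> \<subseteq> \<Union>D"
  proof (rule compact_bdry[unfolded compact_eq_openin_cover, rule_format], intro conjI ballI)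
    show "openin (top_of_set (bdry \<Omega>)) s" if "s \<in> ?im ` Collect P" for s using that by (rule 1)
  qed (rule 2)
  then obtain D where D: "D \<subseteq> ?im ` Collect P" "finite D" "bdry \<Omega> \<subseteq> \<Union>D" by (elim exE conjE)
  obtain K where K: "K \<subseteq> Collect P" "finite K" "D = ?im ` K"
    using finite_subset_image[OF D(2,1)] by (elim exE conjE)
  obtain m and c :: "nat \<Rightarrow> _" where c: "K = c ` {i. i < m}"
    using finite_imp_nat_seg_image_inj_on[OF K(2)] by metis
  define U where "U k = fst (c k)" for k
  define \<phi> where "\<phi> k = snd (c k)" for k
  define S where "S = disjointed (\<lambda>k. \<phi> k ` U k)"
  define A where "A k = U k \<inter> \<phi> k -` S k" for k
  have "P (c k)" if "k < m" for k using K(1) that unfolding c by blast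
  then have ch: "local_parametrization (bdry \<Omega>) (U k) (\<phi> k)" and sm: "smooth_on (U k) (\<lambda>x. outer_normal \<Omega> (\<phi> k x))"
    if "k < m" for k
    using that by (simp_all add: P_def U_def \<phi>_def)
  have "\<phi> k ` U k \<subseteq> bdry \<Omega>" if "k < m" for k by (rule local_parametrizationD(5)[OF ch[OF that]])
  moreover have "bdry \<Omega> \<subseteq> (\<Union>k<m. \<phi> k ` U k)" using D(3) unfolding K(3) c U_def \<phi>_def lessThan_def image_image .
  ultimately have cov: "bdry \<Omega> = (\<Union>k<m. \<phi> k ` U k)" by blast
  have imU: "\<phi> k ` U k \<in> sets borel" if "k < m" for k
    using borel_image_chart[OF ch[OF that] bdry_borel _ order_refl] local_parametrizationD(1)[OF ch[OF that]] by simp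
  have Sm: "S k \<in> sets borel" if "k < m" for k
    unfolding S_def disjointed_def using that imU by (intro sets.Diff sets.finite_UN) auto
  have Am: "A k \<in> sets borel" "A k \<subseteq> U k" if "k < m" for k
    using borel_vimage_chart[OF ch[OF that] Sm[OF that]] by (auto simp: A_def)
  have "S k \<subseteq> \<phi> k ` U k" for k unfolding S_def by (rule disjointed_subset)
  then have im: "\<phi> k ` A k = S k" for k unfolding A_def by blast
  have dis: "disjoint_family_on (\<lambda>k. \<phi> k ` A k) {..<m}"
    unfolding im S_def using disjoint_family_disjointed by (rule disjoint_family_on_mono[OF subset_UNIV])
  have "bdry \<Omega> = (\<Union>k<m. \<phi> k ` A k)"
    unfolding im S_def cov using finite_UN_disjointed_eq[of "\<lambda>k. \<phi> k ` U k" m] by (simp add: atLeast0LessThan)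
  from that[OF ch sm cov Am dis this] show ?thesis by blast
qed

section \<open>Bounds for the volume of the parallel bodies\<close>

lemma tube_weight_nonneg:
  assumes "p \<in> bdry \<Omega>" "0 \<le> t"
  shows "0 \<le> tube_weight t p"
  unfolding tube_weight_def using assms elem_sym_nonneg[OF assms(1)] normal_identities(4)[OF assms(1)]
  by (intro mult_nonneg_nonneg sum_nonneg) auto

text \<open>For t \<le> 1 each term with k \<ge> 1 is at most t^2 times its value at 1, so only the
  term with \<open>elem_sym 0\<close> is of first order in t.\<close>

lemma tube_weight_le:
  assumes p: "p \<in> bdry \<Omega>" and t: "0 \<le> t" "t \<le> 1"
  shows "tube_weight t p \<le> t * fst p + t\<^sup>2 * tube_weight 1 p"
proof -
  let ?e = "\<lambda>k. elem_sym k (principal_curvatures \<Omega> p)"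
  have "(\<Sum>k=0..CARD('a). t ^ (k + 1) / (real k + 1) * ?e k)
    \<le> (\<Sum>k=0..CARD('a). (if k = 0 then t else 0) + t\<^sup>2 * (1 ^ (k + 1) / (real k + 1) * ?e k))"
  proof (rule sum_mono)
    fix k
    show "t ^ (k + 1) / (real k + 1) * ?e k \<le> (if k = 0 then t else 0) + t\<^sup>2 * (1 ^ (k + 1) / (real k + 1) * ?e k)"
    proof (cases "k = 0")
      case True
      then show ?thesis by (simp add: elem_sym_0)
    next
      case False
      then have "t ^ (k + 1) \<le> t ^ 2" using t by (intro power_decreasing) auto
      then have "t ^ (k + 1) * (?e k / (real k + 1)) \<le> t ^ 2 * (?e k / (real k + 1))"
        using elem_sym_nonneg[OF p] by (intro mult_right_mono) simp_all
      then show ?thesis using False by simp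
    qed
  qed
  also have "\<dots> = t + t\<^sup>2 * (\<Sum>k=0..CARD('a). 1 ^ (k + 1) / (real k + 1) * ?e k)"
    by (simp add: sum.distrib sum_distrib_left)
  finally have "fst p * (\<Sum>k=0..CARD('a). t ^ (k + 1) / (real k + 1) * ?e k)
      \<le> fst p * (t + t\<^sup>2 * (\<Sum>k=0..CARD('a). 1 ^ (k + 1) / (real k + 1) * ?e k))"
    using normal_identities(4)[OF p] by (intro mult_left_mono) simp_all
  then show ?thesis unfolding tube_weight_def by (simp add: algebra_simps)
qed

text \<open>These inequalities stand in for the expansion of the volume in powers of t. The whole
  tube weight is measurable in charts by \<open>tube\<close>, but the single functions
  \<open>elem_sym k\<close> of the chosen curvatures are not known to be, so the second claim is
  only a lower bound for the volume at time 1.\<close>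

lemma measure_parallel_bounds:
  shows "0 \<le> t \<Longrightarrow> t \<le> 1 \<Longrightarrow> measure lborel (parallel t) \<le> measure lborel base
      + t * (LINT p:bdry \<Omega>|area_measure \<Omega>. cosh (hyp_radius p))
      + t\<^sup>2 * (measure lborel (parallel 1) - measure lborel base)"
    and "measure lborel base + (\<Sum>k=0..CARD('a). 1 / (real k + 1) * weighted_curvature_integral k \<Omega>)
      \<le> measure lborel (parallel 1)"
    and "0 \<le> (LINT p:bdry \<Omega>|area_measure \<Omega>. cosh (hyp_radius p))"
proof -
  obtain m :: nat and U \<phi> A where
    ch: "\<And>k. k < m \<Longrightarrow> local_parametrization (bdry \<Omega>) (U k :: (real ^ 'a) set) (\<phi> k)"
    and sm: "\<And>k. k < m \<Longrightarrow> smooth_on (U k) (\<lambda>x. outer_normal \<Omega> (\<phi> k x))"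
    and covU: "bdry \<Omega> = (\<Union>k<m. \<phi> k ` U k)" and Am: "\<And>k. k < m \<Longrightarrow> A k \<in> sets borel" "\<And>k. k < m \<Longrightarrow> A k \<subseteq> U k"
    and dis: "disjoint_family_on (\<lambda>k. \<phi> k ` A k) {..<m}" and cov: "bdry \<Omega> = (\<Union>k<m. \<phi> k ` A k)"
    by (rule boundary_atlas) blast
  have phiM: "\<phi> k x \<in> bdry \<Omega>" if "k < m" "x \<in> A k" for k x using cov that by blast
  define \<mu> where "\<mu> = area_measure \<Omega>"
  have mu: "sets \<mu> = sets borel"
    unfolding \<mu>_def area_measure_def
    by (rule riemannian_measure_characterization(1)[OF bdry_subset_hyp_space bdry_borel ch covU])
  have mu_chart: "emeasure \<mu> (\<phi> k ` B) = (\<integral>\<^sup>+x\<in>B. ennreal (sqrt (det (metric_matrix (\<phi> k) x))) \<partial>lborel)"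
    if "k < m" "B \<in> sets borel" "B \<subseteq> U k" for k B
    unfolding \<mu>_def area_measure_def
    by (rule riemannian_measure_characterization(3)[OF bdry_subset_hyp_space bdry_borel ch covU]) (use that ch in auto)
  \<comment> \<open>Boundary integrals are taken in the charts, where \<open>tube\<close> provides
    measurability of \<open>tube_weight\<close>. For Borel functions \<open>I_borel\<close>
    identifies I with the integral for the area measure.\<close>
  define d where "d k f x = ennreal (f (\<phi> k x)) * chart_density (\<phi> k) (A k) x" for k and f :: "'a minkowski \<Rightarrow> real" and x
  define I where "I f = (\<Sum>k<m. \<integral>\<^sup>+x. d k f x \<partial>lborel)" for f
  have d0: "d k f x = 0" if "x \<notin> A k" for k f x using that by (simp add: d_def chart_density_def)
  have d_mono: "d k f x \<le> d k g x" if "k < m" "\<And>p. p \<in> bdry \<Omega> \<Longrightarrow> f p \<le> g p" for k f g x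
  proof (cases "x \<in> A k")
    case True
    show ?thesis unfolding d_def by (intro mult_right_mono ennreal_leI that(2) phiM[OF that(1) True]) simp
  qed (simp add: d0)
  have I_mono: "I f \<le> I g" if "\<And>p. p \<in> bdry \<Omega> \<Longrightarrow> f p \<le> g p" for f g
    unfolding I_def by (intro sum_mono nn_integral_mono d_mono that) auto
  have d_borel: "d k f \<in> borel_measurable borel" if k: "k < m" and f: "f \<in> borel_measurable borel" for k f
  proof -
    have "(\<lambda>x. f (if x \<in> A k then \<phi> k x else 0)) \<in> borel_measurable borel"
      using measurable_compose[OF measurable_chart[OF ch[OF k] Am[OF k]] f] .
    then have "(\<lambda>x. ennreal (f (if x \<in> A k then \<phi> k x else 0)) * chart_density (\<phi> k) (A k) x) \<in> borel_measurable borel"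
      by (intro borel_measurable_times_ennreal measurable_chart_density[OF ch[OF k] Am[OF k]]) simp
    also have "(\<lambda>x. ennreal (f (if x \<in> A k then \<phi> k x else 0)) * chart_density (\<phi> k) (A k) x) = d k f"
      by (auto simp: d_def chart_density_def fun_eq_iff)
    finally show ?thesis .
  qed
  have I_sum: "I (\<lambda>p. \<Sum>j\<in>J. c j * h j p) = (\<Sum>j\<in>J. ennreal (c j) * I (h j))"
    if J: "finite J" and c: "\<And>j. j \<in> J \<Longrightarrow> 0 \<le> c j" and h: "\<And>j p. j \<in> J \<Longrightarrow> p \<in> bdry \<Omega> \<Longrightarrow> 0 \<le> h j p"
      and hm: "\<And>j k. j \<in> J \<Longrightarrow> k < m \<Longrightarrow> d k (h j) \<in> borel_measurable borel"
    for J :: "nat set" and c h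
  proof -
    have "(\<integral>\<^sup>+x. d k (\<lambda>p. \<Sum>j\<in>J. c j * h j p) x \<partial>lborel) = (\<Sum>j\<in>J. ennreal (c j) * (\<integral>\<^sup>+x. d k (h j) x \<partial>lborel))"
      if k: "k < m" for k
    proof -
      have "d k (\<lambda>p. \<Sum>j\<in>J. c j * h j p) x = (\<Sum>j\<in>J. ennreal (c j) * d k (h j) x)" for x
      proof (cases "x \<in> A k")
        case True
        have "ennreal (\<Sum>j\<in>J. c j * h j (\<phi> k x)) = (\<Sum>j\<in>J. ennreal (c j) * ennreal (h j (\<phi> k x)))"
          using c h phiM[OF k True] by (simp add: sum_ennreal[symmetric] ennreal_mult mult_nonneg_nonneg)
        then show ?thesis unfolding d_def by (simp add: sum_distrib_right mult.assoc)
      qed (simp add: d0)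
      then show ?thesis using hm k
        by (simp add: nn_integral_sum nn_integral_cmult)
    qed
    then show ?thesis unfolding I_def
      by (simp add: sum_distrib_left sum.swap[of _ J])
  qed
  have I_borel: "I f = (\<integral>\<^sup>+p\<in>bdry \<Omega>. ennreal (f p) \<partial>\<mu>)" if f: "f \<in> borel_measurable borel" for f
  proof -
    have fm: "(\<lambda>p. ennreal (f p)) \<in> borel_measurable borel" using f by measurable
    have img: "\<phi> k ` A k \<in> sets borel" if "k < m" for k
      by (rule borel_image_chart[OF ch[OF that] bdry_borel Am[OF that]])
    have e: "(\<integral>\<^sup>+p\<in>\<phi> k ` A k. ennreal (f p) \<partial>\<mu>) = (\<integral>\<^sup>+x. d k f x \<partial>lborel)" if k: "k < m" for k
      using nn_integral_chart[OF mu mu_chart[OF k] ch[OF k] bdry_borel Am[OF k] fm]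
      by (simp add: d_def chart_density_def mult.assoc)
    have "(\<integral>\<^sup>+p\<in>bdry \<Omega>. ennreal (f p) \<partial>\<mu>) = (\<integral>\<^sup>+p. (\<Sum>k<m. ennreal (f p) * indicator (\<phi> k ` A k) p) \<partial>\<mu>)"
      unfolding cov indicator_UN_disjoint[OF finite_lessThan dis] sum_distrib_left ..
    also have "\<dots> = (\<Sum>k<m. \<integral>\<^sup>+p\<in>\<phi> k ` A k. ennreal (f p) \<partial>\<mu>)"
    proof (rule nn_integral_sum)
      fix k assume "k \<in> {..<m}"
      then have "(\<lambda>p. ennreal (f p) * indicator (\<phi> k ` A k) p) \<in> borel_measurable borel"
        using fm img by simp
      then show "(\<lambda>p. ennreal (f p) * indicator (\<phi> k ` A k) p) \<in> borel_measurable \<mu>"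
        by (simp add: measurable_cong_sets[OF mu refl])
    qed
    also have "\<dots> = I f" unfolding I_def using e by simp
    finally show ?thesis by simp
  qed
  have tw: "d k (tube_weight t) \<in> borel_measurable borel"
      "emeasure lborel (\<Union>p\<in>\<phi> k ` A k. ray p ` {0<..t}) = (\<integral>\<^sup>+x. d k (tube_weight t) x \<partial>lborel)"
      "(\<Union>p\<in>\<phi> k ` A k. ray p ` {0<..t}) \<in> sets borel" if "k < m" "0 \<le> t" for k t
    using tube[OF ch[OF that(1)] sm[OF that(1)] Am[OF that(1)] that(2)]
    by (simp_all add: d_def[abs_def] chart_density_def mult.assoc)
  \<comment> \<open>The parallel body is the disjoint union of the base and the tubes over the
    pieces \<open>A k\<close>.\<close>
  have vol: "emeasure lborel (parallel t) = emeasure lborel base + I (tube_weight t)" if t: "0 \<le> t" for t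
  proof -
    let ?T = "\<lambda>k. \<Union>p\<in>\<phi> k ` A k. ray p ` {0<..t}"
    have uT: "(\<Union>p\<in>bdry \<Omega>. ray p ` {0<..t}) = (\<Union>k<m. ?T k)" unfolding cov by blast
    have dT: "disjoint_family_on ?T {..<m}"
      unfolding disjoint_family_on_def
    proof (intro ballI impI)
      fix i j assume ij: "i \<in> {..<m}" "j \<in> {..<m}" "i \<noteq> j"
      then have im: "i < m" "j < m" by auto
      have dj: "\<phi> i ` A i \<inter> \<phi> j ` A j = {}" using dis ij unfolding disjoint_family_on_def by blast
      show "?T i \<inter> ?T j = {}"
      proof (rule ccontr)
        assume "?T i \<inter> ?T j \<noteq> {}"
        then obtain z where z: "z \<in> ?T i" "z \<in> ?T j" by blast
        obtain p where p: "p \<in> \<phi> i ` A i" "z \<in> ray p ` {0<..t}" using z(1) by (rule UN_E)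
        obtain s where s: "z = ray p s" "s \<in> {0<..t}" using p(2) by (rule imageE)
        obtain q where q: "q \<in> \<phi> j ` A j" "z \<in> ray q ` {0<..t}" using z(2) by (rule UN_E)
        obtain s' where s': "z = ray q s'" "s' \<in> {0<..t}" using q(2) by (rule imageE)
        have pq: "p \<in> \<phi> i ` A i" "q \<in> \<phi> j ` A j" "0 < s" "0 < s'" "ray p s = ray q s'"
          using p(1) q(1) s s' by simp_all
        have "p \<in> bdry \<Omega>" "q \<in> bdry \<Omega>" using pq(1,2) phiM im by auto
        from ray_inject(1)[OF this _ _ pq(5)] pq(3,4) have "p = q" by simp
        then show False using dj pq(1,2) by blast
      qed
    qed
    have Tm: "?T k \<in> sets lborel" if "k < m" for k using tw(3)[OF that t] by simp
    have "base \<in> sets lborel" using closed_base by simp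
    moreover have "(\<Union>k<m. ?T k) \<in> sets lborel" by (rule sets.finite_UN[OF finite_lessThan]) (rule Tm, simp)
    moreover have "base \<inter> (\<Union>k<m. ?T k) = {}" unfolding uT[symmetric]
    proof (intro equals0I, elim IntE UN_E)
      fix z p assume p: "p \<in> bdry \<Omega>" and z: "z \<in> base" "z \<in> ray p ` {0<..t}"
      obtain s where "z = ray p s" "s \<in> {0<..t}" using z(2) by (rule imageE)
      then show False using z(1) ray_notin_base[OF p, of s] by simp
    qed
    ultimately have "emeasure lborel base + emeasure lborel (\<Union>k<m. ?T k) = emeasure lborel (base \<union> (\<Union>k<m. ?T k))"
      by (rule plus_emeasure)
    moreover have "(\<Sum>k<m. emeasure lborel (?T k)) = emeasure lborel (\<Union>k<m. ?T k)"
      by (rule sum_emeasure[OF _ dT finite_lessThan]) (use Tm in blast)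
    moreover have "(\<Sum>k<m. emeasure lborel (?T k)) = I (tube_weight t)"
      unfolding I_def using tw(2)[OF _ t] by simp
    ultimately show ?thesis unfolding parallel_eq[OF t] uT by simp
  qed
  have em: "emeasure lborel (parallel t) = ennreal (measure lborel (parallel t))" if "0 \<le> t" for t
    using emeasure_bounded_finite[OF bounded_parallel[OF that]] by (intro emeasure_eq_ennreal_measure) simp
  have em0: "emeasure lborel base = ennreal (measure lborel base)" using em[of 0] by (simp add: parallel_0)
  define v where "v t = measure lborel (parallel t)" for t
  define v0 where "v0 = measure lborel base"
  have v0: "0 \<le> v0" "0 \<le> v t" for t by (simp_all add: v0_def v_def)
  have Itw: "I (tube_weight t) = ennreal (v t - v0)" "v0 \<le> v t" if t: "0 \<le> t" for t
  proof -
    have "ennreal v0 + I (tube_weight t) = ennreal (v t)"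
      using vol[OF t] em[OF t] em0 by (simp add: v_def v0_def)
    moreover then have "I (tube_weight t) \<noteq> top" by auto
    moreover then obtain r where r: "0 \<le> r" "I (tube_weight t) = ennreal r" by (cases "I (tube_weight t)") auto
    ultimately have "ennreal (v0 + r) = ennreal (v t)" using v0 by (simp add: ennreal_plus)
    then have "v0 + r = v t" by (subst (asm) ennreal_inj) (use v0 r in auto)
    then show "I (tube_weight t) = ennreal (v t - v0)" "v0 \<le> v t" using r by auto
  qed
  have fpos: "0 \<le> fst p" if "p \<in> bdry \<Omega>" for p using normal_identities(4)[OF that] by simp
  have fst_borel: "(fst :: 'a minkowski \<Rightarrow> real) \<in> borel_measurable borel"
    by (intro borel_measurable_continuous_onI continuous_intros)
  have ch_fst: "cosh (hyp_radius p) = fst p" if "p \<in> bdry \<Omega>" for p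
    using cosh_hyp_radius[OF bdryD(1)[OF that]] .
  have integral_I: "(LINT p|\<mu>. g p) = enn2real (I g)"
    if g: "g \<in> borel_measurable borel" "\<And>p. 0 \<le> g p" "\<And>p. p \<notin> bdry \<Omega> \<Longrightarrow> g p = 0" for g
  proof -
    have "(LINT p|\<mu>. g p) = enn2real (\<integral>\<^sup>+p. ennreal (g p) \<partial>\<mu>)"
      using g by (intro integral_eq_nn_integral) (simp_all add: measurable_cong_sets[OF mu refl])
    also have "(\<integral>\<^sup>+p. ennreal (g p) \<partial>\<mu>) = I g"
      unfolding I_borel[OF g(1)] by (rule nn_integral_cong) (use g(3) in \<open>auto simp: indicator_def\<close>)
    finally show ?thesis .
  qed
  define W where "W = (LINT p:bdry \<Omega>|area_measure \<Omega>. cosh (hyp_radius p))"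
  have fst_le: "fst p \<le> tube_weight 1 p" if p: "p \<in> bdry \<Omega>" for p
  proof -
    let ?g = "\<lambda>k. 1 ^ (k + 1) / (real k + 1) * elem_sym k (principal_curvatures \<Omega> p)"
    have "?g 0 \<le> (\<Sum>k=0..CARD('a). ?g k)"
      using elem_sym_nonneg[OF p] by (intro member_le_sum) auto
    then have "fst p * 1 \<le> fst p * (\<Sum>k=0..CARD('a). ?g k)"
      using fpos[OF p] by (intro mult_left_mono) (simp_all add: elem_sym_0)
    then show ?thesis unfolding tube_weight_def by simp
  qed
  have W: "I fst = ennreal W" "0 \<le> W"
  proof -
    define g where "g p = indicator (bdry \<Omega>) p * fst p" for p :: "'a minkowski"
    have gm: "g \<in> borel_measurable borel" unfolding g_def using fst_borel bdry_borel by simp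
    have g0: "0 \<le> g p" for p using fpos by (simp add: g_def indicator_def)
    have "W = (LINT p|\<mu>. g p)"
      unfolding W_def \<mu>_def set_lebesgue_integral_def g_def
      by (rule Bochner_Integration.integral_cong) (auto simp: indicator_def ch_fst)
    also have "\<dots> = enn2real (I g)" by (rule integral_I[OF gm g0]) (simp add: g_def)
    also have "I g = I fst" by (intro antisym I_mono) (simp_all add: g_def)
    finally have We: "W = enn2real (I fst)" .
    \<comment> \<open>Finiteness of the area integral is inherited from the bounded body
      \<open>parallel 1\<close>.\<close>
    have "I fst \<le> I (tube_weight 1)" by (rule I_mono[OF fst_le])
    then have "I fst \<noteq> top" using Itw(1)[of 1] by (auto simp: top_unique)
    then show "I fst = ennreal W" "0 \<le> W" unfolding We by (simp_all add: less_top)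
  qed
  show "0 \<le> (LINT p:bdry \<Omega>|area_measure \<Omega>. cosh (hyp_radius p))" using W(2) by (simp add: W_def)
  show "measure lborel (parallel t) \<le> measure lborel base
      + t * (LINT p:bdry \<Omega>|area_measure \<Omega>. cosh (hyp_radius p))
      + t\<^sup>2 * (measure lborel (parallel 1) - measure lborel base)" if t: "0 \<le> t" "t \<le> 1"
  proof -
    \<comment> \<open>The bound of \<open>tube_weight_le\<close> written as a sum of two terms, in
      the shape of \<open>I_sum\<close>.\<close>
    let ?c = "\<lambda>j. if j = 0 then t else t\<^sup>2" and ?h = "\<lambda>j. if j = 0 then fst else tube_weight 1"
    have "I (tube_weight t) \<le> I (\<lambda>p. \<Sum>j\<in>{0, 1 :: nat}. ?c j * ?h j p)"
      by (rule I_mono) (simp add: tube_weight_le t)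
    also have "\<dots> = (\<Sum>j\<in>{0, 1 :: nat}. ennreal (?c j) * I (?h j))"
      by (rule I_sum) (use t fpos tube_weight_nonneg tw(1)[of _ 1] d_borel[OF _ fst_borel] in auto)
    also have "\<dots> = ennreal (t * W + t\<^sup>2 * (v 1 - v0))"
      using t W Itw[of 1] by (simp add: ennreal_mult)
    finally have "ennreal (v t - v0) \<le> ennreal (t * W + t\<^sup>2 * (v 1 - v0))" unfolding Itw(1)[OF t(1)] .
    then have "v t - v0 \<le> t * W + t\<^sup>2 * (v 1 - v0)"
      by (subst (asm) ennreal_le_iff) (use t W Itw(2)[of 1] in auto)
    then show ?thesis by (simp add: v_def v0_def W_def)
  qed
  let ?K = "{0..CARD('a)}" and ?e = "\<lambda>k p. elem_sym k (principal_curvatures \<Omega> p)"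
  let ?w = "\<lambda>k. weighted_curvature_integral k \<Omega>"
  define f where "f k p = indicator (bdry \<Omega>) p *\<^sub>R (cosh (hyp_radius p) * ?e k p)" for k p
  \<comment> \<open>The principal curvatures are chosen pointwise, so \<open>f k\<close> is replaced by 0 where its
    measurability could fail; its Bochner integral is 0 in that case.\<close>
  define g where "g k = (if f k \<in> borel_measurable borel then f k else (\<lambda>p. 0))" for k
  have gm: "g k \<in> borel_measurable borel" for k by (simp add: g_def)
  have f0: "0 \<le> f k p" "p \<notin> bdry \<Omega> \<Longrightarrow> f k p = 0" "p \<in> bdry \<Omega> \<Longrightarrow> f k p = fst p * ?e k p" for k p
    using elem_sym_nonneg[of p k] ch_fst[of p] fpos[of p] by (auto simp: f_def indicator_def)
  have g0: "0 \<le> g k p" "p \<notin> bdry \<Omega> \<Longrightarrow> g k p = 0" "p \<in> bdry \<Omega> \<Longrightarrow> g k p \<le> fst p * ?e k p" for k p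
    using f0(1)[of k p] f0(2,3)[of p k] by (auto simp: g_def)
  have wg: "?w k = enn2real (I (g k))" for k
  proof -
    have "?w k = (LINT p|\<mu>. f k p)"
      by (simp add: weighted_curvature_integral_def set_lebesgue_integral_def f_def \<mu>_def)
    also have "\<dots> = (LINT p|\<mu>. g k p)"
    proof (cases "f k \<in> borel_measurable borel")
      case False
      then have "\<not> integrable \<mu> (f k)"
        using borel_measurable_integrable measurable_cong_sets[OF mu refl] by blast
      then show ?thesis using False by (simp add: g_def not_integrable_integral_eq)
    qed (simp add: g_def)
    also have "\<dots> = enn2real (I (g k))" by (rule integral_I[OF gm g0(1,2)])
    finally show ?thesis .
  qed
  have "(\<Sum>k\<in>?K. ennreal (1 / (real k + 1)) * I (g k)) = I (\<lambda>p. \<Sum>k\<in>?K. 1 / (real k + 1) * g k p)"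
    by (rule I_sum[symmetric]) (use g0 d_borel[OF _ gm] in auto)
  also have "\<dots> \<le> I (tube_weight 1)"
  proof (rule I_mono)
    fix p assume p: "p \<in> bdry \<Omega>"
    have "(\<Sum>k\<in>?K. 1 / (real k + 1) * g k p) \<le> (\<Sum>k\<in>?K. 1 / (real k + 1) * (fst p * ?e k p))"
      by (intro sum_mono mult_left_mono g0(3)[OF p]) simp
    then show "(\<Sum>k\<in>?K. 1 / (real k + 1) * g k p) \<le> tube_weight 1 p"
      unfolding tube_weight_def by (simp add: sum_distrib_left mult.left_commute mult.commute)
  qed
  finally have le: "(\<Sum>k\<in>?K. ennreal (1 / (real k + 1)) * I (g k)) \<le> ennreal (v 1 - v0)"
    using Itw(1)[of 1] by simp
  \<comment> \<open>Each integral, with its positive coefficient, is a summand of a finite total, so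
    \<open>enn2real\<close> loses nothing.\<close>
  have fin: "I (g k) = ennreal (?w k)" if k: "k \<in> ?K" for k
  proof -
    have "ennreal (1 / (real k + 1)) * I (g k) \<le> (\<Sum>k\<in>?K. ennreal (1 / (real k + 1)) * I (g k))"
      using k by (intro member_le_sum) auto
    from order_trans[OF this le] have "ennreal (1 / (real k + 1)) * I (g k) \<noteq> top"
      by (auto simp: top_unique)
    then have "I (g k) \<noteq> top" by (auto simp: ennreal_mult_top)
    then show ?thesis unfolding wg by (simp add: less_top)
  qed
  have w0: "0 \<le> ?w k" for k unfolding wg by simp
  have "(\<Sum>k\<in>?K. ennreal (1 / (real k + 1)) * I (g k)) = (\<Sum>k\<in>?K. ennreal (1 / (real k + 1) * ?w k))"
    by (rule sum.cong) (use fin w0 in \<open>auto simp: ennreal_mult[symmetric]\<close>)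
  also have "\<dots> = ennreal (\<Sum>k\<in>?K. 1 / (real k + 1) * ?w k)"
    by (rule sum_ennreal) (use w0 in auto)
  finally have "(\<Sum>k\<in>?K. 1 / (real k + 1) * ?w k) \<le> v 1 - v0"
    using le Itw(2)[of 1] by simp
  then show "measure lborel base + (\<Sum>k=0..CARD('a). 1 / (real k + 1) * weighted_curvature_integral k \<Omega>)
      \<le> measure lborel (parallel 1)"
    by (simp add: v_def v0_def)
qed

section \<open>Concavity of the volume root and the final comparison\<close>

lemma measure_interior_convex:
  fixes S :: "'b::euclidean_space set"
  assumes "convex S" "closed S"
  shows "measure lborel (interior S) = measure lborel S"
proof -
  have "frontier S \<in> null_sets lborel"
    using negligible_convex_frontier[OF assms(1)]
    by (simp add: negligible_iff_null_sets null_sets_completion_iff)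
  then have "measure lborel (interior S \<union> frontier S) = measure lborel (interior S)"
    by (intro measure_Un_null_set) simp_all
  moreover have "interior S \<union> frontier S = S"
    using assms(2) interior_subset[of S] by (auto simp: frontier_def)
  ultimately show ?thesis by simp
qed

lemma measure_scaled:
  fixes S :: "'b::euclidean_space set"
  assumes S: "open S" and c: "c > 0"
  shows "measure lborel ((*\<^sub>R) c ` S) = c ^ DIM('b) * measure lborel S"
proof -
  have "open ((*\<^sub>R) c ` S)" using open_scaling[of c S] S c by simp
  moreover have "measure lebesgue ((\<lambda>x. c *\<^sub>R x + 0) ` S) = \<bar>c\<bar> ^ DIM('b) * measure lebesgue S"
    using measure_lebesgue_affine[of c 0 S] by simp
  moreover have "(\<lambda>x. c *\<^sub>R x + 0) ` S = (*\<^sub>R) c ` S" by simp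
  ultimately show ?thesis using S c by (simp only: measure_completion sets_lborel borel_open abs_of_pos)
qed

text \<open>By \<open>parallel_combination\<close> the combination of the bodies at times 0 and 1
  with weights 1 - t and t lies in the body at time t. The inequality is applied to the interiors,
  which are open and, by convexity, of full measure.\<close>

lemma parallel_brunn_minkowski:
  assumes t: "0 < t" "t < 1"
  defines "N \<equiv> Suc CARD('a)"
  shows "(1 - t) * root N (measure lborel base) + t * root N (measure lborel (parallel 1))
    \<le> root N (measure lborel (parallel t))"
proof -
  have N: "DIM(real ^ ('a option)) = N" "0 < N" by (simp_all add: N_def)
  let ?B = "interior base" and ?P = "interior (parallel 1)"
  let ?X = "(*\<^sub>R) (1 - t) ` ?B" and ?Y = "(*\<^sub>R) t ` ?P"
  have BP: "?B \<subseteq> ?P" using base_subset_parallel[of 1] by (intro interior_mono) simp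
  have op: "open ?X" "open ?Y"
    using t open_scaling[OF _ open_interior, of "1 - t" base] open_scaling[OF _ open_interior, of t "parallel 1"] by simp_all
  have bd: "bounded ?X" "bounded ?Y"
    using bounded_parallel[of 1] compact_imp_bounded[OF compact_base]
    by (intro bounded_scaling bounded_interior; simp)+
  have ne: "?X \<noteq> {}" "?Y \<noteq> {}" using interior_base BP by blast+
  have sub: "msum ?X ?Y \<subseteq> parallel t"
  proof
    fix z assume "z \<in> msum ?X ?Y"
    then obtain x y where xy: "x \<in> ?B" "y \<in> ?P" "z = (1 - t) *\<^sub>R x + t *\<^sub>R y" by (auto simp: msum_def)
    have "x \<in> parallel 0" "y \<in> parallel 1" using xy(1,2) interior_subset parallel_0 by blast+
    then show "z \<in> parallel t" using parallel_combination[of x 0 y 1 t] t xy(3) by simp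
  qed
  have sc: "root N (measure lborel ((*\<^sub>R) c ` interior S)) = c * root N (measure lborel S)"
    if "0 < c" "convex S" "closed S" for c and S :: "(real ^ ('a option)) set"
    using that N by (simp add: measure_scaled measure_interior_convex real_root_mult real_root_power_cancel)
  have "(1 - t) * root N (measure lborel base) + t * root N (measure lborel (parallel 1))
      = root N (measure lborel ?X) + root N (measure lborel ?Y)"
    using t sc[OF _ convex_base closed_base, of "1 - t"] sc[OF _ convex_parallel closed_parallel, of t 1] by simp
  also have "\<dots> \<le> root N (measure lborel (msum ?X ?Y))"
    using brunn_minkowski_open[OF op(1) bd(1) ne(1) op(2) bd(2) ne(2)] unfolding N(1) .
  also have "\<dots> \<le> root N (measure lborel (parallel t))"
  proof -
    have "parallel t \<in> fmeasurable lborel"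
      using emeasure_bounded_finite[OF bounded_parallel] closed_parallel t by (intro fmeasurableI) auto
    then have "measure lborel (msum ?X ?Y) \<le> measure lborel (parallel t)"
      using op by (intro measure_mono_fmeasurable[OF sub]) (simp_all add: open_msum)
    then show ?thesis using N(2) by simp
  qed
  finally show ?thesis .
qed

text \<open>Let a and b be the roots of order N = n + 1 of the volumes at times 0 and 1. The volume
  at time t is at least (a + t * (b - a))^N by concavity and at most v + t * W up to a term of order
  t^2. This bounds b - a, and b^N dominates the left side of the claim.\<close>

lemma weighted_inequality:
  defines "n \<equiv> CARD('a)"
  shows "weighted_volume \<Omega> + (\<Sum>k=0..n. 1 / (real k + 1) * weighted_curvature_integral k \<Omega>)
    \<le> (weighted_volume \<Omega> powr (1 / (real n + 1))
        + 1 / (real n + 1) * weighted_volume \<Omega> powr (- (real n / (real n + 1)))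
          * (LINT p:bdry \<Omega>|area_measure \<Omega>. cosh (hyp_radius p))) ^ (n + 1)"
proof -
  let ?N = "Suc n"
  define W where "W = (LINT p:bdry \<Omega>|area_measure \<Omega>. cosh (hyp_radius p))"
  define v where "v = measure lborel base"
  define v1 where "v1 = measure lborel (parallel 1)"
  define a where "a = root ?N v"
  define b where "b = root ?N v1"
  have wv: "weighted_volume \<Omega> = v"
    unfolding v_def by (rule weighted_volume_eq[OF domain_subset compact_domain])
  have "measure lborel (interior base) = v"
    unfolding v_def by (rule measure_interior_convex[OF convex_base closed_base])
  \<comment> \<open>A ball inside the base makes its volume positive, so that a can be divided
    by.\<close>
  moreover obtain c r where cr: "r > 0" "ball c r \<subseteq> interior base"
    using interior_base open_interior by (metis ex_in_conv openE)
  moreover have "interior base \<in> fmeasurable lborel"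
    by (rule open_bounded_fmeasurable[OF open_interior bounded_subset[OF compact_imp_bounded[OF compact_base] interior_subset]])
  ultimately have "measure lborel (ball c r) \<le> v"
    using measure_mono_fmeasurable[OF cr(2), of lborel] by (metis borel_open open_ball sets_lborel)
  moreover have "measure lborel (ball c r) > 0" using content_ball_pos[OF cr(1), of c] by simp
  ultimately have v: "v > 0" by linarith
  then have a: "a > 0" "a ^ ?N = v" unfolding a_def by (simp_all del: power_Suc)
  have v1: "v1 \<ge> 0" by (simp add: v1_def)
  then have b: "b \<ge> 0" "b ^ ?N = v1" unfolding b_def by (simp_all del: power_Suc)
  note bounds = measure_parallel_bounds[folded W_def v1_def v_def]
  have W: "0 \<le> W" by (rule bounds(3))
  have step: "real ?N * a ^ n * (b - a) \<le> W + t * (v1 - v)" if t: "0 < t" "t < 1" for t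
  proof -
    have "a + t * (b - a) = (1 - t) * a + t * b" by (simp add: algebra_simps)
    also have "\<dots> \<le> root ?N (measure lborel (parallel t))"
      using parallel_brunn_minkowski[OF t] by (simp add: a_def b_def v_def v1_def n_def)
    finally have le: "a + t * (b - a) \<le> root ?N (measure lborel (parallel t))" .
    have "0 \<le> (1 - t) * a + t * b" using a b t by simp
    then have nn: "0 \<le> a + t * (b - a)" by (simp add: algebra_simps)
    \<comment> \<open>Bernoulli's inequality in this variable extracts the first-order term N * a^n
      * t * (b - a); it applies because the interpolated root is nonnegative, that is, the variable
      is at least -1.\<close>
    let ?x = "t * (b - a) / a"
    have "- 1 \<le> ?x" using nn a(1) by (simp add: field_simps)
    then have "1 + real ?N * ?x \<le> (1 + ?x) ^ ?N" by (rule Bernoulli_inequality)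
    then have "a ^ ?N * (1 + real ?N * ?x) \<le> a ^ ?N * (1 + ?x) ^ ?N" using a(1) by (intro mult_left_mono) simp_all
    also have "a ^ ?N * (1 + ?x) ^ ?N = (a + t * (b - a)) ^ ?N"
      using a(1) by (simp add: power_mult_distrib[symmetric] distrib_left del: power_Suc)
    also have "\<dots> \<le> root ?N (measure lborel (parallel t)) ^ ?N" using le nn by (rule power_mono)
    also have "\<dots> = measure lborel (parallel t)" by (rule real_root_pow_pos2) simp_all
    also have "\<dots> \<le> v + t * W + t\<^sup>2 * (v1 - v)" using bounds(1)[of t] t by simp
    finally have "a ^ ?N * (real ?N * ?x) \<le> t * W + t\<^sup>2 * (v1 - v)"
      using a(2) by (simp add: distrib_left del: power_Suc)
    moreover have "a ^ ?N * (real ?N * ?x) = t * (real ?N * a ^ n * (b - a))" using a(1) by simp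
    ultimately have "t * (real ?N * a ^ n * (b - a)) \<le> t * (W + t * (v1 - v))"
      by (simp add: distrib_left power2_eq_square mult.assoc)
    then show ?thesis using t(1) by (rule mult_left_le_imp_le)
  qed
  \<comment> \<open>Division by t has left a remainder t * (v1 - v), which disappears as t tends to
    0.\<close>
  have "real ?N * a ^ n * (b - a) \<le> W"
  proof (rule tendsto_lowerbound)
    have "((\<lambda>t. W + t * (v1 - v)) \<longlongrightarrow> W + 0 * (v1 - v)) (at_right 0)" by (intro tendsto_intros)
    then show "((\<lambda>t. W + t * (v1 - v)) \<longlongrightarrow> W) (at_right 0)" by simp
    show "\<forall>\<^sub>F t in at_right 0. real ?N * a ^ n * (b - a) \<le> W + t * (v1 - v)"
      using step by (intro eventually_at_rightI[of 0 1]) auto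
  qed simp
  then have "b - a \<le> W / (real ?N * a ^ n)"
    using a(1) by (simp add: pos_le_divide_eq mult.commute)
  also have "\<dots> = 1 / (real n + 1) * inverse (a ^ n) * W" by (simp add: field_simps)
  finally have ba: "b \<le> a + 1 / (real n + 1) * inverse (a ^ n) * W" by simp
  have ap: "a = v powr (1 / (real n + 1))"
    unfolding a_def using v by (simp add: root_powr_inverse add.commute inverse_eq_divide)
  have "inverse (a ^ n) = v powr (- (real n / (real n + 1)))"
    unfolding ap using v by (simp add: powr_powr powr_minus flip: powr_realpow)
  note ba = ba[unfolded this]
  have "weighted_volume \<Omega> + (\<Sum>k=0..n. 1 / (real k + 1) * weighted_curvature_integral k \<Omega>) \<le> v1"
    using bounds(2) by (simp add: wv n_def)
  also have "v1 = b ^ ?N" using b(2) by simp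
  also have "\<dots> \<le> (a + 1 / (real n + 1) * v powr (- (real n / (real n + 1))) * W) ^ ?N"
    using ba b(1) by (rule power_mono)
  finally show ?thesis unfolding wv W_def[symmetric] ap by simp
qed

end

theorem theorem6p5:
  fixes \<Omega> :: "'n::finite minkowski set" and n :: nat
  assumes "n = CARD('n)" and "n \<ge> 1"
    and "smooth_bounded_domain \<Omega>"
    and "uniformly_h_convex \<Omega>"
  shows "weighted_volume \<Omega> + (\<Sum>k=0..n. 1 / (real k + 1) * weighted_curvature_integral k \<Omega>)
    \<le> (weighted_volume \<Omega> powr (1 / (real n + 1))
        + 1 / (real n + 1) * weighted_volume \<Omega> powr (- (real n / (real n + 1)))
          * (LINT p:bdry \<Omega>|area_measure \<Omega>. cosh (hyp_radius p))) ^ (n + 1)"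
proof -
  interpret h_convex_domain \<Omega>
    using assms(3,4) by unfold_locales
  show ?thesis using weighted_inequality unfolding assms(1) .
qed

end
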